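(* Let $n\ge 1$ and $\alpha\in\mathbb{R}^n$ with $\alpha_i>-\frac12$ for all $i$. Let $s,t\in\mathbb{R}$ with $t<s$. For every compact set $K\subset\mathbb{R}^n$, the embedding $H_{\alpha,K}^s\hookrightarrow H_{\alpha,K}^t$ is a compact operator.
   Context: Fix $n\ge1$ and $\alpha=(\alpha_1,\dots,\alpha_n)\in\mathbb{R}^n$ with $\alpha_i>-\frac12$; $|\alpha|=\alpha_1+\dots+\alpha_n$ and $\|x\|$ is the Euclidean norm. $\mathbb{R}^n_+=\{x\in\mathbb{R}^n: x_1>0,\dots,x_n>0\}$, $d\mu_\alpha(x)=\prod_{i=1}^n x_i^{2\alpha_i+1}dx_i$, and $L^p_\alpha(\mathbb{R}^n_+)=L^p(\mathbb{R}^n_+,d\mu_\alpha)$ (complex-valued functions). A function on $\mathbb{R}^n$ is called even if it is even in each variable. $\mathcal{D}_e(\mathbb{R}^n)$ is the space of even compactly supported $\mathcal{C}^\infty$ functions, $\mathcal{S}_e(\mathbb{R}^n)$ is the space of even Schwartz functions with its usual Fréchet topology, and $\mathcal{S}'_e(\mathbb{R}^n)$ is its topological dual (even tempered distributions). A function $\psi\in L^p_\alpha(\mathbb{R}^n_+)$ is identified with the element of $\mathcal{S}'_e(\mathbb{R}^n)$ given by $\langle\psi,f\rangle=\int_{\mathbb{R}^n_+}\psi f\,d\mu_\alpha$. An even smooth function $h$ all of whose derivatives grow at most polynomially acts on $\mathcal{S}'_e(\mathbb{R}^n)$ by $\langle hT,\varphi\rangle=\langle T,h\varphi\rangle$. For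 $\gamma>-\frac12$, $j_\gamma(t)=\Gamma(\gamma+1)\sum_{k\ge0}\frac{(-1)^k}{k!\,\Gamma(k+\gamma+1)}\left(\frac t2\right)^{2k}$ is the normalized Bessel function. The Fourier-Bessel transform is $\mathcal{F}_\alpha f(\lambda)=\int_{\mathbb{R}^n_+}f(x)\prod_{i=1}^n j_{\alpha_i}(\lambda_ix_i)\,d\mu_\alpha(x)$; it is a topological isomorphism of $\mathcal{S}_e(\mathbb{R}^n)$ with inverse $c_\alpha^2\mathcal{F}_\alpha$, where $c_\alpha=\frac{2^{-|\alpha|}}{\prod_{i=1}^n\Gamma(\alpha_i+1)}$. It is extended to $\mathcal{S}'_e(\mathbb{R}^n)$ by $\langle\mathcal{F}_\alpha(T),\varphi\rangle=\langle T,\mathcal{F}_\alpha(\varphi)\rangle$. For $s\in\mathbb{R}$: $H_\alpha^s=\{T\in\mathcal{S}'_e(\mathbb{R}^n): (1+\|\xi\|^2)^s\mathcal{F}_\alpha(T)\in L^2_\alpha(\mathbb{R}^n_+)\}$, with norm $\|T\|_{H_\alpha^s}=c_\alpha\|(1+\|\xi\|^2)^s\mathcal{F}_\alpha(T)\|_{L^2_\alpha}$. For $t\le s$ one has $H^s_\alpha\subset H^t_\alpha$. For $K\subset\mathbb{R}^n$ compact, $H_{\alpha,K}^s=\{T\in H_\alpha^s:\operatorname{supp}(T)\subset K\}$, with the norm of $H_\alpha^s$. Since $T$ is even, $\operatorname{supp}(T)\subset K$ is understood up to sign changes of coordinates: $\langle T,\varphi\rangle=0$ for every $\varphi\in\mathcal{D}_e(\mathbb{R}^n)$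 vanishing on a neighbourhood of $\{(\epsilon_1x_1,\dots,\epsilon_nx_n): x\in K,\ \epsilon_i\in\{-1,1\}\}$. *)

theory Defs
  imports "HOL-Analysis.Analysis"
begin

text \<open>
  Functions on \<open>\<real>\<^sup>n\<close> have type \<open>real ^ 'n \<Rightarrow> complex\<close>, with \<open>n = CARD('n)\<close>; distributions are
  functionals on such functions, normalised to be \<open>0\<close> outside the space of even Schwartz
  functions, so that equality of distributions is equality in HOL.
\<close>

definition even_fun :: "(real ^ 'n \<Rightarrow> complex) \<Rightarrow> bool" where
  "even_fun f \<longleftrightarrow> (\<forall>i x. f (\<chi> j. if j = i then - (x $ j) else x $ j) = f x)"

definition partial :: "'n \<Rightarrow> (real ^ 'n \<Rightarrow> complex) \<Rightarrow> real ^ 'n \<Rightarrow> complex" where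
  "partial i f = (\<lambda>x. frechet_derivative f (at x) (axis i 1))"

primrec partials :: "'n list \<Rightarrow> (real ^ 'n \<Rightarrow> complex) \<Rightarrow> real ^ 'n \<Rightarrow> complex" where
  "partials [] f = f"
| "partials (i # is) f = partial i (partials is f)"

definition smooth :: "(real ^ 'n \<Rightarrow> complex) \<Rightarrow> bool" where
  "smooth f \<longleftrightarrow> (\<forall>is. partials is f differentiable_on UNIV)"

definition test_e :: "(real ^ 'n \<Rightarrow> complex) set" where
  "test_e = {f. smooth f \<and> even_fun f \<and> (\<exists>C. compact C \<and> (\<forall>x. x \<notin> C \<longrightarrow> f x = 0))}"

definition schwartz_e :: "(real ^ 'n \<Rightarrow> complex) set" where
  "schwartz_e = {f. smooth f \<and> even_fun f \<and>
     (\<forall>k is. bdd_above (range (\<lambda>x. (1 + norm x) ^ k * norm (partials is f x))))}"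

definition schwartz_seminorm :: "nat \<Rightarrow> 'n list \<Rightarrow> (real ^ 'n \<Rightarrow> complex) \<Rightarrow> real" where
  "schwartz_seminorm k is f = (SUP x. (1 + norm x) ^ k * norm (partials is f x))"

definition schwartz_e_topology :: "(real ^ 'n \<Rightarrow> complex) topology" where
  "schwartz_e_topology = topology_generated_by
     {{g \<in> schwartz_e. schwartz_seminorm k is (\<lambda>x. g x - f x) < e} | f k is e.
        f \<in> schwartz_e \<and> 0 < e}"

type_synonym 'n dist = "(real ^ 'n \<Rightarrow> complex) \<Rightarrow> complex"

definition tempered_e :: "'n::finite dist set" where
  "tempered_e = {T.
     (\<forall>f\<in>schwartz_e. \<forall>g\<in>schwartz_e. T (\<lambda>x. f x + g x) = T f + T g) \<and>
     (\<forall>c. \<forall>f\<in>schwartz_e. T (\<lambda>x. c * f x) = c * T f) \<and>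
     continuous_map schwartz_e_topology euclidean T \<and>
     (\<forall>f. f \<notin> schwartz_e \<longrightarrow> T f = 0)}"

definition pos_orthant :: "(real ^ 'n) set" where
  "pos_orthant = {x. \<forall>i. 0 < x $ i}"

definition bessel_measure :: "real ^ 'n \<Rightarrow> (real ^ 'n) measure" where
  "bessel_measure \<alpha> = density (restrict_space lborel pos_orthant)
     (\<lambda>x. ennreal (\<Prod>i\<in>UNIV. (x $ i) powr (2 * \<alpha> $ i + 1)))"

definition L2 :: "real ^ 'n \<Rightarrow> (real ^ 'n \<Rightarrow> complex) set" where
  "L2 \<alpha> = {\<psi> \<in> borel_measurable (bessel_measure \<alpha>).
             integrable (bessel_measure \<alpha>) (\<lambda>x. (norm (\<psi> x))\<^sup>2)}"

definition L2_norm :: "real ^ 'n \<Rightarrow> (real ^ 'n \<Rightarrow> complex) \<Rightarrow> real" where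
  "L2_norm \<alpha> \<psi> = sqrt (LINT x|bessel_measure \<alpha>. (norm (\<psi> x))\<^sup>2)"

definition dist_of_fun :: "real ^ 'n \<Rightarrow> (real ^ 'n \<Rightarrow> complex) \<Rightarrow> 'n::finite dist" where
  "dist_of_fun \<alpha> \<psi> = (\<lambda>f. if f \<in> schwartz_e then LINT x|bessel_measure \<alpha>. \<psi> x * f x else 0)"

definition mult_dist :: "(real ^ 'n \<Rightarrow> complex) \<Rightarrow> 'n::finite dist \<Rightarrow> 'n dist" where
  "mult_dist h T = (\<lambda>\<phi>. if \<phi> \<in> schwartz_e then T (\<lambda>x. h x * \<phi> x) else 0)"

definition norm_bessel :: "real \<Rightarrow> real \<Rightarrow> real" where
  "norm_bessel \<gamma> t = Gamma (\<gamma> + 1) *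
     (\<Sum>k. (-1) ^ k / (fact k * Gamma (real k + \<gamma> + 1)) * (t / 2) ^ (2 * k))"

definition fourier_bessel ::
    "real ^ 'n \<Rightarrow> (real ^ 'n \<Rightarrow> complex) \<Rightarrow> real ^ 'n \<Rightarrow> complex" where
  "fourier_bessel \<alpha> f = (\<lambda>\<xi>. LINT x|bessel_measure \<alpha>.
     f x * complex_of_real (\<Prod>i\<in>UNIV. norm_bessel (\<alpha> $ i) (\<xi> $ i * x $ i)))"

definition fourier_bessel_dist :: "real ^ 'n \<Rightarrow> 'n::finite dist \<Rightarrow> 'n dist" where
  "fourier_bessel_dist \<alpha> T = (\<lambda>\<phi>. if \<phi> \<in> schwartz_e then T (fourier_bessel \<alpha> \<phi>) else 0)"

definition bessel_const :: "real ^ 'n \<Rightarrow> real" where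
  "bessel_const \<alpha> = 2 powr (- (\<Sum>i\<in>UNIV. \<alpha> $ i)) / (\<Prod>i\<in>UNIV. Gamma (\<alpha> $ i + 1))"

text \<open>The distribution \<open>(1 + \<parallel>\<xi>\<parallel>\<^sup>2)\<^sup>s \<F>\<^sub>\<alpha>(T)\<close>; the exponent is \<open>s\<close>, not \<open>s/2\<close>.\<close>

definition weighted_transform :: "real ^ 'n \<Rightarrow> real \<Rightarrow> 'n::finite dist \<Rightarrow> 'n dist" where
  "weighted_transform \<alpha> s T =
     mult_dist (\<lambda>\<xi>. complex_of_real ((1 + (norm \<xi>)\<^sup>2) powr s)) (fourier_bessel_dist \<alpha> T)"

definition sobolev :: "real ^ 'n \<Rightarrow> real \<Rightarrow> 'n::finite dist set" where
  "sobolev \<alpha> s = {T \<in> tempered_e. \<exists>\<psi>\<in>L2 \<alpha>. weighted_transform \<alpha> s T = dist_of_fun \<alpha> \<psi>}"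

text \<open>The representing \<open>\<psi>\<close> is determined up to a null set, so its norm does not depend on the choice.\<close>

definition sobolev_norm :: "real ^ 'n \<Rightarrow> real \<Rightarrow> 'n::finite dist \<Rightarrow> real" where
  "sobolev_norm \<alpha> s T = bessel_const \<alpha> *
     L2_norm \<alpha> (SOME \<psi>. \<psi> \<in> L2 \<alpha> \<and> weighted_transform \<alpha> s T = dist_of_fun \<alpha> \<psi>)"

definition sign_orbit :: "(real ^ 'n) set \<Rightarrow> (real ^ 'n) set" where
  "sign_orbit K = {(\<chi> i. \<epsilon> i * x $ i) | \<epsilon> x. x \<in> K \<and> (\<forall>i. \<epsilon> i \<in> {-1, 1})}"

definition supp_in :: "'n::finite dist \<Rightarrow> (real ^ 'n) set \<Rightarrow> bool" where
  "supp_in T K \<longleftrightarrow> (\<forall>\<phi>\<in>test_e.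
     (\<exists>U. open U \<and> sign_orbit K \<subseteq> U \<and> (\<forall>x\<in>U. \<phi> x = 0)) \<longrightarrow> T \<phi> = 0)"

definition sobolev_supp :: "real ^ 'n \<Rightarrow> real \<Rightarrow> (real ^ 'n) set \<Rightarrow> 'n::finite dist set" where
  "sobolev_supp \<alpha> s K = {T \<in> sobolev \<alpha> s. supp_in T K}"

text \<open>
  A linear operator \<open>A : V \<rightarrow> W\<close> between normed spaces of complex-valued functions (with the pointwise
  operations) is compact if it maps bounded sets to relatively compact subsets of \<open>W\<close>.
\<close>

definition norm_topology :: "('b \<Rightarrow> complex) set \<Rightarrow> (('b \<Rightarrow> complex) \<Rightarrow> real) \<Rightarrow>
    ('b \<Rightarrow> complex) topology" where
  "norm_topology W N = Metric_space.mtopology W (\<lambda>S T. N (\<lambda>f. S f - T f))"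

definition compact_operator ::
    "('a \<Rightarrow> complex) set \<Rightarrow> (('a \<Rightarrow> complex) \<Rightarrow> real) \<Rightarrow>
     ('b \<Rightarrow> complex) set \<Rightarrow> (('b \<Rightarrow> complex) \<Rightarrow> real) \<Rightarrow>
     (('a \<Rightarrow> complex) \<Rightarrow> 'b \<Rightarrow> complex) \<Rightarrow> bool" where
  "compact_operator V NV W NW A \<longleftrightarrow>
     A ` V \<subseteq> W \<and>
     (\<forall>S\<in>V. \<forall>T\<in>V. A (\<lambda>f. S f + T f) = (\<lambda>f. A S f + A T f)) \<and>
     (\<forall>c. \<forall>T\<in>V. A (\<lambda>f. c * T f) = (\<lambda>f. c * A T f)) \<and>
     (\<forall>B\<subseteq>V. (\<exists>C. \<forall>T\<in>B. NV T \<le> C) \<longrightarrow>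
        compactin (norm_topology W NW) (norm_topology W NW closure_of (A ` B)))"

end

theory Submission
  imports Defs "HOL-Probability.Sinc_Integral" "HOL-Complex_Analysis.Great_Picard"
begin

text \<open>
  Instead of seminorms one works with bounded sets of Schwartz functions: a linear functional that is bounded on them is
  continuous, and the Fourier-Bessel transform preserves them. Since products of one-dimensional Gaussians are mapped to
  Gaussians and separate functions, they yield the inversion formula, and \<open>H\<^sup>s\<close> is parametrized by the functions
  \<open>\<psi> = (1 + |\<xi>|\<^sup>2)\<^sup>s F(T)\<close> in the weighted space \<open>L\<^sup>2\<close>.

  If \<open>T\<close> is supported in \<open>K\<close> and the cutoff function \<open>\<chi>\<close> equals 1 near \<open>K\<close>, then \<open>T = \<chi> T\<close>, so \<open>F(T)(\<eta>)\<close> is the pairing of \<open>\<psi>\<close>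
  with a kernel \<open>k(\<eta>, \<cdot>)\<close> in \<open>L\<^sup>2\<close> that depends continuously on \<open>\<eta>\<close>. For a bounded sequence in \<open>H\<^sup>s\<close> with supports in \<open>K\<close>
  the functions \<open>F(T\<^sub>m)\<close> are therefore locally bounded and equicontinuous, and a subsequence converges pointwise. Fatou's lemma
  puts the limit in \<open>H\<^sup>s\<close>; convergence in the norm of \<open>H\<^sup>t\<close> follows by dominated convergence on a large ball and, outside of it,
  from the smallness of the factor \<open>(1 + |\<xi>|\<^sup>2)\<^bsup>t - s\<^esup>\<close>.
\<close>

section \<open>Bounded families of functions\<close>

text \<open>The obstacle is division by the coordinates. The Bessel operator contains
  \<open>(1/x_i) d_i\<close>, and this quotient has to be an even Schwartz function again, with
  bounds that are uniform on families; it is therefore written as an average of the second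
  derivative over the segment along which \<open>x_i\<close> is contracted to 0. The operator
  \<open>(1/x_i) d_i\<close> belongs to a change of parameter: a derivative of the transform raises
  \<open>\<alpha>_i\<close> by 1, an integration by parts lowers it again. Hence most statements up
  to the inversion formula are made for an arbitrary admissible parameter. Boundedness on bounded
  sets yields continuity because countably many seminorms generate the topology. The inversion
  constant is only shown to be nonzero, which suffices to recover \<open>T\<close> from
  \<open>\<psi>\<close>. The factor \<open>exp (|\<eta>|^2/2)\<close> in the bounds for the kernel
  has no intrinsic meaning: it dominates every power of \<open>|\<eta>|\<close> produced by
  differentiation, so that one bounded family covers all \<eta>, and it is harmless since the bounds
  are used locally in \<eta> or against faster decaying Gaussians.\<close>

definition rapid :: "(real ^ 'n \<Rightarrow> complex) set \<Rightarrow> bool" where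
  "rapid B \<longleftrightarrow> (\<forall>k. \<exists>C. \<forall>f\<in>B. \<forall>x. (1 + norm x) ^ k * norm (f x) \<le> C)"

definition slow :: "(real ^ 'n \<Rightarrow> complex) set \<Rightarrow> bool" where
  "slow B \<longleftrightarrow> (\<exists>k C. \<forall>f\<in>B. \<forall>x. norm (f x) \<le> C * (1 + norm x) ^ k)"

text \<open>The recursion runs over families instead of functions: uniform constants stay hidden in
  \<open>Q\<close>, and the product rule becomes an inclusion of sets. \<open>Q\<close> is a
  parameter because the same calculus serves rapid decrease, polynomial growth and decay near a
  hyperplane.\<close>

primrec bdd_upto :: "((real ^ 'n \<Rightarrow> complex) set \<Rightarrow> bool) \<Rightarrow> nat \<Rightarrow> (real ^ 'n \<Rightarrow> complex) set \<Rightarrow> bool" where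
  "bdd_upto Q 0 B \<longleftrightarrow> Q B \<and> (\<forall>f\<in>B. \<forall>x. f differentiable at x)"
| "bdd_upto Q (Suc m) B \<longleftrightarrow> Q B \<and> (\<forall>f\<in>B. \<forall>x. f differentiable at x) \<and>
     (\<forall>i. bdd_upto Q m (partial i ` B))"

definition bdd_smooth :: "((real ^ 'n \<Rightarrow> complex) set \<Rightarrow> bool) \<Rightarrow> (real ^ 'n \<Rightarrow> complex) set \<Rightarrow> bool" where
  "bdd_smooth Q B \<longleftrightarrow> (\<forall>m. bdd_upto Q m B)"

definition pointwise_mult :: "('a \<Rightarrow> complex) set \<Rightarrow> ('a \<Rightarrow> complex) set \<Rightarrow> ('a \<Rightarrow> complex) set" where
  "pointwise_mult A B = {\<lambda>x. f x * g x | f g. f \<in> A \<and> g \<in> B}"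

definition pointwise_add :: "('a \<Rightarrow> complex) set \<Rightarrow> ('a \<Rightarrow> complex) set \<Rightarrow> ('a \<Rightarrow> complex) set" where
  "pointwise_add A B = {\<lambda>x. f x + g x | f g. f \<in> A \<and> g \<in> B}"

lemma pointwise_multI: "f \<in> A \<Longrightarrow> g \<in> B \<Longrightarrow> (\<lambda>x. f x * g x) \<in> pointwise_mult A B"
  by (auto simp: pointwise_mult_def)

lemma pointwise_addI: "f \<in> A \<Longrightarrow> g \<in> B \<Longrightarrow> (\<lambda>x. f x + g x) \<in> pointwise_add A B"
  by (auto simp: pointwise_add_def)

text \<open>Just what the Leibniz rule consumes. One factor in \<open>mult\<close> always grows at
  most polynomially, so rapid decrease and polynomial growth are both instances.\<close>

locale growth =
  fixes Q :: "(real ^ 'n \<Rightarrow> complex) set \<Rightarrow> bool"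
  assumes mono: "Q B \<Longrightarrow> A \<subseteq> B \<Longrightarrow> Q A"
    and add: "Q A \<Longrightarrow> Q B \<Longrightarrow> Q (pointwise_add A B)"
    and mult: "slow A \<Longrightarrow> Q B \<Longrightarrow> Q (pointwise_mult A B)"

lemma rapidE:
  assumes "rapid B"
  obtains C where "C > 0" "\<And>f x. f \<in> B \<Longrightarrow> (1 + norm x) ^ k * norm (f x) \<le> C"
proof -
  obtain C where "\<forall>f\<in>B. \<forall>x. (1 + norm x) ^ k * norm (f x) \<le> C"
    using assms unfolding rapid_def by meson
  then show ?thesis
    using that[of "max C 1"] by (auto simp: le_max_iff_disj)
qed

lemma slowE:
  assumes "slow B"
  obtains C k where "C > 0" "\<And>f x. f \<in> B \<Longrightarrow> norm (f x) \<le> C * (1 + norm x) ^ k"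
proof -
  obtain C k where *: "\<forall>f\<in>B. \<forall>x. norm (f x) \<le> C * (1 + norm x) ^ k"
    using assms unfolding slow_def by meson
  have "norm (f x) \<le> max C 1 * (1 + norm x) ^ k" if "f \<in> B" for f x
    using * that by (intro order_trans[OF _ mult_right_mono[of C "max C 1" "(1 + norm x) ^ k"]]) auto
  then show ?thesis
    using that[of "max C 1" k] by auto
qed

lemma growth_rapid: "growth rapid"
proof
  show "rapid A" if "rapid B" "A \<subseteq> B" for A B :: "(real ^ 'n \<Rightarrow> complex) set"
    using that unfolding rapid_def by (meson subsetD)
next
  fix A B :: "(real ^ 'n \<Rightarrow> complex) set"
  assume A: "rapid A" and B: "rapid B"
  show "rapid (pointwise_add A B)"
    unfolding rapid_def
  proof
    fix k
    obtain C where C: "\<And>f x. f \<in> A \<Longrightarrow> (1 + norm x) ^ k * norm (f x) \<le> C"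
      using rapidE[OF A] by metis
    obtain D where D: "\<And>f x. f \<in> B \<Longrightarrow> (1 + norm x) ^ k * norm (f x) \<le> D"
      using rapidE[OF B] by metis
    have "(1 + norm x) ^ k * norm (f x + g x) \<le> C + D" if "f \<in> A" "g \<in> B" for f g x
    proof -
      have "(1 + norm x) ^ k * norm (f x + g x) \<le> (1 + norm x) ^ k * (norm (f x) + norm (g x))"
        by (intro mult_left_mono norm_triangle_ineq) auto
      with C[OF that(1), of x] D[OF that(2), of x] show ?thesis
        by (simp add: algebra_simps)
    qed
    then show "\<exists>C. \<forall>f\<in>pointwise_add A B. \<forall>x. (1 + norm x) ^ k * norm (f x) \<le> C"
      by (auto simp: pointwise_add_def)
  qed
next
  fix A B :: "(real ^ 'n \<Rightarrow> complex) set"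
  assume A: "slow A" and B: "rapid B"
  obtain C m where C: "C > 0" "\<And>f x. f \<in> A \<Longrightarrow> norm (f x) \<le> C * (1 + norm x) ^ m"
    using slowE[OF A] by metis
  show "rapid (pointwise_mult A B)"
    unfolding rapid_def
  proof
    fix k
    obtain D where D: "\<And>f x. f \<in> B \<Longrightarrow> (1 + norm x) ^ (k + m) * norm (f x) \<le> D"
      using rapidE[OF B] by metis
    have "(1 + norm x) ^ k * norm (f x * g x) \<le> C * D" if "f \<in> A" "g \<in> B" for f g x
    proof -
      have "(1 + norm x) ^ k * norm (f x * g x) \<le> (1 + norm x) ^ k * (C * (1 + norm x) ^ m * norm (g x))"
        using C(2)[OF that(1), of x] by (intro mult_left_mono) (auto simp: norm_mult intro!: mult_right_mono)
      also have "\<dots> = C * ((1 + norm x) ^ (k + m) * norm (g x))"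
        by (simp add: power_add mult_ac)
      also have "\<dots> \<le> C * D"
        using C(1) D[OF that(2)] by (intro mult_left_mono) auto
      finally show ?thesis .
    qed
    then show "\<exists>C. \<forall>f\<in>pointwise_mult A B. \<forall>x. (1 + norm x) ^ k * norm (f x) \<le> C"
      by (auto simp: pointwise_mult_def)
  qed
qed

lemma growth_slow: "growth slow"
proof
  show "slow A" if "slow B" "A \<subseteq> B" for A B :: "(real ^ 'n \<Rightarrow> complex) set"
    using that unfolding slow_def by (meson subsetD)
next
  fix A B :: "(real ^ 'n \<Rightarrow> complex) set"
  assume A: "slow A" and B: "slow B"
  obtain C m where C: "C > 0" "\<And>f x. f \<in> A \<Longrightarrow> norm (f x) \<le> C * (1 + norm x) ^ m"
    using slowE[OF A] by metis
  obtain D k where D: "D > 0" "\<And>f x. f \<in> B \<Longrightarrow> norm (f x) \<le> D * (1 + norm x) ^ k"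
    using slowE[OF B] by metis
  have "norm (f x + g x) \<le> (C + D) * (1 + norm x) ^ (m + k)" if "f \<in> A" "g \<in> B" for f g x
  proof -
    have "norm (f x + g x) \<le> C * (1 + norm x) ^ m + D * (1 + norm x) ^ k"
      using C(2)[OF that(1), of x] D(2)[OF that(2), of x] norm_triangle_ineq[of "f x" "g x"] by linarith
    also have "\<dots> \<le> C * (1 + norm x) ^ (m + k) + D * (1 + norm x) ^ (m + k)"
      using C(1) D(1) by (intro add_mono mult_left_mono power_increasing) auto
    finally show ?thesis by (simp add: algebra_simps)
  qed
  then show "slow (pointwise_add A B)"
    unfolding slow_def pointwise_add_def by blast
  have "norm (f x * g x) \<le> (C * D) * (1 + norm x) ^ (m + k)" if "f \<in> A" "g \<in> B" for f g x
  proof -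
    have "norm (f x * g x) \<le> (C * (1 + norm x) ^ m) * (D * (1 + norm x) ^ k)"
      unfolding norm_mult using C D that by (intro mult_mono) auto
    then show ?thesis by (simp add: power_add mult_ac)
  qed
  then show "slow (pointwise_mult A B)"
    unfolding slow_def pointwise_mult_def by blast
qed

section \<open>Sums and products of families of smooth functions\<close>

lemma partial_eqI: "(f has_derivative f') (at x) \<Longrightarrow> partial i f x = f' (axis i 1)"
  unfolding partial_def using frechet_derivative_at by metis

lemma partial_add:
  "f differentiable at x \<Longrightarrow> g differentiable at x \<Longrightarrow> partial i (\<lambda>x. f x + g x) x = partial i f x + partial i g x"
  by (rule partial_eqI[THEN trans, OF has_derivative_add[OF frechet_derivative_works[THEN iffD1]
        frechet_derivative_works[THEN iffD1]]]) (auto simp: partial_def)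

lemma partial_mult:
  fixes f g :: "real ^ 'n \<Rightarrow> complex"
  assumes "f differentiable at x" "g differentiable at x"
  shows "partial i (\<lambda>x. f x * g x) x = partial i f x * g x + f x * partial i g x"
  using partial_eqI[OF has_derivative_mult[OF frechet_derivative_works[THEN iffD1, OF assms(1)]
      frechet_derivative_works[THEN iffD1, OF assms(2)]], of i]
  by (simp add: partial_def add.commute)

context growth
begin

lemma bdd_upto_mono: "bdd_upto Q m B \<Longrightarrow> A \<subseteq> B \<Longrightarrow> bdd_upto Q m A"
proof (induction m arbitrary: A B)
  case 0
  then have "Q A" using mono[of B A] by simp
  with 0 show ?case by (simp add: subset_iff)
next
  case (Suc m)
  have "bdd_upto Q m (partial i ` A)" for i
  proof (rule Suc.IH)
    show "bdd_upto Q m (partial i ` B)" using Suc.prems by simp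
  qed (use Suc.prems in blast)
  moreover have "Q A" using mono[of B A] Suc.prems by simp
  moreover have "\<forall>f\<in>A. \<forall>x. f differentiable at x"
    using Suc.prems by (simp add: subset_iff)
  ultimately show ?case by simp
qed

lemma bdd_upto_Suc_imp: "bdd_upto Q (Suc m) B \<Longrightarrow> bdd_upto Q m B"
proof (induction m arbitrary: B)
  case (Suc m)
  have "Q B \<and> (\<forall>f\<in>B. \<forall>x. f differentiable at x) \<and> (\<forall>i. bdd_upto Q (Suc m) (partial i ` B))"
    using bdd_upto.simps(2)[of Q "Suc m" B] Suc.prems by (simp only:)
  with Suc.IH show ?case unfolding bdd_upto.simps(2)[of Q m B] by (meson)
qed simp

lemma bdd_upto_add: "bdd_upto Q m A \<Longrightarrow> bdd_upto Q m B \<Longrightarrow> bdd_upto Q m (pointwise_add A B)"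
proof (induction m arbitrary: A B)
  case 0 then show ?case using add[of A B] by (auto simp: pointwise_add_def)
next
  case (Suc m)
  have "bdd_upto Q m (partial i ` pointwise_add A B)" for i
  proof (rule bdd_upto_mono[OF Suc.IH])
    show "bdd_upto Q m (partial i ` A)" "bdd_upto Q m (partial i ` B)"
      using Suc.prems by auto
    have "partial i (\<lambda>x. f x + g x) = (\<lambda>x. partial i f x + partial i g x)" if "f \<in> A" "g \<in> B" for f g
      using Suc.prems that by (intro ext partial_add) auto
    then show "partial i ` pointwise_add A B \<subseteq> pointwise_add (partial i ` A) (partial i ` B)"
      unfolding pointwise_add_def by (safe, metis (mono_tags, lifting) CollectI imageI)
  qed
  with Suc.prems add[of A B] show ?case by (auto simp: pointwise_add_def)
qed

text \<open>By the product rule, the derivatives of the products lie in a sum of two families of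
  products. In each of them only one factor has lost an order; the other is weakened to the same
  order by \<open>bdd_upto_Suc_imp\<close> before the induction hypothesis applies.\<close>

lemma bdd_upto_mult: "bdd_upto slow m A \<Longrightarrow> bdd_upto Q m B \<Longrightarrow> bdd_upto Q m (pointwise_mult A B)"
proof (induction m arbitrary: A B)
  case 0 then show ?case using mult[of A B] by (auto simp: pointwise_mult_def)
next
  case (Suc m)
  have "bdd_upto Q m (partial i ` pointwise_mult A B)" for i
  proof (rule bdd_upto_mono)
    have "bdd_upto slow m (partial i ` A)" "bdd_upto Q m (partial i ` B)"
      using Suc.prems by auto
    moreover have "bdd_upto slow m A" "bdd_upto Q m B"
      by (rule growth.bdd_upto_Suc_imp[OF growth_slow Suc.prems(1)], rule bdd_upto_Suc_imp[OF Suc.prems(2)])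
    ultimately show "bdd_upto Q m (pointwise_add (pointwise_mult (partial i ` A) B) (pointwise_mult A (partial i ` B)))"
      by (intro bdd_upto_add Suc.IH)
    have *: "partial i (\<lambda>x. f x * g x) = (\<lambda>x. partial i f x * g x + f x * partial i g x)" if "f \<in> A" "g \<in> B" for f g
      using Suc.prems that by (intro ext partial_mult) auto
    show "partial i ` pointwise_mult A B \<subseteq>
      pointwise_add (pointwise_mult (partial i ` A) B) (pointwise_mult A (partial i ` B))"
    proof
      fix h assume "h \<in> partial i ` pointwise_mult A B"
      then obtain f g where "f \<in> A" "g \<in> B" "h = partial i (\<lambda>x. f x * g x)"
        by (auto simp: pointwise_mult_def)
      then show "h \<in> pointwise_add (pointwise_mult (partial i ` A) B) (pointwise_mult A (partial i ` B))"
        using * by (auto intro!: pointwise_addI pointwise_multI)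
    qed
  qed
  moreover have "slow A" "Q B" "f \<in> A \<Longrightarrow> f differentiable at x" "f \<in> B \<Longrightarrow> f differentiable at x" for f x
    using Suc.prems by simp_all
  ultimately show ?case using mult[of A B] by (auto simp: pointwise_mult_def)
qed

lemma bdd_smooth_mono: "bdd_smooth Q B \<Longrightarrow> A \<subseteq> B \<Longrightarrow> bdd_smooth Q A"
  unfolding bdd_smooth_def using bdd_upto_mono by blast

lemma bdd_smooth_add: "bdd_smooth Q A \<Longrightarrow> bdd_smooth Q B \<Longrightarrow> bdd_smooth Q (pointwise_add A B)"
  unfolding bdd_smooth_def using bdd_upto_add by blast

lemma bdd_smooth_mult: "bdd_smooth slow A \<Longrightarrow> bdd_smooth Q B \<Longrightarrow> bdd_smooth Q (pointwise_mult A B)"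
  unfolding bdd_smooth_def using bdd_upto_mult by blast

end

lemma bdd_smooth_partial: "bdd_smooth Q B \<Longrightarrow> bdd_smooth Q (partial i ` B)"
  unfolding bdd_smooth_def using bdd_upto.simps(2) by blast

lemma bdd_smooth_partials: "bdd_smooth Q B \<Longrightarrow> bdd_smooth Q (partials is ` B)"
proof (induction "is")
  case (Cons i js)
  then show ?case using bdd_smooth_partial[of Q "partials js ` B" i] by (simp add: image_image)
qed auto

lemma bdd_smoothD:
  assumes "bdd_smooth Q B"
  shows "Q B" "f \<in> B \<Longrightarrow> f differentiable at x"
  using assms[unfolded bdd_smooth_def, THEN spec, of 0] by simp_all

text \<open>Connects the recursion on the order with the iterated derivatives
  \<open>partials is\<close> in which the Schwartz space is defined.\<close>

lemma bdd_smooth_iff: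
  "bdd_smooth Q B \<longleftrightarrow> (\<forall>is. Q (partials is ` B) \<and> (\<forall>f\<in>B. \<forall>x. partials is f differentiable at x))"
proof
  assume "bdd_smooth Q B"
  then have "bdd_smooth Q (partials is ` B)" for "is" by (rule bdd_smooth_partials)
  then show "\<forall>is. Q (partials is ` B) \<and> (\<forall>f\<in>B. \<forall>x. partials is f differentiable at x)"
    by (metis bdd_smoothD image_eqI)
next
  assume *: "\<forall>is. Q (partials is ` B) \<and> (\<forall>f\<in>B. \<forall>x. partials is f differentiable at x)"
  have "bdd_upto Q m (partials is ` B)" for m "is"
  proof (induction m arbitrary: "is")
    case 0 then show ?case using * by auto
  next
    case (Suc m)
    have "bdd_upto Q m (partial i ` partials is ` B)" for i
      using Suc.IH[of "i # is"] by (simp add: image_image)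
    with * show ?case by auto
  qed
  from this[of _ "[]"] show "bdd_smooth Q B" by (simp add: bdd_smooth_def)
qed

text \<open>Most families below are stable under differentiation up to the factor \<open>x\<^sub>i\<close>.\<close>

definition linear_coords :: "real \<Rightarrow> 'n \<Rightarrow> (real ^ 'n \<Rightarrow> complex) set" where
  "linear_coords C i = {\<lambda>x. c * complex_of_real (x $ i) | c. norm c \<le> C}"

lemma has_derivative_coord:
  "((\<lambda>x. c * complex_of_real (x $ i)) has_derivative (\<lambda>h. c * complex_of_real (h $ i))) (at x)"
  by (rule bounded_linear_imp_has_derivative)
    (intro bounded_linear_mult_right[THEN bounded_linear_compose] bounded_linear_of_real[THEN bounded_linear_compose] bounded_linear_vec_nth)

lemma slow_const: "bdd_upto slow m {\<lambda>x. c | c. norm c \<le> C}"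
proof -
  have slow: "slow {\<lambda>x. c | c. norm c \<le> C}" for C
    unfolding slow_def by (rule exI[of _ 0], rule exI[of _ C]) auto
  have p: "partial i (\<lambda>x. c) = (\<lambda>x. 0)" for c :: complex and i :: 'a
    by (simp add: partial_def fun_eq_iff)
  show ?thesis
  proof (induction m arbitrary: C)
    case 0 then show ?case using slow by auto
  next
    case (Suc m)
    have "bdd_upto slow m (partial i ` {\<lambda>x. c | c. norm c \<le> C})" for i :: 'a
      by (rule growth.bdd_upto_mono[OF growth_slow Suc.IH[of 0]]) (auto simp: p)
    then show ?case using slow by auto
  qed
qed

lemma bdd_smooth_const: "bdd_smooth slow {\<lambda>x. c | c. norm c \<le> C}"
  unfolding bdd_smooth_def using slow_const by blast

lemma bdd_smooth_linear_coords:
  fixes i :: "'n::finite"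
  shows "bdd_smooth slow (linear_coords C i)"
proof -
  have "norm (c * complex_of_real (x $ i)) \<le> C * (1 + norm x)^1" if "norm c \<le> C" for c and x :: "real ^ 'n"
    using component_le_norm_cart[of x i] that order_trans[OF norm_ge_zero that] unfolding norm_mult
    by (intro mult_mono) auto
  then have slow: "slow (linear_coords C i)"
    unfolding slow_def linear_coords_def by blast
  have p: "partial j (\<lambda>x. c * complex_of_real (x $ i)) = (\<lambda>x. c * of_bool (i = j))" for c j
    using partial_eqI[OF has_derivative_coord, of j c i] by (auto simp: fun_eq_iff axis_def)
  have d: "f differentiable at x" if "f \<in> linear_coords C i" for f x
    using that has_derivative_coord differentiable_def unfolding linear_coords_def by blast
  have "bdd_upto slow m (partial j ` linear_coords C i)" for j m
  proof (rule growth.bdd_upto_mono[OF growth_slow slow_const])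
    show "partial j ` linear_coords C i \<subseteq> {\<lambda>x. c |c. cmod c \<le> \<bar>C\<bar>}"
    proof
      fix h assume "h \<in> partial j ` linear_coords C i"
      then obtain c where "cmod c \<le> C" "h = (\<lambda>x. c * of_bool (i = j))"
        using p by (auto simp: linear_coords_def)
      then show "h \<in> {\<lambda>x. c |c. cmod c \<le> \<bar>C\<bar>}"
        by (auto intro!: exI[of _ "c * of_bool (i = j)"])
    qed
  qed
  then have "bdd_upto slow m (linear_coords C i)" for m
    using slow d by (cases m) auto
  then show ?thesis by (simp add: bdd_smooth_def)
qed

text \<open>Induction on the order with the index \<open>a\<close> left free: a derivative of
  \<open>B a\<close> is a coordinate with bounded coefficient times a member of \<open>B b\<close>,
  so the induction hypothesis for \<open>b\<close> and the product rule give the next order. The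
  index is what moves under differentiation, such as a Bessel parameter or the exponent of a
  weight.\<close>

lemma (in growth) bdd_smooth_family:
  assumes Q: "\<And>a. a \<in> I \<Longrightarrow> Q (B a)"
    and d: "\<And>a f x. a \<in> I \<Longrightarrow> f \<in> B a \<Longrightarrow> f differentiable at x"
    and p: "\<And>a i. a \<in> I \<Longrightarrow> \<exists>b\<in>I. \<exists>C. partial i ` B a \<subseteq> pointwise_mult (linear_coords C i) (B b)"
    and a: "a \<in> I"
  shows "bdd_smooth Q (B a)"
proof -
  have "bdd_upto Q m (B a)" if "a \<in> I" for m a
    using that
  proof (induction m arbitrary: a)
    case 0 then show ?case using Q d by auto
  next
    case (Suc m)
    have "bdd_upto Q m (partial i ` B a)" for i
    proof -
      obtain b C where "b \<in> I" "partial i ` B a \<subseteq> pointwise_mult (linear_coords C i) (B b)"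
        using p[OF Suc.prems] by blast
      then show ?thesis
        using bdd_upto_mono[OF bdd_upto_mult[OF _ Suc.IH]] bdd_smooth_linear_coords
        unfolding bdd_smooth_def by blast
    qed
    then show ?case using Q d Suc.prems by auto
  qed
  then show ?thesis using a by (simp add: bdd_smooth_def)
qed

section \<open>Bounded sets of even Schwartz functions and of their multipliers\<close>

definition schwartz_bdd :: "(real ^ 'n \<Rightarrow> complex) set \<Rightarrow> bool" where
  "schwartz_bdd B \<longleftrightarrow> bdd_smooth rapid B \<and> (\<forall>f\<in>B. even_fun f)"

definition mult_bdd :: "(real ^ 'n \<Rightarrow> complex) set \<Rightarrow> bool" where
  "mult_bdd B \<longleftrightarrow> bdd_smooth slow B \<and> (\<forall>f\<in>B. even_fun f)"

text \<open>Membership is boundedness of a singleton, so each result on bounded sets contains the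
  one on single functions.\<close>

lemma schwartz_e_iff: "f \<in> schwartz_e \<longleftrightarrow> schwartz_bdd {f}"
proof -
  have "bdd_above (range g) \<longleftrightarrow> (\<exists>C. \<forall>x. g x \<le> C)" for g :: "real ^ 'n \<Rightarrow> real"
    by (auto simp: bdd_above_def)
  note * = this[of "\<lambda>x. (1 + norm x) ^ k * norm (partials is f x)" for k "is"]
  show ?thesis
    by (auto simp: * schwartz_e_def schwartz_bdd_def bdd_smooth_iff smooth_def rapid_def differentiable_on_def)
qed

lemma schwartz_bdd_mono: "schwartz_bdd B \<Longrightarrow> A \<subseteq> B \<Longrightarrow> schwartz_bdd A"
  unfolding schwartz_bdd_def using growth.bdd_smooth_mono[OF growth_rapid] by blast

lemma schwartz_bdd_subset: "schwartz_bdd B \<Longrightarrow> B \<subseteq> schwartz_e"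
  using schwartz_bdd_mono schwartz_e_iff by blast

lemma mult_bdd_mono: "mult_bdd B \<Longrightarrow> A \<subseteq> B \<Longrightarrow> mult_bdd A"
  unfolding mult_bdd_def using growth.bdd_smooth_mono[OF growth_slow] by blast

lemma even_fun_mult: "even_fun f \<Longrightarrow> even_fun g \<Longrightarrow> even_fun (\<lambda>x. f x * g x)"
  by (simp add: even_fun_def)

lemma even_fun_add: "even_fun f \<Longrightarrow> even_fun g \<Longrightarrow> even_fun (\<lambda>x. f x + g x)"
  by (simp add: even_fun_def)

lemma schwartz_bdd_mult: "mult_bdd A \<Longrightarrow> schwartz_bdd B \<Longrightarrow> schwartz_bdd (pointwise_mult A B)"
  unfolding schwartz_bdd_def mult_bdd_def using growth.bdd_smooth_mult[OF growth_rapid]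
  by (auto simp: pointwise_mult_def even_fun_mult)

lemma schwartz_bdd_add: "schwartz_bdd A \<Longrightarrow> schwartz_bdd B \<Longrightarrow> schwartz_bdd (pointwise_add A B)"
  unfolding schwartz_bdd_def using growth.bdd_smooth_add[OF growth_rapid]
  by (auto simp: pointwise_add_def even_fun_add)

lemma mult_bdd_const: "mult_bdd {\<lambda>x. c | c. norm c \<le> C}"
  unfolding mult_bdd_def using bdd_smooth_const by (auto simp: even_fun_def)

lemma schwartz_e_mult: "mult_bdd {h} \<Longrightarrow> f \<in> schwartz_e \<Longrightarrow> (\<lambda>x. h x * f x) \<in> schwartz_e"
  using schwartz_bdd_mult[of "{h}" "{f}"] schwartz_e_iff by (auto simp: pointwise_mult_def)

lemma schwartz_e_cmult: "f \<in> schwartz_e \<Longrightarrow> (\<lambda>x. c * f x) \<in> schwartz_e"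
  by (rule schwartz_e_mult[OF mult_bdd_mono[OF mult_bdd_const[of "norm c"]]]) auto

lemma schwartz_e_add: "f \<in> schwartz_e \<Longrightarrow> g \<in> schwartz_e \<Longrightarrow> (\<lambda>x. f x + g x) \<in> schwartz_e"
  using schwartz_bdd_add[of "{f}" "{g}"] schwartz_e_iff by (auto simp: pointwise_add_def)

lemma schwartz_e_diff: "f \<in> schwartz_e \<Longrightarrow> g \<in> schwartz_e \<Longrightarrow> (\<lambda>x. f x - g x) \<in> schwartz_e"
  using schwartz_e_add[of f "\<lambda>x. -1 * g x"] schwartz_e_cmult[of g "-1"] by simp

lemma schwartz_e_smooth: "f \<in> schwartz_e \<Longrightarrow> partials is f differentiable at x"
  by (auto simp: schwartz_e_def smooth_def differentiable_on_def)

lemma schwartz_e_continuous: "f \<in> schwartz_e \<Longrightarrow> continuous_on UNIV f"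
  using schwartz_e_smooth[of f "[]"] by (simp add: continuous_at_imp_continuous_on differentiable_imp_continuous_within)

lemma schwartz_bdd_rapid: "schwartz_bdd B \<Longrightarrow> rapid B"
  unfolding schwartz_bdd_def using bdd_smoothD(1) by metis

lemma schwartz_e_rapid: "f \<in> schwartz_e \<Longrightarrow> rapid {f}"
  using schwartz_bdd_rapid schwartz_e_iff by blast

section \<open>Normalized Bessel functions\<close>

text \<open>Coefficients in the variable \<open>z = t^2/4\<close>;
  \<open>norm_bessel \<gamma>\<close> is the hypergeometric function 0F1 of parameter \<gamma> + 1
  at -z. Pochhammer symbols replace quotients of Gamma values, so that identities between parameters
  become rational.\<close>

definition bessel_coeff :: "real \<Rightarrow> nat \<Rightarrow> real" where
  "bessel_coeff \<gamma> k = (-1) ^ k / (fact k * pochhammer (\<gamma> + 1) k)"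

lemma pochhammer_ge:
  fixes a :: real
  assumes "a \<ge> 1/2"
  shows "pochhammer a k \<ge> (1/2) ^ k"
proof (induction k)
  case (Suc k)
  have "(1/2) ^ k * (1/2) \<le> pochhammer a k * (a + real k)"
    using Suc assms by (intro mult_mono) (auto intro: order_trans[OF _ Suc])
  then show ?case by (simp add: pochhammer_Suc)
qed simp

text \<open>As \<gamma> + 1 > 1/2, the Pochhammer symbol is at least \<open>(1/2)^k\<close>, and the
  exponential series at \<open>2 * \<bar>z\<bar>\<close> is a majorant.\<close>

lemma summable_bessel_coeff:
  assumes "\<gamma> > -1/2"
  shows "summable (\<lambda>k. bessel_coeff \<gamma> k * z ^ k)"
proof (rule summable_comparison_test')
  show "summable (\<lambda>k. (2 * \<bar>z\<bar>) ^ k / fact k)"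
    using summable_exp[of "2 * \<bar>z\<bar>"] by (simp add: field_simps)
  show "norm (bessel_coeff \<gamma> k * z ^ k) \<le> (2 * \<bar>z\<bar>) ^ k / fact k" for k
  proof -
    have p: "(1/2) ^ k \<le> pochhammer (\<gamma> + 1) k" using assms by (intro pochhammer_ge) auto
    then have p0: "pochhammer (\<gamma> + 1) k > 0" by (rule less_le_trans[rotated]) auto
    have "norm (bessel_coeff \<gamma> k * z ^ k) = \<bar>z\<bar> ^ k / fact k * (1 / pochhammer (\<gamma> + 1) k)"
      using p0 by (simp add: bessel_coeff_def abs_mult power_abs)
    also have "\<dots> \<le> \<bar>z\<bar> ^ k / fact k * (1 / (1/2) ^ k)"
      using p p0 by (intro mult_left_mono divide_left_mono) auto
    also have "\<dots> = (2 * \<bar>z\<bar>) ^ k / fact k"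
      by (simp add: power_mult_distrib power_divide)
    finally show ?thesis .
  qed
qed

lemma norm_bessel_eq:
  assumes "\<gamma> > -1/2"
  shows "norm_bessel \<gamma> t = (\<Sum>k. bessel_coeff \<gamma> k * (t\<^sup>2 / 4) ^ k)"
proof -
  have G: "Gamma (\<gamma> + 1) \<noteq> 0"
    using assms Gamma_real_pos[of "\<gamma> + 1"] by linarith
  have "\<gamma> + 1 \<notin> \<int>\<^sub>\<le>\<^sub>0" using assms by (auto elim!: nonpos_Ints_cases)
  then have P: "pochhammer (\<gamma> + 1) k = Gamma (real k + \<gamma> + 1) / Gamma (\<gamma> + 1)" for k
    using pochhammer_Gamma[of "\<gamma> + 1" k] by (simp add: ac_simps)
  have c: "(-1) ^ k / (fact k * Gamma (real k + \<gamma> + 1)) * (t / 2) ^ (2 * k)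
      = 1 / Gamma (\<gamma> + 1) * (bessel_coeff \<gamma> k * (t\<^sup>2 / 4) ^ k)" for k
    using G by (simp add: bessel_coeff_def P power_mult power_divide)
  show ?thesis
    unfolding norm_bessel_def c
    using suminf_mult[OF summable_bessel_coeff[OF assms, of "t\<^sup>2 / 4"], of "1 / Gamma (\<gamma> + 1)"] G by simp
qed

lemma norm_bessel_0: "\<gamma> > -1/2 \<Longrightarrow> norm_bessel \<gamma> 0 = 1"
  using powser_zero[of "bessel_coeff \<gamma>"] by (simp add: norm_bessel_eq bessel_coeff_def)

lemma norm_bessel_minus: "\<gamma> > -1/2 \<Longrightarrow> norm_bessel \<gamma> (- t) = norm_bessel \<gamma> t"
  by (simp add: norm_bessel_eq)

lemma diffs_bessel_coeff:
  assumes "\<gamma> > -1/2"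
  shows "diffs (bessel_coeff \<gamma>) k = - (1 / (\<gamma> + 1)) * bessel_coeff (\<gamma> + 1) k"
proof -
  have "pochhammer (\<gamma> + 2) k > 0" "\<gamma> + 1 > 0" using assms by (auto intro!: pochhammer_pos)
  then show ?thesis
    using pochhammer_rec[of "\<gamma> + 1" k]
    by (simp add: diffs_def bessel_coeff_def field_simps del: of_nat_Suc)
qed

text \<open>Termwise differentiation in \<open>z = t^2/4\<close> turns the series for \<gamma> into
  the one for \<gamma> + 1, up to a constant; the inner derivative contributes \<open>t/2\<close>.
  This shift of the parameter governs all later derivatives.\<close>

lemma norm_bessel_deriv:
  assumes "\<gamma> > -1/2"
  shows "(norm_bessel \<gamma> has_real_derivative - (t / (2 * (\<gamma> + 1))) * norm_bessel (\<gamma> + 1) t) (at t)"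
proof -
  have "((\<lambda>z. \<Sum>k. bessel_coeff \<gamma> k * z ^ k) has_real_derivative
      (\<Sum>k. diffs (bessel_coeff \<gamma>) k * (t\<^sup>2 / 4) ^ k)) (at (t\<^sup>2 / 4))"
    by (rule termdiffs_strong_converges_everywhere[OF summable_bessel_coeff[OF assms]])
  moreover have "(\<Sum>k. diffs (bessel_coeff \<gamma>) k * (t\<^sup>2 / 4) ^ k) = - (1 / (\<gamma> + 1)) * norm_bessel (\<gamma> + 1) t"
    unfolding diffs_bessel_coeff[OF assms]
    using assms suminf_mult[OF summable_bessel_coeff[of "\<gamma> + 1" "t\<^sup>2 / 4"], of "- (1 / (\<gamma> + 1))"]
    by (simp add: norm_bessel_eq mult.assoc)
  ultimately have "((\<lambda>z. \<Sum>k. bessel_coeff \<gamma> k * z ^ k) has_real_derivative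
      - (1 / (\<gamma> + 1)) * norm_bessel (\<gamma> + 1) t) (at (t\<^sup>2 / 4))" by simp
  moreover have "((\<lambda>t::real. t\<^sup>2 / 4) has_real_derivative t / 2) (at t)"
    by (auto intro!: derivative_eq_intros)
  ultimately have "((\<lambda>t. \<Sum>k. bessel_coeff \<gamma> k * (t\<^sup>2 / 4) ^ k) has_real_derivative
      - (1 / (\<gamma> + 1)) * norm_bessel (\<gamma> + 1) t * (t / 2)) (at t)"
    by (rule DERIV_chain2)
  moreover have "norm_bessel \<gamma> = (\<lambda>t. \<Sum>k. bessel_coeff \<gamma> k * (t\<^sup>2 / 4) ^ k)"
    using assms norm_bessel_eq by auto
  moreover have "- (1 / (\<gamma> + 1)) * norm_bessel (\<gamma> + 1) t * (t / 2) = - (t / (2 * (\<gamma> + 1))) * norm_bessel (\<gamma> + 1) t"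
    by (simp add: field_simps)
  ultimately show ?thesis by metis
qed

text \<open>The contiguous relation of 0F1. Together with two applications of
  \<open>norm_bessel_deriv\<close> it is Bessel's differential equation, freed from
  derivatives.\<close>

lemma norm_bessel_recurrence:
  assumes "\<gamma> > -1/2"
  shows "t\<^sup>2 * norm_bessel (\<gamma> + 2) t = 4 * (\<gamma> + 1) * (\<gamma> + 2) * (norm_bessel (\<gamma> + 1) t - norm_bessel \<gamma> t)"
proof -
  define z where "z = t\<^sup>2 / 4"
  define d where "d k = (\<gamma> + 1) * (\<gamma> + 2) * (bessel_coeff (\<gamma> + 1) k * z ^ k - bessel_coeff \<gamma> k * z ^ k)" for k
  have s1: "summable (\<lambda>k. bessel_coeff (\<gamma> + 1) k * z ^ k)" and s0: "summable (\<lambda>k. bessel_coeff \<gamma> k * z ^ k)"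
    and s2: "summable (\<lambda>k. bessel_coeff (\<gamma> + 2) k * z ^ k)"
    using assms by (auto intro!: summable_bessel_coeff)
  have sd: "summable d" unfolding d_def by (intro summable_mult summable_diff s0 s1)
  \<comment> \<open>The constant terms of the two series cancel, so the index can be shifted by one;
    this produces the factor \<open>z\<close>.\<close>
  have "d (Suc k) = z * (bessel_coeff (\<gamma> + 2) k * z ^ k)" for k
  proof -
    define p where "p = pochhammer (\<gamma> + 3) k"
    have pos: "p > 0" "\<gamma> + 1 > 0" "\<gamma> + 2 > 0" "\<gamma> + 2 + real k > 0"
      using assms by (auto simp: p_def intro!: pochhammer_pos)
    have P2: "pochhammer (\<gamma> + 2) (Suc k) = (\<gamma> + 2) * p"
      using pochhammer_rec[of "\<gamma> + 2" k] by (simp add: p_def add.assoc)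
    have P1': "pochhammer (\<gamma> + 1) (Suc (Suc k)) = (\<gamma> + 1) * ((\<gamma> + 2) * p)"
      using pochhammer_rec[of "\<gamma> + 1" "Suc k"] P2 by (simp add: add.assoc)
    have P1: "pochhammer (\<gamma> + 1) (Suc k) = (\<gamma> + 1) * ((\<gamma> + 2) * p) / (\<gamma> + 2 + real k)"
      using P1' pochhammer_Suc[of "\<gamma> + 1" "Suc k"] pos by (simp add: field_simps)
    have c1: "bessel_coeff (\<gamma> + 1) (Suc k) = (-1) ^ Suc k / (fact (Suc k) * ((\<gamma> + 2) * p))"
      unfolding bessel_coeff_def using P2 by (simp add: add.assoc)
    have c0: "bessel_coeff \<gamma> (Suc k) = (-1) ^ Suc k / (fact (Suc k) * ((\<gamma> + 1) * ((\<gamma> + 2) * p) / (\<gamma> + 2 + real k)))"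
      unfolding bessel_coeff_def P1 by simp
    have c2: "bessel_coeff (\<gamma> + 2) k = (-1) ^ k / (fact k * p)"
      unfolding bessel_coeff_def p_def by (simp add: add.assoc)
    have "(\<gamma> + 1) * (\<gamma> + 2) * (bessel_coeff (\<gamma> + 1) (Suc k) - bessel_coeff \<gamma> (Suc k)) = bessel_coeff (\<gamma> + 2) k"
      unfolding c0 c1 c2 using pos by (simp add: divide_simps) (simp add: algebra_simps)
    moreover have "d (Suc k) = ((\<gamma> + 1) * (\<gamma> + 2) * (bessel_coeff (\<gamma> + 1) (Suc k) - bessel_coeff \<gamma> (Suc k))) * z ^ Suc k"
      unfolding d_def by (simp add: algebra_simps)
    ultimately show ?thesis by simp
  qed
  moreover have "d 0 = 0" by (simp add: d_def bessel_coeff_def)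
  ultimately have "suminf d = z * (\<Sum>k. bessel_coeff (\<gamma> + 2) k * z ^ k)"
    using suminf_split_head[OF sd] suminf_mult[OF s2, of z] by simp
  moreover have "suminf d = (\<gamma> + 1) * (\<gamma> + 2) * (norm_bessel (\<gamma> + 1) t - norm_bessel \<gamma> t)"
    unfolding d_def using suminf_mult[OF summable_diff[OF s1 s0]] suminf_diff[OF s1 s0] assms
    by (simp add: norm_bessel_eq z_def)
  moreover have "(\<Sum>k. bessel_coeff (\<gamma> + 2) k * z ^ k) = norm_bessel (\<gamma> + 2) t"
    using assms by (simp add: norm_bessel_eq z_def)
  ultimately show ?thesis unfolding z_def by (simp add: algebra_simps)
qed

text \<open>The energy \<open>j\<^sup>2 + j'\<^sup>2\<close> is nonincreasing on \<open>[0, \<infinity>)\<close> because of the Bessel equation.\<close>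

lemma norm_bessel_energy:
  assumes "\<gamma> > -1/2"
  shows "(norm_bessel \<gamma> t)\<^sup>2 + (t / (2 * (\<gamma> + 1)) * norm_bessel (\<gamma> + 1) t)\<^sup>2 \<le> 1"
proof -
  define c where "c = 1 / (2 * (\<gamma> + 1))"
  \<comment> \<open>Here \<gamma> > -1/2 enters: it makes \<open>c - 1\<close> nonpositive, and for
    t \<ge> 0 the derivative of the energy is \<open>c - 1\<close> times a nonnegative
    factor.\<close>
  have c: "0 < c" "c \<le> 1" using assms by (auto simp: c_def field_simps)
  define en where "en t = (norm_bessel \<gamma> t)\<^sup>2 + (c * t * norm_bessel (\<gamma> + 1) t)\<^sup>2" for t
  have d: "(en has_real_derivative 2 * c * t * (norm_bessel (\<gamma> + 1) t)\<^sup>2 * (c - 1)) (at t)" for t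
  proof -
    define j b b2 where "j = norm_bessel \<gamma> t" and "b = norm_bessel (\<gamma> + 1) t" and "b2 = norm_bessel (\<gamma> + 2) t"
    have 1: "(norm_bessel \<gamma> has_real_derivative - (c * t * b)) (at t)"
      using norm_bessel_deriv[OF assms, of t] by (simp add: c_def b_def)
    have 2: "(norm_bessel (\<gamma> + 1) has_real_derivative - (t / (2 * (\<gamma> + 2)) * b2)) (at t)"
      using norm_bessel_deriv[of "\<gamma> + 1" t] assms by (simp add: b2_def add.assoc)
    have "c * t * (t / (2 * (\<gamma> + 2)) * b2) = (t\<^sup>2 * b2) / (4 * (\<gamma> + 1) * (\<gamma> + 2))"
      by (simp add: c_def power2_eq_square algebra_simps)
    also have "\<dots> = b - j"
      using norm_bessel_recurrence[OF assms, of t] assms by (simp add: b_def b2_def j_def)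
    finally have rec: "c * t * (t / (2 * (\<gamma> + 2)) * b2) = b - j" .
    have a: "((\<lambda>t. c * t * norm_bessel (\<gamma> + 1) t) has_real_derivative
        c * b - c * t * (t / (2 * (\<gamma> + 2)) * b2)) (at t)"
      by (rule DERIV_cong[OF DERIV_mult[OF DERIV_cmult[OF DERIV_ident, of c] 2]]) (simp add: b_def)
    have "(en has_real_derivative 2 * (j * - (c * t * b)) +
        2 * ((c * t * b) * (c * b - c * t * (t / (2 * (\<gamma> + 2)) * b2)))) (at t)"
      unfolding en_def
      by (rule DERIV_cong[OF DERIV_add[OF DERIV_power[OF 1, of 2] DERIV_power[OF a, of 2]]])
        (simp add: j_def b_def)
    also have "2 * (j * - (c * t * b)) + 2 * ((c * t * b) * (c * b - c * t * (t / (2 * (\<gamma> + 2)) * b2)))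
        = 2 * c * t * b\<^sup>2 * (c - 1)"
      unfolding rec by (simp add: power2_eq_square algebra_simps)
    finally show ?thesis by (simp add: b_def)
  qed
  have pos: "en t \<le> 1" if "t \<ge> 0" for t
  proof -
    have "en t \<le> en 0"
    proof (rule DERIV_nonpos_imp_nonincreasing[OF that])
      fix x assume "0 \<le> x" "x \<le> t"
      then have "2 * c * x * (norm_bessel (\<gamma> + 1) x)\<^sup>2 * (c - 1) \<le> 0"
        using c by (intro mult_nonneg_nonpos mult_nonneg_nonneg) simp_all
      with d show "\<exists>y. (en has_real_derivative y) (at x) \<and> y \<le> 0" by blast
    qed
    also have "en 0 = 1" using assms by (simp add: en_def norm_bessel_0)
    finally show ?thesis .
  qed
  have "en t = en \<bar>t\<bar>"
    using assms by (auto simp: en_def abs_if norm_bessel_minus)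
  then have "en t \<le> 1" using pos[of "\<bar>t\<bar>"] by simp
  then show ?thesis by (simp add: en_def c_def)
qed

section \<open>Bounds for Bessel functions that are uniform in the argument\<close>

lemma abs_norm_bessel_le: "\<gamma> > -1/2 \<Longrightarrow> \<bar>norm_bessel \<gamma> t\<bar> \<le> 1"
  using norm_bessel_energy[of \<gamma> t] zero_le_power2[of "t / (2 * (\<gamma> + 1)) * norm_bessel (\<gamma> + 1) t"]
  by (subst abs_square_le_1[symmetric]) linarith

lemma abs_norm_bessel_deriv_le: "\<gamma> > -1/2 \<Longrightarrow> \<bar>t / (2 * (\<gamma> + 1)) * norm_bessel (\<gamma> + 1) t\<bar> \<le> 1"
  using norm_bessel_energy[of \<gamma> t] zero_le_power2[of "norm_bessel \<gamma> t"]
  by (subst abs_square_le_1[symmetric]) linarith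

lemma continuous_norm_bessel [continuous_intros]:
  assumes "\<gamma> > -1/2" "continuous_on S f"
  shows "continuous_on S (\<lambda>x. norm_bessel \<gamma> (f x))"
proof -
  have "continuous_on UNIV (norm_bessel \<gamma>)"
    using norm_bessel_deriv[OF assms(1)] DERIV_isCont continuous_at_imp_continuous_on by blast
  then show ?thesis
    using continuous_on_compose2[OF _ assms(2)] by blast
qed

section \<open>The measure\<close>

definition orthant_weight :: "real ^ 'n \<Rightarrow> real ^ 'n \<Rightarrow> real" where
  "orthant_weight \<beta> x = (\<Prod>i\<in>UNIV. (x $ i) powr (2 * \<beta> $ i + 1))"

lemma orthant_weight_nonneg: "0 \<le> orthant_weight \<beta> x"
  by (simp add: orthant_weight_def prod_nonneg)

lemma orthant_weight_pos: "x \<in> pos_orthant \<Longrightarrow> 0 < orthant_weight \<beta> x"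
  unfolding orthant_weight_def pos_orthant_def
  by (rule prod_pos) (metis (mono_tags) mem_Collect_eq less_irrefl powr_gt_zero)

lemma orthant_weight_measurable [measurable]: "orthant_weight \<beta> \<in> borel_measurable borel"
  unfolding orthant_weight_def by measurable

lemma open_pos_orthant: "open (pos_orthant :: (real ^ 'n) set)"
  using open_halfspace_component_gt_cart[of 0] unfolding pos_orthant_def
  by (subst Collect_all_eq) (auto intro!: open_INT)

lemma pos_orthant_measurable [measurable]: "pos_orthant \<in> sets borel"
  using open_pos_orthant by (rule borel_open)

lemma space_bessel_measure [simp]: "space (bessel_measure \<beta>) = pos_orthant"
  by (simp add: bessel_measure_def space_restrict_space)

lemma sets_bessel_measure [measurable_cong]: "sets (bessel_measure \<beta>) = sets (restrict_space borel pos_orthant)"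
  by (simp add: bessel_measure_def sets_restrict_space)

lemma bessel_measure_eq: "bessel_measure \<beta> = density (restrict_space lborel pos_orthant) (\<lambda>x. ennreal (orthant_weight \<beta> x))"
  by (simp add: bessel_measure_def orthant_weight_def)

lemma borel_imp_bessel_measurable: "f \<in> borel_measurable borel \<Longrightarrow> f \<in> borel_measurable (bessel_measure \<beta>)"
  using measurable_cong_sets[OF sets_bessel_measure refl] measurable_restrict_space1 by blast

lemma continuous_imp_bessel_measurable: "continuous_on UNIV f \<Longrightarrow> f \<in> borel_measurable (bessel_measure \<beta>)"
  by (intro borel_imp_bessel_measurable borel_measurable_continuous_onI)

lemma bessel_measurable_independent: "f \<in> borel_measurable (bessel_measure \<beta>) \<longleftrightarrow> f \<in> borel_measurable (bessel_measure \<gamma>)"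
  using measurable_cong_sets[OF sets_bessel_measure[of \<beta>] refl] measurable_cong_sets[OF sets_bessel_measure[of \<gamma>] refl]
  by blast

lemma orthant_weight_restrict: "orthant_weight \<beta> \<in> borel_measurable (restrict_space lborel pos_orthant)"
  by (intro measurable_restrict_space1) (simp add: orthant_weight_measurable)

lemma
  fixes f :: "real ^ 'n \<Rightarrow> 'b::{banach, second_countable_topology}"
  assumes "f \<in> borel_measurable (bessel_measure \<beta>)"
  shows integrable_bessel_iff: "integrable (bessel_measure \<beta>) f \<longleftrightarrow>
      integrable lborel (\<lambda>x. indicator pos_orthant x *\<^sub>R (orthant_weight \<beta> x *\<^sub>R f x))"
    and integral_bessel: "integral\<^sup>L (bessel_measure \<beta>) f =
      (LINT x|lborel. indicator pos_orthant x *\<^sub>R (orthant_weight \<beta> x *\<^sub>R f x))"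
proof -
  have f: "f \<in> borel_measurable (restrict_space lborel pos_orthant)"
    using assms by (subst measurable_cong_sets[OF _ refl, of _ "bessel_measure \<beta>"]) (auto simp: sets_bessel_measure sets_restrict_space)
  show "integrable (bessel_measure \<beta>) f \<longleftrightarrow> integrable lborel (\<lambda>x. indicator pos_orthant x *\<^sub>R (orthant_weight \<beta> x *\<^sub>R f x))"
    unfolding bessel_measure_eq
    by (subst integrable_density[OF f orthant_weight_restrict])
      (auto simp: orthant_weight_nonneg integrable_restrict_space)
  show "integral\<^sup>L (bessel_measure \<beta>) f = (LINT x|lborel. indicator pos_orthant x *\<^sub>R (orthant_weight \<beta> x *\<^sub>R f x))"
    unfolding bessel_measure_eq
    by (subst integral_density[OF f orthant_weight_restrict])
      (auto simp: orthant_weight_nonneg integral_restrict_space)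
qed

text \<open>The density is positive on the orthant, so the null sets are those of Lebesgue measure
  there, whatever the parameter.\<close>

lemma AE_bessel_iff:
  assumes [measurable]: "Measurable.pred borel P"
  shows "(AE x in bessel_measure \<beta>. P x) \<longleftrightarrow> (AE x in lborel. x \<in> pos_orthant \<longrightarrow> P x)"
proof -
  have [measurable]: "(\<lambda>x. ennreal (orthant_weight \<beta> x)) \<in> borel_measurable (restrict_space lborel pos_orthant)"
    using orthant_weight_restrict by measurable
  have "(AE x in bessel_measure \<beta>. P x) \<longleftrightarrow> (AE x in restrict_space lborel pos_orthant. 0 < ennreal (orthant_weight \<beta> x) \<longrightarrow> P x)"
    unfolding bessel_measure_eq by (rule AE_density) measurable
  also have "\<dots> \<longleftrightarrow> (AE x in lborel. x \<in> pos_orthant \<longrightarrow> (0 < ennreal (orthant_weight \<beta> x) \<longrightarrow> P x))"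
    by (rule AE_restrict_space_iff) simp
  also have "\<dots> \<longleftrightarrow> (AE x in lborel. x \<in> pos_orthant \<longrightarrow> P x)"
    by (rule AE_cong) (auto simp: orthant_weight_pos)
  finally show ?thesis .
qed

lemma sigma_finite_bessel: "sigma_finite_measure (bessel_measure \<beta>)"
proof -
  interpret r: sigma_finite_measure "restrict_space lborel (pos_orthant :: (real ^ 'n) set)"
    by (rule sigma_finite_measure_restrict_space) (auto intro: sigma_finite_lborel)
  have [measurable]: "(\<lambda>x. ennreal (orthant_weight \<beta> x)) \<in> borel_measurable (restrict_space lborel pos_orthant)"
    using orthant_weight_restrict by measurable
  show ?thesis unfolding bessel_measure_eq
    by (subst r.sigma_finite_iff_density_finite) auto
qed

section \<open>Shifts of the parameter and integrability\<close>

lemma orthant_weight_shift: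
  assumes "x \<in> pos_orthant"
  shows "orthant_weight (\<beta> + axis i 1) x = (x $ i)\<^sup>2 * orthant_weight \<beta> x"
proof -
  have "(x $ j) powr (2 * (\<beta> + axis i 1) $ j + 1) = (if j = i then (x $ i)\<^sup>2 else 1) * (x $ j) powr (2 * \<beta> $ j + 1)" for j
  proof (cases "j = i")
    case True
    have "(x $ i) powr (2 + (2 * \<beta> $ i + 1)) = (x $ i)\<^sup>2 * (x $ i) powr (2 * \<beta> $ i + 1)"
      using assms by (subst powr_add) (simp add: pos_orthant_def less_imp_le)
    then show ?thesis using True by (simp add: axis_def algebra_simps)
  qed (simp add: axis_def)
  then show ?thesis
    unfolding orthant_weight_def by (simp add: prod.distrib)
qed

text \<open>Raising the i-th parameter by 1 multiplies the density by \<open>x_i^2\<close>. In this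
  way the factor \<open>x_i^2\<close> that each derivative of the kernel produces is absorbed into
  the measure.\<close>

lemma
  fixes f :: "real ^ 'n \<Rightarrow> complex"
  assumes f: "f \<in> borel_measurable (bessel_measure \<beta>)"
  shows integrable_bessel_shift: "integrable (bessel_measure (\<beta> + axis i 1)) f \<longleftrightarrow>
      integrable (bessel_measure \<beta>) (\<lambda>x. complex_of_real ((x $ i)\<^sup>2) * f x)"
    and integral_bessel_shift: "integral\<^sup>L (bessel_measure (\<beta> + axis i 1)) f =
      (LINT x|bessel_measure \<beta>. complex_of_real ((x $ i)\<^sup>2) * f x)"
proof -
  have f': "f \<in> borel_measurable (bessel_measure (\<beta> + axis i 1))"
    using f bessel_measurable_independent by blast
  have "(\<lambda>x. complex_of_real ((x $ i)\<^sup>2)) \<in> borel_measurable (bessel_measure \<beta>)"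
    by (intro continuous_imp_bessel_measurable continuous_intros)
  then have g: "(\<lambda>x. complex_of_real ((x $ i)\<^sup>2) * f x) \<in> borel_measurable (bessel_measure \<beta>)"
    using f by (rule borel_measurable_times)
  have e: "indicator pos_orthant x *\<^sub>R (orthant_weight (\<beta> + axis i 1) x *\<^sub>R f x) =
     indicator pos_orthant x *\<^sub>R (orthant_weight \<beta> x *\<^sub>R (complex_of_real ((x $ i)\<^sup>2) * f x))" for x
    by (auto simp: indicator_def orthant_weight_shift scaleR_conv_of_real)
  show "integrable (bessel_measure (\<beta> + axis i 1)) f \<longleftrightarrow>
      integrable (bessel_measure \<beta>) (\<lambda>x. complex_of_real ((x $ i)\<^sup>2) * f x)"
    unfolding integrable_bessel_iff[OF f'] integrable_bessel_iff[OF g] e ..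
  show "integral\<^sup>L (bessel_measure (\<beta> + axis i 1)) f =
      (LINT x|bessel_measure \<beta>. complex_of_real ((x $ i)\<^sup>2) * f x)"
    unfolding integral_bessel[OF f'] integral_bessel[OF g] e ..
qed

text \<open>The exponent comes from a comparison with a product: each factor
  \<open>1 + (x \<bullet> b)^2\<close> is at most \<open>(1 + norm x)^2\<close>, and the reciprocals
  of these factors have finite one-dimensional integrals.\<close>

lemma integrable_decay_lborel:
  "integrable lborel (\<lambda>x::'a::euclidean_space. 1 / (1 + norm x) ^ (2 * DIM('a)))"
proof -
  have one: "integrable lborel (\<lambda>t::real. inverse (1 + t\<^sup>2))"
    using integrable_inverse_1_plus_square by (simp add: set_integrable_def)
  have fin: "(\<integral>\<^sup>+ t. ennreal (inverse (1 + t\<^sup>2)) \<partial>lborel) < \<infinity>"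
    using one by (subst nn_integral_eq_integral) auto
  have "(\<integral>\<^sup>+ x. (\<Prod>b\<in>Basis. ennreal (inverse (1 + (x \<bullet> b)\<^sup>2))) \<partial>(lborel :: 'a measure)) =
      (\<Prod>b\<in>(Basis :: 'a set). \<integral>\<^sup>+ t. ennreal (inverse (1 + t\<^sup>2)) \<partial>lborel)"
    by (rule nn_integral_lborel_prod) auto
  also have "\<dots> < \<infinity>" using fin by (simp add: power_less_top_ennreal)
  finally have "(\<integral>\<^sup>+ x. ennreal (\<Prod>b\<in>Basis. inverse (1 + (x \<bullet> b)\<^sup>2)) \<partial>(lborel :: 'a measure)) < \<infinity>"
    by (simp add: prod_ennreal)
  then have int: "integrable (lborel :: 'a measure) (\<lambda>x. \<Prod>b\<in>Basis. inverse (1 + (x \<bullet> b)\<^sup>2))"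
    by (intro integrableI_bounded) (auto simp: prod_nonneg)
  show ?thesis
  proof (rule Bochner_Integration.integrable_bound[OF int])
    show "AE x::'a in lborel. norm (1 / (1 + norm x) ^ (2 * DIM('a))) \<le> norm (\<Prod>b\<in>Basis. inverse (1 + (x \<bullet> b)\<^sup>2))"
    proof (rule AE_I2)
      fix x :: 'a
      have "(\<Prod>b\<in>(Basis::'a set). 1 + (x \<bullet> b)\<^sup>2) \<le> (\<Prod>b\<in>(Basis::'a set). (1 + norm x)\<^sup>2)"
      proof (rule prod_mono)
        fix b :: 'a assume "b \<in> Basis"
        then have "(x \<bullet> b)\<^sup>2 \<le> (norm x)\<^sup>2"
          using Basis_le_norm[of b x] by (simp add: abs_le_square_iff[symmetric])
        then have "1 + (x \<bullet> b)\<^sup>2 \<le> 1 + (norm x)\<^sup>2 + 2 * norm x"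
          using norm_ge_zero[of x] by linarith
        then show "0 \<le> 1 + (x \<bullet> b)\<^sup>2 \<and> 1 + (x \<bullet> b)\<^sup>2 \<le> (1 + norm x)\<^sup>2"
          by (simp add: power2_sum)
      qed
      then have *: "(\<Prod>b\<in>(Basis::'a set). 1 + (x \<bullet> b)\<^sup>2) \<le> (1 + norm x) ^ (2 * DIM('a))"
        by (simp add: power_mult)
      have "0 < (\<Prod>b\<in>(Basis::'a set). 1 + (x \<bullet> b)\<^sup>2)"
        by (intro prod_pos) (auto intro: add_pos_nonneg)
      with * have "1 / (1 + norm x) ^ (2 * DIM('a)) \<le> 1 / (\<Prod>b\<in>(Basis::'a set). 1 + (x \<bullet> b)\<^sup>2)"
        by (intro divide_left_mono) (auto intro!: mult_pos_pos zero_less_power add_pos_nonneg)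
      moreover have "(\<Prod>b\<in>Basis. inverse (1 + (x \<bullet> b)\<^sup>2)) = 1 / (\<Prod>b\<in>(Basis::'a set). 1 + (x \<bullet> b)\<^sup>2)"
        using prod_inversef[of "\<lambda>b. 1 + (x \<bullet> b)\<^sup>2" Basis] by (simp add: comp_def inverse_eq_divide)
      ultimately show "norm (1 / (1 + norm x) ^ (2 * DIM('a))) \<le> norm (\<Prod>b\<in>Basis. inverse (1 + (x \<bullet> b)\<^sup>2))"
        by (metis abs_ge_self abs_of_nonneg order_trans real_norm_def zero_le_divide_1_iff zero_le_power add_nonneg_nonneg norm_ge_zero zero_le_one)
    qed
  qed measurable
qed

definition admissible :: "real ^ 'n \<Rightarrow> bool" where
  "admissible \<beta> \<longleftrightarrow> (\<forall>i. \<beta> $ i > -1/2)"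

lemma admissible_shift: "admissible \<beta> \<Longrightarrow> admissible (\<beta> + axis i 1)"
proof -
  assume "admissible \<beta>"
  then have "(\<beta> + axis i 1) $ j > -1/2" for j
    unfolding admissible_def vector_add_component by (cases "j = i") (auto simp: axis_def intro: less_trans[of _ "\<beta> $ i"])
  then show ?thesis by (simp add: admissible_def)
qed

lemma integrable_decay:
  fixes \<beta> :: "real ^ 'n"
  assumes "admissible \<beta>"
  obtains N where "integrable (bessel_measure \<beta>) (\<lambda>x. 1 / (1 + norm x) ^ N)"
proof
  define m where "m i = nat \<lceil>2 * \<beta> $ i + 1\<rceil>" for i
  \<comment> \<open>The first summand pays for the weight, the second is the exponent that is
    integrable for Lebesgue measure.\<close>
  define N where "N = (\<Sum>i\<in>UNIV. m i) + 2 * DIM(real ^ 'n)"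
  have w: "orthant_weight \<beta> x \<le> (1 + norm x) ^ (\<Sum>i\<in>UNIV. m i)" if "x \<in> pos_orthant" for x
    unfolding orthant_weight_def power_sum
  proof (rule prod_mono)
    fix i
    have x: "0 < x $ i" "x $ i \<le> 1 + norm x"
      using that component_le_norm_cart[of x i] by (auto simp: pos_orthant_def)
    have b: "0 < 2 * \<beta> $ i + 1" using assms[unfolded admissible_def, rule_format, of i] by simp
    have "(x $ i) powr (2 * \<beta> $ i + 1) \<le> (1 + norm x) powr (2 * \<beta> $ i + 1)"
      using x b by (intro powr_mono2) auto
    also have "\<dots> \<le> (1 + norm x) powr real (m i)"
      using b norm_ge_zero[of x] unfolding m_def by (intro powr_mono) linarith+
    also have "\<dots> = (1 + norm x) ^ m i" by (intro powr_realpow) (auto intro: add_pos_nonneg)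
    finally show "0 \<le> (x $ i) powr (2 * \<beta> $ i + 1) \<and> (x $ i) powr (2 * \<beta> $ i + 1) \<le> (1 + norm x) ^ m i"
      by simp
  qed
  have meas: "(\<lambda>x::real ^ 'n. 1 / (1 + norm x) ^ N) \<in> borel_measurable (bessel_measure \<beta>)"
    by (intro borel_imp_bessel_measurable) measurable
  show "integrable (bessel_measure \<beta>) (\<lambda>x. 1 / (1 + norm x) ^ N)"
    unfolding integrable_bessel_iff[OF meas]
  proof (rule Bochner_Integration.integrable_bound[OF integrable_decay_lborel])
    show "AE x in lborel. norm (indicat_real pos_orthant x *\<^sub>R orthant_weight \<beta> x *\<^sub>R (1 / (1 + norm x) ^ N))
      \<le> norm (1 / (1 + norm (x :: real ^ 'n)) ^ (2 * DIM(real ^ 'n)))"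
    proof (rule AE_I2)
      fix x :: "real ^ 'n"
      show "norm (indicat_real pos_orthant x *\<^sub>R orthant_weight \<beta> x *\<^sub>R (1 / (1 + norm x) ^ N))
        \<le> norm (1 / (1 + norm x) ^ (2 * DIM(real ^ 'n)))"
      proof (cases "x \<in> pos_orthant")
        case True
        have "orthant_weight \<beta> x * (1 / (1 + norm x) ^ N) \<le> (1 + norm x) ^ (\<Sum>i\<in>UNIV. m i) * (1 / (1 + norm x) ^ N)"
          using w[OF True] by (intro mult_right_mono) auto
        also have "\<dots> = 1 / (1 + norm x) ^ (2 * DIM(real ^ 'n))"
          by (simp add: N_def power_add add_pos_nonneg less_imp_neq[THEN not_sym])
        finally show ?thesis using True orthant_weight_nonneg[of \<beta> x] by simp
      qed simp
    qed
  qed measurable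
qed

lemma le_divide_power:
  fixes x :: "'a::real_normed_vector"
  assumes "(1 + norm x) ^ k * a \<le> C"
  shows "a \<le> C / (1 + norm x) ^ k"
proof -
  have "0 < (1 + norm x) ^ k" by (intro zero_less_power add_pos_nonneg) auto
  with assms show ?thesis by (simp add: pos_le_divide_eq mult.commute)
qed

lemma rapid_singleE:
  assumes "rapid {f}"
  obtains C where "C > 0" "\<And>x. (1 + norm x) ^ k * norm (f x) \<le> C"
  using rapidE[OF assms, of k] by (metis singletonI)

lemma rapid_integrable:
  assumes "admissible \<beta>" "rapid {f}" "f \<in> borel_measurable (bessel_measure \<beta>)"
  shows "integrable (bessel_measure \<beta>) f"
proof -
  obtain N where N: "integrable (bessel_measure \<beta>) (\<lambda>x. 1 / (1 + norm x) ^ N)"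
    using integrable_decay[OF assms(1)] .
  obtain C where C: "C > 0" "\<And>x. (1 + norm x) ^ N * norm (f x) \<le> C"
    using rapid_singleE[OF assms(2), of N] by metis
  have "integrable (bessel_measure \<beta>) (\<lambda>x. C * (1 / (1 + norm x) ^ N))"
    using N by (rule integrable_mult_right)
  then show ?thesis
  proof (rule Bochner_Integration.integrable_bound)
    show "AE x in bessel_measure \<beta>. norm (f x) \<le> norm (C * (1 / (1 + norm x) ^ N))"
    proof (rule AE_I2)
      fix x
      show "norm (f x) \<le> norm (C * (1 / (1 + norm x) ^ N))"
        using C(1) le_divide_power[OF C(2)[of x]] by simp
    qed
  qed (use assms in simp)
qed

lemma rapid_integral_bound:
  assumes "admissible \<beta>" "rapid B"
  obtains C where "C > 0" "\<And>f. f \<in> B \<Longrightarrow> f \<in> borel_measurable (bessel_measure \<beta>) \<Longrightarrow> (LINT x|bessel_measure \<beta>. norm (f x)) \<le> C"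
proof -
  obtain N where N: "integrable (bessel_measure \<beta>) (\<lambda>x. 1 / (1 + norm x) ^ N)"
    using integrable_decay[OF assms(1)] .
  obtain C where C: "C > 0" "\<And>f x. f \<in> B \<Longrightarrow> (1 + norm x) ^ N * norm (f x) \<le> C"
    using rapidE[OF assms(2), of N] by metis
  define D where "D = (LINT x|bessel_measure \<beta>. C * (1 / (1 + norm x) ^ N))"
  have "(LINT x|bessel_measure \<beta>. norm (f x)) \<le> D" if f: "f \<in> B" "f \<in> borel_measurable (bessel_measure \<beta>)" for f
    unfolding D_def
  proof (rule integral_mono)
    have "rapid {f}" using assms(2) f(1) growth.mono[OF growth_rapid] by blast
    then show "integrable (bessel_measure \<beta>) (\<lambda>x. norm (f x))"
      using rapid_integrable assms(1) f(2) by blast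
    show "norm (f x) \<le> C * (1 / (1 + norm x) ^ N)" for x
      using le_divide_power[OF C(2)[OF f(1), of x]] by simp
  qed (intro integrable_mult_right N)
  then show ?thesis using that[of "max D 1"] by (auto simp: le_max_iff_disj)
qed

lemma schwartz_integrable: "admissible \<beta> \<Longrightarrow> f \<in> schwartz_e \<Longrightarrow> integrable (bessel_measure \<beta>) f"
  using rapid_integrable schwartz_e_rapid schwartz_e_continuous continuous_imp_bessel_measurable by blast

section \<open>Differentiation under the integral sign\<close>

text \<open>Dominated convergence along sequences: the mean value inequality on the ball bounds an
  increment of \<open>k\<close> by \<open>g x\<close> times the displacement, and the derivative
  obeys the same bound, so the remainder quotients are dominated by \<open>2 * g x\<close>.\<close>

lemma has_derivative_lebesgue_integral:
  fixes k :: "'a::real_normed_vector \<Rightarrow> 'b \<Rightarrow> 'c::{banach, second_countable_topology}"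
  assumes r: "r > 0"
    and int: "\<And>\<xi>. \<xi> \<in> ball \<xi>0 r \<Longrightarrow> integrable M (k \<xi>)"
    and der: "\<And>\<xi> x. \<xi> \<in> ball \<xi>0 r \<Longrightarrow> x \<in> space M \<Longrightarrow> ((\<lambda>\<xi>. k \<xi> x) has_derivative k' \<xi> x) (at \<xi>)"
    and bd: "\<And>\<xi> x h. \<xi> \<in> ball \<xi>0 r \<Longrightarrow> x \<in> space M \<Longrightarrow> norm (k' \<xi> x h) \<le> g x * norm h"
    and g: "integrable M g"
    and meas: "\<And>h. (\<lambda>x. k' \<xi>0 x h) \<in> borel_measurable M"
  shows "((\<lambda>\<xi>. LINT x|M. k \<xi> x) has_derivative (\<lambda>h. LINT x|M. k' \<xi>0 x h)) (at \<xi>0)"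
proof -
  have \<xi>0: "\<xi>0 \<in> ball \<xi>0 r" using r by simp
  have intk': "integrable M (\<lambda>x. k' \<xi>0 x h)" for h
    by (rule Bochner_Integration.integrable_bound[of _ "\<lambda>x. g x * norm h"])
      (use g meas bd[OF \<xi>0] in \<open>auto intro!: AE_I2 intro: order_trans[OF _ abs_ge_self]\<close>)
  have lin: "bounded_linear (k' \<xi>0 x)" if "x \<in> space M" for x
    using der[OF \<xi>0 that] by (rule has_derivative_bounded_linear)
  have bl: "bounded_linear (\<lambda>h. LINT x|M. k' \<xi>0 x h)"
  proof (rule bounded_linear_intro[where K = "LINT x|M. g x"])
    show "(LINT x|M. k' \<xi>0 x (h + h')) = (LINT x|M. k' \<xi>0 x h) + (LINT x|M. k' \<xi>0 x h')" for h h'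
      unfolding Bochner_Integration.integral_add[OF intk' intk', symmetric]
      by (rule Bochner_Integration.integral_cong) (auto simp: linear_add bounded_linear.linear lin)
    show "(LINT x|M. k' \<xi>0 x (c *\<^sub>R h)) = c *\<^sub>R (LINT x|M. k' \<xi>0 x h)" for c h
      unfolding integral_scaleR_right[symmetric]
      by (rule Bochner_Integration.integral_cong) (auto simp: linear_scale bounded_linear.linear lin)
    show "norm (LINT x|M. k' \<xi>0 x h) \<le> norm h * (LINT x|M. g x)" for h
    proof -
      have "norm (LINT x|M. k' \<xi>0 x h) \<le> (LINT x|M. g x * norm h)"
        by (rule order_trans[OF integral_norm_bound integral_mono]) (use g intk' bd[OF \<xi>0] in auto)
      then show ?thesis by (simp add: mult.commute)
    qed
  qed
  show ?thesis
    unfolding has_derivative_at_within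
  proof (intro conjI bl, unfold tendsto_at_iff_sequentially, intro allI impI)
    fix X assume X: "\<forall>i. X i \<in> UNIV - {\<xi>0}" and lim: "X \<longlonglongrightarrow> \<xi>0"
    have "\<forall>\<^sub>F n in sequentially. X n \<in> ball \<xi>0 r"
      using lim r tendstoD[OF lim r] by (simp add: dist_commute)
    then obtain n0 where n0: "\<And>n. n \<ge> n0 \<Longrightarrow> X n \<in> ball \<xi>0 r"
      by (auto simp: eventually_sequentially)
    define Y where "Y n = X (n + n0)" for n
    have Y: "Y n \<in> ball \<xi>0 r" "Y n \<noteq> \<xi>0" for n using n0 X by (auto simp: Y_def)
    have Ylim: "Y \<longlonglongrightarrow> \<xi>0" unfolding Y_def using lim by (rule LIMSEQ_ignore_initial_segment)
    define e where "e n x = (k (Y n) x - k \<xi>0 x - k' \<xi>0 x (Y n - \<xi>0)) /\<^sub>R norm (Y n - \<xi>0)" for n x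
    have inte: "integrable M (e n)" for n
      unfolding e_def by (intro integrable_scaleR_right Bochner_Integration.integrable_diff int Y \<xi>0 intk')
    have "(\<lambda>n. LINT x|M. e n x) \<longlonglongrightarrow> (LINT x|M. 0)"
    proof (rule integral_dominated_convergence[where w = "\<lambda>x. 2 * g x"])
      show "integrable M (\<lambda>x. 2 * g x)" using g by simp
      show "AE x in M. (\<lambda>n. e n x) \<longlonglongrightarrow> 0"
      proof (rule AE_I2)
        fix x assume x: "x \<in> space M"
        have "((\<lambda>y. (k y x - k \<xi>0 x - k' \<xi>0 x (y - \<xi>0)) /\<^sub>R norm (y - \<xi>0)) \<longlongrightarrow> 0) (at \<xi>0)"
          using der[OF \<xi>0 x] by (simp add: has_derivative_at_within)
        moreover have "filterlim Y (at \<xi>0) sequentially"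
          using Ylim Y by (simp add: filterlim_at)
        ultimately show "(\<lambda>n. e n x) \<longlonglongrightarrow> 0"
          unfolding e_def by (rule filterlim_compose)
      qed
      show "AE x in M. norm (e n x) \<le> 2 * g x" for n
      proof (rule AE_I2)
        fix x assume x: "x \<in> space M"
        have g0: "0 \<le> g x"
        proof -
          have "0 \<le> g x * norm (Y n - \<xi>0)"
            using bd[OF \<xi>0 x, of "Y n - \<xi>0"] norm_ge_zero order_trans by blast
          then show ?thesis using Y(2)[of n] by (simp add: zero_le_mult_iff)
        qed
        have "norm (k (Y n) x - k \<xi>0 x) \<le> g x * norm (Y n - \<xi>0)"
        proof (rule differentiable_bound[of "ball \<xi>0 r" "\<lambda>\<xi>. k \<xi> x" "\<lambda>\<xi>. k' \<xi> x"])
          show "onorm (k' \<xi> x) \<le> g x" if "\<xi> \<in> ball \<xi>0 r" for \<xi>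
            using bd[OF that x] g0 by (intro onorm_bound) auto
          show "((\<lambda>\<xi>. k \<xi> x) has_derivative k' \<xi> x) (at \<xi> within ball \<xi>0 r)" if "\<xi> \<in> ball \<xi>0 r" for \<xi>
            by (rule has_derivative_at_withinI[OF der[OF that x]])
        qed (use Y \<xi>0 in auto)
        moreover have "norm (k' \<xi>0 x (Y n - \<xi>0)) \<le> g x * norm (Y n - \<xi>0)"
          using bd[OF \<xi>0 x] .
        ultimately have "norm (k (Y n) x - k \<xi>0 x - k' \<xi>0 x (Y n - \<xi>0)) \<le> 2 * g x * norm (Y n - \<xi>0)"
          using norm_triangle_ineq4[of "k (Y n) x - k \<xi>0 x" "k' \<xi>0 x (Y n - \<xi>0)"] by (simp add: algebra_simps)
        then show "norm (e n x) \<le> 2 * g x"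
          unfolding e_def using Y(2)[of n] by (simp add: divide_inverse_commute[symmetric] pos_divide_le_eq)
      qed
    qed (use inte in auto)
    moreover have "(LINT x|M. e n x) = ((LINT x|M. k (Y n) x) - (LINT x|M. k \<xi>0 x) - (LINT x|M. k' \<xi>0 x (Y n - \<xi>0))) /\<^sub>R norm (Y n - \<xi>0)" for n
    proof -
      have "(LINT x|M. k (Y n) x - k \<xi>0 x - k' \<xi>0 x (Y n - \<xi>0)) =
          (LINT x|M. k (Y n) x) - (LINT x|M. k \<xi>0 x) - (LINT x|M. k' \<xi>0 x (Y n - \<xi>0))"
        by (subst Bochner_Integration.integral_diff[OF Bochner_Integration.integrable_diff[OF int[OF Y(1)] int[OF \<xi>0]] intk'],
            subst Bochner_Integration.integral_diff[OF int[OF Y(1)] int[OF \<xi>0]]) (rule refl)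
      then show ?thesis unfolding e_def by simp
    qed
    ultimately have "(\<lambda>n. ((\<lambda>y. ((LINT x|M. k y x) - (LINT x|M. k \<xi>0 x) - (LINT x|M. k' \<xi>0 x (y - \<xi>0))) /\<^sub>R norm (y - \<xi>0)) \<circ> X) (n + n0)) \<longlonglongrightarrow> 0"
      by (simp add: Y_def)
    then show "((\<lambda>y. ((LINT x|M. k y x) - (LINT x|M. k \<xi>0 x) - (LINT x|M. k' \<xi>0 x (y - \<xi>0))) /\<^sub>R norm (y - \<xi>0)) \<circ> X) \<longlonglongrightarrow> 0"
      by (rule LIMSEQ_offset)
  qed
qed

section \<open>Division of the derivative of an even function by the coordinate\<close>

text \<open>Used in three ways: as contraction to a hyperplane (0 \<le> s \<le> 1), as reflection (s
  = -1) and as dilation near s = 1. In this form it is visibly affine in \<open>s\<close> with the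
  fixed direction \<open>axis i 1\<close>, which makes derivatives in \<open>s\<close>
  immediate.\<close>

definition scale_coord :: "'n \<Rightarrow> real \<Rightarrow> real ^ 'n \<Rightarrow> real ^ 'n" where
  "scale_coord i s x = x + ((s - 1) * x $ i) *\<^sub>R axis i 1"

lemma scale_coord_nth: "scale_coord i s x $ j = (if j = i then s * x $ j else x $ j)"
  by (auto simp: scale_coord_def axis_def algebra_simps)

lemma scale_coord_1 [simp]: "scale_coord i 1 x = x"
  by (simp add: scale_coord_def)

lemma bounded_linear_scale_coord: "bounded_linear (scale_coord i s)"
  unfolding scale_coord_def
  by (intro bounded_linear_add bounded_linear_ident bounded_linear_scaleR_const[THEN bounded_linear_compose]
      bounded_linear_mult_right[THEN bounded_linear_compose] bounded_linear_vec_nth)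

lemma scale_coord_axis: "scale_coord i s (axis j 1) = (if j = i then s else 1) *\<^sub>R axis j 1"
  by (auto simp: vec_eq_iff scale_coord_nth axis_def)

lemma norm_scale_coord_le: "0 \<le> s \<Longrightarrow> s \<le> 1 \<Longrightarrow> norm (scale_coord i s x) \<le> norm x"
  by (rule norm_le_componentwise_cart) (auto simp: scale_coord_nth abs_mult mult_left_le_one_le)

lemma norm_le_scale_coord: "0 < c \<Longrightarrow> c \<le> 1 \<Longrightarrow> c \<le> s \<Longrightarrow> c * norm x \<le> norm (scale_coord i s x)"
proof -
  assume c: "0 < c" "c \<le> 1" "c \<le> s"
  have "norm (c *\<^sub>R x) \<le> norm (scale_coord i s x)"
    using c by (intro norm_le_componentwise_cart)
      (auto simp: scale_coord_nth abs_mult mult_left_le_one_le intro!: mult_right_mono)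
  with c show ?thesis by simp
qed

lemma continuous_scale_coord [continuous_intros]:
  assumes "continuous_on S f" "continuous_on S g"
  shows "continuous_on S (\<lambda>x. scale_coord i (f x) (g x))"
  unfolding scale_coord_def by (intro continuous_intros assms)

lemma frechet_partial:
  fixes f :: "real ^ 'n \<Rightarrow> complex"
  assumes "f differentiable at x"
  shows "frechet_derivative f (at x) h = (\<Sum>j\<in>UNIV. of_real (h $ j) * partial j f x)"
proof -
  interpret bounded_linear "frechet_derivative f (at x)"
    using assms frechet_derivative_works has_derivative_bounded_linear by blast
  have "h = (\<Sum>j\<in>UNIV. h $ j *\<^sub>R axis j 1)"
    by (auto simp: vec_eq_iff axis_def if_distrib if_distribR cong: if_cong)
  then have "frechet_derivative f (at x) h = frechet_derivative f (at x) (\<Sum>j\<in>UNIV. h $ j *\<^sub>R axis j 1)" by simp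
  also have "\<dots> = (\<Sum>j\<in>UNIV. of_real (h $ j) * partial j f x)"
    unfolding sum by (simp add: scale partial_def scaleR_conv_of_real[where x = "_ :: complex"])
  finally show ?thesis .
qed

lemma frechet_axis:
  fixes f :: "real ^ 'n \<Rightarrow> complex"
  assumes "f differentiable at x"
  shows "frechet_derivative f (at x) (c *\<^sub>R axis j 1) = of_real c * partial j f x"
  unfolding partial_def
  using linear_scale[OF has_derivative_linear[OF frechet_derivative_works[THEN iffD1, OF assms]], of c "axis j 1"]
  by (simp add: scaleR_conv_of_real[where x = "_ :: complex"])

lemma frechet_bound:
  fixes f :: "real ^ 'n \<Rightarrow> complex"
  assumes "f differentiable at x" "\<And>j. norm (partial j f x) \<le> C"
  shows "norm (frechet_derivative f (at x) h) \<le> real CARD('n) * C * norm h"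
proof -
  have "norm (frechet_derivative f (at x) h) \<le> (\<Sum>j\<in>(UNIV :: 'n set). norm h * C)"
    unfolding frechet_partial[OF assms(1)]
    by (rule order_trans[OF norm_sum sum_mono])
      (auto simp: norm_mult intro!: mult_mono component_le_norm_cart assms(2))
  then show ?thesis by (simp add: mult_ac)
qed

section \<open>Averages along one coordinate\<close>

definition unit_interval :: "real measure" where
  "unit_interval = restrict_space lborel {0..1}"

lemma space_unit_interval: "space unit_interval = {0..1}"
  by (simp add: unit_interval_def space_restrict_space)

lemma integral_unit_interval:
  fixes f :: "real \<Rightarrow> 'a::{banach, second_countable_topology}"
  shows "integral\<^sup>L unit_interval f = (LINT s|lborel. indicator {0..1} s *\<^sub>R f s)"
  unfolding unit_interval_def by (rule integral_restrict_space) simp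

lemma integrable_unit_interval:
  fixes f :: "real \<Rightarrow> 'a::{banach, second_countable_topology}"
  assumes "continuous_on {0..1} f"
  shows "integrable unit_interval f"
  unfolding unit_interval_def
  by (subst integrable_restrict_space) (auto intro!: borel_integrable_compact assms)

lemma norm_integral_unit_interval_le:
  fixes f :: "real \<Rightarrow> complex"
  assumes "continuous_on {0..1} f" "\<And>s. 0 \<le> s \<Longrightarrow> s \<le> 1 \<Longrightarrow> norm (f s) \<le> C"
  shows "norm (integral\<^sup>L unit_interval f) \<le> C"
proof -
  have "norm (integral\<^sup>L unit_interval f) \<le> (LINT s|unit_interval. C)"
    by (intro order_trans[OF integral_norm_bound integral_mono])
      (auto intro!: integrable_unit_interval continuous_intros assms simp: space_unit_interval)
  also have "\<dots> = C" unfolding integral_unit_interval by simp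
  finally show ?thesis .
qed

text \<open>The weight \<open>s ^ m\<close> makes the construction stable under differentiation: the
  derivative in direction \<open>i\<close> contributes one more factor \<open>s\<close>, the others
  none.\<close>

definition coord_average :: "'n \<Rightarrow> nat \<Rightarrow> (real ^ 'n \<Rightarrow> complex) \<Rightarrow> real ^ 'n \<Rightarrow> complex" where
  "coord_average i m g x = (LINT s|unit_interval. of_real (s ^ m) * g (scale_coord i s x))"

lemma bdd_smooth_continuous: "bdd_smooth Q B \<Longrightarrow> g \<in> B \<Longrightarrow> continuous_on UNIV g"
  using bdd_smoothD(2) by (metis continuous_at_imp_continuous_on differentiable_imp_continuous_within)

lemma continuous_coord_average_integrand:
  assumes "continuous_on UNIV g"
  shows "continuous_on {0..1} (\<lambda>s. complex_of_real (s ^ m) * g (scale_coord i s x))"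
  by (intro continuous_intros continuous_on_compose2[OF assms]) auto

lemma coord_average_derivative:
  fixes g :: "real ^ 'n \<Rightarrow> complex"
  assumes B: "bdd_smooth rapid {g}"
  shows "(coord_average i m g has_derivative
    (\<lambda>h. LINT s|unit_interval. of_real (s ^ m) * frechet_derivative g (at (scale_coord i s x)) (scale_coord i s h))) (at x)"
    and "partial j (coord_average i m g) x = coord_average i (m + of_bool (j = i)) (partial j g) x"
proof -
  have cont: "continuous_on UNIV g" using bdd_smooth_continuous[OF B] by simp
  have contp: "continuous_on UNIV (partial j g)" for j
    using bdd_smooth_continuous[OF bdd_smooth_partial[OF B]] by simp
  have diff: "g differentiable at y" for y using bdd_smoothD(2)[OF B] by simp
  have "\<exists>C. \<forall>y. norm (partial j g y) \<le> C" for j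
  proof -
    obtain C where "\<And>f y. f \<in> partial j ` {g} \<Longrightarrow> (1 + norm y) ^ 0 * norm (f y) \<le> C"
      using rapidE[OF bdd_smoothD(1)[OF bdd_smooth_partial[OF B, of j]], of 0] by metis
    then show ?thesis by (intro exI[of _ C]) simp
  qed
  then obtain C where C: "\<And>j y. norm (partial j g y) \<le> C j" by metis
  define D where "D = Max (range C)"
  have D: "norm (partial j g y) \<le> D" for j y
    unfolding D_def by (rule order_trans[OF C[of j y] Max_ge]) auto
  have D0: "0 \<le> D" using D[of undefined 0] norm_ge_zero order_trans by blast
  have contk: "continuous_on {0..1} (\<lambda>s. complex_of_real (s ^ m) * frechet_derivative g (at (scale_coord i s x)) (scale_coord i s h))" for h
  proof -
    have "continuous_on {0..1} (\<lambda>s. if j = i then s * h $ j else h $ j)" for j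
      by (cases "j = i") (auto intro!: continuous_intros)
    then show ?thesis
      unfolding frechet_partial[OF diff] scale_coord_nth
      by (intro continuous_intros continuous_on_compose2[OF contp]) auto
  qed
  show d: "(coord_average i m g has_derivative
    (\<lambda>h. LINT s|unit_interval. of_real (s ^ m) * frechet_derivative g (at (scale_coord i s x)) (scale_coord i s h))) (at x)"
    unfolding coord_average_def[abs_def]
  proof (rule has_derivative_lebesgue_integral[where r = 1 and g = "\<lambda>s. real CARD('n) * D"])
    show "integrable unit_interval (\<lambda>s. complex_of_real (s ^ m) * g (scale_coord i s \<xi>))" for \<xi>
      by (intro integrable_unit_interval continuous_coord_average_integrand cont)
    show "integrable unit_interval (\<lambda>s. real CARD('n) * D)"
      by (intro integrable_unit_interval continuous_intros)
    show "(\<lambda>s. complex_of_real (s ^ m) * frechet_derivative g (at (scale_coord i s x)) (scale_coord i s h))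
      \<in> borel_measurable unit_interval" for h
      by (intro borel_measurable_integrable integrable_unit_interval contk)
    fix \<xi> :: "real ^ 'n" and s assume "s \<in> space unit_interval"
    then have s: "0 \<le> s" "s \<le> 1" by (auto simp: space_unit_interval)
    have "(scale_coord i s has_derivative scale_coord i s) (at \<xi>)"
      by (intro bounded_linear_imp_has_derivative bounded_linear_scale_coord)
    moreover have "(g has_derivative frechet_derivative g (at (scale_coord i s \<xi>))) (at (scale_coord i s \<xi>))"
      using diff frechet_derivative_works by blast
    ultimately have "((\<lambda>\<xi>. g (scale_coord i s \<xi>)) has_derivative
        (\<lambda>h. frechet_derivative g (at (scale_coord i s \<xi>)) (scale_coord i s h))) (at \<xi>)"
      using has_derivative_compose by blast
    then show "((\<lambda>\<xi>. complex_of_real (s ^ m) * g (scale_coord i s \<xi>)) has_derivative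
        (\<lambda>h. complex_of_real (s ^ m) * frechet_derivative g (at (scale_coord i s \<xi>)) (scale_coord i s h))) (at \<xi>)"
      by (rule has_derivative_mult_right)
    fix h :: "real ^ 'n"
    have "norm (complex_of_real (s ^ m) * frechet_derivative g (at (scale_coord i s \<xi>)) (scale_coord i s h))
      \<le> 1 * (real CARD('n) * D * norm (scale_coord i s h))"
      unfolding norm_mult using s by (intro mult_mono frechet_bound diff D) (auto simp: norm_power power_le_one)
    also have "\<dots> \<le> real CARD('n) * D * norm h"
      using norm_scale_coord_le[OF s, of i h] D0 by (simp add: mult_left_mono)
    finally show "norm (complex_of_real (s ^ m) * frechet_derivative g (at (scale_coord i s \<xi>)) (scale_coord i s h))
      \<le> real CARD('n) * D * norm h" .
  qed simp
  show "partial j (coord_average i m g) x = coord_average i (m + of_bool (j = i)) (partial j g) x"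
    unfolding partial_eqI[OF d] coord_average_def scale_coord_axis frechet_axis[OF diff]
    by (intro Bochner_Integration.integral_cong) auto
qed

text \<open>The segment of an average ends on the hyperplane \<open>x_i = 0\<close>, so the
  integrand gives no decay in the direction of \<open>x_i\<close>. In the slab \<bar>x_i\<bar> \<le>
  1 the contraction displaces a point by at most 1, and there the decay of the integrand
  survives.\<close>

definition rapid_near :: "'n \<Rightarrow> (real ^ 'n \<Rightarrow> complex) set \<Rightarrow> bool" where
  "rapid_near i B \<longleftrightarrow> (\<forall>k. \<exists>C. \<forall>f\<in>B. \<forall>x. \<bar>x $ i\<bar> \<le> 1 \<longrightarrow> (1 + norm x) ^ k * norm (f x) \<le> C)"

lemma rapid_near_coord_average:
  assumes B: "bdd_smooth rapid B"
  shows "rapid_near i (coord_average i m ` B)"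
  unfolding rapid_near_def
proof
  fix k
  obtain C where C: "C > 0" "\<And>f x. f \<in> B \<Longrightarrow> (1 + norm x) ^ k * norm (f x) \<le> C"
    using rapidE[OF bdd_smoothD(1)[OF B]] by metis
  have "(1 + norm x) ^ k * norm (coord_average i m g x) \<le> 2 ^ k * C" if g: "g \<in> B" and x: "\<bar>x $ i\<bar> \<le> 1" for g x
  proof -
    have "norm (coord_average i m g x) \<le> 2 ^ k * C / (1 + norm x) ^ k"
      unfolding coord_average_def
    proof (rule norm_integral_unit_interval_le[OF continuous_coord_average_integrand])
      show "continuous_on UNIV g" using bdd_smooth_continuous[OF B g] .
      fix s :: real assume s: "0 \<le> s" "s \<le> 1"
      have "norm x \<le> norm (scale_coord i s x) + norm ((x - scale_coord i s x))"
        using norm_triangle_ineq[of "scale_coord i s x" "x - scale_coord i s x"] by simp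
      moreover have "norm (x - scale_coord i s x) \<le> 1"
        using s x by (simp add: scale_coord_def norm_axis_1 abs_mult mult_le_one)
      ultimately have "1 + norm x \<le> 2 * (1 + norm (scale_coord i s x))"
        using norm_ge_zero[of "scale_coord i s x"] by argo
      then have "(1 + norm x) ^ k \<le> 2 ^ k * (1 + norm (scale_coord i s x)) ^ k"
        unfolding power_mult_distrib[symmetric] by (intro power_mono) auto
      then have "norm (g (scale_coord i s x)) * (1 + norm x) ^ k \<le> norm (g (scale_coord i s x)) * (2 ^ k * (1 + norm (scale_coord i s x)) ^ k)"
        by (intro mult_left_mono) auto
      also have "\<dots> \<le> 2 ^ k * C" using C(2)[OF g, of "scale_coord i s x"] by (simp add: mult_ac)
      finally have "(1 + norm x) ^ k * norm (g (scale_coord i s x)) \<le> 2 ^ k * C"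
        by (simp add: mult.commute)
      then have "norm (g (scale_coord i s x)) \<le> 2 ^ k * C / (1 + norm x) ^ k"
        by (rule le_divide_power)
      moreover have "norm (complex_of_real (s ^ m) * g (scale_coord i s x)) \<le> 1 * norm (g (scale_coord i s x))"
        unfolding norm_mult using s by (intro mult_right_mono) (auto simp: norm_power power_le_one)
      ultimately show "norm (complex_of_real (s ^ m) * g (scale_coord i s x)) \<le> 2 ^ k * C / (1 + norm x) ^ k"
        by simp
    qed
    moreover have "0 < (1 + norm x) ^ k" by (intro zero_less_power add_pos_nonneg) auto
    ultimately show ?thesis by (simp add: pos_le_divide_eq mult.commute)
  qed
  then show "\<exists>C. \<forall>f\<in>coord_average i m ` B. \<forall>x. \<bar>x $ i\<bar> \<le> 1 \<longrightarrow> (1 + norm x) ^ k * norm (f x) \<le> C"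
    by blast
qed

lemma bdd_smooth_single:
  "bdd_smooth rapid B \<Longrightarrow> g \<in> B \<Longrightarrow> bdd_smooth rapid {g}"
  using growth.bdd_smooth_mono[OF growth_rapid] by blast

lemma bdd_smooth_coord_average:
  assumes "bdd_smooth rapid B"
  shows "bdd_smooth (rapid_near i) (coord_average i m ` B)"
proof -
  have "bdd_upto (rapid_near i) n (coord_average i m ` B)" if "bdd_smooth rapid B" for n m and B :: "(real ^ 'a \<Rightarrow> complex) set"
    using that
  proof (induction n arbitrary: m B)
    case 0
    have "coord_average i m g differentiable at x" if "g \<in> B" for g x
      unfolding differentiable_def using coord_average_derivative(1)[OF bdd_smooth_single[OF 0 that]] by blast
    then show ?case
      using rapid_near_coord_average[OF 0, of i m] by simp
  next
    case (Suc n)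
    have "partial j ` coord_average i m ` B = coord_average i (m + of_bool (j = i)) ` partial j ` B" for j
      using coord_average_derivative(2)[OF bdd_smooth_single[OF Suc.prems]] by (auto simp: image_image intro!: image_cong ext)
    moreover have "bdd_upto (rapid_near i) n (coord_average i (m + of_bool (j = i)) ` partial j ` B)" for j
      by (intro Suc.IH bdd_smooth_partial Suc.prems)
    moreover have "coord_average i m g differentiable at x" if "g \<in> B" for g x
      unfolding differentiable_def using coord_average_derivative(1)[OF bdd_smooth_single[OF Suc.prems that]] by blast
    ultimately show ?case
      using rapid_near_coord_average[OF Suc.prems, of i m] by simp
  qed
  then show ?thesis using assms by (simp add: bdd_smooth_def)
qed

text \<open>Outside the slab the factor \<open>x_i\<close> only increases the modulus, so the decay
  of \<open>x_i * u\<close> is inherited by \<open>u\<close>.\<close>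

lemma rapid_if_near:
  assumes U: "rapid_near i U" and R: "rapid (pointwise_mult {\<lambda>x. of_real (x $ i)} U)"
  shows "rapid U"
  unfolding rapid_def
proof
  fix k
  obtain C where C: "\<And>f x. f \<in> U \<Longrightarrow> \<bar>x $ i\<bar> \<le> 1 \<Longrightarrow> (1 + norm x) ^ k * norm (f x) \<le> C"
    using U unfolding rapid_near_def by metis
  obtain D where D: "\<And>f x. f \<in> pointwise_mult {\<lambda>x. of_real (x $ i)} U \<Longrightarrow> (1 + norm x) ^ k * norm (f x) \<le> D"
    using rapidE[OF R] by metis
  have "(1 + norm x) ^ k * norm (f x) \<le> max C D" if f: "f \<in> U" for f x
  proof (cases "\<bar>x $ i\<bar> \<le> 1")
    case True
    then show ?thesis using C[OF f] by (simp add: le_max_iff_disj)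
  next
    case False
    have "(1 + norm x) ^ k * norm (f x) \<le> (1 + norm x) ^ k * (\<bar>x $ i\<bar> * norm (f x))"
      using False by (intro mult_left_mono) (auto simp: mult_le_cancel_right1)
    also have "\<dots> \<le> D"
      using D[OF pointwise_multI[OF singletonI f], of x] by (simp add: norm_mult)
    finally show ?thesis by (simp add: le_max_iff_disj)
  qed
  then show "\<exists>C. \<forall>f\<in>U. \<forall>x. (1 + norm x) ^ k * norm (f x) \<le> C" by blast
qed

text \<open>Decay of \<open>x_i * d_j u\<close> has to be derived: it equals
  \<open>d_j (x_i * u)\<close>, minus \<open>u\<close> if i = j. Therefore the induction hypothesis
  is used twice, first for \<open>U\<close> itself (\<open>Un\<close>), whose members occur in the
  correction term, and then for the derivatives.\<close>

lemma bdd_smooth_if_near: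
  fixes U :: "(real ^ 'n \<Rightarrow> complex) set"
  assumes "bdd_smooth (rapid_near i) U" "bdd_smooth rapid (pointwise_mult {\<lambda>x. of_real (x $ i)} U)"
  shows "bdd_smooth rapid U"
proof -
  let ?x = "\<lambda>x::real ^ 'n. complex_of_real (x $ i)"
  have dx: "?x differentiable at x" for x
    using has_derivative_coord[of 1 i x] by (auto simp: differentiable_def)
  have px: "partial j ?x x = of_bool (i = j)" for j x
    using partial_eqI[OF has_derivative_coord[of 1 i x], of j] by (auto simp: axis_def)
  have "bdd_upto rapid n U" if "bdd_upto (rapid_near i) n U" "bdd_upto rapid n (pointwise_mult {?x} U)"
    for n and U :: "(real ^ 'n \<Rightarrow> complex) set"
    using that
  proof (induction n arbitrary: U)
    case 0
    then show ?case using rapid_if_near[of i U] by simp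
  next
    case (Suc n)
    have near: "rapid_near i U" "\<And>f x. f \<in> U \<Longrightarrow> f differentiable at x"
      "\<And>j. bdd_upto (rapid_near i) n (partial j ` U)" using Suc.prems(1) by simp_all
    have far: "rapid (pointwise_mult {?x} U)" "\<And>j. bdd_upto rapid n (partial j ` pointwise_mult {?x} U)"
      "bdd_upto rapid n (pointwise_mult {?x} U)"
      using Suc.prems(2) growth.bdd_upto_Suc_imp[OF growth_rapid Suc.prems(2)] by simp_all
    have mono: "bdd_upto (rapid_near i) (Suc n) V \<Longrightarrow> bdd_upto (rapid_near i) n V" for n and V :: "(real ^ 'n \<Rightarrow> complex) set"
    proof (induction n arbitrary: V)
      case (Suc n)
      have "rapid_near i V \<and> (\<forall>f\<in>V. \<forall>x. f differentiable at x) \<and> (\<forall>j. bdd_upto (rapid_near i) (Suc n) (partial j ` V))"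
        using bdd_upto.simps(2)[of "rapid_near i" "Suc n" V] Suc.prems by (simp only:)
      with Suc.IH show ?case unfolding bdd_upto.simps(2)[of "rapid_near i" n V] by meson
    qed simp
    have Un: "bdd_upto rapid n U" by (rule Suc.IH[OF mono[OF Suc.prems(1)] far(3)])
    have "bdd_upto rapid n (partial j ` U)" for j
    proof (rule Suc.IH[OF near(3)])
      let ?K = "{\<lambda>x::real ^ 'n. c | c. cmod c \<le> 1}"
      show "bdd_upto rapid n (pointwise_mult {?x} (partial j ` U))"
      proof (rule growth.bdd_upto_mono[OF growth_rapid])
        show "bdd_upto rapid n (pointwise_add (partial j ` pointwise_mult {?x} U) (pointwise_mult ?K U))"
          by (intro growth.bdd_upto_add[OF growth_rapid] growth.bdd_upto_mult[OF growth_rapid] far slow_const Un)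
        show "pointwise_mult {?x} (partial j ` U) \<subseteq> pointwise_add (partial j ` pointwise_mult {?x} U) (pointwise_mult ?K U)"
        proof
          fix h assume "h \<in> pointwise_mult {?x} (partial j ` U)"
          then obtain u where u: "u \<in> U" "h = (\<lambda>x. ?x x * partial j u x)" by (auto simp: pointwise_mult_def)
          have "h = (\<lambda>x. partial j (\<lambda>x. ?x x * u x) x + (- of_bool (i = j)) * u x)"
            unfolding u(2) partial_mult[OF dx near(2)[OF u(1)]] px by auto
          also have "\<dots> \<in> pointwise_add (partial j ` pointwise_mult {?x} U) (pointwise_mult ?K U)"
            by (intro pointwise_addI imageI pointwise_multI u(1) singletonI) auto
          finally show "h \<in> pointwise_add (partial j ` pointwise_mult {?x} U) (pointwise_mult ?K U)" .
        qed
      qed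
    qed
    then show ?case using near(2) rapid_if_near[OF near(1) far(1)] by simp
  qed
  then show ?thesis using assms by (simp add: bdd_smooth_def)
qed

text \<open>For even \<open>f\<close> this is \<open>(1/x_i) d_i f\<close>, extended smoothly across
  the hyperplane \<open>x_i = 0\<close>: there the odd function \<open>d_i f\<close> vanishes, and
  the fundamental theorem of calculus along the contraction yields the integral.\<close>

definition bessel_D :: "'n \<Rightarrow> (real ^ 'n \<Rightarrow> complex) \<Rightarrow> real ^ 'n \<Rightarrow> complex" where
  "bessel_D i f = coord_average i 0 (partial i (partial i f))"

definition reflect :: "'n \<Rightarrow> real ^ 'n \<Rightarrow> real ^ 'n" where
  "reflect i x = (\<chi> j. if j = i then - (x $ j) else x $ j)"

lemma even_fun_reflect: "even_fun f \<longleftrightarrow> (\<forall>i x. f (reflect i x) = f x)"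
  by (simp add: even_fun_def reflect_def)

lemma reflect_eq: "reflect i = scale_coord i (-1)"
  by (auto simp: fun_eq_iff vec_eq_iff reflect_def scale_coord_nth)

text \<open>The factor \<open>c\<close> admits both parities, so that the rule can be iterated: a
  first derivative is odd in its own variable, a second one even again.\<close>

lemma partial_reflect:
  fixes f :: "real ^ 'n \<Rightarrow> complex"
  assumes "\<And>x. f differentiable at x" "\<And>x. f (reflect j x) = c * f x"
  shows "partial i f (reflect j x) = (if i = j then - c else c) * partial i f x"
proof -
  have "(reflect j has_derivative reflect j) (at x)"
    unfolding reflect_eq by (intro bounded_linear_imp_has_derivative bounded_linear_scale_coord)
  moreover have "(f has_derivative frechet_derivative f (at (reflect j x))) (at (reflect j x))"
    using assms frechet_derivative_works by blast
  ultimately have "((\<lambda>x. f (reflect j x)) has_derivative (\<lambda>h. frechet_derivative f (at (reflect j x)) (reflect j h))) (at x)"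
    using has_derivative_compose by blast
  then have "partial i (\<lambda>x. f (reflect j x)) x = frechet_derivative f (at (reflect j x)) (reflect j (axis i 1))"
    by (rule partial_eqI)
  also have "reflect j (axis i 1) = (if i = j then -1 else 1) *\<^sub>R axis i (1::real)"
    unfolding reflect_eq scale_coord_axis by simp
  also have "frechet_derivative f (at (reflect j x)) \<dots> = (if i = j then -1 else 1) * partial i f (reflect j x)"
    unfolding frechet_axis[OF assms(1)] by simp
  also have "partial i (\<lambda>x. f (reflect j x)) x = c * partial i f x"
    unfolding assms(2)
    using partial_eqI[OF has_derivative_mult_right[OF assms(1)[THEN frechet_derivative_works[THEN iffD1]]]]
    by (simp add: partial_def)
  finally show ?thesis by (auto split: if_splits)
qed

lemma schwartz_bdd_single: "schwartz_bdd B \<Longrightarrow> f \<in> B \<Longrightarrow> f \<in> schwartz_e"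
  using schwartz_bdd_subset by blast

lemma schwartz_e_bdd_smooth: "f \<in> schwartz_e \<Longrightarrow> bdd_smooth rapid {f}"
  by (simp add: schwartz_e_iff schwartz_bdd_def)

lemma coord_times_bessel_D:
  fixes f :: "real ^ 'n \<Rightarrow> complex"
  assumes f: "f \<in> schwartz_e"
  shows "of_real (x $ i) * bessel_D i f x = partial i f x"
proof -
  have d0: "f differentiable at y" for y using schwartz_e_smooth[OF f, of "[]"] by simp
  have d1: "partial i f differentiable at y" for y using schwartz_e_smooth[OF f, of "[i]"] by simp
  have c2: "continuous_on UNIV (partial i (partial i f))"
    using schwartz_e_smooth[OF f, of "[i, i]"]
    by (simp add: continuous_at_imp_continuous_on differentiable_imp_continuous_within)
  have ev: "f (reflect j y) = f y" for j y
    using f by (simp add: schwartz_e_def even_fun_reflect)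
  \<comment> \<open>The first derivative along the segment from the hyperplane
    \<open>x_i = 0\<close> (s = 0) to \<open>x\<close> (s = 1).\<close>
  define F where "F s = partial i f (scale_coord i s x)" for s
  define F' where "F' s = of_real (x $ i) * partial i (partial i f) (scale_coord i s x)" for s
  have "(F has_vector_derivative F' s) (at s)" for s
  proof -
    have "((\<lambda>s. scale_coord i s x) has_derivative (\<lambda>h. (h * x $ i) *\<^sub>R axis i 1)) (at s)"
      unfolding scale_coord_def by (auto intro!: derivative_eq_intros)
    moreover have "(partial i f has_derivative frechet_derivative (partial i f) (at (scale_coord i s x))) (at (scale_coord i s x))"
      using d1 frechet_derivative_works by blast
    ultimately have "(F has_derivative (\<lambda>h. frechet_derivative (partial i f) (at (scale_coord i s x)) ((h * x $ i) *\<^sub>R axis i 1))) (at s)"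
      unfolding F_def using has_derivative_compose by blast
    moreover have "frechet_derivative (partial i f) (at (scale_coord i s x)) ((h * x $ i) *\<^sub>R axis i 1) = h *\<^sub>R F' s" for h
      unfolding frechet_axis[OF d1] F'_def by (simp add: scaleR_conv_of_real)
    ultimately show ?thesis by (simp add: has_vector_derivative_def)
  qed
  then have "(LINT s|lborel. indicator {0..1} s *\<^sub>R F' s) = F 1 - F 0"
    unfolding F'_def
    by (intro integral_FTC_atLeastAtMost) (auto intro: has_vector_derivative_at_within
        intro!: continuous_intros continuous_on_compose2[OF c2])
  moreover have "F 0 = 0"
  proof -
    have "reflect i (scale_coord i 0 x) = scale_coord i 0 x"
      by (auto simp: vec_eq_iff reflect_def scale_coord_nth)
    then have "F 0 = - F 0"
      using partial_reflect[of f i 1 i "scale_coord i 0 x", OF d0] ev by (simp add: F_def)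
    then show ?thesis by simp
  qed
  moreover have "(LINT s|lborel. indicator {0..1} s *\<^sub>R F' s) = of_real (x $ i) * bessel_D i f x"
    unfolding bessel_D_def coord_average_def integral_unit_interval[symmetric] F'_def by simp
  ultimately show ?thesis by (simp add: F_def)
qed

lemma even_fun_bessel_D:
  fixes f :: "real ^ 'n \<Rightarrow> complex"
  assumes f: "f \<in> schwartz_e"
  shows "even_fun (bessel_D i f)"
  unfolding even_fun_reflect
proof (intro allI)
  fix j x
  have d0: "f differentiable at y" for y using schwartz_e_smooth[OF f, of "[]"] by simp
  have d1: "partial i f differentiable at y" for y using schwartz_e_smooth[OF f, of "[i]"] by simp
  have "f (reflect j y) = 1 * f y" for y
    using f by (simp add: schwartz_e_def even_fun_reflect)
  from partial_reflect[OF d1 partial_reflect[OF d0 this]]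
  have "partial i (partial i f) (reflect j y) = partial i (partial i f) y" for y by auto
  moreover have "scale_coord i s (reflect j x) = reflect j (scale_coord i s x)" for s
    by (auto simp: vec_eq_iff reflect_def scale_coord_nth)
  ultimately show "bessel_D i f (reflect j x) = bessel_D i f x"
    by (simp add: bessel_D_def coord_average_def)
qed

text \<open>Near the hyperplane the integral formula gives the bounds; away from it they come from
  \<open>x_i * bessel_D i f = d_i f\<close>.\<close>

lemma schwartz_bdd_bessel_D:
  fixes B :: "(real ^ 'n \<Rightarrow> complex) set"
  assumes B: "schwartz_bdd B"
  shows "schwartz_bdd (bessel_D i ` B)"
proof -
  have b: "bdd_smooth rapid B" using B by (simp add: schwartz_bdd_def)
  have "bdd_smooth (rapid_near i) (coord_average i 0 ` partial i ` partial i ` B)"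
    by (intro bdd_smooth_coord_average bdd_smooth_partial b)
  moreover have "pointwise_mult {\<lambda>x. of_real (x $ i)} (bessel_D i ` B) \<subseteq> partial i ` B"
  proof
    fix h assume "h \<in> pointwise_mult {\<lambda>x. of_real (x $ i)} (bessel_D i ` B)"
    then obtain f where f: "f \<in> B" and h: "h = (\<lambda>x. of_real (x $ i) * bessel_D i f x)"
      unfolding pointwise_mult_def by blast
    have "h = partial i f"
      unfolding h using coord_times_bessel_D[OF schwartz_bdd_single[OF B f]] by (rule ext)
    then show "h \<in> partial i ` B" using f by (rule image_eqI)
  qed
  then have "bdd_smooth rapid (pointwise_mult {\<lambda>x. of_real (x $ i)} (bessel_D i ` B))"
    by (rule growth.bdd_smooth_mono[OF growth_rapid bdd_smooth_partial[OF b]])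
  moreover have "coord_average i 0 ` partial i ` partial i ` B = bessel_D i ` B"
    by (simp add: image_image bessel_D_def)
  ultimately have "bdd_smooth rapid (bessel_D i ` B)"
    using bdd_smooth_if_near by metis
  then show ?thesis
    unfolding schwartz_bdd_def using even_fun_bessel_D[OF schwartz_bdd_single[OF B]] by blast
qed

section \<open>The Fourier-Bessel transform on Schwartz functions\<close>

definition bessel_kernel :: "real ^ 'n \<Rightarrow> real ^ 'n \<Rightarrow> real ^ 'n \<Rightarrow> real" where
  "bessel_kernel \<beta> \<xi> x = (\<Prod>i\<in>UNIV. norm_bessel (\<beta> $ i) (\<xi> $ i * x $ i))"

lemma fourier_bessel_eq:
  "fourier_bessel \<beta> f \<xi> = (LINT x|bessel_measure \<beta>. f x * of_real (bessel_kernel \<beta> \<xi> x))"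
  by (simp add: fourier_bessel_def bessel_kernel_def)

lemma bessel_kernel_commute: "bessel_kernel \<beta> \<xi> x = bessel_kernel \<beta> x \<xi>"
  by (simp add: bessel_kernel_def mult.commute)

lemma admissibleD: "admissible \<beta> \<Longrightarrow> \<beta> $ i > -1/2"
  by (auto simp: admissible_def)

lemma admissible_norm_bessel:
  assumes "admissible \<beta>"
  shows "\<bar>norm_bessel (\<beta> $ i) t\<bar> \<le> 1" "norm_bessel (\<beta> $ i) 0 = 1"
    "norm_bessel (\<beta> $ i) (- t) = norm_bessel (\<beta> $ i) t"
  using admissibleD[OF assms, of i] by (rule abs_norm_bessel_le norm_bessel_0 norm_bessel_minus)+

lemma abs_bessel_kernel_le: "admissible \<beta> \<Longrightarrow> \<bar>bessel_kernel \<beta> \<xi> x\<bar> \<le> 1"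
  unfolding bessel_kernel_def abs_prod
  by (intro prod_le_1) (auto simp: admissible_norm_bessel)

lemma bessel_kernel_0: "admissible \<beta> \<Longrightarrow> bessel_kernel \<beta> 0 x = 1"
  by (simp add: bessel_kernel_def admissible_norm_bessel)

lemma continuous_bessel_kernel [continuous_intros]:
  assumes "admissible \<beta>" "continuous_on S f" "continuous_on S g"
  shows "continuous_on S (\<lambda>x. bessel_kernel \<beta> (f x) (g x))"
  unfolding bessel_kernel_def by (intro continuous_intros assms admissibleD)

lemma bessel_kernel_reflect: "admissible \<beta> \<Longrightarrow> bessel_kernel \<beta> (reflect i \<xi>) x = bessel_kernel \<beta> \<xi> x"
  unfolding bessel_kernel_def
  by (intro prod.cong) (auto simp: reflect_def admissible_norm_bessel)

text \<open>The derivative in the i-th component of \<xi>. One factor \<open>x_i\<close> stems from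
  the chain rule, the other from the factor \<open>t\<close> in \<open>norm_bessel_deriv\<close>;
  together they fit the shift of the measure.\<close>

definition bessel_kernel_deriv :: "real ^ 'n \<Rightarrow> 'n \<Rightarrow> real ^ 'n \<Rightarrow> real ^ 'n \<Rightarrow> real" where
  "bessel_kernel_deriv \<beta> i \<xi> x = - (\<xi> $ i * (x $ i)\<^sup>2 / (2 * (\<beta> $ i + 1))) * bessel_kernel (\<beta> + axis i 1) \<xi> x"

lemma bessel_kernel_shift:
  "bessel_kernel (\<beta> + axis i c) \<xi> x = norm_bessel (\<beta> $ i + c) (\<xi> $ i * x $ i) *
     (\<Prod>j\<in>UNIV - {i}. norm_bessel (\<beta> $ j) (\<xi> $ j * x $ j))"
  unfolding bessel_kernel_def
  by (subst prod.remove[of _ i]) (auto simp: axis_def intro!: prod.cong)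

lemma bessel_kernel_split:
  "bessel_kernel \<beta> \<xi> x = norm_bessel (\<beta> $ i) (\<xi> $ i * x $ i) *
     (\<Prod>j\<in>UNIV - {i}. norm_bessel (\<beta> $ j) (\<xi> $ j * x $ j))"
  unfolding bessel_kernel_def by (subst prod.remove[of _ i]) auto

lemma bessel_kernel_has_derivative:
  assumes "admissible \<beta>"
  shows "((\<lambda>\<xi>. bessel_kernel \<beta> \<xi> x) has_derivative (\<lambda>h. \<Sum>i\<in>UNIV. h $ i * bessel_kernel_deriv \<beta> i \<xi> x)) (at \<xi>)"
proof -
  have "((\<lambda>\<xi>. norm_bessel (\<beta> $ i) (\<xi> $ i * x $ i)) has_derivative
      (\<lambda>h. (h $ i * x $ i) * (- (\<xi> $ i * x $ i / (2 * (\<beta> $ i + 1))) * norm_bessel (\<beta> $ i + 1) (\<xi> $ i * x $ i)))) (at \<xi>)" for i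
  proof -
    have "((\<lambda>\<xi>. \<xi> $ i * x $ i) has_derivative (\<lambda>h. h $ i * x $ i)) (at \<xi>)"
      by (intro bounded_linear_imp_has_derivative bounded_linear_mult_left[THEN bounded_linear_compose] bounded_linear_vec_nth)
    from has_derivative_compose[OF this norm_bessel_deriv[OF admissibleD[OF assms, of i], unfolded has_field_derivative_def]]
    show ?thesis by (simp add: mult.commute)
  qed
  from has_derivative_prod[where I = UNIV, OF this]
  have "((\<lambda>\<xi>. bessel_kernel \<beta> \<xi> x) has_derivative (\<lambda>h. \<Sum>i\<in>UNIV.
      (h $ i * x $ i) * (- (\<xi> $ i * x $ i / (2 * (\<beta> $ i + 1))) * norm_bessel (\<beta> $ i + 1) (\<xi> $ i * x $ i))
      * (\<Prod>j\<in>UNIV - {i}. norm_bessel (\<beta> $ j) (\<xi> $ j * x $ j)))) (at \<xi>)"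
    unfolding bessel_kernel_def[abs_def] by simp
  also have "(\<lambda>h. \<Sum>i\<in>UNIV.
      (h $ i * x $ i) * (- (\<xi> $ i * x $ i / (2 * (\<beta> $ i + 1))) * norm_bessel (\<beta> $ i + 1) (\<xi> $ i * x $ i))
      * (\<Prod>j\<in>UNIV - {i}. norm_bessel (\<beta> $ j) (\<xi> $ j * x $ j))) =
      (\<lambda>h::real ^ 'a. \<Sum>i\<in>UNIV. h $ i * bessel_kernel_deriv \<beta> i \<xi> x)"
    unfolding bessel_kernel_deriv_def bessel_kernel_shift
    by (intro ext sum.cong refl) (simp add: power2_eq_square mult_ac)
  finally show ?thesis .
qed

text \<open>The second half of the energy estimate: a factor \<xi>_i x_i together with the shifted
  Bessel function is a derivative of the unshifted one, hence bounded by 1, and a single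
  \<open>x_i\<close> remains. The bound does not depend on \<xi>, as domination requires.\<close>

lemma abs_bessel_kernel_deriv_le:
  assumes "admissible \<beta>"
  shows "\<bar>bessel_kernel_deriv \<beta> i \<xi> x\<bar> \<le> \<bar>x $ i\<bar>"
proof -
  define P where "P = (\<Prod>j\<in>UNIV - {i}. norm_bessel (\<beta> $ j) (\<xi> $ j * x $ j))"
  have P: "\<bar>P\<bar> \<le> 1"
    unfolding P_def abs_prod using assms by (intro prod_le_1) (auto simp: admissible_norm_bessel)
  define Q where "Q = \<xi> $ i * x $ i / (2 * (\<beta> $ i + 1)) * norm_bessel (\<beta> $ i + 1) (\<xi> $ i * x $ i)"
  have Q: "\<bar>Q\<bar> \<le> 1" unfolding Q_def using abs_norm_bessel_deriv_le[OF admissibleD[OF assms]] .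
  have "bessel_kernel_deriv \<beta> i \<xi> x = - (x $ i * (Q * P))"
    unfolding bessel_kernel_deriv_def bessel_kernel_shift P_def[symmetric] Q_def by (simp add: power2_eq_square)
  then have "\<bar>bessel_kernel_deriv \<beta> i \<xi> x\<bar> = \<bar>x $ i\<bar> * (\<bar>Q\<bar> * \<bar>P\<bar>)" by (simp add: abs_mult)
  also have "\<dots> \<le> \<bar>x $ i\<bar> * (1 * 1)" using P Q by (intro mult_left_mono mult_mono) auto
  finally show ?thesis by simp
qed

lemma continuous_bessel_kernel_deriv [continuous_intros]:
  assumes "admissible \<beta>" "continuous_on S f" "continuous_on S g"
  shows "continuous_on S (\<lambda>x. bessel_kernel_deriv \<beta> i (f x) (g x))"
  unfolding bessel_kernel_deriv_def using admissibleD[OF assms(1), of i]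
  by (intro continuous_intros assms admissible_shift) auto

lemma rapid_mult_coord_integrable:
  assumes "admissible \<beta>" "rapid {f}" "continuous_on UNIV f"
  shows "integrable (bessel_measure \<beta>) (\<lambda>x. norm x * norm (f x))"
proof -
  have "slow {\<lambda>x. complex_of_real (norm x)}"
    unfolding slow_def by (rule exI[of _ 1], rule exI[of _ 1]) auto
  then have "rapid (pointwise_mult {\<lambda>x. complex_of_real (norm x)} {f})"
    by (rule growth.mult[OF growth_rapid _ assms(2)])
  then have "rapid {\<lambda>x. complex_of_real (norm x) * f x}"
    by (simp add: pointwise_mult_def)
  moreover have "(\<lambda>x. complex_of_real (norm x) * f x) \<in> borel_measurable (bessel_measure \<beta>)"
    by (intro continuous_imp_bessel_measurable continuous_intros assms)
  ultimately have "integrable (bessel_measure \<beta>) (\<lambda>x. norm (complex_of_real (norm x) * f x))"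
    by (intro integrable_norm rapid_integrable[OF assms(1)])
  then show ?thesis by (simp add: norm_mult)
qed

lemma kernel_integrable:
  assumes "admissible \<beta>" "admissible \<gamma>" "integrable (bessel_measure \<beta>) f"
  shows "integrable (bessel_measure \<beta>) (\<lambda>x. f x * complex_of_real (bessel_kernel \<gamma> \<xi> x))"
proof (rule Bochner_Integration.integrable_bound[OF assms(3)])
  have "(\<lambda>x. complex_of_real (bessel_kernel \<gamma> \<xi> x)) \<in> borel_measurable (bessel_measure \<beta>)"
    by (intro continuous_imp_bessel_measurable continuous_intros assms)
  then show "(\<lambda>x. f x * complex_of_real (bessel_kernel \<gamma> \<xi> x)) \<in> borel_measurable (bessel_measure \<beta>)"
    using borel_measurable_integrable[OF assms(3)] by (intro borel_measurable_times)
  show "AE x in bessel_measure \<beta>. norm (f x * complex_of_real (bessel_kernel \<gamma> \<xi> x)) \<le> norm (f x)"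
    using abs_bessel_kernel_le[OF assms(2)] by (auto simp: norm_mult mult_left_le)
qed

text \<open>The parameters of the measure and of the kernel are kept apart because the integration
  by parts pairs the measure of \<beta> with the kernel of the shifted parameter.\<close>

lemma kernel_integral_has_derivative:
  fixes f :: "real ^ 'n \<Rightarrow> complex"
  assumes \<beta>: "admissible \<beta>" and \<gamma>: "admissible \<gamma>" and f: "rapid {f}" "continuous_on UNIV f"
  shows "((\<lambda>\<xi>. LINT x|bessel_measure \<beta>. f x * of_real (bessel_kernel \<gamma> \<xi> x)) has_derivative
    (\<lambda>h. LINT x|bessel_measure \<beta>. f x * of_real (\<Sum>i\<in>UNIV. h $ i * bessel_kernel_deriv \<gamma> i \<xi> x))) (at \<xi>)"
proof (rule has_derivative_lebesgue_integral[where r = 1 and g = "\<lambda>x. real CARD('n) * (norm x * norm (f x))"])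
  have int: "integrable (bessel_measure \<beta>) f"
    using rapid_integrable[OF \<beta> f(1) continuous_imp_bessel_measurable[OF f(2)]] .
  show "integrable (bessel_measure \<beta>) (\<lambda>x. f x * complex_of_real (bessel_kernel \<gamma> \<xi> x))" for \<xi>
    by (intro kernel_integrable \<beta> \<gamma> int)
  show "integrable (bessel_measure \<beta>) (\<lambda>x. real CARD('n) * (norm x * norm (f x)))"
    by (intro integrable_mult_right rapid_mult_coord_integrable \<beta> f)
  show "(\<lambda>x. f x * complex_of_real (\<Sum>i\<in>UNIV. h $ i * bessel_kernel_deriv \<gamma> i \<xi> x)) \<in> borel_measurable (bessel_measure \<beta>)" for h
    by (intro continuous_imp_bessel_measurable continuous_intros \<gamma> f)
  fix \<xi>' x :: "real ^ 'n"
  have "((\<lambda>\<xi>. complex_of_real (bessel_kernel \<gamma> \<xi> x)) has_derivative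
      (\<lambda>h. complex_of_real (\<Sum>i\<in>UNIV. h $ i * bessel_kernel_deriv \<gamma> i \<xi>' x))) (at \<xi>')"
    by (rule has_derivative_of_real[OF bessel_kernel_has_derivative[OF \<gamma>]])
  then show "((\<lambda>\<xi>. f x * complex_of_real (bessel_kernel \<gamma> \<xi> x)) has_derivative
      (\<lambda>h. f x * complex_of_real (\<Sum>i\<in>UNIV. h $ i * bessel_kernel_deriv \<gamma> i \<xi>' x))) (at \<xi>')"
    by (rule has_derivative_mult_right)
  fix h :: "real ^ 'n"
  have "\<bar>\<Sum>i\<in>UNIV. h $ i * bessel_kernel_deriv \<gamma> i \<xi>' x\<bar> \<le> (\<Sum>i\<in>(UNIV::'n set). norm h * norm x)"
    by (intro order_trans[OF sum_abs] sum_mono)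
      (auto simp: abs_mult intro!: mult_mono component_le_norm_cart order_trans[OF abs_bessel_kernel_deriv_le[OF \<gamma>]])
  then have "norm (f x) * \<bar>\<Sum>i\<in>UNIV. h $ i * bessel_kernel_deriv \<gamma> i \<xi>' x\<bar> \<le> norm (f x) * (real CARD('n) * (norm h * norm x))"
    by (intro mult_left_mono) auto
  then show "norm (f x * complex_of_real (\<Sum>i\<in>UNIV. h $ i * bessel_kernel_deriv \<gamma> i \<xi>' x))
      \<le> real CARD('n) * (norm x * norm (f x)) * norm h"
    unfolding norm_mult norm_of_real by (simp add: mult_ac)
qed simp

lemma fourier_bessel_has_derivative:
  fixes f :: "real ^ 'n \<Rightarrow> complex"
  assumes \<beta>: "admissible \<beta>" and f: "rapid {f}" "continuous_on UNIV f"
  shows "(fourier_bessel \<beta> f has_derivative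
    (\<lambda>h. \<Sum>i\<in>UNIV. of_real (h $ i) * (of_real (- (\<xi> $ i / (2 * (\<beta> $ i + 1)))) * fourier_bessel (\<beta> + axis i 1) f \<xi>))) (at \<xi>)"
proof -
  have fb: "f \<in> borel_measurable (bessel_measure \<beta>)" for \<beta>
    by (rule continuous_imp_bessel_measurable[OF f(2)])
  have int: "integrable (bessel_measure \<beta>) f" if "admissible \<beta>" for \<beta>
    using rapid_integrable[OF that f(1) fb] .
  have k: "(LINT x|bessel_measure \<beta>. f x * of_real (bessel_kernel_deriv \<beta> i \<xi> x)) =
      of_real (- (\<xi> $ i / (2 * (\<beta> $ i + 1)))) * fourier_bessel (\<beta> + axis i 1) f \<xi>"
    and ki: "integrable (bessel_measure \<beta>) (\<lambda>x. f x * of_real (bessel_kernel_deriv \<beta> i \<xi> x))" for i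
  proof -
    have i: "integrable (bessel_measure (\<beta> + axis i 1)) (\<lambda>x. f x * complex_of_real (bessel_kernel (\<beta> + axis i 1) \<xi> x))"
      by (intro kernel_integrable admissible_shift \<beta> int)
    have m: "(\<lambda>x. f x * complex_of_real (bessel_kernel (\<beta> + axis i 1) \<xi> x)) \<in> borel_measurable (bessel_measure \<beta>)"
      by (intro continuous_imp_bessel_measurable continuous_intros admissible_shift \<beta> f)
    have e: "f x * of_real (bessel_kernel_deriv \<beta> i \<xi> x) = of_real (- (\<xi> $ i / (2 * (\<beta> $ i + 1)))) *
      (complex_of_real ((x $ i)\<^sup>2) * (f x * complex_of_real (bessel_kernel (\<beta> + axis i 1) \<xi> x)))" for x
      by (simp add: bessel_kernel_deriv_def mult_ac)
    show "(LINT x|bessel_measure \<beta>. f x * of_real (bessel_kernel_deriv \<beta> i \<xi> x)) =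
      of_real (- (\<xi> $ i / (2 * (\<beta> $ i + 1)))) * fourier_bessel (\<beta> + axis i 1) f \<xi>"
      unfolding e fourier_bessel_eq integral_bessel_shift[OF m] by simp
    show "integrable (bessel_measure \<beta>) (\<lambda>x. f x * of_real (bessel_kernel_deriv \<beta> i \<xi> x))"
      unfolding e using i[unfolded integrable_bessel_shift[OF m]] by (rule integrable_mult_right)
  qed
  have "(LINT x|bessel_measure \<beta>. f x * of_real (\<Sum>i\<in>UNIV. h $ i * bessel_kernel_deriv \<beta> i \<xi> x)) =
      (\<Sum>i\<in>UNIV. of_real (h $ i) * (of_real (- (\<xi> $ i / (2 * (\<beta> $ i + 1)))) * fourier_bessel (\<beta> + axis i 1) f \<xi>))" for h
  proof -
    have "(LINT x|bessel_measure \<beta>. f x * of_real (\<Sum>i\<in>UNIV. h $ i * bessel_kernel_deriv \<beta> i \<xi> x)) =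
       (LINT x|bessel_measure \<beta>. (\<Sum>i\<in>UNIV. of_real (h $ i) * (f x * of_real (bessel_kernel_deriv \<beta> i \<xi> x))))"
      by (simp add: sum_distrib_left mult_ac)
    also have "\<dots> = (\<Sum>i\<in>UNIV. of_real (h $ i) * (LINT x|bessel_measure \<beta>. f x * of_real (bessel_kernel_deriv \<beta> i \<xi> x)))"
      by (subst Bochner_Integration.integral_sum) (auto intro!: integrable_mult_right ki)
    finally show ?thesis unfolding k .
  qed
  then show ?thesis
    using kernel_integral_has_derivative[OF \<beta> \<beta> f, of \<xi>] by (simp add: fourier_bessel_eq[abs_def])
qed

lemma partial_fourier_bessel:
  fixes f :: "real ^ 'n \<Rightarrow> complex"
  assumes \<beta>: "admissible \<beta>" and f: "rapid {f}" "continuous_on UNIV f"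
  shows "partial i (fourier_bessel \<beta> f) \<xi> = of_real (- (\<xi> $ i / (2 * (\<beta> $ i + 1)))) * fourier_bessel (\<beta> + axis i 1) f \<xi>"
  unfolding partial_eqI[OF fourier_bessel_has_derivative[OF assms]]
  by (auto simp: axis_def if_distrib if_distribR cong: if_cong)

lemma fourier_bessel_bound:
  assumes \<beta>: "admissible \<beta>" and B: "schwartz_bdd B"
  obtains C where "C > 0" "\<And>f \<xi>. f \<in> B \<Longrightarrow> norm (fourier_bessel \<beta> f \<xi>) \<le> C"
proof -
  obtain C where C: "C > 0" "\<And>f. f \<in> B \<Longrightarrow> f \<in> borel_measurable (bessel_measure \<beta>) \<Longrightarrow> (LINT x|bessel_measure \<beta>. norm (f x)) \<le> C"
    using rapid_integral_bound[OF \<beta> schwartz_bdd_rapid[OF B]] by metis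
  have "norm (fourier_bessel \<beta> f \<xi>) \<le> C" if f: "f \<in> B" for f \<xi>
  proof -
    have fs: "f \<in> schwartz_e" using schwartz_bdd_single[OF B f] .
    have int: "integrable (bessel_measure \<beta>) f" by (rule schwartz_integrable[OF \<beta> fs])
    have "norm (fourier_bessel \<beta> f \<xi>) \<le> (LINT x|bessel_measure \<beta>. norm (f x))"
      unfolding fourier_bessel_eq
    proof (intro order_trans[OF integral_norm_bound integral_mono])
      show "norm (f x * complex_of_real (bessel_kernel \<beta> \<xi> x)) \<le> norm (f x)" for x
        using abs_bessel_kernel_le[OF \<beta>] by (auto simp: norm_mult mult_left_le)
    qed (intro integrable_norm kernel_integrable[OF \<beta> \<beta>] int)+
    also have "\<dots> \<le> C" using C(2)[OF f] int by auto
    finally show ?thesis .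
  qed
  then show ?thesis using that C(1) by blast
qed

lemma even_fun_fourier_bessel: "admissible \<beta> \<Longrightarrow> even_fun (fourier_bessel \<beta> f)"
  by (simp add: even_fun_reflect fourier_bessel_eq bessel_kernel_reflect)

subsection \<open>Dilations\<close>

text \<open>The exponent is that of the weight, \<open>2 * \<beta> $ i + 1\<close>, plus 1 from the
  Jacobian.\<close>

lemma integral_dilation:
  fixes f :: "real ^ 'n \<Rightarrow> complex" and c :: "real ^ 'n"
  assumes c: "\<And>i. c $ i > 0" and f: "continuous_on UNIV f"
  shows "integral\<^sup>L (bessel_measure \<beta>) f =
    of_real (\<Prod>i\<in>UNIV. (c $ i) powr (2 * \<beta> $ i + 2)) * (LINT x|bessel_measure \<beta>. f (\<chi> i. c $ i * x $ i))"
proof -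
  define T :: "real ^ 'n \<Rightarrow> real ^ 'n" where "T x = (\<chi> i. c $ i * x $ i)" for x
  have contT: "continuous_on UNIV T"
    unfolding T_def by (intro continuous_on_vec_lambda continuous_intros)
  have T [measurable]: "T \<in> borel_measurable borel"
    using contT by (rule borel_measurable_continuous_onI)
  have cB: "c \<bullet> b > 0" if "b \<in> Basis" for b
    using that c by (auto simp: Basis_vec_def inner_axis)
  have T_eq: "T = (\<lambda>x. 0 + (\<Sum>j\<in>Basis. ((c \<bullet> j) * (x \<bullet> j)) *\<^sub>R j))"
  proof (rule ext, rule euclidean_eqI)
    fix x b :: "real ^ 'n" assume b: "b \<in> Basis"
    then obtain i where "b = axis i 1" by (auto simp: Basis_vec_def)
    then have "T x \<bullet> b = (c \<bullet> b) * (x \<bullet> b)" by (simp add: T_def inner_axis)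
    also have "\<dots> = (0 + (\<Sum>j\<in>Basis. ((c \<bullet> j) * (x \<bullet> j)) *\<^sub>R j)) \<bullet> b" using b by simp
    finally show "T x \<bullet> b = (0 + (\<Sum>j\<in>Basis. ((c \<bullet> j) * (x \<bullet> j)) *\<^sub>R j)) \<bullet> b" .
  qed
  have pc: "(\<Prod>j\<in>Basis. \<bar>c \<bullet> j\<bar>) = (\<Prod>i\<in>UNIV. c $ i)"
  proof -
    have "inj (\<lambda>i::'n. axis i (1::real))" by (auto simp: inj_on_def axis_eq_axis)
    moreover have "(Basis :: (real ^ 'n) set) = range (\<lambda>i. axis i 1)" by (auto simp: Basis_vec_def)
    ultimately have "(\<Prod>j\<in>Basis. \<bar>c \<bullet> j\<bar>) = (\<Prod>i\<in>UNIV. \<bar>c \<bullet> axis i 1\<bar>)"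
      using prod.reindex[of "\<lambda>i::'n. axis i (1::real)" UNIV "\<lambda>j. \<bar>c \<bullet> j\<bar>"] by (simp add: comp_def)
    also have "\<dots> = (\<Prod>i\<in>UNIV. c $ i)"
      using c by (intro prod.cong) (auto simp: inner_axis less_imp_le)
    finally show ?thesis .
  qed
  have "lborel = density (distr lborel borel T) (\<lambda>_. (\<Prod>j\<in>Basis. \<bar>c \<bullet> j\<bar>))"
    unfolding T_eq by (rule lborel_affine_euclidean) (use cB in force)
  then have lb: "lborel = density (distr lborel borel T) (\<lambda>_. ennreal (\<Prod>i\<in>UNIV. c $ i))"
    unfolding pc .
  define g where "g x = indicator pos_orthant x *\<^sub>R (orthant_weight \<beta> x *\<^sub>R f x)" for x
  have fm: "f \<in> borel_measurable borel" using f by (rule borel_measurable_continuous_onI)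
  have [measurable]: "g \<in> borel_measurable borel"
    unfolding g_def using fm by measurable
  have pos: "0 < (\<Prod>i\<in>UNIV. c $ i)" by (intro prod_pos c)
  have "integral\<^sup>L lborel g = (LINT x|distr lborel borel T. (\<Prod>i\<in>UNIV. c $ i) *\<^sub>R g x)"
    by (subst lb, subst integral_density) (use pos in auto)
  also have "\<dots> = (LINT x|lborel. (\<Prod>i\<in>UNIV. c $ i) *\<^sub>R g (T x))"
    by (rule integral_distr) auto
  also have "\<dots> = (LINT x|lborel. (\<Prod>i\<in>UNIV. (c $ i) powr (2 * \<beta> $ i + 2)) *\<^sub>R
      (indicator pos_orthant x *\<^sub>R (orthant_weight \<beta> x *\<^sub>R f (T x))))"
  proof (rule Bochner_Integration.integral_cong[OF refl])
    fix x
    have "0 < c $ i * x $ i \<longleftrightarrow> 0 < x $ i" for i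
      using c[of i] by (auto simp: zero_less_mult_iff)
    then have "T x \<in> pos_orthant \<longleftrightarrow> x \<in> pos_orthant"
      by (simp add: pos_orthant_def T_def)
    then have ind: "(indicator pos_orthant (T x) :: real) = indicator pos_orthant x" by (simp add: indicator_def)
    have "(\<Prod>i\<in>UNIV. c $ i) * orthant_weight \<beta> (T x) = (\<Prod>i\<in>UNIV. (c $ i) powr (2 * \<beta> $ i + 2)) * orthant_weight \<beta> x"
      if "x \<in> pos_orthant"
    proof -
      have "c $ i * (c $ i * x $ i) powr (2 * \<beta> $ i + 1) = (c $ i) powr (2 * \<beta> $ i + 2) * (x $ i) powr (2 * \<beta> $ i + 1)" for i
      proof -
        have x: "0 < x $ i" using that by (simp add: pos_orthant_def)
        have "(c $ i) powr (1 + (2 * \<beta> $ i + 1)) = c $ i * (c $ i) powr (2 * \<beta> $ i + 1)"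
          using c[of i] by (subst powr_add) simp
        then show ?thesis using c[of i] x by (simp add: powr_mult mult.assoc add.commute)
      qed
      then show ?thesis unfolding orthant_weight_def T_def by (simp add: prod.distrib[symmetric])
    qed
    then show "(\<Prod>i\<in>UNIV. c $ i) *\<^sub>R g (T x) = (\<Prod>i\<in>UNIV. (c $ i) powr (2 * \<beta> $ i + 2)) *\<^sub>R
      (indicator pos_orthant x *\<^sub>R (orthant_weight \<beta> x *\<^sub>R f (T x)))"
      unfolding g_def ind by (auto simp: indicator_def)
  qed
  also have "\<dots> = of_real (\<Prod>i\<in>UNIV. (c $ i) powr (2 * \<beta> $ i + 2)) * (LINT x|bessel_measure \<beta>. f (T x))"
    by (subst integral_bessel) (auto simp: scaleR_conv_of_real intro!: continuous_imp_bessel_measurable continuous_on_compose2[OF f contT])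
  finally show ?thesis
    unfolding integral_bessel[OF continuous_imp_bessel_measurable[OF f]] g_def[abs_def] T_def .
qed

text \<open>Boundary terms are avoided by differentiating a scaling identity at
  \<open>l = 1\<close>. Dilating \<open>x_i\<close> in \<open>f\<close> is the same, up to a power
  of \<open>l\<close>, as dilating \<xi>_i inversely in the kernel. On one side the derivative falls
  on \<open>f\<close>, on the other on the power of \<open>l\<close> and on the kernel, where the
  recurrence evaluates it.\<close>

lemma fourier_bessel_integration_by_parts:
  fixes f :: "real ^ 'n \<Rightarrow> complex"
  assumes \<beta>: "admissible \<beta>" and f: "f \<in> schwartz_e"
  shows "(LINT x|bessel_measure \<beta>. of_real (x $ i) * partial i f x * of_real (bessel_kernel (\<beta> + axis i 1) \<xi> x))
     = - (2 * of_real (\<beta> $ i + 1)) * fourier_bessel \<beta> f \<xi>"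
proof -
  define \<gamma> where "\<gamma> = \<beta> + axis i 1"
  have \<gamma>: "admissible \<gamma>" unfolding \<gamma>_def by (rule admissible_shift[OF \<beta>])
  have rap: "rapid {f}" and cont: "continuous_on UNIV f"
    using schwartz_e_rapid[OF f] schwartz_e_continuous[OF f] .
  have rap1: "rapid {partial i f}"
    using bdd_smoothD(1)[OF bdd_smooth_partial[OF schwartz_e_bdd_smooth[OF f]], of i] by simp
  have cont1: "continuous_on UNIV (partial i f)"
    using bdd_smooth_continuous[OF bdd_smooth_partial[OF schwartz_e_bdd_smooth[OF f]], of _ i] by simp
  have diff: "f differentiable at y" for y using schwartz_e_smooth[OF f, of "[]"] by simp
  define \<Phi> where "\<Phi> \<xi> = (LINT x|bessel_measure \<beta>. f x * of_real (bessel_kernel \<gamma> \<xi> x))" for \<xi>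
  define A where "A l = (LINT x|bessel_measure \<beta>. f (scale_coord i l x) * of_real (bessel_kernel \<gamma> \<xi> x))" for l
  define A' where "A' = (LINT x|bessel_measure \<beta>. of_real (x $ i) * partial i f x * of_real (bessel_kernel \<gamma> \<xi> x))"
  obtain N where N: "integrable (bessel_measure \<beta>) (\<lambda>x. 1 / (1 + norm x) ^ N)"
    using integrable_decay[OF \<beta>] .
  obtain C where C: "C > 0" "\<And>x. (1 + norm x) ^ N * norm (f x) \<le> C"
    using rapid_singleE[OF rap, of N] by metis
  \<comment> \<open>The additional power of decay pays for the factor \<open>x $ i\<close> that the
    derivative in \<open>l\<close> produces.\<close>
  obtain D where D: "D > 0" "\<And>x. (1 + norm x) ^ Suc N * norm (partial i f x) \<le> D"
    using rapid_singleE[OF rap1, of "Suc N"] by metis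
  have sc: "1 + norm x \<le> 2 * (1 + norm (scale_coord i l x))" if "l \<in> ball 1 (1/2)" for x and l :: real
  proof -
    have "1/2 \<le> l" using that by (auto simp: dist_real_def abs_if split: if_splits)
    then have "1/2 * norm x \<le> norm (scale_coord i l x)" by (intro norm_le_scale_coord) auto
    then show ?thesis by simp
  qed
  \<comment> \<open>For \<open>l\<close> within 1/2 of 1 the dilation changes
    \<open>1 + norm x\<close> at most by a factor 2, so decay of order \<open>k\<close> is
    transferred at the cost of \<open>2 ^ k\<close>.\<close>
  have scp: "norm (u (scale_coord i l x)) \<le> 2 ^ k * E / (1 + norm x) ^ k"
    if l: "l \<in> ball 1 (1/2)" and u: "\<And>x. (1 + norm x) ^ k * norm (u x) \<le> E" for x l k E and u :: "real ^ 'n \<Rightarrow> complex"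
  proof -
    have "(1 + norm x) ^ k * norm (u (scale_coord i l x)) \<le> (2 * (1 + norm (scale_coord i l x))) ^ k * norm (u (scale_coord i l x))"
      by (intro mult_right_mono power_mono sc l) auto
    also have "\<dots> = 2 ^ k * ((1 + norm (scale_coord i l x)) ^ k * norm (u (scale_coord i l x)))"
      by (simp only: power_mult_distrib mult.assoc)
    also have "\<dots> \<le> 2 ^ k * E" by (intro mult_left_mono u) auto
    finally show ?thesis by (rule le_divide_power)
  qed
  have int1: "integrable (bessel_measure \<beta>) (\<lambda>x. f (scale_coord i l x) * of_real (bessel_kernel \<gamma> \<xi> x))"
    if l: "l \<in> ball 1 (1/2)" for l
  proof (rule Bochner_Integration.integrable_bound[OF integrable_mult_right[OF N, of "2 ^ N * C"]])
    show "(\<lambda>x. f (scale_coord i l x) * complex_of_real (bessel_kernel \<gamma> \<xi> x)) \<in> borel_measurable (bessel_measure \<beta>)"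
      by (intro continuous_imp_bessel_measurable continuous_intros \<gamma> continuous_on_compose2[OF cont]) auto
    have "norm (f (scale_coord i l x) * complex_of_real (bessel_kernel \<gamma> \<xi> x)) \<le> norm (f (scale_coord i l x))" for x
      using abs_bessel_kernel_le[OF \<gamma>] by (auto simp: norm_mult mult_left_le)
    from order_trans[OF this scp[OF l C(2)]]
    show "AE x in bessel_measure \<beta>. norm (f (scale_coord i l x) * complex_of_real (bessel_kernel \<gamma> \<xi> x))
      \<le> norm (2 ^ N * C * (1 / (1 + norm x) ^ N))"
      using C(1) by (auto intro!: AE_I2)
  qed
  have dA: "(A has_derivative (\<lambda>h. LINT x|bessel_measure \<beta>. of_real (h * x $ i) * partial i f (scale_coord i 1 x) * of_real (bessel_kernel \<gamma> \<xi> x))) (at 1)"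
    unfolding A_def[abs_def]
  proof (rule has_derivative_lebesgue_integral[where r = "1/2" and g = "\<lambda>x. 2 ^ Suc N * D * (1 / (1 + norm x) ^ N)"])
    show "integrable (bessel_measure \<beta>) (\<lambda>x. 2 ^ Suc N * D * (1 / (1 + norm x) ^ N))"
      by (intro integrable_mult_right N)
    show "(\<lambda>x. complex_of_real (h * x $ i) * partial i f (scale_coord i 1 x) * complex_of_real (bessel_kernel \<gamma> \<xi> x))
      \<in> borel_measurable (bessel_measure \<beta>)" for h
      by (intro continuous_imp_bessel_measurable continuous_intros \<gamma> continuous_on_compose2[OF cont1]) auto
    fix l :: real and x assume l: "l \<in> ball 1 (1/2)"
    have "((\<lambda>l. scale_coord i l x) has_derivative (\<lambda>h. (h * x $ i) *\<^sub>R axis i 1)) (at l)"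
      unfolding scale_coord_def by (auto intro!: derivative_eq_intros)
    moreover have "(f has_derivative frechet_derivative f (at (scale_coord i l x))) (at (scale_coord i l x))"
      using diff frechet_derivative_works by blast
    ultimately have "((\<lambda>l. f (scale_coord i l x)) has_derivative (\<lambda>h. frechet_derivative f (at (scale_coord i l x)) ((h * x $ i) *\<^sub>R axis i 1))) (at l)"
      using has_derivative_compose by blast
    moreover have "frechet_derivative f (at (scale_coord i l x)) ((h * x $ i) *\<^sub>R axis i 1) = of_real (h * x $ i) * partial i f (scale_coord i l x)" for h
      by (rule frechet_axis[OF diff])
    ultimately show "((\<lambda>l. f (scale_coord i l x) * complex_of_real (bessel_kernel \<gamma> \<xi> x)) has_derivative
       (\<lambda>h. of_real (h * x $ i) * partial i f (scale_coord i l x) * complex_of_real (bessel_kernel \<gamma> \<xi> x))) (at l)"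
      by (simp add: has_derivative_mult_left)
    fix h :: real
    have "norm (complex_of_real (h * x $ i) * partial i f (scale_coord i l x) * complex_of_real (bessel_kernel \<gamma> \<xi> x))
      \<le> (\<bar>h\<bar> * (1 + norm x)) * (2 ^ Suc N * D / (1 + norm x) ^ Suc N) * 1"
      unfolding norm_mult norm_of_real abs_mult
      using abs_bessel_kernel_le[OF \<gamma>] component_le_norm_cart[of x i] D(1)
      by (intro mult_mono scp[OF l D(2)]) (auto intro: mult_nonneg_nonneg)
    also have "\<dots> = 2 ^ Suc N * D * (1 / (1 + norm x) ^ N) * norm h"
      by (simp add: add_pos_nonneg less_imp_neq[THEN not_sym])
    finally show "norm (complex_of_real (h * x $ i) * partial i f (scale_coord i l x) * complex_of_real (bessel_kernel \<gamma> \<xi> x))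
      \<le> 2 ^ Suc N * D * (1 / (1 + norm x) ^ N) * norm h" .
  qed (use int1 in auto)
  have "(LINT x|bessel_measure \<beta>. of_real (h * x $ i) * partial i f (scale_coord i 1 x) * of_real (bessel_kernel \<gamma> \<xi> x)) = h *\<^sub>R A'" for h
    unfolding A'_def integral_scaleR_right[symmetric]
    by (intro Bochner_Integration.integral_cong) (auto simp: scaleR_conv_of_real)
  with dA have A1: "(A has_vector_derivative A') (at 1)"
    by (simp add: has_vector_derivative_def)
  define p where "p = 2 * \<beta> $ i + 2"
  \<comment> \<open>The kernel depends only on the products \<xi>_j x_j, so a substitution moves the
    dilation from \<open>f\<close> to the frequency.\<close>
  have rel: "\<Phi> (scale_coord i (1 / l) \<xi>) = of_real (l powr p) * A l" if l: "l > 0" for l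
  proof -
    define c :: "real ^ 'n" where "c = (\<chi> j. if j = i then l else 1)"
    have c: "c $ j > 0" for j using l by (simp add: c_def)
    have cx: "(\<chi> j. c $ j * x $ j) = scale_coord i l x" for x
      by (auto simp: vec_eq_iff c_def scale_coord_nth)
    have pr: "(\<Prod>j\<in>UNIV. (c $ j) powr (2 * \<beta> $ j + 2)) = l powr p"
    proof -
      have "(\<Prod>j\<in>UNIV. (c $ j) powr (2 * \<beta> $ j + 2)) = (\<Prod>j\<in>UNIV. if j = i then l powr p else 1)"
        by (intro prod.cong) (auto simp: c_def p_def)
      then show ?thesis by simp
    qed
    have "bessel_kernel \<gamma> (scale_coord i (1 / l) \<xi>) (scale_coord i l x) = bessel_kernel \<gamma> \<xi> x" for x
      unfolding bessel_kernel_def using l by (intro prod.cong) (auto simp: scale_coord_nth)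
    then show ?thesis
      unfolding \<Phi>_def A_def
      by (subst integral_dilation[of c]) (auto simp: c cx pr intro!: continuous_intros \<gamma> cont)
  qed
  define \<Phi>' where "\<Phi>' = (LINT x|bessel_measure \<beta>. f x * of_real (bessel_kernel_deriv \<gamma> i \<xi> x))"
  have "((\<lambda>l. \<Phi> (scale_coord i (1 / l) \<xi>)) has_vector_derivative of_real (- (\<xi> $ i)) * \<Phi>') (at 1)"
  proof -
    have "((\<lambda>l. scale_coord i (1 / l) \<xi>) has_derivative (\<lambda>h. (- h * \<xi> $ i) *\<^sub>R axis i 1)) (at 1)"
      unfolding scale_coord_def by (auto intro!: derivative_eq_intros)
    moreover have "(\<Phi> has_derivative (\<lambda>h. LINT x|bessel_measure \<beta>. f x *
        of_real (\<Sum>j\<in>UNIV. h $ j * bessel_kernel_deriv \<gamma> j \<xi> x))) (at (scale_coord i (1 / 1) \<xi>))"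
      unfolding \<Phi>_def[abs_def] div_by_1 scale_coord_1 by (rule kernel_integral_has_derivative[OF \<beta> \<gamma> rap cont])
    ultimately have "((\<lambda>l. \<Phi> (scale_coord i (1 / l) \<xi>)) has_derivative (\<lambda>h. LINT x|bessel_measure \<beta>. f x *
        of_real (\<Sum>j\<in>UNIV. ((- h * \<xi> $ i) *\<^sub>R axis i 1) $ j * bessel_kernel_deriv \<gamma> j \<xi> x))) (at 1)"
      by (rule has_derivative_compose)
    moreover have "(LINT x|bessel_measure \<beta>. f x *
        of_real (\<Sum>j\<in>UNIV. ((- h * \<xi> $ i) *\<^sub>R axis i 1) $ j * bessel_kernel_deriv \<gamma> j \<xi> x)) = h *\<^sub>R (of_real (- (\<xi> $ i)) * \<Phi>')" for h
    proof -
      have "(\<Sum>j\<in>UNIV. ((- h * \<xi> $ i) *\<^sub>R axis i 1) $ j * bessel_kernel_deriv \<gamma> j \<xi> x) = - h * \<xi> $ i * bessel_kernel_deriv \<gamma> i \<xi> x" for x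
        by (auto simp: axis_def if_distrib if_distribR sum_negf cong: if_cong)
      then have "(LINT x|bessel_measure \<beta>. f x *
        of_real (\<Sum>j\<in>UNIV. ((- h * \<xi> $ i) *\<^sub>R axis i 1) $ j * bessel_kernel_deriv \<gamma> j \<xi> x)) =
        (LINT x|bessel_measure \<beta>. of_real (- h * \<xi> $ i) * (f x * of_real (bessel_kernel_deriv \<gamma> i \<xi> x)))"
        by (intro Bochner_Integration.integral_cong) auto
      then show ?thesis unfolding \<Phi>'_def by (simp add: scaleR_conv_of_real)
    qed
    ultimately show ?thesis by (simp add: has_vector_derivative_def)
  qed
  moreover have "((\<lambda>l. \<Phi> (scale_coord i (1 / l) \<xi>)) has_vector_derivative of_real p * \<Phi> \<xi> + A') (at 1)"
  proof (rule has_vector_derivative_transform_within_open[of _ _ _ "{0<..}"])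
    have "((\<lambda>l. l powr p) has_real_derivative p) (at 1)"
      by (auto intro!: derivative_eq_intros)
    then have "((\<lambda>l. complex_of_real (l powr p)) has_vector_derivative of_real p) (at 1)"
      using has_vector_derivative_of_real has_real_derivative_iff_has_vector_derivative by blast
    from has_vector_derivative_mult[OF this A1]
    have "((\<lambda>l. of_real (l powr p) * A l) has_vector_derivative A' + of_real p * A 1) (at 1)" by simp
    moreover have "A 1 = \<Phi> \<xi>" by (simp add: A_def \<Phi>_def)
    ultimately show "((\<lambda>l. of_real (l powr p) * A l) has_vector_derivative of_real p * \<Phi> \<xi> + A') (at 1)"
      by (simp add: add.commute)
  qed (use rel in auto)
  ultimately have "of_real (- (\<xi> $ i)) * \<Phi>' = of_real p * \<Phi> \<xi> + A'"
    by (rule vector_derivative_unique_at)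
  then have "A' = - (of_real (\<xi> $ i) * \<Phi>' + of_real p * \<Phi> \<xi>)" by (simp add: algebra_simps)
  \<comment> \<open>The recurrence removes the parameter \<beta>_i + 2 that the derivative of the
    shifted kernel has introduced; the terms with \<beta>_i + 1 cancel because
    \<open>p = 2 * (\<beta> $ i + 1)\<close>.\<close>
  also have "of_real (\<xi> $ i) * \<Phi>' + of_real p * \<Phi> \<xi> = 2 * of_real (\<beta> $ i + 1) * fourier_bessel \<beta> f \<xi>"
  proof -
    have int: "integrable (bessel_measure \<beta>) f" by (rule schwartz_integrable[OF \<beta> f])
    have i1: "integrable (bessel_measure \<beta>) (\<lambda>x. f x * of_real (bessel_kernel_deriv \<gamma> i \<xi> x))"
    proof (rule Bochner_Integration.integrable_bound[OF rapid_mult_coord_integrable[OF \<beta> rap cont]])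
      show "(\<lambda>x. f x * complex_of_real (bessel_kernel_deriv \<gamma> i \<xi> x)) \<in> borel_measurable (bessel_measure \<beta>)"
        by (intro continuous_imp_bessel_measurable continuous_intros \<gamma> cont)
      have "\<bar>bessel_kernel_deriv \<gamma> i \<xi> x\<bar> \<le> norm x" for x
        using abs_bessel_kernel_deriv_le[OF \<gamma>, of i \<xi> x] component_le_norm_cart[of x i] by linarith
      then show "AE x in bessel_measure \<beta>. norm (f x * complex_of_real (bessel_kernel_deriv \<gamma> i \<xi> x)) \<le> norm (norm x * norm (f x))"
        by (auto simp: norm_mult abs_mult mult.commute[of _ "norm (f _)"] intro!: mult_left_mono)
    qed
    have "of_real (\<xi> $ i) * \<Phi>' + of_real p * \<Phi> \<xi> =
       (LINT x|bessel_measure \<beta>. of_real (\<xi> $ i) * (f x * of_real (bessel_kernel_deriv \<gamma> i \<xi> x)) + of_real p * (f x * of_real (bessel_kernel \<gamma> \<xi> x)))"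
      unfolding \<Phi>'_def \<Phi>_def
      by (subst Bochner_Integration.integral_add) (auto intro!: integrable_mult_right i1 kernel_integrable \<beta> \<gamma> int)
    also have "\<dots> = (LINT x|bessel_measure \<beta>. 2 * of_real (\<beta> $ i + 1) * (f x * of_real (bessel_kernel \<beta> \<xi> x)))"
    proof (rule Bochner_Integration.integral_cong[OF refl])
      fix x
      define P where "P = (\<Prod>j\<in>UNIV - {i}. norm_bessel (\<beta> $ j) (\<xi> $ j * x $ j))"
      define t where "t = \<xi> $ i * x $ i"
      have \<gamma>2: "\<gamma> + axis i 1 = \<beta> + axis i 2" by (auto simp: \<gamma>_def vec_eq_iff axis_def)
      have b: "\<beta> $ i + 2 \<noteq> 0" using admissibleD[OF \<beta>, of i] by simp
      have "\<xi> $ i * bessel_kernel_deriv \<gamma> i \<xi> x = - (t\<^sup>2 * norm_bessel (\<beta> $ i + 2) t) / (2 * (\<beta> $ i + 2)) * P"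
        unfolding bessel_kernel_deriv_def \<gamma>2 bessel_kernel_shift t_def[symmetric] P_def[symmetric]
        by (simp add: \<gamma>_def t_def power2_eq_square algebra_simps)
      also have "t\<^sup>2 * norm_bessel (\<beta> $ i + 2) t = 4 * (\<beta> $ i + 1) * (\<beta> $ i + 2) * (norm_bessel (\<beta> $ i + 1) t - norm_bessel (\<beta> $ i) t)"
        by (rule norm_bessel_recurrence[OF admissibleD[OF \<beta>]])
      also have "- (4 * (\<beta> $ i + 1) * (\<beta> $ i + 2) * (norm_bessel (\<beta> $ i + 1) t - norm_bessel (\<beta> $ i) t)) / (2 * (\<beta> $ i + 2)) * P
          = - p * (norm_bessel (\<beta> $ i + 1) t * P) + p * (norm_bessel (\<beta> $ i) t * P)"
        using b by (simp add: p_def divide_simps) (simp add: algebra_simps)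
      finally have "\<xi> $ i * bessel_kernel_deriv \<gamma> i \<xi> x + p * bessel_kernel \<gamma> \<xi> x = 2 * (\<beta> $ i + 1) * bessel_kernel \<beta> \<xi> x"
        unfolding bessel_kernel_split[of \<beta> \<xi> x i] \<gamma>_def bessel_kernel_shift t_def[symmetric] P_def[symmetric]
        by (simp add: p_def algebra_simps)
      from arg_cong[OF this, of "\<lambda>r. f x * complex_of_real r"]
      show "of_real (\<xi> $ i) * (f x * of_real (bessel_kernel_deriv \<gamma> i \<xi> x)) + of_real p * (f x * of_real (bessel_kernel \<gamma> \<xi> x))
        = 2 * of_real (\<beta> $ i + 1) * (f x * of_real (bessel_kernel \<beta> \<xi> x))"
        by (simp add: algebra_simps)
    qed
    finally show ?thesis unfolding fourier_bessel_eq by simp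
  qed
  finally show ?thesis unfolding A'_def \<gamma>_def minus_mult_left[symmetric] .
qed

text \<open>Passing to the measure of \<beta> gives a factor \<open>x_i^2\<close>: one
  \<open>x_i\<close> undoes the division in \<open>bessel_D\<close>, the other is the factor in the
  integration by parts.\<close>

lemma fourier_bessel_bessel_D:
  fixes f :: "real ^ 'n \<Rightarrow> complex"
  assumes \<beta>: "admissible \<beta>" and f: "f \<in> schwartz_e"
  shows "fourier_bessel (\<beta> + axis i 1) (bessel_D i f) \<xi> = - (2 * of_real (\<beta> $ i + 1)) * fourier_bessel \<beta> f \<xi>"
proof -
  have Ds: "bessel_D i f \<in> schwartz_e"
    using schwartz_bdd_bessel_D[of "{f}"] f by (simp add: schwartz_e_iff)
  have "fourier_bessel (\<beta> + axis i 1) (bessel_D i f) \<xi> =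
      (LINT x|bessel_measure \<beta>. of_real ((x $ i)\<^sup>2) * (bessel_D i f x * of_real (bessel_kernel (\<beta> + axis i 1) \<xi> x)))"
    unfolding fourier_bessel_eq
    by (intro integral_bessel_shift continuous_imp_bessel_measurable continuous_intros admissible_shift \<beta> schwartz_e_continuous Ds)
  also have "\<dots> = (LINT x|bessel_measure \<beta>. of_real (x $ i) * partial i f x * of_real (bessel_kernel (\<beta> + axis i 1) \<xi> x))"
    unfolding coord_times_bessel_D[OF f, symmetric] by (simp add: power2_eq_square mult_ac)
  finally show ?thesis unfolding fourier_bessel_integration_by_parts[OF assms] .
qed

subsection \<open>Rapid decay of the transform\<close>

lemma fourier_bessel_add:
  assumes "admissible \<beta>" "f \<in> schwartz_e" "g \<in> schwartz_e"
  shows "fourier_bessel \<beta> (\<lambda>x. f x + g x) \<xi> = fourier_bessel \<beta> f \<xi> + fourier_bessel \<beta> g \<xi>"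
  unfolding fourier_bessel_eq distrib_right
  by (intro Bochner_Integration.integral_add kernel_integrable schwartz_integrable assms)

lemma fourier_bessel_cmult: "fourier_bessel \<beta> (\<lambda>x. c * f x) \<xi> = c * fourier_bessel \<beta> f \<xi>"
  unfolding fourier_bessel_eq mult.assoc by simp

lemma bessel_D_schwartz: "f \<in> schwartz_e \<Longrightarrow> bessel_D i f \<in> schwartz_e"
  using schwartz_bdd_bessel_D[of "{f}" i] by (simp add: schwartz_e_iff)

lemma mult_bdd_coord_square:
  fixes i :: "'n::finite"
  shows "mult_bdd {\<lambda>x. complex_of_real ((x $ i)\<^sup>2)}"
proof -
  have "bdd_smooth slow (pointwise_mult (linear_coords 1 i) (linear_coords 1 i))"
    by (intro growth.bdd_smooth_mult[OF growth_slow] bdd_smooth_linear_coords)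
  moreover have "(\<lambda>x. complex_of_real (x $ i)) \<in> linear_coords 1 i"
    by (auto simp: linear_coords_def intro!: exI[of _ 1])
  then have "(\<lambda>x. complex_of_real (x $ i) * complex_of_real (x $ i)) \<in> pointwise_mult (linear_coords 1 i) (linear_coords 1 i)"
    by (intro pointwise_multI)
  then have "{\<lambda>x. complex_of_real ((x $ i)\<^sup>2)} \<subseteq> pointwise_mult (linear_coords 1 i) (linear_coords 1 i)"
    by (simp add: power2_eq_square)
  ultimately have "bdd_smooth slow {\<lambda>x. complex_of_real ((x $ i)\<^sup>2)}"
    by (rule growth.bdd_smooth_mono[OF growth_slow])
  then show ?thesis by (auto simp: mult_bdd_def even_fun_def)
qed

text \<open>Minus the Bessel operator \<open>d_i^2 + ((2 * \<beta>_i + 1)/x_i) d_i\<close>. The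
  second derivative is rewritten as
  \<open>d_i^2 f = bessel_D i f + x_i^2 * bessel_D i (bessel_D i f)\<close>, so that only operations
  preserving evenness and bounded sets occur.\<close>

definition neg_bessel_op :: "real ^ 'n \<Rightarrow> 'n \<Rightarrow> (real ^ 'n \<Rightarrow> complex) \<Rightarrow> real ^ 'n \<Rightarrow> complex" where
  "neg_bessel_op \<beta> i f x = of_real (- (2 * (\<beta> $ i + 1))) * bessel_D i f x +
     - 1 * (of_real ((x $ i)\<^sup>2) * bessel_D i (bessel_D i f) x)"

lemma norm_of_real_minus_le: "cmod (complex_of_real (- r)) \<le> \<bar>r\<bar>"
  by simp

lemma schwartz_bdd_neg_bessel_op:
  assumes "schwartz_bdd B"
  shows "schwartz_bdd (neg_bessel_op \<beta> i ` B)"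
proof (rule schwartz_bdd_mono)
  let ?K = "\<lambda>C. {\<lambda>x::real ^ 'a. c | c. cmod c \<le> C}"
  let ?S = "{\<lambda>x. complex_of_real ((x $ i)\<^sup>2)}"
  let ?A = "pointwise_add (pointwise_mult (?K \<bar>2 * (\<beta> $ i + 1)\<bar>) (bessel_D i ` B))
      (pointwise_mult (?K 1) (pointwise_mult ?S (bessel_D i ` bessel_D i ` B)))"
  show "schwartz_bdd ?A"
    by (intro schwartz_bdd_add schwartz_bdd_mult mult_bdd_const mult_bdd_coord_square schwartz_bdd_bessel_D assms)
  show "neg_bessel_op \<beta> i ` B \<subseteq> ?A"
  proof
    fix h assume "h \<in> neg_bessel_op \<beta> i ` B"
    then obtain f where f: "f \<in> B" and h: "h = neg_bessel_op \<beta> i f" by blast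
    have "(\<lambda>x. complex_of_real (- (2 * (\<beta> $ i + 1)))) \<in> ?K \<bar>2 * (\<beta> $ i + 1)\<bar>"
      by (intro CollectI exI conjI, rule refl, rule norm_of_real_minus_le)
    moreover have "(\<lambda>x. -1) \<in> ?K 1" by (intro CollectI exI conjI, rule refl, simp)
    ultimately show "h \<in> ?A"
      unfolding h neg_bessel_op_def[abs_def] by (intro pointwise_addI pointwise_multI imageI f singletonI)
  qed
qed

text \<open>With \<open>u = bessel_D i (bessel_D i f)\<close>, two integrations by parts show that
  the transform of \<open>u\<close> at the parameter raised by 2 is \<open>c\<close> times that of
  \<open>f\<close>. The recurrence for kernels turns \<xi>_i^2 times the former into
  \<open>c\<close> times a difference of integrals with kernels raised by 1 and by 0, and these two
  are the two terms of the operator.\<close>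

lemma fourier_bessel_neg_bessel_op:
  fixes f :: "real ^ 'n \<Rightarrow> complex"
  assumes \<beta>: "admissible \<beta>" and f: "f \<in> schwartz_e"
  shows "fourier_bessel \<beta> (neg_bessel_op \<beta> i f) \<xi> = of_real ((\<xi> $ i)\<^sup>2) * fourier_bessel \<beta> f \<xi>"
proof -
  define b where "b = \<beta> $ i"
  define u where "u = bessel_D i (bessel_D i f)"
  have Ds: "bessel_D i f \<in> schwartz_e" and us: "u \<in> schwartz_e"
    unfolding u_def by (intro bessel_D_schwartz f)+
  have b: "b > -1/2" unfolding b_def by (rule admissibleD[OF \<beta>])
  have x2u: "(\<lambda>x. of_real ((x $ i)\<^sup>2) * u x) \<in> schwartz_e"
    by (rule schwartz_e_mult[OF mult_bdd_coord_square us])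
  let ?\<gamma> = "\<beta> + axis i 1"
  have \<gamma>: "admissible ?\<gamma>" by (rule admissible_shift[OF \<beta>])
  have \<gamma>2: "?\<gamma> + axis i 1 = \<beta> + axis i 2" by (auto simp: vec_eq_iff axis_def)
  have \<gamma>i: "?\<gamma> $ i = b + 1" by (simp add: b_def)
  have d1: "fourier_bessel ?\<gamma> (bessel_D i f) \<xi> = - (2 * of_real (b + 1)) * fourier_bessel \<beta> f \<xi>"
    using fourier_bessel_bessel_D[OF \<beta> f] by (simp add: b_def)
  have d1': "fourier_bessel ?\<gamma> u \<xi> = - (2 * of_real (b + 1)) * fourier_bessel \<beta> (bessel_D i f) \<xi>"
    using fourier_bessel_bessel_D[OF \<beta> Ds] by (simp add: b_def u_def)
  have d2: "fourier_bessel (?\<gamma> + axis i 1) u \<xi> = - (2 * of_real (b + 2)) * fourier_bessel ?\<gamma> (bessel_D i f) \<xi>"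
    using fourier_bessel_bessel_D[OF \<gamma> Ds, of i \<xi>] unfolding u_def \<gamma>i by (simp add: add.assoc)
  have i1: "integrable (bessel_measure ?\<gamma>) (\<lambda>x. u x * complex_of_real (bessel_kernel ?\<gamma> \<xi> x))"
    and i2: "integrable (bessel_measure ?\<gamma>) (\<lambda>x. u x * complex_of_real (bessel_kernel \<beta> \<xi> x))"
    by (intro kernel_integrable schwartz_integrable us \<gamma> \<beta>)+
  have m: "(\<lambda>x. u x * complex_of_real (bessel_kernel (?\<gamma> + axis i 1) \<xi> x)) \<in> borel_measurable (bessel_measure ?\<gamma>)"
    by (intro continuous_imp_bessel_measurable continuous_intros schwartz_e_continuous us admissible_shift \<gamma>)
  have m': "(\<lambda>x. u x * complex_of_real (bessel_kernel \<beta> \<xi> x)) \<in> borel_measurable (bessel_measure \<beta>)"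
    by (intro continuous_imp_bessel_measurable continuous_intros schwartz_e_continuous us \<beta>)
  define c where "c = 4 * (b + 1) * (b + 2)"
  have k: "(\<xi> $ i)\<^sup>2 * ((x $ i)\<^sup>2 * bessel_kernel (?\<gamma> + axis i 1) \<xi> x) = c * (bessel_kernel ?\<gamma> \<xi> x - bessel_kernel \<beta> \<xi> x)" for x
  proof -
    define P where "P = (\<Prod>j\<in>UNIV - {i}. norm_bessel (\<beta> $ j) (\<xi> $ j * x $ j))"
    define t where "t = \<xi> $ i * x $ i"
    have "(\<xi> $ i)\<^sup>2 * ((x $ i)\<^sup>2 * bessel_kernel (?\<gamma> + axis i 1) \<xi> x) = t\<^sup>2 * norm_bessel (b + 2) t * P"
      unfolding \<gamma>2 bessel_kernel_shift P_def[symmetric] t_def[symmetric] b_def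
      by (simp add: t_def power_mult_distrib)
    also have "\<dots> = c * (norm_bessel (b + 1) t - norm_bessel b t) * P"
      unfolding norm_bessel_recurrence[OF b] c_def ..
    also have "\<dots> = c * (bessel_kernel ?\<gamma> \<xi> x - bessel_kernel \<beta> \<xi> x)"
      unfolding bessel_kernel_split[of \<beta> \<xi> x i] bessel_kernel_shift P_def[symmetric] t_def[symmetric] b_def
      by (simp add: algebra_simps)
    finally show ?thesis .
  qed
  have "of_real ((\<xi> $ i)\<^sup>2) * fourier_bessel (?\<gamma> + axis i 1) u \<xi> =
      (LINT x|bessel_measure ?\<gamma>. of_real ((\<xi> $ i)\<^sup>2) * (of_real ((x $ i)\<^sup>2) * (u x * of_real (bessel_kernel (?\<gamma> + axis i 1) \<xi> x))))"
    unfolding fourier_bessel_eq integral_bessel_shift[OF m] by simp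
  also have "\<dots> = (LINT x|bessel_measure ?\<gamma>. of_real c * (u x * of_real (bessel_kernel ?\<gamma> \<xi> x) - u x * of_real (bessel_kernel \<beta> \<xi> x)))"
  proof (rule Bochner_Integration.integral_cong[OF refl])
    fix x
    show "of_real ((\<xi> $ i)\<^sup>2) * (of_real ((x $ i)\<^sup>2) * (u x * of_real (bessel_kernel (?\<gamma> + axis i 1) \<xi> x))) =
      of_real c * (u x * of_real (bessel_kernel ?\<gamma> \<xi> x) - u x * of_real (bessel_kernel \<beta> \<xi> x))"
      using arg_cong[OF k[of x], of "\<lambda>r. u x * complex_of_real r"] by (simp add: algebra_simps)
  qed
  also have "\<dots> = of_real c * (fourier_bessel ?\<gamma> u \<xi> - (LINT x|bessel_measure ?\<gamma>. u x * of_real (bessel_kernel \<beta> \<xi> x)))"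
    unfolding fourier_bessel_eq using Bochner_Integration.integral_diff[OF i1 i2] by simp
  also have "(LINT x|bessel_measure ?\<gamma>. u x * of_real (bessel_kernel \<beta> \<xi> x)) = fourier_bessel \<beta> (\<lambda>x. of_real ((x $ i)\<^sup>2) * u x) \<xi>"
    unfolding integral_bessel_shift[OF m'] fourier_bessel_eq by (simp add: mult.assoc)
  finally have e: "of_real ((\<xi> $ i)\<^sup>2) * fourier_bessel (?\<gamma> + axis i 1) u \<xi> =
      of_real c * (fourier_bessel ?\<gamma> u \<xi> - fourier_bessel \<beta> (\<lambda>x. of_real ((x $ i)\<^sup>2) * u x) \<xi>)" .
  have "fourier_bessel (?\<gamma> + axis i 1) u \<xi> = of_real c * fourier_bessel \<beta> f \<xi>"
    unfolding d2 d1 c_def by (simp add: algebra_simps)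
  then have "of_real c * (of_real ((\<xi> $ i)\<^sup>2) * fourier_bessel \<beta> f \<xi>) =
      of_real c * (fourier_bessel ?\<gamma> u \<xi> - fourier_bessel \<beta> (\<lambda>x. of_real ((x $ i)\<^sup>2) * u x) \<xi>)"
    using e by (simp add: mult_ac)
  moreover have "c \<noteq> 0" using b by (simp add: c_def)
  ultimately have "of_real ((\<xi> $ i)\<^sup>2) * fourier_bessel \<beta> f \<xi> =
      fourier_bessel ?\<gamma> u \<xi> - fourier_bessel \<beta> (\<lambda>x. of_real ((x $ i)\<^sup>2) * u x) \<xi>" by simp
  moreover have "neg_bessel_op \<beta> i f = (\<lambda>x. of_real (- (2 * (b + 1))) * bessel_D i f x + - 1 * (of_real ((x $ i)\<^sup>2) * u x))"
    by (simp add: fun_eq_iff neg_bessel_op_def b_def u_def)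
  then have "fourier_bessel \<beta> (neg_bessel_op \<beta> i f) \<xi> =
      of_real (- (2 * (b + 1))) * fourier_bessel \<beta> (bessel_D i f) \<xi> + - 1 * fourier_bessel \<beta> (\<lambda>x. of_real ((x $ i)\<^sup>2) * u x) \<xi>"
    using fourier_bessel_add[OF \<beta> schwartz_e_cmult[OF Ds] schwartz_e_cmult[OF x2u]]
    by (simp only: fourier_bessel_cmult)
  ultimately show ?thesis unfolding d1' by simp
qed

definition one_minus_bessel_laplacian :: "real ^ 'n \<Rightarrow> (real ^ 'n \<Rightarrow> complex) \<Rightarrow> real ^ 'n \<Rightarrow> complex" where
  "one_minus_bessel_laplacian \<beta> f x = f x + (\<Sum>i\<in>UNIV. neg_bessel_op \<beta> i f x)"

lemma one_minus_bessel_laplacian_props: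
  fixes \<beta> :: "real ^ 'n"
  assumes \<beta>: "admissible \<beta>"
  shows "schwartz_bdd B \<Longrightarrow> schwartz_bdd (one_minus_bessel_laplacian \<beta> ` B)"
    and "f \<in> schwartz_e \<Longrightarrow> fourier_bessel \<beta> (one_minus_bessel_laplacian \<beta> f) \<xi> =
       of_real (1 + (norm \<xi>)\<^sup>2) * fourier_bessel \<beta> f \<xi>"
proof -
  define L where "L S f x = f x + (\<Sum>i\<in>S. neg_bessel_op \<beta> i f x)" for S f x
  have bdd: "schwartz_bdd (L S ` B)" if "finite S" "schwartz_bdd B" for S B
    using that
  proof (induction S)
    case empty
    then show ?case by (simp add: L_def)
  next
    case (insert i S)
    have "L (insert i S) f = (\<lambda>x. L S f x + neg_bessel_op \<beta> i f x)" for f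
      using insert.hyps by (simp add: L_def fun_eq_iff)
    then have "L (insert i S) ` B \<subseteq> pointwise_add (L S ` B) (neg_bessel_op \<beta> i ` B)"
      by (auto intro: pointwise_addI)
    then show ?case
      using schwartz_bdd_mono[OF schwartz_bdd_add] insert.IH insert.prems schwartz_bdd_neg_bessel_op by blast
  qed
  have Ls: "L S f \<in> schwartz_e" if "finite S" "f \<in> schwartz_e" for S f
    using bdd[of S "{f}"] that by (simp add: schwartz_e_iff)
  have Ns: "neg_bessel_op \<beta> i f \<in> schwartz_e" if "f \<in> schwartz_e" for f i
    using schwartz_bdd_neg_bessel_op[of "{f}"] that by (simp add: schwartz_e_iff)
  have eq: "fourier_bessel \<beta> (L S f) \<xi> = of_real (1 + (\<Sum>i\<in>S. (\<xi> $ i)\<^sup>2)) * fourier_bessel \<beta> f \<xi>"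
    if "finite S" "f \<in> schwartz_e" for S f
    using that
  proof (induction S)
    case empty
    then show ?case by (simp add: L_def)
  next
    case (insert i S)
    have "L (insert i S) f = (\<lambda>x. L S f x + neg_bessel_op \<beta> i f x)"
      using insert.hyps by (simp add: L_def fun_eq_iff)
    then have "fourier_bessel \<beta> (L (insert i S) f) \<xi> = fourier_bessel \<beta> (L S f) \<xi> + fourier_bessel \<beta> (neg_bessel_op \<beta> i f) \<xi>"
      using fourier_bessel_add[OF \<beta> Ls Ns] insert by simp
    then show ?case
      using insert fourier_bessel_neg_bessel_op[OF \<beta>, of f i \<xi>] by (simp add: algebra_simps)
  qed
  have L: "one_minus_bessel_laplacian \<beta> f = L UNIV f" for f
    by (simp add: fun_eq_iff one_minus_bessel_laplacian_def L_def)
  show "schwartz_bdd B \<Longrightarrow> schwartz_bdd (one_minus_bessel_laplacian \<beta> ` B)"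
    unfolding L by (rule bdd) auto
  have "(norm \<xi>)\<^sup>2 = (\<Sum>i\<in>UNIV. (\<xi> $ i)\<^sup>2)"
    by (simp add: norm_vec_def L2_set_def sum_nonneg)
  then show "f \<in> schwartz_e \<Longrightarrow> fourier_bessel \<beta> (one_minus_bessel_laplacian \<beta> f) \<xi> =
       of_real (1 + (norm \<xi>)\<^sup>2) * fourier_bessel \<beta> f \<xi>"
    unfolding L using eq[of UNIV f] by simp
qed

lemma one_plus_power_le:
  fixes r :: real
  assumes "0 \<le> r"
  shows "(1 + r) ^ k \<le> 2 ^ k * (1 + r\<^sup>2) ^ k"
proof -
  have "1 + r \<le> 2 * (1 + r\<^sup>2)"
  proof -
    have "0 \<le> (r - 1)\<^sup>2" by simp
    then have "2 * r \<le> 1 + r\<^sup>2" by (simp add: power2_diff)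
    then show ?thesis using zero_le_power2[of r] by argo
  qed
  then show ?thesis
    unfolding power_mult_distrib[symmetric] using assms by (intro power_mono) auto
qed

text \<open>The transform turns \<open>one_minus_bessel_laplacian\<close> into multiplication by
  \<open>1 + |\<xi>|^2\<close>. Its k-th power maps \<open>B\<close> to a bounded set, whose
  transforms are uniformly bounded; this is decay of order \<open>k\<close>.\<close>

lemma rapid_fourier_bessel:
  fixes B :: "(real ^ 'n \<Rightarrow> complex) set"
  assumes \<beta>: "admissible \<beta>" and B: "schwartz_bdd B"
  shows "rapid (fourier_bessel \<beta> ` B)"
  unfolding rapid_def
proof
  fix k
  have P: "schwartz_bdd ((one_minus_bessel_laplacian \<beta> ^^ k) ` B)" for k
  proof (induction k)
    case (Suc k)
    have "(one_minus_bessel_laplacian \<beta> ^^ Suc k) ` B = one_minus_bessel_laplacian \<beta> ` (one_minus_bessel_laplacian \<beta> ^^ k) ` B"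
      by (simp add: image_image)
    then show ?case using one_minus_bessel_laplacian_props(1)[OF \<beta> Suc] by simp
  qed (simp add: B)
  have eq: "fourier_bessel \<beta> ((one_minus_bessel_laplacian \<beta> ^^ k) f) \<xi> = of_real (1 + (norm \<xi>)\<^sup>2) ^ k * fourier_bessel \<beta> f \<xi>"
    if "f \<in> B" for f \<xi> k
  proof (induction k)
    case (Suc k)
    have "(one_minus_bessel_laplacian \<beta> ^^ k) f \<in> schwartz_e"
      using schwartz_bdd_single[OF P] that by blast
    then show ?case using one_minus_bessel_laplacian_props(2)[OF \<beta>] Suc by (simp add: mult_ac)
  qed simp
  obtain C where C: "C > 0" "\<And>f \<xi>. f \<in> (one_minus_bessel_laplacian \<beta> ^^ k) ` B \<Longrightarrow> norm (fourier_bessel \<beta> f \<xi>) \<le> C"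
    using fourier_bessel_bound[OF \<beta> P[of k]] by metis
  have "(1 + norm \<xi>) ^ k * norm (fourier_bessel \<beta> f \<xi>) \<le> 2 ^ k * C" if f: "f \<in> B" for f \<xi>
  proof -
    have "norm (of_real (1 + (norm \<xi>)\<^sup>2) ^ k * fourier_bessel \<beta> f \<xi>) \<le> C"
      unfolding eq[OF f, symmetric] by (intro C imageI f)
    moreover have "norm (of_real (1 + (norm \<xi>)\<^sup>2) ^ k * fourier_bessel \<beta> f \<xi>) = (1 + (norm \<xi>)\<^sup>2) ^ k * norm (fourier_bessel \<beta> f \<xi>)"
      unfolding norm_mult norm_power norm_of_real by simp
    ultimately have "2 ^ k * ((1 + (norm \<xi>)\<^sup>2) ^ k * norm (fourier_bessel \<beta> f \<xi>)) \<le> 2 ^ k * C"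
      by (intro mult_left_mono) auto
    moreover have "(1 + norm \<xi>) ^ k * norm (fourier_bessel \<beta> f \<xi>) \<le> (2 ^ k * (1 + (norm \<xi>)\<^sup>2) ^ k) * norm (fourier_bessel \<beta> f \<xi>)"
      by (intro mult_right_mono one_plus_power_le) auto
    ultimately show ?thesis by (simp only: mult.assoc)
  qed
  then show "\<exists>C. \<forall>f\<in>fourier_bessel \<beta> ` B. \<forall>x. (1 + norm x) ^ k * norm (f x) \<le> C" by blast
qed

text \<open>Decay is available for all admissible parameters, and a derivative is a coordinate times
  the transform of raised parameter. The parameter thus serves as the index in
  \<open>bdd_smooth_family\<close>.\<close>

lemma schwartz_bdd_fourier_bessel:
  fixes B :: "(real ^ 'n \<Rightarrow> complex) set"
  assumes \<beta>: "admissible \<beta>" and B: "schwartz_bdd B"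
  shows "schwartz_bdd (fourier_bessel \<beta> ` B)"
proof -
  have r: "rapid {f}" and c: "continuous_on UNIV f" if "f \<in> B" for f
    using schwartz_bdd_single[OF B that] schwartz_e_rapid schwartz_e_continuous by blast+
  have "bdd_smooth rapid (fourier_bessel \<beta> ` B)"
  proof (rule growth.bdd_smooth_family[OF growth_rapid, where I = "Collect admissible" and B = "\<lambda>\<beta>. fourier_bessel \<beta> ` B"])
    show "\<beta> \<in> Collect admissible" using \<beta> by simp
    fix \<beta> :: "real ^ 'n" assume "\<beta> \<in> Collect admissible"
    then have \<beta>: "admissible \<beta>" by simp
    show "rapid (fourier_bessel \<beta> ` B)" by (rule rapid_fourier_bessel[OF \<beta> B])
    show "f differentiable at x" if "f \<in> fourier_bessel \<beta> ` B" for f x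
      using that fourier_bessel_has_derivative[OF \<beta> r c] unfolding differentiable_def by blast
    fix i :: 'n
    have "partial i ` fourier_bessel \<beta> ` B \<subseteq>
       pointwise_mult (linear_coords \<bar>1 / (2 * (\<beta> $ i + 1))\<bar> i) (fourier_bessel (\<beta> + axis i 1) ` B)"
    proof
      fix h assume "h \<in> partial i ` fourier_bessel \<beta> ` B"
      then obtain f where f: "f \<in> B" and h: "h = partial i (fourier_bessel \<beta> f)" by blast
      have hh: "h = (\<lambda>\<xi>. (complex_of_real (- (1 / (2 * (\<beta> $ i + 1)))) * of_real (\<xi> $ i)) * fourier_bessel (\<beta> + axis i 1) f \<xi>)"
        unfolding h fun_eq_iff partial_fourier_bessel[OF \<beta> r[OF f] c[OF f]] by simp
      have m: "(\<lambda>\<xi>. complex_of_real (- (1 / (2 * (\<beta> $ i + 1)))) * of_real (\<xi> $ i)) \<in> linear_coords \<bar>1 / (2 * (\<beta> $ i + 1))\<bar> i"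
        unfolding linear_coords_def by (intro CollectI exI conjI, rule refl, rule norm_of_real_minus_le)
      show "h \<in> pointwise_mult (linear_coords \<bar>1 / (2 * (\<beta> $ i + 1))\<bar> i) (fourier_bessel (\<beta> + axis i 1) ` B)"
        unfolding hh by (rule pointwise_multI[OF m imageI[OF f]])
    qed
    then show "\<exists>b\<in>Collect admissible. \<exists>C. partial i ` fourier_bessel \<beta> ` B \<subseteq> pointwise_mult (linear_coords C i) (fourier_bessel b ` B)"
      using admissible_shift[OF \<beta>] by blast
  qed
  then show ?thesis
    unfolding schwartz_bdd_def using even_fun_fourier_bessel[OF \<beta>] by blast
qed

lemma fourier_bessel_schwartz: "admissible \<beta> \<Longrightarrow> f \<in> schwartz_e \<Longrightarrow> fourier_bessel \<beta> f \<in> schwartz_e"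
  using schwartz_bdd_fourier_bessel[of \<beta> "{f}"] by (simp add: schwartz_e_iff)

section \<open>Symmetry of the transform\<close>

lemma fourier_bessel_symmetric:
  assumes \<beta>: "admissible \<beta>" and f: "integrable (bessel_measure \<beta>) f" and g: "integrable (bessel_measure \<beta>) g"
  shows "(LINT x|bessel_measure \<beta>. fourier_bessel \<beta> f x * g x) = (LINT x|bessel_measure \<beta>. f x * fourier_bessel \<beta> g x)"
proof -
  interpret M: sigma_finite_measure "bessel_measure \<beta>" by (rule sigma_finite_bessel)
  interpret P: pair_sigma_finite "bessel_measure \<beta>" "bessel_measure \<beta>" ..
  have [measurable]: "f \<in> borel_measurable (bessel_measure \<beta>)" "g \<in> borel_measurable (bessel_measure \<beta>)"
    using f g by auto
  have k [measurable]: "(\<lambda>z. bessel_kernel \<beta> (fst z) (snd z)) \<in> borel_measurable (bessel_measure \<beta> \<Otimes>\<^sub>M bessel_measure \<beta>)"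
  proof -
    have "(\<lambda>z. bessel_kernel \<beta> (fst z) (snd z)) \<in> borel_measurable (borel \<Otimes>\<^sub>M borel)"
      unfolding borel_prod by (intro borel_measurable_continuous_onI continuous_intros \<beta>)
    moreover have "(\<lambda>x. x) \<in> bessel_measure \<beta> \<rightarrow>\<^sub>M borel" by (intro borel_imp_bessel_measurable) simp
    then have "(\<lambda>z. (fst z, snd z)) \<in> bessel_measure \<beta> \<Otimes>\<^sub>M bessel_measure \<beta> \<rightarrow>\<^sub>M borel \<Otimes>\<^sub>M borel"
      by (intro measurable_Pair measurable_compose[OF measurable_fst] measurable_compose[OF measurable_snd])
    ultimately show ?thesis using measurable_compose[of "\<lambda>z. (fst z, snd z)"] by fastforce
  qed
  have fg: "integrable (bessel_measure \<beta> \<Otimes>\<^sub>M bessel_measure \<beta>) (\<lambda>(x, y). f x * g y)"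
  proof (rule P.Fubini_integrable)
    show "integrable (bessel_measure \<beta>) (\<lambda>x. LINT y|bessel_measure \<beta>. norm (case (x, y) of (x, y) \<Rightarrow> f x * g y))"
      using f by (simp add: norm_mult)
    show "AE x in bessel_measure \<beta>. integrable (bessel_measure \<beta>) (\<lambda>y. case (x, y) of (x, y) \<Rightarrow> f x * g y)"
      using g by simp
  qed measurable
  have "integrable (bessel_measure \<beta> \<Otimes>\<^sub>M bessel_measure \<beta>) (\<lambda>(x, y). f x * g y * of_real (bessel_kernel \<beta> x y))"
  proof (rule Bochner_Integration.integrable_bound[OF fg])
    show "(\<lambda>(x, y). f x * g y * complex_of_real (bessel_kernel \<beta> x y)) \<in> borel_measurable (bessel_measure \<beta> \<Otimes>\<^sub>M bessel_measure \<beta>)"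
      using k by (simp add: split_beta')
    show "AE z in bessel_measure \<beta> \<Otimes>\<^sub>M bessel_measure \<beta>. norm (case z of (x, y) \<Rightarrow> f x * g y * complex_of_real (bessel_kernel \<beta> x y))
        \<le> norm (case z of (x, y) \<Rightarrow> f x * g y)"
      using abs_bessel_kernel_le[OF \<beta>] by (auto simp: norm_mult mult_left_le)
  qed
  from P.Fubini_integral[OF this]
  have "(LINT y|bessel_measure \<beta>. LINT x|bessel_measure \<beta>. f x * g y * of_real (bessel_kernel \<beta> x y)) =
     (LINT x|bessel_measure \<beta>. LINT y|bessel_measure \<beta>. f x * g y * of_real (bessel_kernel \<beta> x y))" .
  moreover have "(LINT x|bessel_measure \<beta>. f x * g y * of_real (bessel_kernel \<beta> x y)) = fourier_bessel \<beta> f y * g y" for y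
  proof -
    have "(LINT x|bessel_measure \<beta>. f x * g y * of_real (bessel_kernel \<beta> x y)) =
        (LINT x|bessel_measure \<beta>. (f x * of_real (bessel_kernel \<beta> y x)) * g y)"
      by (simp add: mult_ac bessel_kernel_commute[of \<beta> y])
    then show ?thesis unfolding fourier_bessel_eq by simp
  qed
  moreover have "(LINT y|bessel_measure \<beta>. f x * g y * of_real (bessel_kernel \<beta> x y)) = f x * fourier_bessel \<beta> g x" for x
    unfolding fourier_bessel_eq by (simp add: mult.assoc)
  ultimately show ?thesis by simp
qed

section \<open>Gaussians and the inversion formula\<close>

text \<open>Independent rates in the coordinates: they provide enough exponents to separate
  functions, and the transform acts on them by \<open>a_i\<close> to
  \<open>1/(4 * a_i)\<close>.\<close>

definition gauss :: "real ^ 'n \<Rightarrow> real ^ 'n \<Rightarrow> complex" where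
  "gauss a x = complex_of_real (exp (- (\<Sum>i\<in>UNIV. a $ i * (x $ i)\<^sup>2)))"

lemma gauss_has_derivative:
  "(gauss a has_derivative (\<lambda>h. \<Sum>i\<in>UNIV. of_real (h $ i) * (of_real (- (2 * a $ i)) * of_real (x $ i) * gauss a x))) (at x)"
proof -
  have nth: "((\<lambda>x. x $ i) has_derivative (\<lambda>h. h $ i)) (at x)" for i :: 'a and x :: "real ^ 'a"
    by (intro bounded_linear_imp_has_derivative bounded_linear_vec_nth)
  have "((\<lambda>x. a $ i * (x $ i)\<^sup>2) has_derivative (\<lambda>h. 2 * a $ i * x $ i * h $ i)) (at x)" for i
    by (rule has_derivative_eq_rhs, rule has_derivative_mult_right, rule has_derivative_power[OF nth])
      (simp add: fun_eq_iff mult_ac)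
  then have *: "((\<lambda>x. - (\<Sum>i\<in>UNIV. a $ i * (x $ i)\<^sup>2)) has_derivative (\<lambda>h. - (\<Sum>i\<in>UNIV. 2 * a $ i * x $ i * h $ i))) (at x)"
    by (intro has_derivative_minus has_derivative_sum)
  have "(gauss a has_derivative (\<lambda>h. complex_of_real (exp (- (\<Sum>i\<in>UNIV. a $ i * (x $ i)\<^sup>2)) * - (\<Sum>i\<in>UNIV. 2 * a $ i * x $ i * h $ i)))) (at x)"
    unfolding gauss_def[abs_def]
    by (rule has_derivative_of_real, rule has_derivative_eq_rhs[OF has_derivative_exp[OF *]]) (simp add: fun_eq_iff mult.commute)
  moreover have "complex_of_real (exp (- (\<Sum>i\<in>UNIV. a $ i * (x $ i)\<^sup>2)) * - (\<Sum>i\<in>UNIV. 2 * a $ i * x $ i * h $ i)) =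
    (\<Sum>i\<in>UNIV. of_real (h $ i) * (of_real (- (2 * a $ i)) * of_real (x $ i) * gauss a x))" for h
    unfolding gauss_def by (simp add: sum_distrib_left sum_negf mult_ac)
  ultimately show ?thesis by simp
qed

lemma gauss_differentiable: "gauss a differentiable at x"
  using gauss_has_derivative differentiable_def by blast

lemma partial_gauss: "partial i (gauss a) x = of_real (- (2 * a $ i)) * of_real (x $ i) * gauss a x"
  unfolding partial_eqI[OF gauss_has_derivative]
  by (auto simp: axis_def if_distrib if_distribR cong: if_cong)

lemma power_le_exp:
  fixes y :: real
  assumes "0 \<le> y"
  shows "y ^ k \<le> real k ^ k * exp y"
proof (cases "k = 0")
  case False
  have "(y / real k) ^ k \<le> (1 + y / real k) ^ k" using assms by (intro power_mono) auto
  also have "\<dots> \<le> exp y" using assms False by (intro exp_ge_one_plus_x_over_n_power_n) auto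
  finally show ?thesis using False by (simp add: power_divide field_simps)
qed (use assms in simp)

text \<open>\<open>power_le_exp\<close> is applied at \<open>y = m * (1 + r^2)\<close>; the surplus
  \<open>m\<close> in this exponent is the origin of \<open>exp m\<close>.\<close>

lemma poly_exp_bound:
  fixes m r :: real
  assumes "m > 0" "0 \<le> r"
  shows "(1 + r) ^ k * exp (- m * r\<^sup>2) \<le> 2 ^ k * ((real k / m) ^ k * exp m)"
proof -
  have "(m * (1 + r\<^sup>2)) ^ k \<le> real k ^ k * exp (m * (1 + r\<^sup>2))"
    using assms by (intro power_le_exp) auto
  moreover have "exp (m * (1 + r\<^sup>2)) = exp m * exp (m * r\<^sup>2)" by (simp add: distrib_left exp_add)
  ultimately have "(1 + r\<^sup>2) ^ k * m ^ k \<le> real k ^ k * (exp m * exp (m * r\<^sup>2))"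
    by (simp only: power_mult_distrib mult.commute[of "(1 + r\<^sup>2) ^ k"])
  then have "(1 + r\<^sup>2) ^ k \<le> real k ^ k * (exp m * exp (m * r\<^sup>2)) / m ^ k"
    using assms by (simp only: pos_le_divide_eq zero_less_power)
  also have "\<dots> = (real k / m) ^ k * exp m * exp (m * r\<^sup>2)" by (simp add: power_divide)
  finally have "(1 + r\<^sup>2) ^ k * exp (- m * r\<^sup>2) \<le> (real k / m) ^ k * exp m * exp (m * r\<^sup>2) * exp (- m * r\<^sup>2)"
    by (intro mult_right_mono) auto
  then have *: "(1 + r\<^sup>2) ^ k * exp (- m * r\<^sup>2) \<le> (real k / m) ^ k * exp m"
    by (simp add: mult.assoc exp_add[symmetric])
  have "(1 + r) ^ k * exp (- m * r\<^sup>2) \<le> (2 ^ k * (1 + r\<^sup>2) ^ k) * exp (- m * r\<^sup>2)"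
    by (intro mult_right_mono one_plus_power_le assms) auto
  also have "\<dots> \<le> 2 ^ k * ((real k / m) ^ k * exp m)"
    using * by (simp add: mult.assoc)
  finally show ?thesis .
qed

lemma norm_square_sum: "(norm (x :: real ^ 'n))\<^sup>2 = (\<Sum>i\<in>UNIV. (x $ i)\<^sup>2)"
  by (simp add: norm_vec_def L2_set_def sum_nonneg)

lemma rapid_gauss:
  fixes a :: "real ^ 'n"
  assumes "\<And>i. a $ i > 0"
  shows "rapid {gauss a}"
proof -
  define m where "m = Min (range (\<lambda>i. a $ i))"
  have m: "m > 0" "m \<le> a $ i" for i
    using assms by (auto simp: m_def)
  have "(1 + norm x) ^ k * norm (gauss a x) \<le> 2 ^ k * ((real k / m) ^ k * exp m)" for k x
  proof -
    have "m * (norm x)\<^sup>2 \<le> (\<Sum>i\<in>UNIV. a $ i * (x $ i)\<^sup>2)"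
      unfolding norm_square_sum sum_distrib_left by (intro sum_mono mult_right_mono m) auto
    then have "norm (gauss a x) \<le> exp (- m * (norm x)\<^sup>2)" by (simp add: gauss_def)
    then have "(1 + norm x) ^ k * norm (gauss a x) \<le> (1 + norm x) ^ k * exp (- m * (norm x)\<^sup>2)"
      by (intro mult_left_mono) auto
    also have "\<dots> \<le> 2 ^ k * ((real k / m) ^ k * exp m)" by (intro poly_exp_bound m) auto
    finally show ?thesis .
  qed
  then show ?thesis unfolding rapid_def by blast
qed

lemma gauss_schwartz:
  fixes a :: "real ^ 'n"
  assumes "\<And>i. a $ i > 0"
  shows "gauss a \<in> schwartz_e"
proof -
  have "bdd_smooth rapid {gauss a}"
  proof (rule growth.bdd_smooth_family[OF growth_rapid, where I = "{()}" and B = "\<lambda>_. {gauss a}"])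
    fix i :: 'n
    have "(\<lambda>x. of_real (- (2 * a $ i)) * of_real (x $ i)) \<in> linear_coords \<bar>2 * a $ i\<bar> i"
      unfolding linear_coords_def by (intro CollectI exI conjI, rule refl, rule norm_of_real_minus_le)
    then have "(\<lambda>x. of_real (- (2 * a $ i)) * of_real (x $ i) * gauss a x) \<in> pointwise_mult (linear_coords \<bar>2 * a $ i\<bar> i) {gauss a}"
      by (rule pointwise_multI) simp
    moreover have "partial i (gauss a) = (\<lambda>x. of_real (- (2 * a $ i)) * of_real (x $ i) * gauss a x)"
      by (rule ext) (rule partial_gauss)
    ultimately show "\<exists>b\<in>{()}. \<exists>C. partial i ` {gauss a} \<subseteq> pointwise_mult (linear_coords C i) {gauss a}"
      by (intro bexI[of _ "()"] exI[of _ "\<bar>2 * a $ i\<bar>"]) auto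
  qed (use gauss_differentiable rapid_gauss[OF assms] in auto)
  moreover have "even_fun (gauss a)"
  proof -
    have "(\<Sum>j\<in>UNIV. a $ j * (if j = i then - (x $ j) else x $ j)\<^sup>2) = (\<Sum>j\<in>UNIV. a $ j * (x $ j)\<^sup>2)" for i x
      by (intro sum.cong) auto
    then show ?thesis by (simp add: even_fun_def gauss_def)
  qed
  ultimately show ?thesis by (simp add: schwartz_e_iff schwartz_bdd_def)
qed

lemma gauss_0 [simp]: "gauss a 0 = 1"
  by (simp add: gauss_def)

text \<open>The gradient of the transform and the integration by parts both involve the transform
  with raised parameter, since \<open>d_i\<close> of a Gaussian is \<open>x_i\<close> times it.
  Eliminating that term leaves a first-order linear equation for the transform itself.\<close>

lemma fourier_bessel_gauss:
  fixes a \<beta> :: "real ^ 'n"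
  assumes \<beta>: "admissible \<beta>" and a: "\<And>i. a $ i > 0"
  shows "fourier_bessel \<beta> (gauss a) \<xi> = fourier_bessel \<beta> (gauss a) 0 * gauss (\<chi> i. 1 / (4 * a $ i)) \<xi>"
proof -
  note g = gauss_schwartz[OF a]
  have rg: "rapid {gauss a}" "continuous_on UNIV (gauss a)"
    using schwartz_e_rapid[OF g] schwartz_e_continuous[OF g] .
  have shift: "of_real (- (1 / (2 * (\<beta> $ i + 1)))) * fourier_bessel (\<beta> + axis i 1) (gauss a) \<xi> =
      of_real (- (1 / (2 * a $ i))) * fourier_bessel \<beta> (gauss a) \<xi>" for i \<xi>
  proof -
    have m: "(\<lambda>x. gauss a x * complex_of_real (bessel_kernel (\<beta> + axis i 1) \<xi> x)) \<in> borel_measurable (bessel_measure \<beta>)"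
      by (intro continuous_imp_bessel_measurable continuous_intros rg admissible_shift \<beta>)
    have "of_real (- (2 * a $ i)) * fourier_bessel (\<beta> + axis i 1) (gauss a) \<xi> =
      (LINT x|bessel_measure \<beta>. of_real (- (2 * a $ i)) * (of_real ((x $ i)\<^sup>2) * (gauss a x * complex_of_real (bessel_kernel (\<beta> + axis i 1) \<xi> x))))"
      unfolding fourier_bessel_eq integral_bessel_shift[OF m] by simp
    also have "\<dots> = (LINT x|bessel_measure \<beta>. of_real (x $ i) * partial i (gauss a) x * of_real (bessel_kernel (\<beta> + axis i 1) \<xi> x))"
      unfolding partial_gauss by (simp add: power2_eq_square mult_ac)
    also have "\<dots> = - (2 * of_real (\<beta> $ i + 1)) * fourier_bessel \<beta> (gauss a) \<xi>"
      by (rule fourier_bessel_integration_by_parts[OF \<beta> g])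
    finally have "of_real (a $ i) * fourier_bessel (\<beta> + axis i 1) (gauss a) \<xi> = of_real (\<beta> $ i + 1) * fourier_bessel \<beta> (gauss a) \<xi>"
      by (simp add: algebra_simps) algebra
    moreover have "complex_of_real (a $ i) \<noteq> 0" "complex_of_real (\<beta> $ i + 1) \<noteq> 0"
      using a[of i] admissibleD[OF \<beta>, of i] by (auto simp del: of_real_add)
    moreover have "- (1 / (2 * z)) * G = - (1 / (2 * w)) * H" if "w * G = z * H" "w \<noteq> 0" "z \<noteq> 0" for w z G H :: complex
      using that by (simp add: field_simps)
    ultimately have "- (1 / (2 * complex_of_real (\<beta> $ i + 1))) * fourier_bessel (\<beta> + axis i 1) (gauss a) \<xi> =
        - (1 / (2 * complex_of_real (a $ i))) * fourier_bessel \<beta> (gauss a) \<xi>" by blast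
    then show ?thesis by simp
  qed
  \<comment> \<open>An integrating factor: the rates are negative, so \<open>gauss b\<close> is the
    growing reciprocal of the expected Gaussian, and the product \<open>H\<close> has zero
    gradient.\<close>
  define b :: "real ^ 'n" where "b = (\<chi> i. - (1 / (4 * a $ i)))"
  define H where "H \<xi> = fourier_bessel \<beta> (gauss a) \<xi> * gauss b \<xi>" for \<xi>
  have "(H has_derivative (\<lambda>h. 0)) (at \<xi>)" for \<xi>
  proof -
    have "(H has_derivative (\<lambda>h. fourier_bessel \<beta> (gauss a) \<xi> *
        (\<Sum>i\<in>UNIV. of_real (h $ i) * (of_real (- (2 * b $ i)) * of_real (\<xi> $ i) * gauss b \<xi>)) +
        (\<Sum>i\<in>UNIV. of_real (h $ i) * (of_real (- (\<xi> $ i / (2 * (\<beta> $ i + 1)))) * fourier_bessel (\<beta> + axis i 1) (gauss a) \<xi>)) * gauss b \<xi>)) (at \<xi>)"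
      unfolding H_def[abs_def]
      by (intro has_derivative_mult fourier_bessel_has_derivative[OF \<beta> rg] gauss_has_derivative)
    moreover have "fourier_bessel \<beta> (gauss a) \<xi> *
        (\<Sum>i\<in>UNIV. of_real (h $ i) * (of_real (- (2 * b $ i)) * of_real (\<xi> $ i) * gauss b \<xi>)) +
        (\<Sum>i\<in>UNIV. of_real (h $ i) * (of_real (- (\<xi> $ i / (2 * (\<beta> $ i + 1)))) * fourier_bessel (\<beta> + axis i 1) (gauss a) \<xi>)) * gauss b \<xi> = 0" for h
    proof -
      have "of_real (- (\<xi> $ i / (2 * (\<beta> $ i + 1)))) * fourier_bessel (\<beta> + axis i 1) (gauss a) \<xi> =
          - (of_real (- (2 * b $ i)) * of_real (\<xi> $ i) * fourier_bessel \<beta> (gauss a) \<xi>)" for i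
        using arg_cong[OF shift[of i \<xi>], of "\<lambda>z. complex_of_real (\<xi> $ i) * z"] by (simp add: b_def)
      then show ?thesis
        by (simp add: sum_distrib_left sum_distrib_right sum_negf mult_ac)
    qed
    ultimately show ?thesis by simp
  qed
  then obtain c where c: "\<And>\<xi>. H \<xi> = c"
    using has_derivative_zero_constant[OF convex_UNIV, of H] by auto
  have "gauss b \<xi> * gauss (\<chi> i. 1 / (4 * a $ i)) \<xi> = 1" for \<xi>
    by (simp add: gauss_def b_def exp_add[symmetric] of_real_mult[symmetric] sum_negf del: of_real_mult)
  moreover have "fourier_bessel \<beta> (gauss a) \<xi> * gauss b \<xi> = fourier_bessel \<beta> (gauss a) 0"
    using c[of \<xi>] c[of 0] by (simp add: H_def)
  ultimately show ?thesis by (metis mult.assoc mult.right_neutral)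
qed

text \<open>The factor by which the transform applied twice multiplies every Gaussian. By dilation
  the integrals of \<open>gauss a\<close> and of the Gaussian with rates \<open>1/(4 * a_i)\<close>
  reduce to that of \<open>gauss 1\<close>; since the square roots of the two rates multiply to 1/2,
  only a power of 2 is left.\<close>

definition inversion_const :: "real ^ 'n \<Rightarrow> complex" where
  "inversion_const \<beta> = (fourier_bessel \<beta> (gauss 1) 0)\<^sup>2 * of_real (\<Prod>i\<in>UNIV. 2 powr (2 * \<beta> $ i + 2))"

lemma fourier_bessel_gauss_0:
  fixes a \<beta> :: "real ^ 'n"
  assumes \<beta>: "admissible \<beta>" and a: "\<And>i. a $ i > 0"
  shows "fourier_bessel \<beta> (gauss 1) 0 = of_real (\<Prod>i\<in>UNIV. (sqrt (a $ i)) powr (2 * \<beta> $ i + 2)) * fourier_bessel \<beta> (gauss a) 0"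
proof -
  define c :: "real ^ 'n" where "c = (\<chi> i. sqrt (a $ i))"
  have "gauss 1 (\<chi> i. c $ i * x $ i) = gauss a x" for x
    using a by (simp add: gauss_def c_def power_mult_distrib less_imp_le)
  moreover have "continuous_on UNIV (gauss (1 :: real ^ 'n))"
    by (intro schwartz_e_continuous gauss_schwartz) simp
  moreover have "c $ i > 0" for i using a by (simp add: c_def)
  ultimately show ?thesis
    using integral_dilation[of c "gauss 1" \<beta>] by (simp add: fourier_bessel_eq bessel_kernel_0[OF \<beta>] c_def)
qed

lemma fourier_bessel_gauss_twice:
  fixes a \<beta> :: "real ^ 'n"
  assumes \<beta>: "admissible \<beta>" and a: "\<And>i. a $ i > 0"
  shows "fourier_bessel \<beta> (fourier_bessel \<beta> (gauss a)) \<xi> = inversion_const \<beta> * gauss a \<xi>"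
proof -
  define a' :: "real ^ 'n" where "a' = (\<chi> i. 1 / (4 * a $ i))"
  have a': "a' $ i > 0" for i using a by (simp add: a'_def)
  have a'': "(\<chi> i. 1 / (4 * a' $ i)) = a" using a by (auto simp: a'_def vec_eq_iff)
  have "fourier_bessel \<beta> (gauss a) = (\<lambda>\<xi>. fourier_bessel \<beta> (gauss a) 0 * gauss a' \<xi>)"
    unfolding a'_def by (rule ext) (rule fourier_bessel_gauss[OF \<beta> a])
  then have "fourier_bessel \<beta> (fourier_bessel \<beta> (gauss a)) \<xi> = fourier_bessel \<beta> (gauss a) 0 * fourier_bessel \<beta> (gauss a') \<xi>"
    using fourier_bessel_cmult[of \<beta> "fourier_bessel \<beta> (gauss a) 0" "gauss a'" \<xi>] by simp
  also have "fourier_bessel \<beta> (gauss a') \<xi> = fourier_bessel \<beta> (gauss a') 0 * gauss a \<xi>"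
    using fourier_bessel_gauss[OF \<beta> a', of \<xi>] unfolding a'' .
  finally have 1: "fourier_bessel \<beta> (fourier_bessel \<beta> (gauss a)) \<xi> =
      fourier_bessel \<beta> (gauss a) 0 * fourier_bessel \<beta> (gauss a') 0 * gauss a \<xi>" by simp
  define P where "P = (\<Prod>i\<in>UNIV. (sqrt (a $ i)) powr (2 * \<beta> $ i + 2))"
  define P' where "P' = (\<Prod>i\<in>UNIV. (sqrt (a' $ i)) powr (2 * \<beta> $ i + 2))"
  define R where "R = (\<Prod>i\<in>(UNIV :: 'n set). 2 powr (2 * \<beta> $ i + 2))"
  have "sqrt (a $ i) * sqrt (a' $ i) * 2 = 1" for i
  proof -
    have "sqrt (a $ i) * sqrt (a' $ i) = sqrt (1 / 4)"
      using a[of i] by (simp add: a'_def real_sqrt_mult[symmetric])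
    then show ?thesis by (simp add: real_sqrt_divide)
  qed
  moreover have "(sqrt (a $ i)) powr p * (sqrt (a' $ i)) powr p * 2 powr p = (sqrt (a $ i) * sqrt (a' $ i) * 2) powr p" for i p
    using a[of i] a'[of i] by (simp add: powr_mult)
  ultimately have "P * P' * R = 1"
    unfolding P_def P'_def R_def prod.distrib[symmetric] by simp
  then have PR: "complex_of_real P * complex_of_real P' * complex_of_real R = 1"
    by (metis of_real_1 of_real_mult)
  have "inversion_const \<beta> = (of_real P * fourier_bessel \<beta> (gauss a) 0) * (of_real P' * fourier_bessel \<beta> (gauss a') 0) * of_real R"
    unfolding inversion_const_def power2_eq_square P_def P'_def R_def
    fourier_bessel_gauss_0[OF \<beta> a, symmetric] fourier_bessel_gauss_0[OF \<beta> a', symmetric] ..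
  also have "\<dots> = (complex_of_real P * complex_of_real P' * complex_of_real R) * (fourier_bessel \<beta> (gauss a) 0 * fourier_bessel \<beta> (gauss a') 0)"
    by (simp add: mult_ac)
  finally show ?thesis unfolding 1 PR by simp
qed

lemma AE_continuous_zero:
  fixes h :: "real ^ 'n \<Rightarrow> complex"
  assumes h: "continuous_on UNIV h" and ae: "AE x in bessel_measure \<beta>. h x = 0" and x: "x \<in> pos_orthant"
  shows "h x = 0"
proof (rule ccontr)
  assume nz: "h x \<noteq> 0"
  define U where "U = {x. h x \<noteq> 0} \<inter> pos_orthant"
  have [measurable]: "h \<in> borel_measurable borel" using h by (rule borel_measurable_continuous_onI)
  have "open {x. h x \<noteq> 0}"
    using continuous_open_preimage[OF h open_UNIV, of "- {0}"] by (simp add: vimage_def open_Compl)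
  then have U: "open U" unfolding U_def by (intro open_Int open_pos_orthant)
  have "AE x in lborel. x \<in> pos_orthant \<longrightarrow> h x = 0"
    using ae by (subst (asm) AE_bessel_iff) measurable
  then have "AE x in lborel. x \<notin> U" by (rule eventually_mono) (auto simp: U_def)
  then have "U \<in> null_sets lborel" using U by (subst (asm) AE_iff_null_sets[symmetric]) auto
  then have "negligible U" by (simp add: negligible_iff_null_sets null_sets_completionI)
  moreover have "U \<noteq> {}" using nz x by (auto simp: U_def)
  ultimately show False using open_not_negligible[OF U] by blast
qed

lemma inversion_const_nonzero:
  fixes \<beta> :: "real ^ 'n"
  assumes \<beta>: "admissible \<beta>"
  shows "inversion_const \<beta> \<noteq> 0"
proof -
  have g: "gauss (1 :: real ^ 'n) \<in> schwartz_e" by (rule gauss_schwartz) simp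
  define e :: "real ^ 'n \<Rightarrow> real" where "e x = exp (- (\<Sum>i\<in>UNIV. (x $ i)\<^sup>2))" for x
  have ge: "gauss 1 x = of_real (e x)" for x :: "real ^ 'n" by (simp add: gauss_def e_def)
  have int: "integrable (bessel_measure \<beta>) e"
    using schwartz_integrable[OF \<beta> g] unfolding ge by (simp add: complex_of_real_integrable_eq)
  have "fourier_bessel \<beta> (gauss 1) 0 \<noteq> 0"
  proof
    assume "fourier_bessel \<beta> (gauss 1) 0 = 0"
    then have "integral\<^sup>L (bessel_measure \<beta>) e = 0"
      by (simp add: fourier_bessel_eq bessel_kernel_0[OF \<beta>] ge)
    then have "AE x in bessel_measure \<beta>. e x = 0"
      using integral_nonneg_eq_0_iff_AE[OF int] by (auto simp: e_def)
    then have "AE x in bessel_measure \<beta>. gauss 1 x = 0" by (simp add: ge)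
    then have "gauss 1 (1 :: real ^ 'n) = 0"
      by (rule AE_continuous_zero[OF schwartz_e_continuous[OF g]]) (simp add: pos_orthant_def)
    then show False by (simp add: gauss_def)
  qed
  then show ?thesis
    unfolding inversion_const_def by simp
qed

subsection \<open>Gaussians separate functions\<close>

text \<open>In the coordinates \<open>u\<^sub>i = exp (- x\<^sub>i\<^sup>2)\<close>, integrals against Gaussians become moments of a complex measure on
  the cube, so the Stone-Weierstrass theorem applies.\<close>

lemma gauss_moments_zero:
  fixes \<psi> :: "real ^ 'n \<Rightarrow> complex"
  assumes meas: "\<psi> \<in> borel_measurable (bessel_measure \<beta>)"
    and int: "integrable (bessel_measure \<beta>) (\<lambda>x. \<psi> x * gauss 1 x)"
    and zero: "\<And>k :: 'n \<Rightarrow> nat. (\<And>i. k i \<ge> 1) \<Longrightarrow> (LINT x|bessel_measure \<beta>. \<psi> x * gauss (\<chi> i. real (k i)) x) = 0"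
  shows "AE x in bessel_measure \<beta>. \<psi> x = 0"
proof -
  let ?M = "bessel_measure \<beta>"
  define u :: "real ^ 'n \<Rightarrow> real ^ 'n" where "u x = (\<chi> i. exp (- (x $ i)\<^sup>2))" for x
  define cube :: "(real ^ 'n) set" where "cube = cbox 0 1"
  have u_cube: "u x \<in> cube" for x by (simp add: cube_def u_def mem_box_cart)
  have contu: "continuous_on UNIV u"
    unfolding u_def by (intro continuous_on_vec_lambda continuous_intros)
  have compact: "compact cube" by (simp add: cube_def compact_cbox)
  have bmul: "integrable ?M (\<lambda>x. \<rho> x * of_real (p (u x)))"
    if "integrable ?M \<rho>" "continuous_on UNIV p" for \<rho> :: "real ^ 'n \<Rightarrow> complex" and p
  proof -
    have "compact (p ` cube)"
      by (intro compact_continuous_image compact continuous_on_subset[OF that(2)]) auto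
    then obtain C where C: "\<And>v. v \<in> cube \<Longrightarrow> \<bar>p v\<bar> \<le> C"
      using compact_imp_bounded[of "p ` cube"] unfolding bounded_iff by auto
    have "integrable ?M (\<lambda>x. of_real C * \<rho> x)" using that(1) by (rule integrable_mult_right)
    then show ?thesis
    proof (rule Bochner_Integration.integrable_bound)
      have "(\<lambda>x. complex_of_real (p (u x))) \<in> borel_measurable ?M"
        by (intro continuous_imp_bessel_measurable continuous_intros continuous_on_compose2[OF that(2) contu]) auto
      then show "(\<lambda>x. \<rho> x * complex_of_real (p (u x))) \<in> borel_measurable ?M"
        using that(1) by (intro borel_measurable_times) auto
      show "AE x in ?M. norm (\<rho> x * complex_of_real (p (u x))) \<le> norm (complex_of_real C * \<rho> x)"
      proof (rule AE_I2)
        fix x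
        have "\<bar>p (u x)\<bar> \<le> \<bar>C\<bar>" using C[OF u_cube[of x]] by simp
        then show "norm (\<rho> x * complex_of_real (p (u x))) \<le> norm (complex_of_real C * \<rho> x)"
          by (simp add: norm_mult mult.commute[of "norm (\<rho> x)"] mult_right_mono)
      qed
    qed
  qed
  \<comment> \<open>Densities all of whose monomial moments vanish. Formulating the induction on
    polynomials as stability of \<open>X\<close> under multiplication makes the case of a product a
    mere iteration.\<close>
  define X :: "(real ^ 'n \<Rightarrow> complex) set" where "X = {\<rho>. integrable ?M \<rho> \<and> (\<forall>k. (LINT x|?M. \<rho> x * of_real (\<Prod>i\<in>UNIV. (u x $ i) ^ k i)) = 0)}"
  have contmon: "continuous_on UNIV (\<lambda>v::real ^ 'n. \<Prod>i\<in>UNIV. (v $ i) ^ k i)" for k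
    by (intro continuous_intros)
  have Xcoord: "(\<lambda>x. \<rho> x * of_real (u x $ i)) \<in> X" if "\<rho> \<in> X" for \<rho> i
  proof -
    have "integrable ?M (\<lambda>x. \<rho> x * of_real (u x $ i))"
    proof (rule bmul)
      show "integrable ?M \<rho>" using that by (simp add: X_def)
    qed (intro continuous_intros)
    moreover have "(LINT x|?M. \<rho> x * of_real (u x $ i) * of_real (\<Prod>j\<in>UNIV. (u x $ j) ^ k j)) = 0" for k
    proof -
      have *: "\<rho> x * of_real (u x $ i) * of_real (\<Prod>j\<in>UNIV. (u x $ j) ^ k j) = \<rho> x * of_real (\<Prod>j\<in>UNIV. (u x $ j) ^ (k(i := Suc (k i))) j)" for x
      proof -
        have "(\<Prod>j\<in>UNIV. (u x $ j) ^ (k(i := Suc (k i))) j) = (\<Prod>j\<in>UNIV. (if j = i then u x $ i else 1) * (u x $ j) ^ k j)"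
          by (intro prod.cong) auto
        then show ?thesis by (simp add: prod.distrib mult.assoc)
      qed
      show ?thesis unfolding * using that unfolding X_def by fast
    qed
    ultimately show ?thesis by (simp add: X_def)
  qed
  have Xscale: "(\<lambda>x. \<rho> x * of_real c) \<in> X" if "\<rho> \<in> X" for \<rho> c
  proof -
    have "(LINT x|?M. \<rho> x * of_real c * of_real (\<Prod>j\<in>UNIV. (u x $ j) ^ k j)) =
        of_real c * (LINT x|?M. \<rho> x * of_real (\<Prod>j\<in>UNIV. (u x $ j) ^ k j))" for k
      unfolding integral_mult_right_zero[symmetric] by (simp only: mult_ac)
    with that show ?thesis by (simp add: X_def)
  qed
  have Xadd: "(\<lambda>x. \<rho> x + \<sigma> x) \<in> X" if "\<rho> \<in> X" "\<sigma> \<in> X" for \<rho> \<sigma>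
  proof -
    have i: "integrable ?M \<rho>" "integrable ?M \<sigma>" using that by (auto simp: X_def)
    have "(LINT x|?M. (\<rho> x + \<sigma> x) * of_real (\<Prod>j\<in>UNIV. (u x $ j) ^ k j)) = 0" for k
      unfolding distrib_right
      using that Bochner_Integration.integral_add[OF bmul[OF i(1) contmon[of k]] bmul[OF i(2) contmon[of k]]] by (simp add: X_def)
    with i show ?thesis by (simp add: X_def)
  qed
  have Xpoly: "(\<lambda>x. \<rho> x * of_real (P (u x))) \<in> X" if "real_polynomial_function P" "\<rho> \<in> X" for P \<rho>
    using that
  proof (induction arbitrary: \<rho>)
    case (linear f)
    have lin: "linear f" using linear.hyps by (rule bounded_linear.linear)
    have "(\<lambda>x. \<Sum>i\<in>S. \<rho> x * of_real (u x $ i) * of_real (f (axis i 1))) \<in> X" if "finite S" for S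
      using that
    proof (induction S)
      case empty
      have "(\<lambda>x. \<rho> x * of_real 0) \<in> X" using Xscale[OF linear.prems, of 0] .
      then show ?case by simp
    next
      case (insert i S)
      from Xadd[OF Xscale[OF Xcoord[OF linear.prems, of i], of "f (axis i 1)"] insert.IH]
      show ?case using insert.hyps by simp
    qed
    from this[of UNIV] have "(\<lambda>x. \<Sum>i\<in>UNIV. \<rho> x * of_real (u x $ i) * of_real (f (axis i 1))) \<in> X" by simp
    moreover have "(\<Sum>i\<in>UNIV. \<rho> x * of_real (u x $ i) * of_real (f (axis i 1))) = \<rho> x * of_real (f (u x))" for x
    proof -
      have "u x = (\<Sum>i\<in>UNIV. u x $ i *\<^sub>R axis i 1)"
        by (auto simp: vec_eq_iff axis_def if_distrib if_distribR cong: if_cong)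
      then have "f (u x) = f (\<Sum>i\<in>UNIV. u x $ i *\<^sub>R axis i 1)" by simp
      also have "\<dots> = (\<Sum>i\<in>UNIV. u x $ i * f (axis i 1))"
        by (simp add: linear_sum[OF lin] linear_scale[OF lin])
      finally show ?thesis by (simp add: sum_distrib_left mult.assoc)
    qed
    ultimately show ?case by simp
  next
    case (const c)
    then show ?case by (rule Xscale)
  next
    case (add f g)
    from Xadd[OF add.IH(1)[OF add.prems] add.IH(2)[OF add.prems]]
    show ?case by (simp add: distrib_left)
  next
    case (mult f g)
    from mult.IH(2)[OF mult.IH(1)[OF mult.prems]]
    show ?case by (simp add: mult.assoc)
  qed
  \<comment> \<open>The factor \<open>gauss 1\<close> gives integrability and raises all rates by 1,
    so the monomial exponents k \<ge> 0 correspond to the rates k + 1 \<ge> 1 of the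
    hypothesis.\<close>
  define \<rho> where "\<rho> x = \<psi> x * gauss 1 x" for x
  have \<rho>int: "integrable ?M \<rho>" using int by (simp add: \<rho>_def[abs_def])
  have "(LINT x|?M. \<rho> x * of_real (\<Prod>i\<in>UNIV. (u x $ i) ^ k i)) = 0" for k
  proof -
    have "\<rho> x * of_real (\<Prod>i\<in>UNIV. (u x $ i) ^ k i) = \<psi> x * gauss (\<chi> i. real (k i + 1)) x" for x
    proof -
      have "(\<Prod>i\<in>UNIV. (u x $ i) ^ k i) = exp (- (\<Sum>i\<in>UNIV. real (k i) * (x $ i)\<^sup>2))"
        by (simp add: u_def exp_of_nat_mult[symmetric] exp_sum[symmetric] sum_negf[symmetric])
      then have "exp (- (\<Sum>i\<in>UNIV. (x $ i)\<^sup>2)) * (\<Prod>i\<in>UNIV. (u x $ i) ^ k i) = exp (- (\<Sum>i\<in>UNIV. real (k i + 1) * (x $ i)\<^sup>2))"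
        by (simp add: exp_add[symmetric] sum.distrib algebra_simps)
      then have "gauss 1 x * of_real (\<Prod>i\<in>UNIV. (u x $ i) ^ k i) = gauss (\<chi> i. real (k i + 1)) x"
        unfolding gauss_def by (simp only: of_real_mult[symmetric]) simp
      then show ?thesis unfolding \<rho>_def mult.assoc by simp
    qed
    then show ?thesis using zero[of "\<lambda>i. k i + 1"] by simp
  qed
  then have \<rho>X: "\<rho> \<in> X" using \<rho>int by (simp add: X_def)
  have contz: "(LINT x|?M. \<rho> x * of_real (p (u x))) = 0" if p: "continuous_on UNIV p" for p
  proof -
    have bound: "norm (LINT x|?M. \<rho> x * of_real (p (u x))) \<le> e * (LINT x|?M. norm (\<rho> x))" if e: "e > 0" for e
    proof -
      obtain P where P: "real_polynomial_function P" "\<And>v. v \<in> cube \<Longrightarrow> \<bar>p v - P v\<bar> < e"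
        using Stone_Weierstrass_real_polynomial_function[OF compact continuous_on_subset[OF p subset_UNIV] e] by metis
      have cP: "continuous_on UNIV P"
        using P(1) continuous_on_polymonial_function real_polynomial_function_eq by blast
      have "(LINT x|?M. \<rho> x * of_real (P (u x)) * of_real (\<Prod>i\<in>UNIV. (u x $ i) ^ 0)) = 0"
        using Xpoly[OF P(1) \<rho>X] unfolding X_def by fast
      then have "(LINT x|?M. \<rho> x * of_real (p (u x))) = (LINT x|?M. \<rho> x * of_real (p (u x)) - \<rho> x * of_real (P (u x)))"
        using Bochner_Integration.integral_diff[OF bmul[OF \<rho>int p] bmul[OF \<rho>int cP]] by simp
      also have "norm \<dots> \<le> (LINT x|?M. e * norm (\<rho> x))"
      proof (rule order_trans[OF integral_norm_bound integral_mono])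
        show "integrable ?M (\<lambda>x. norm (\<rho> x * of_real (p (u x)) - \<rho> x * of_real (P (u x))))"
          by (intro integrable_norm Bochner_Integration.integrable_diff bmul \<rho>int p cP)
        show "integrable ?M (\<lambda>x. e * norm (\<rho> x))" by (intro integrable_mult_right integrable_norm \<rho>int)
        fix x
        have "norm (\<rho> x * of_real (p (u x)) - \<rho> x * of_real (P (u x))) = norm (\<rho> x) * \<bar>p (u x) - P (u x)\<bar>"
          by (metis norm_mult norm_of_real of_real_diff right_diff_distrib)
        also have "\<dots> \<le> norm (\<rho> x) * e" using P(2)[OF u_cube[of x]] by (intro mult_left_mono) auto
        finally show "norm (\<rho> x * of_real (p (u x)) - \<rho> x * of_real (P (u x))) \<le> e * norm (\<rho> x)" by (simp add: mult.commute)
      qed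
      finally show ?thesis by simp
    qed
    define N where "N = (LINT x|?M. norm (\<rho> x))"
    have "N \<ge> 0" by (simp add: N_def)
    have "norm (LINT x|?M. \<rho> x * of_real (p (u x))) \<le> 0 + e" if "e > 0" for e
    proof -
      have "norm (LINT x|?M. \<rho> x * of_real (p (u x))) \<le> e / (N + 1) * N"
        using bound[of "e / (N + 1)"] \<open>e > 0\<close> \<open>N \<ge> 0\<close> unfolding N_def[symmetric] by simp
      also have "\<dots> \<le> e" using \<open>e > 0\<close> \<open>N \<ge> 0\<close> by (simp add: field_simps)
      finally show ?thesis by simp
    qed
    then have "norm (LINT x|?M. \<rho> x * of_real (p (u x))) \<le> 0" by (rule field_le_epsilon)
    then show ?thesis by simp
  qed
  \<comment> \<open>Since \<open>u\<close> sees only the squares of the coordinates, it is injective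
    on the closed orthant only; accordingly \<open>D\<close> below is the image of the part of
    \<open>C\<close> with nonnegative coordinates.\<close>
  have uinj: "x = y" if "u x = u y" "\<And>i. 0 \<le> x $ i" "\<And>i. 0 \<le> y $ i" for x y
  proof -
    have "(x $ i)\<^sup>2 = (y $ i)\<^sup>2" for i
      using arg_cong[OF that(1), of "\<lambda>v. v $ i"] by (simp add: u_def)
    then show ?thesis using that(2,3) by (simp add: vec_eq_iff power2_eq_iff_nonneg)
  qed
  have compz: "(LINT x|?M. indicator C x *\<^sub>R \<rho> x) = 0" if C: "compact C" for C
  proof (cases "C \<inter> {x. \<forall>i. 0 \<le> x $ i} = {}")
    case True
    then have "indicator C x *\<^sub>R \<rho> x = 0" if "x \<in> pos_orthant" for x
      using that by (auto simp: pos_orthant_def indicator_def less_imp_le)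
    then have "(LINT x|?M. indicator C x *\<^sub>R \<rho> x) = (LINT x|?M. 0)"
      by (intro Bochner_Integration.integral_cong) auto
    then show ?thesis by simp
  next
    case False
    define D where "D = u ` (C \<inter> {x. \<forall>i. 0 \<le> x $ i})"
    have "closed {x::real ^ 'n. \<forall>i. 0 \<le> x $ i}"
      by (subst Collect_all_eq) (intro closed_INT ballI closed_halfspace_component_ge_cart)
    then have "compact D" unfolding D_def
      by (intro compact_continuous_image continuous_on_subset[OF contu] compact_Int_closed C) auto
    then have D: "closed D" "D \<noteq> {}" using False by (auto simp: D_def compact_imp_closed)
    \<comment> \<open>Continuous functions that decrease to the indicator function of
      \<open>D\<close>; composed with \<open>u\<close> they converge on the orthant to the indicator
      function of \<open>C\<close>.\<close>
    define p where "p m v = max 0 (1 - real m * infdist v D)" for m v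
    have cp: "continuous_on UNIV (p m)" for m
      unfolding p_def by (intro continuous_intros)
    have lim: "(\<lambda>m. LINT x|?M. \<rho> x * of_real (p m (u x))) \<longlonglongrightarrow> (LINT x|?M. indicator C x *\<^sub>R \<rho> x)"
    proof (rule integral_dominated_convergence[where w = "\<lambda>x. norm (\<rho> x)"])
      have "C \<in> sets borel" using C by (simp add: borel_compact)
      then have "indicator C \<in> borel_measurable ?M"
        by (intro borel_imp_bessel_measurable borel_measurable_indicator)
      then show "(\<lambda>x. indicat_real C x *\<^sub>R \<rho> x) \<in> borel_measurable ?M"
        using \<rho>int by (intro borel_measurable_scaleR) auto
      show "(\<lambda>x. \<rho> x * of_real (p m (u x))) \<in> borel_measurable ?M" for m
        using bmul[OF \<rho>int cp[of m]] by auto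
      show "integrable ?M (\<lambda>x. norm (\<rho> x))" using \<rho>int by simp
      show "AE x in ?M. norm (\<rho> x * of_real (p m (u x))) \<le> norm (\<rho> x)" for m
      proof (rule AE_I2)
        fix x
        have "\<bar>p m (u x)\<bar> \<le> 1" unfolding p_def using infdist_nonneg[of "u x" D] by auto
        then show "norm (\<rho> x * of_real (p m (u x))) \<le> norm (\<rho> x)" by (simp add: norm_mult mult_left_le)
      qed
      show "AE x in ?M. (\<lambda>m. \<rho> x * of_real (p m (u x))) \<longlonglongrightarrow> indicator C x *\<^sub>R \<rho> x"
      proof (rule AE_I2)
        fix x assume "x \<in> space ?M"
        then have x: "\<And>i. 0 \<le> x $ i" by (auto simp: pos_orthant_def less_imp_le)
        have uD: "u x \<in> D \<longleftrightarrow> x \<in> C" using uinj[of x] x by (auto simp: D_def)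
        have "(\<lambda>m. p m (u x)) \<longlonglongrightarrow> indicator C x"
        proof (cases "x \<in> C")
          case True
          then have "infdist (u x) D = 0" using uD by simp
          then show ?thesis using True by (simp add: p_def)
        next
          case nC: False
          then have pos: "0 < infdist (u x) D"
            using D uD in_closed_iff_infdist_zero[of D "u x"] infdist_nonneg[of "u x" D] by auto
          obtain m0 where m0: "1 / infdist (u x) D < real m0" using reals_Archimedean2 by blast
          have "\<forall>\<^sub>F m in sequentially. p m (u x) = 0"
            unfolding eventually_sequentially
          proof (intro exI allI impI)
            fix m assume "m0 \<le> m"
            then have "1 / infdist (u x) D \<le> real m" using m0 by simp
            then have "1 \<le> real m * infdist (u x) D" using pos by (simp add: field_simps)
            then show "p m (u x) = 0" by (simp add: p_def)
          qed
          then show ?thesis using nC by (simp add: tendsto_eventually)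
        qed
        then have "(\<lambda>m. \<rho> x * of_real (p m (u x))) \<longlonglongrightarrow> \<rho> x * of_real (indicator C x)"
          by (intro tendsto_mult tendsto_const tendsto_of_real)
        then show "(\<lambda>m. \<rho> x * of_real (p m (u x))) \<longlonglongrightarrow> indicator C x *\<^sub>R \<rho> x"
          by (simp add: scaleR_conv_of_real mult.commute)
      qed
    qed
    moreover have "(\<lambda>m. LINT x|?M. \<rho> x * of_real (p m (u x))) \<longlonglongrightarrow> 0"
      using contz[OF cp] by simp
    ultimately show ?thesis using LIMSEQ_unique by blast
  qed
  have indint: "integrable ?M (\<lambda>x. indicator A x *\<^sub>R \<rho> x)" if "A \<in> sets borel" for A
  proof (rule Bochner_Integration.integrable_bound[OF \<rho>int])
    have "indicator A \<in> borel_measurable ?M"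
      using that by (intro borel_imp_bessel_measurable borel_measurable_indicator)
    then show "(\<lambda>x. indicat_real A x *\<^sub>R \<rho> x) \<in> borel_measurable ?M"
      using \<rho>int by (intro borel_measurable_scaleR) auto
  qed (auto simp: indicator_def)
  have indmeas: "(\<lambda>x. indicator A x *\<^sub>R \<rho> x) \<in> borel_measurable ?M" if "A \<in> sets borel" for A
    by (rule borel_measurable_integrable[OF indint[OF that]])
  have indbound: "norm (indicator A x *\<^sub>R \<rho> x) \<le> norm (\<rho> x)" for A x
    by (simp add: indicator_def)
  have closedz: "(LINT x|?M. indicator C x *\<^sub>R \<rho> x) = 0" if C: "closed C" for C
  proof -
    have "(\<lambda>m. LINT x|?M. indicator (C \<inter> cball 0 (real m)) x *\<^sub>R \<rho> x) \<longlonglongrightarrow> (LINT x|?M. indicator C x *\<^sub>R \<rho> x)"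
    proof (rule integral_dominated_convergence[where w = "\<lambda>x. norm (\<rho> x)"])
      show "AE x in ?M. (\<lambda>m. indicat_real (C \<inter> cball 0 (real m)) x *\<^sub>R \<rho> x) \<longlonglongrightarrow> indicat_real C x *\<^sub>R \<rho> x"
      proof (rule AE_I2)
        fix x :: "real ^ 'n"
        obtain m0 where m0: "norm x \<le> real m0" using real_arch_simple by blast
        have "\<forall>\<^sub>F m in sequentially. indicat_real (C \<inter> cball 0 (real m)) x *\<^sub>R \<rho> x = indicat_real C x *\<^sub>R \<rho> x"
          unfolding eventually_sequentially
        proof (intro exI allI impI)
          fix m assume "m0 \<le> m"
          then have "norm x \<le> real m" using m0 by simp
          then show "indicat_real (C \<inter> cball 0 (real m)) x *\<^sub>R \<rho> x = indicat_real C x *\<^sub>R \<rho> x"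
            by (simp add: indicator_def)
        qed
        then show "(\<lambda>m. indicat_real (C \<inter> cball 0 (real m)) x *\<^sub>R \<rho> x) \<longlonglongrightarrow> indicat_real C x *\<^sub>R \<rho> x"
          by (rule tendsto_eventually)
      qed
      show "integrable ?M (\<lambda>x. norm (\<rho> x))" using \<rho>int by (rule integrable_norm)
    qed (intro indmeas AE_I2 indbound; use C in auto)+
    moreover have "(LINT x|?M. indicator (C \<inter> cball 0 (real m)) x *\<^sub>R \<rho> x) = 0" for m
      by (intro compz closed_Int_compact C compact_cball)
    ultimately show ?thesis using LIMSEQ_unique[OF _ tendsto_const] by fastforce
  qed
  \<comment> \<open>Closed sets form a generator that is stable under intersections, so vanishing
    extends to all Borel sets by Dynkin's theorem.\<close>
  have borelz: "(LINT x|?M. indicator A x *\<^sub>R \<rho> x) = 0" if A: "A \<in> sets borel" for A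
  proof -
    have b: "sets borel = sigma_sets UNIV (Collect closed :: (real ^ 'n) set set)"
      unfolding borel_eq_closed by (simp add: sets_measure_of)
    have univ: "(LINT x|?M. \<rho> x) = 0" using closedz[of UNIV] by simp
    have "Int_stable (Collect closed :: (real ^ 'n) set set)" by (auto simp: Int_stable_def)
    moreover have "(Collect closed :: (real ^ 'n) set set) \<subseteq> Pow UNIV" by simp
    moreover have "A \<in> sigma_sets UNIV (Collect closed)" using A b by simp
    ultimately show ?thesis
    proof (induct rule: sigma_sets_induct_disjoint)
      case (basic S)
      then show ?case using closedz by simp
    next
      case empty
      then show ?case by simp
    next
      case (compl S)
      note S = compl(1) and IH = compl(2)
      have "indicator (UNIV - S) x *\<^sub>R \<rho> x = \<rho> x - indicator S x *\<^sub>R \<rho> x" for x by (auto simp: indicator_def)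
      then show ?case
        using Bochner_Integration.integral_diff[OF \<rho>int indint[of S]] S IH univ b by simp
    next
      case (union F)
      note d = union(1) and F = union(2) and IH = union(3)
      have Fb: "F i \<in> sets borel" for i using F b by auto
      have lim: "(\<lambda>m. LINT x|?M. indicator (\<Union>i<m. F i) x *\<^sub>R \<rho> x) \<longlonglongrightarrow> (LINT x|?M. indicator (\<Union>i. F i) x *\<^sub>R \<rho> x)"
      proof (rule integral_dominated_convergence[where w = "\<lambda>x. norm (\<rho> x)"])
        show "AE x in ?M. (\<lambda>m. indicat_real (\<Union>i<m. F i) x *\<^sub>R \<rho> x) \<longlonglongrightarrow> indicat_real (\<Union>i. F i) x *\<^sub>R \<rho> x"
          by (intro AE_I2 tendsto_scaleR tendsto_const LIMSEQ_indicator_UN)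
        show "integrable ?M (\<lambda>x. norm (\<rho> x))" using \<rho>int by (rule integrable_norm)
      qed (intro indmeas AE_I2 indbound; use Fb in auto)+
      have z: "(LINT x|?M. indicator (\<Union>i<m. F i) x *\<^sub>R \<rho> x) = 0" for m
      proof (induction m)
        case (Suc m)
        have "F m \<inter> (\<Union>i<m. F i) = {}" using d unfolding disjoint_family_on_def by (metis (no_types, lifting) Int_UN_distrib SUP_bot_conv(2) UNIV_I lessThan_iff less_irrefl)
        then have "indicat_real (F m \<union> (\<Union>i<m. F i)) x = indicator (F m) x + indicator (\<Union>i<m. F i) x" for x
          by (rule indicator_add[symmetric])
        then have "indicator (\<Union>i<Suc m. F i) x *\<^sub>R \<rho> x = indicator (F m) x *\<^sub>R \<rho> x + indicator (\<Union>i<m. F i) x *\<^sub>R \<rho> x" for x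
          by (simp only: lessThan_Suc UN_insert scaleR_add_left)
        moreover have "(\<Union>i<m. F i) \<in> sets borel" using Fb by auto
        ultimately show ?case
          using Bochner_Integration.integral_add[OF indint[OF Fb[of m]] indint[of "\<Union>i<m. F i"]] Suc IH by simp
      qed simp
      show ?case by (rule LIMSEQ_unique[OF lim[unfolded z] tendsto_const])
    qed
  qed
  have setz: "(LINT x|?M. indicator A x *\<^sub>R \<rho> x) = 0" if A: "A \<in> sets ?M" for A
  proof -
    obtain A' where A': "A' \<in> sets borel" "A = pos_orthant \<inter> A'"
      by (rule imageE[OF A[unfolded sets_bessel_measure sets_restrict_space]])
    have "(LINT x|?M. indicator A x *\<^sub>R \<rho> x) = (LINT x|?M. indicator A' x *\<^sub>R \<rho> x)"
      by (intro Bochner_Integration.integral_cong) (auto simp: A' indicator_def)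
    then show ?thesis using borelz[OF A'(1)] by simp
  qed
  have indM: "integrable ?M (\<lambda>x. indicator A x *\<^sub>R \<rho> x)" if "A \<in> sets ?M" for A
    using integrable_mult_indicator[OF that \<rho>int] .
  have "AE x in ?M. Re (\<rho> x) = 0"
  proof (rule density_unique_real)
    fix A assume A: "A \<in> sets ?M"
    have "(LINT x:A|?M. Re (\<rho> x)) = Re (LINT x|?M. indicator A x *\<^sub>R \<rho> x)"
      using integral_Re[OF indM[OF A]] by (simp add: set_lebesgue_integral_def)
    then show "(LINT x:A|?M. Re (\<rho> x)) = (LINT x:A|?M. 0)" using setz[OF A] by simp
  qed (use \<rho>int in auto)
  moreover have "AE x in ?M. Im (\<rho> x) = 0"
  proof (rule density_unique_real)
    fix A assume A: "A \<in> sets ?M"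
    have "(LINT x:A|?M. Im (\<rho> x)) = Im (LINT x|?M. indicator A x *\<^sub>R \<rho> x)"
      using integral_Im[OF indM[OF A]] by (simp add: set_lebesgue_integral_def)
    then show "(LINT x:A|?M. Im (\<rho> x)) = (LINT x:A|?M. 0)" using setz[OF A] by simp
  qed (use \<rho>int in auto)
  ultimately show ?thesis
    by eventually_elim (simp add: \<rho>_def gauss_def complex_eq_iff)
qed

section \<open>From almost all points of the orthant to all points, and inversion\<close>

lemma even_fun_abs:
  fixes h :: "real ^ 'n \<Rightarrow> complex"
  assumes "even_fun h"
  shows "h (\<chi> i. \<bar>x $ i\<bar>) = h x"
proof -
  have "h (\<chi> i. if i \<in> S then \<bar>x $ i\<bar> else x $ i) = h x" if "finite S" for S
    using that
  proof (induction S)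
    case (insert i S)
    let ?y = "\<lambda>S. (\<chi> i. if i \<in> S then \<bar>x $ i\<bar> else x $ i) :: real ^ 'n"
    have "?y (insert i S) = ?y S \<or> ?y (insert i S) = reflect i (?y S)"
      using insert.hyps by (cases "0 \<le> x $ i") (auto simp: vec_eq_iff reflect_def)
    then show ?case using insert.IH assms by (auto simp: even_fun_reflect)
  qed simp
  from this[of UNIV] show ?thesis by simp
qed

lemma even_continuous_zero:
  fixes h :: "real ^ 'n \<Rightarrow> complex"
  assumes "even_fun h" "continuous_on UNIV h" "\<And>x. x \<in> pos_orthant \<Longrightarrow> h x = 0"
  shows "h x = 0"
proof -
  \<comment> \<open>The point with coordinates \<bar>x_i\<bar> may lie on the boundary; adding a
    small positive number to every coordinate moves it into the open orthant.\<close>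
  define y where "y m = (\<chi> i. \<bar>x $ i\<bar>) + (1 / real (Suc m)) *\<^sub>R (1 :: real ^ 'n)" for m
  have "h (y m) = 0" for m
    by (rule assms(3)) (auto simp: pos_orthant_def y_def intro!: add_nonneg_pos)
  moreover have "y \<longlonglongrightarrow> (\<chi> i. \<bar>x $ i\<bar>) + 0 *\<^sub>R 1"
    unfolding y_def by (intro tendsto_intros lim_1_over_n[THEN LIMSEQ_Suc])
  then have "(\<lambda>m. h (y m)) \<longlonglongrightarrow> h ((\<chi> i. \<bar>x $ i\<bar>) + 0 *\<^sub>R 1)"
    using assms(2) continuous_on_tendsto_compose[OF assms(2)] by auto
  ultimately have "h (\<chi> i. \<bar>x $ i\<bar>) = 0" using LIMSEQ_unique[OF _ tendsto_const[of 0]] by simp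
  then show ?thesis using even_fun_abs[OF assms(1)] by simp
qed

text \<open>Symmetry moves both transforms to a Gaussian, where the identity is known. The
  difference of the two sides therefore has vanishing Gaussian moments; continuity and evenness turn
  vanishing almost everywhere on the orthant into vanishing everywhere.\<close>

theorem fourier_bessel_inversion:
  fixes f :: "real ^ 'n \<Rightarrow> complex"
  assumes \<beta>: "admissible \<beta>" and f: "f \<in> schwartz_e"
  shows "fourier_bessel \<beta> (fourier_bessel \<beta> f) x = inversion_const \<beta> * f x"
proof -
  let ?F = "fourier_bessel \<beta>"
  define h where "h x = ?F (?F f) x - inversion_const \<beta> * f x" for x
  have Ff: "?F f \<in> schwartz_e" and FFf: "?F (?F f) \<in> schwartz_e" and cf: "(\<lambda>x. inversion_const \<beta> * f x) \<in> schwartz_e"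
    by (intro fourier_bessel_schwartz \<beta> f schwartz_e_cmult)+
  have h: "h \<in> schwartz_e" unfolding h_def[abs_def] by (intro schwartz_e_diff FFf cf)
  have prod: "integrable (bessel_measure \<beta>) (\<lambda>x. u x * gauss a x)" if "u \<in> schwartz_e" "\<And>i. a $ i > 0" for u a
  proof (rule Bochner_Integration.integrable_bound[OF schwartz_integrable[OF \<beta> that(1)]])
    show "(\<lambda>x. u x * gauss a x) \<in> borel_measurable (bessel_measure \<beta>)"
      by (intro continuous_imp_bessel_measurable continuous_intros schwartz_e_continuous that gauss_schwartz)
    have "norm (gauss a x) \<le> 1" for x
      using that(2) by (simp add: gauss_def sum_nonneg less_imp_le)
    then show "AE x in bessel_measure \<beta>. norm (u x * gauss a x) \<le> norm (u x)"
      by (auto simp: norm_mult mult_left_le)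
  qed
  have "AE x in bessel_measure \<beta>. h x = 0"
  proof (rule gauss_moments_zero)
    show "h \<in> borel_measurable (bessel_measure \<beta>)"
      by (intro continuous_imp_bessel_measurable schwartz_e_continuous h)
    show "integrable (bessel_measure \<beta>) (\<lambda>x. h x * gauss 1 x)" by (rule prod[OF h]) simp
    fix k :: "'n \<Rightarrow> nat" assume k: "\<And>i. 1 \<le> k i"
    define a :: "real ^ 'n" where "a = (\<chi> i. real (k i))"
    have a: "a $ i > 0" for i using k[of i] by (simp add: a_def)
    have g: "gauss a \<in> schwartz_e" by (rule gauss_schwartz[OF a])
    have "(LINT x|bessel_measure \<beta>. ?F (?F f) x * gauss a x) = (LINT x|bessel_measure \<beta>. ?F f x * ?F (gauss a) x)"
      by (intro fourier_bessel_symmetric schwartz_integrable \<beta> Ff g)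
    also have "\<dots> = (LINT x|bessel_measure \<beta>. f x * ?F (?F (gauss a)) x)"
      by (intro fourier_bessel_symmetric schwartz_integrable \<beta> f fourier_bessel_schwartz g)
    also have "\<dots> = (LINT x|bessel_measure \<beta>. inversion_const \<beta> * f x * gauss a x)"
      unfolding fourier_bessel_gauss_twice[OF \<beta> a] by (simp only: mult_ac)
    finally have "(LINT x|bessel_measure \<beta>. ?F (?F f) x * gauss a x - inversion_const \<beta> * f x * gauss a x) = 0"
      by (subst Bochner_Integration.integral_diff) (auto intro!: prod FFf cf a)
    then show "(LINT x|bessel_measure \<beta>. h x * gauss (\<chi> i. real (k i)) x) = 0"
      unfolding h_def a_def left_diff_distrib .
  qed
  then have z: "h x = 0" if "x \<in> pos_orthant" for x
    using AE_continuous_zero[OF schwartz_e_continuous[OF h]] that by blast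
  have "even_fun h" using h by (simp add: schwartz_e_def)
  from even_continuous_zero[OF this schwartz_e_continuous[OF h] z] have "h x = 0" .
  then show ?thesis by (simp add: h_def)
qed

section \<open>Cutoff functions and weights\<close>

text \<open>Carrying a negative power along makes the family closed under differentiation up to
  linear combinations.\<close>

definition flat_exp :: "nat \<Rightarrow> real \<Rightarrow> real" where
  "flat_exp k t = (if t > 0 then exp (- (1 / t)) / t ^ k else 0)"

text \<open>Quadratic vanishing is what the difference quotient at 0 needs;
  \<open>power_le_exp\<close> with exponent \<open>k + 2\<close> at \<open>1/t\<close> leaves
  exactly two powers of \<open>t\<close>.\<close>

lemma flat_exp_bound: "\<bar>flat_exp k t\<bar> \<le> real (k + 2) ^ (k + 2) * t\<^sup>2"
proof (cases "t > 0")
  case True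
  have "(1 / t) ^ (k + 2) \<le> real (k + 2) ^ (k + 2) * exp (1 / t)"
    using True by (intro power_le_exp) auto
  then have "(1 / t) ^ (k + 2) * exp (- (1 / t)) \<le> real (k + 2) ^ (k + 2) * exp (1 / t) * exp (- (1 / t))"
    by (intro mult_right_mono) auto
  also have "\<dots> = real (k + 2) ^ (k + 2)" by (simp add: mult.assoc exp_add[symmetric])
  finally have "(1 / t) ^ (k + 2) * exp (- (1 / t)) * t\<^sup>2 \<le> real (k + 2) ^ (k + 2) * t\<^sup>2"
    by (intro mult_right_mono) auto
  moreover have "(1 / t) ^ (k + 2) * exp (- (1 / t)) * t\<^sup>2 = flat_exp k t"
    using True by (simp add: flat_exp_def power_add power_divide power2_eq_square)
  moreover have "flat_exp k t \<ge> 0" using True by (simp add: flat_exp_def)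
  ultimately show ?thesis by simp
qed (simp add: flat_exp_def)

lemma flat_exp_deriv:
  "(flat_exp k has_real_derivative (flat_exp (k + 2) t - real k * flat_exp (k + 1) t)) (at t)"
proof -
  consider "t > 0" | "t < 0" | "t = 0" by linarith
  then show ?thesis
  proof cases
    case 1
    have "((\<lambda>t. exp (- (1 / t)) / t ^ k) has_real_derivative (flat_exp (k + 2) t - real k * flat_exp (k + 1) t)) (at t)"
    proof -
      have e: "((\<lambda>t. exp (- (1 / t))) has_real_derivative exp (- (1 / t)) * (1 / t\<^sup>2)) (at t)"
        using 1 by (auto intro!: derivative_eq_intros simp: power2_eq_square)
      have p: "((\<lambda>t. t ^ k) has_real_derivative real k * t ^ (k - 1)) (at t)"
        by (rule DERIV_pow[THEN DERIV_cong]) simp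
      from DERIV_divide[OF e p] 1
      have "((\<lambda>t. exp (- (1 / t)) / t ^ k) has_real_derivative
        (exp (- (1 / t)) * (1 / t\<^sup>2) * t ^ k - exp (- (1 / t)) * (real k * t ^ (k - 1))) / (t ^ k * t ^ k)) (at t)" by simp
      moreover have "(exp (- (1 / t)) * (1 / t\<^sup>2) * t ^ k - exp (- (1 / t)) * (real k * t ^ (k - 1))) / (t ^ k * t ^ k)
        = flat_exp (k + 2) t - real k * flat_exp (k + 1) t"
      proof (cases k)
        case 0
        then show ?thesis using 1 by (simp add: flat_exp_def power2_eq_square)
      next
        case (Suc j)
        then show ?thesis using 1 by (simp add: flat_exp_def power2_eq_square field_simps)
      qed
      ultimately show ?thesis by simp
    qed
    then show ?thesis
      by (rule DERIV_cong_ev[THEN iffD2, OF refl _ refl, rotated])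
        (use 1 in \<open>auto simp: flat_exp_def intro!: eventually_mono[OF eventually_nhds_in_open[of "{0<..}"]]\<close>)
  next
    case 2
    have "((\<lambda>t::real. 0::real) has_real_derivative 0) (at t)" by simp
    then have "(flat_exp k has_real_derivative 0) (at t)"
      by (rule DERIV_cong_ev[THEN iffD2, OF refl _ refl, rotated])
        (use 2 in \<open>auto simp: flat_exp_def intro!: eventually_mono[OF eventually_nhds_in_open[of "{..<0}"]]\<close>)
    then show ?thesis using 2 by (simp add: flat_exp_def)
  next
    case 3
    define C where "C = real (k + 2) ^ (k + 2)"
    have "((\<lambda>h. (flat_exp k (0 + h) - flat_exp k 0) / h) \<longlongrightarrow> 0) (at 0)"
    proof (rule Lim_null_comparison)
      show "\<forall>\<^sub>F h in at 0. norm ((flat_exp k (0 + h) - flat_exp k 0) / h) \<le> C * \<bar>h\<bar>"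
      proof (rule eventually_at_filter[THEN iffD2], rule always_eventually, intro allI impI)
        fix h :: real assume "h \<noteq> 0"
        have "\<bar>flat_exp k h\<bar> \<le> C * \<bar>h\<bar> * \<bar>h\<bar>" using flat_exp_bound[of k h] by (simp add: C_def power2_eq_square mult.assoc)
        then show "norm ((flat_exp k (0 + h) - flat_exp k 0) / h) \<le> C * \<bar>h\<bar>"
          using \<open>h \<noteq> 0\<close> by (simp add: flat_exp_def[of k 0] pos_divide_le_eq)
      qed
      show "((\<lambda>h. C * \<bar>h\<bar>) \<longlongrightarrow> 0) (at 0)"
        by (rule tendsto_eq_intros refl | simp)+
    qed
    then have "(flat_exp k has_real_derivative 0) (at 0)" by (simp add: DERIV_def)
    then show ?thesis using 3 by (simp add: flat_exp_def)
  qed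
qed

text \<open>A linear class that contains a bump on [1, 2] and is closed under differentiation. It
  yields all derivatives of the bump, their continuity and their supports without explicit
  formulas.\<close>

inductive_set bump_span :: "(real \<Rightarrow> real) set" where
  base: "(\<lambda>t. flat_exp a (t - 1) * flat_exp b (2 - t)) \<in> bump_span"
| add: "f \<in> bump_span \<Longrightarrow> g \<in> bump_span \<Longrightarrow> (\<lambda>t. f t + g t) \<in> bump_span"
| scale: "f \<in> bump_span \<Longrightarrow> (\<lambda>t. c * f t) \<in> bump_span"

lemma bump_span_deriv:
  assumes "f \<in> bump_span"
  shows "\<exists>g\<in>bump_span. \<forall>t. (f has_real_derivative g t) (at t)"
  using assms
proof induction
  case (base a b)
  let ?B = "\<lambda>a b t. flat_exp a (t - 1) * flat_exp b (2 - t)"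
  have 1: "((\<lambda>t. flat_exp a (t - 1)) has_real_derivative (flat_exp (a + 2) (t - 1) - real a * flat_exp (a + 1) (t - 1)) * 1) (at t)" for a t
    by (rule DERIV_chain2[OF flat_exp_deriv]) (auto intro!: derivative_eq_intros)
  have 2: "((\<lambda>t. flat_exp b (2 - t)) has_real_derivative (flat_exp (b + 2) (2 - t) - real b * flat_exp (b + 1) (2 - t)) * - 1) (at t)" for b t
    by (rule DERIV_chain2[OF flat_exp_deriv]) (auto intro!: derivative_eq_intros)
  let ?g = "\<lambda>t. ?B (a + 2) b t + ((- real a) * ?B (a + 1) b t + (-1 * ?B a (b + 2) t + real b * ?B a (b + 1) t))"
  have "?g \<in> bump_span" by (intro bump_span.intros)
  moreover have "((\<lambda>t. flat_exp a (t - 1) * flat_exp b (2 - t)) has_real_derivative ?g t) (at t)" for t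
    by (rule DERIV_cong[OF DERIV_mult[OF 1 2]]) (simp add: algebra_simps)
  ultimately show ?case by (intro bexI[of _ ?g] allI)
next
  case (add f g)
  then obtain f' g' where "f' \<in> bump_span" "g' \<in> bump_span"
    "\<forall>t. (f has_real_derivative f' t) (at t)" "\<forall>t. (g has_real_derivative g' t) (at t)" by blast
  then show ?case by (intro bexI[of _ "\<lambda>t. f' t + g' t"] allI DERIV_add bump_span.add) auto
next
  case (scale f c)
  then obtain f' where "f' \<in> bump_span" "\<forall>t. (f has_real_derivative f' t) (at t)" by blast
  then show ?case by (intro bexI[of _ "\<lambda>t. c * f' t"] allI DERIV_cmult bump_span.scale) auto
qed

lemma bump_span_outside: "f \<in> bump_span \<Longrightarrow> t \<le> 1 \<or> 2 \<le> t \<Longrightarrow> f t = 0"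
  by (induction rule: bump_span.induct) (auto simp: flat_exp_def)

lemma bump_span_continuous:
  assumes "f \<in> bump_span"
  shows "continuous_on S f"
proof -
  obtain g where "\<And>t. (f has_real_derivative g t) (at t)"
    using bump_span_deriv[OF assms] by blast
  then show ?thesis by (intro continuous_at_imp_continuous_on ballI DERIV_isCont)
qed

lemma bump_span_bounded:
  assumes f: "f \<in> bump_span"
  shows "\<exists>M. \<forall>t. \<bar>f t\<bar> \<le> M"
proof -
  have "compact (f ` {1..2})" by (intro compact_continuous_image bump_span_continuous f) auto
  from compact_imp_bounded[OF this] have "\<exists>M. \<forall>y\<in>f ` {1..2}. norm y \<le> M"
    unfolding bounded_iff .
  then obtain M where M: "\<And>t. t \<in> {1..2} \<Longrightarrow> \<bar>f t\<bar> \<le> M"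
    by (metis imageI real_norm_def)
  have "\<bar>f t\<bar> \<le> M" for t
  proof (cases "t \<in> {1..2}")
    case False
    then have "f t = 0" using bump_span_outside[OF f, of t] by auto
    moreover have "0 \<le> M" using M[of 1] abs_ge_zero[of "f 1"] order_trans by fastforce
    ultimately show ?thesis by simp
  qed (use M in auto)
  then show ?thesis by blast
qed

text \<open>One minus the normalized primitive of the bump. The whole sequence of derivatives is
  provided, because the radial functions below are differentiated by advancing in it.\<close>

lemma smooth_step_exists:
  "\<exists>h :: nat \<Rightarrow> real \<Rightarrow> real. (\<forall>k t. (h k has_real_derivative h (Suc k) t) (at t)) \<and>
     (\<forall>k. \<exists>M. \<forall>t. \<bar>h k t\<bar> \<le> M) \<and> (\<forall>t\<le>1. h 0 t = 1) \<and> (\<forall>t\<ge>2. h 0 t = 0)"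
proof -
  define g where "g t = flat_exp 0 (t - 1) * flat_exp 0 (2 - t)" for t
  have gs: "g \<in> bump_span" unfolding g_def[abs_def] by (rule bump_span.base)
  obtain D where D: "\<And>f. f \<in> bump_span \<Longrightarrow> D f \<in> bump_span"
    "\<And>f t. f \<in> bump_span \<Longrightarrow> (f has_real_derivative D f t) (at t)"
    using bump_span_deriv by metis
  define G where "G k = (D ^^ k) g" for k
  have G: "G k \<in> bump_span" for k by (induction k) (auto simp: G_def gs D)
  have G': "(G k has_real_derivative G (Suc k) t) (at t)" for k t
    using D(2)[OF G[of k]] by (simp add: G_def)
  have cont: "continuous_on S g" for S by (rule bump_span_continuous[OF gs])
  have g0: "g t \<ge> 0" for t by (simp add: g_def flat_exp_def)
  \<comment> \<open>The lower limit 0 lies to the left of the support of \<open>g\<close>; for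
    negative \<open>t\<close> the interval is empty and the integral is 0, which agrees with the
    primitive there.\<close>
  define H where "H t = integral {0..t} g" for t
  have H0: "H t = 0" if "t \<le> 1" for t
  proof -
    have "H t = integral {0..t} (\<lambda>t. 0)" unfolding H_def
      by (rule integral_cong) (use that bump_span_outside[OF gs] in auto)
    then show ?thesis by simp
  qed
  have HD: "(H has_real_derivative g t) (at t)" for t
  proof (cases "t < 1")
    case True
    have "((\<lambda>t::real. 0::real) has_real_derivative 0) (at t)" by simp
    then have "(H has_real_derivative 0) (at t)"
      by (rule DERIV_cong_ev[THEN iffD2, OF refl _ refl, rotated])
        (use True H0 in \<open>auto intro!: eventually_mono[OF eventually_nhds_in_open[of "{..<1}"]]\<close>)
    then show ?thesis using True bump_span_outside[OF gs, of t] by simp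
  next
    case False
    have "(H has_real_derivative g t) (at t within {0..t + 1})"
      unfolding H_def[abs_def] by (rule integral_has_real_derivative[OF cont]) (use False in auto)
    then show ?thesis
      using False by (subst (asm) at_within_interior) auto
  qed
  define c where "c = H 2"
  have Hc: "H t = c" if "t \<ge> 2" for t
  proof (cases "t = 2")
    case False
    then have "2 < t" using that by simp
    moreover have "continuous_on {2..t} H"
      by (intro continuous_at_imp_continuous_on ballI DERIV_isCont[OF HD])
    ultimately have "H t = H 2"
      using DERIV_isconst_end[of 2 t H] HD bump_span_outside[OF gs] by (metis less_imp_le)
    then show ?thesis by (simp add: c_def)
  qed (simp add: c_def)
  have "c > 0"
  proof -
    have "H 1 < H 2"
    proof (rule DERIV_pos_imp_increasing_open[of 1 2 H])
      fix t :: real assume "1 < t" "t < 2"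
      then have "g t > 0" by (simp add: g_def flat_exp_def)
      then show "\<exists>y. (H has_real_derivative y) (at t) \<and> 0 < y" using HD by blast
    next
      show "continuous_on {1..2} H"
        by (intro continuous_at_imp_continuous_on ballI DERIV_isCont[OF HD])
    qed simp
    then show ?thesis using H0[of 1] by (simp add: c_def)
  qed
  define h where "h k = (case k of 0 \<Rightarrow> (\<lambda>t. 1 - H t / c) | Suc j \<Rightarrow> (\<lambda>t. (- (1 / c)) * G j t))" for k
  have "(h k has_real_derivative h (Suc k) t) (at t)" for k t
  proof (cases k)
    case 0
    have "((\<lambda>t. 1 - H t / c) has_real_derivative 0 - g t / c) (at t)"
      by (intro DERIV_diff DERIV_const DERIV_cdivide HD)
    then show ?thesis by (simp add: 0 h_def G_def)
  next
    case (Suc j)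
    have "((\<lambda>t. (- (1 / c)) * G j t) has_real_derivative (- (1 / c)) * G (Suc j) t) (at t)"
      by (intro DERIV_cmult G')
    then show ?thesis by (simp add: Suc h_def)
  qed
  moreover have "\<exists>M. \<forall>t. \<bar>h k t\<bar> \<le> M" for k
  proof (cases k)
    case 0
    have mono: "H s \<le> H t" if "s \<le> t" for s t
      by (rule DERIV_nonneg_imp_nondecreasing[OF that]) (use HD g0 in blast)
    have "0 \<le> H t \<and> H t \<le> c" for t
      using mono[of "min t 1" t] H0[of "min t 1"] mono[of t "max t 2"] Hc[of "max t 2"] by simp
    then have "\<bar>h 0 t\<bar> \<le> 1" for t
      using \<open>c > 0\<close> by (auto simp: h_def field_simps)
    then show ?thesis using 0 by blast
  next
    case (Suc j)
    obtain M where "\<forall>t. \<bar>- (1 / c) * G j t\<bar> \<le> M"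
      using bump_span_bounded[OF bump_span.scale[OF G[of j], of "- (1 / c)"]] by blast
    then show ?thesis by (intro exI[of _ M]) (simp add: Suc h_def)
  qed
  moreover have "\<forall>t\<le>1. h 0 t = 1" using H0 by (simp add: h_def)
  moreover have "\<forall>t\<ge>2. h 0 t = 0" using Hc \<open>c > 0\<close> by (simp add: h_def)
  ultimately show ?thesis by blast
qed

section \<open>Radial cutoff functions\<close>

lemma bdd_smoothI:
  assumes "Q B" "\<And>f x. f \<in> B \<Longrightarrow> f differentiable at x" "\<And>i. bdd_smooth Q (partial i ` B)"
  shows "bdd_smooth Q B"
  unfolding bdd_smooth_def
proof
  fix m show "bdd_upto Q m B"
    using assms by (cases m) (simp_all add: bdd_smooth_def)
qed

lemma radial_has_derivative:
  fixes x :: "real ^ 'n"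
  assumes "(\<phi> has_real_derivative d) (at ((norm x)\<^sup>2))"
  shows "((\<lambda>x. complex_of_real (\<phi> ((norm x)\<^sup>2))) has_derivative (\<lambda>h. of_real (d * (2 * (x \<bullet> h))))) (at x)"
    and "partial i (\<lambda>x. complex_of_real (\<phi> ((norm x)\<^sup>2))) x = of_real (2 * d) * of_real (x $ i)"
proof -
  have "((\<lambda>x::real ^ 'n. (norm x)\<^sup>2) has_derivative (\<lambda>h. 2 * (x \<bullet> h))) (at x)"
    unfolding power2_norm_eq_inner by (auto intro!: derivative_eq_intros simp: inner_commute)
  from has_derivative_compose[OF this assms[unfolded has_field_derivative_def]]
  show d: "((\<lambda>x. complex_of_real (\<phi> ((norm x)\<^sup>2))) has_derivative (\<lambda>h. of_real (d * (2 * (x \<bullet> h))))) (at x)"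
    by (rule has_derivative_of_real)
  show "partial i (\<lambda>x. complex_of_real (\<phi> ((norm x)\<^sup>2))) x = of_real (2 * d) * of_real (x $ i)"
    unfolding partial_eqI[OF d] by (simp add: inner_axis)
qed

lemma even_fun_radial: "even_fun (\<lambda>x :: real ^ 'n. \<phi> (norm x))"
proof -
  have "norm (reflect i x) = norm x" for i and x :: "real ^ 'n"
  proof -
    have "(norm (reflect i x))\<^sup>2 = (norm x)\<^sup>2"
      unfolding norm_square_sum by (intro sum.cong) (auto simp: reflect_def)
    then show ?thesis by simp
  qed
  then show ?thesis by (simp add: even_fun_reflect)
qed

text \<open>The last family quantifies how the cutoff approaches 1: where \<open>1 - cut R x\<close>
  is nonzero one has R < norm x, so the factor \<open>R\<close> costs only one power of growth. For
  a functional that is bounded on bounded sets, its value at \<open>(1 - cut R) * g\<close> is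
  therefore of order \<open>1/R\<close>. The square of the norm is used inside to keep the functions
  smooth at the origin.\<close>

lemma cutoff_exists:
  "\<exists>cut :: real \<Rightarrow> real ^ 'n \<Rightarrow> complex.
     (\<forall>R x. R \<ge> 1 \<longrightarrow> norm x \<le> R \<longrightarrow> cut R x = 1) \<and> (\<forall>R x. R \<ge> 1 \<longrightarrow> 2 * R \<le> norm x \<longrightarrow> cut R x = 0) \<and>
     mult_bdd {cut R | R. R \<ge> 1} \<and> mult_bdd {\<lambda>x. of_real R * (1 - cut R x) | R. R \<ge> 1}"
proof -
  obtain h :: "nat \<Rightarrow> real \<Rightarrow> real" where h: "\<And>k t. (h k has_real_derivative h (Suc k) t) (at t)"
    "\<And>k. \<exists>M. \<forall>t. \<bar>h k t\<bar> \<le> M" "\<And>t. t \<le> 1 \<Longrightarrow> h 0 t = 1" "\<And>t. t \<ge> 2 \<Longrightarrow> h 0 t = 0"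
    using smooth_step_exists by blast
  define \<phi> where "\<phi> k R = (\<lambda>x :: real ^ 'n. complex_of_real (h k ((norm x)\<^sup>2 / R\<^sup>2)))" for k R
  have hR: "((\<lambda>r. h k (r / R\<^sup>2)) has_real_derivative h (Suc k) (r / R\<^sup>2) / R\<^sup>2) (at r)" for k r and R :: real
    by (rule DERIV_cong[OF DERIV_chain2[OF h(1) DERIV_cdivide[OF DERIV_ident]]]) simp
  have diff: "\<phi> k R differentiable at x" for k R x
    unfolding \<phi>_def differentiable_def using radial_has_derivative(1)[OF hR] by blast
  have part: "partial i (\<phi> k R) = (\<lambda>x. (of_real (2 / R\<^sup>2) * of_real (x $ i)) * \<phi> (Suc k) R x)" for i k R
    unfolding \<phi>_def fun_eq_iff radial_has_derivative(2)[OF hR] by simp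
  define B where "B k = {\<phi> k R | R. R \<ge> 1}" for k
  have even: "even_fun (\<phi> k R)" for k R
    unfolding \<phi>_def by (rule even_fun_radial)
  have sm: "bdd_smooth slow (B k)" for k
  proof (rule growth.bdd_smooth_family[OF growth_slow, where I = UNIV and B = B])
    show "slow (B k)" for k
    proof -
      obtain M where "\<And>t. \<bar>h k t\<bar> \<le> M" using h(2) by blast
      then show ?thesis unfolding slow_def B_def \<phi>_def
        by (intro exI[of _ "0::nat"] exI[of _ M]) auto
    qed
    show "f differentiable at x" if "f \<in> B k" for k f x
      using that diff by (auto simp: B_def)
    fix k i
    have "partial i ` B k \<subseteq> pointwise_mult (linear_coords 2 i) (B (Suc k))"
    proof
      fix f assume "f \<in> partial i ` B k"
      then obtain R where R: "R \<ge> 1" and f: "f = partial i (\<phi> k R)" by (auto simp: B_def)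
      have "1 \<le> R\<^sup>2" using R by (simp add: one_le_power)
      then have "2 / R\<^sup>2 \<le> 2 / 1" by (intro divide_left_mono) auto
      then have "norm (complex_of_real (2 / R\<^sup>2)) \<le> 2"
        unfolding norm_of_real by simp
      then have "(\<lambda>x. of_real (2 / R\<^sup>2) * of_real (x $ i)) \<in> linear_coords 2 i"
        unfolding linear_coords_def by blast
      moreover have "\<phi> (Suc k) R \<in> B (Suc k)" using R by (auto simp: B_def)
      ultimately show "f \<in> pointwise_mult (linear_coords 2 i) (B (Suc k))"
        unfolding f part by (rule pointwise_multI)
    qed
    then show "\<exists>b\<in>UNIV. \<exists>C. partial i ` B k \<subseteq> pointwise_mult (linear_coords C i) (B b)" by blast
  qed simp
  define B' where "B' = {\<lambda>x. of_real R * (1 - \<phi> 0 R x) | R. R \<ge> 1}"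
  have "bdd_smooth slow B'"
  proof (rule bdd_smoothI)
    obtain M where M: "\<And>t. \<bar>h 0 t\<bar> \<le> M" using h(2) by blast
    have M0: "0 \<le> M" using M[of 0] by simp
    have "norm (of_real R * (1 - \<phi> 0 R x)) \<le> (1 + M) * (1 + norm x) ^ 1" if R: "R \<ge> 1" for R x
    proof (cases "norm x \<le> R")
      case True
      then have "(norm x)\<^sup>2 / R\<^sup>2 \<le> 1" using R by (simp add: pos_divide_le_eq power_mono)
      then have "\<phi> 0 R x = 1" using h(3) by (simp add: \<phi>_def)
      then show ?thesis using M0 by simp
    next
      case False
      have "norm (of_real R * (1 - \<phi> 0 R x)) = R * \<bar>1 - h 0 ((norm x)\<^sup>2 / R\<^sup>2)\<bar>"
      proof -
        have "of_real R * (1 - \<phi> 0 R x) = complex_of_real (R * (1 - h 0 ((norm x)\<^sup>2 / R\<^sup>2)))"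
          by (simp add: \<phi>_def)
        then show ?thesis using R by (simp only: norm_of_real abs_mult)
      qed
      also have "\<dots> \<le> (1 + norm x) * (1 + M)"
        using False R M[of "(norm x)\<^sup>2 / R\<^sup>2"] M0 by (intro mult_mono) (auto intro: add_nonneg_nonneg)
      finally show ?thesis by (simp add: mult.commute)
    qed
    then show "slow B'" unfolding slow_def B'_def by blast
    show "f differentiable at x" if "f \<in> B'" for f x
      using that diff by (auto simp: B'_def intro!: derivative_intros)
    fix i
    have "partial i ` B' \<subseteq> pointwise_mult (linear_coords 2 i) (B 1)"
    proof
      fix f assume "f \<in> partial i ` B'"
      then obtain R where R: "R \<ge> 1" and f: "f = partial i (\<lambda>x. of_real R * (1 - \<phi> 0 R x))" by (auto simp: B'_def)
      have "((\<lambda>x. of_real R * (1 - \<phi> 0 R x)) has_derivative (\<lambda>h. of_real R * (0 - frechet_derivative (\<phi> 0 R) (at x) h))) (at x)" for x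
        by (intro has_derivative_mult_right has_derivative_diff has_derivative_const frechet_derivative_works[THEN iffD1, OF diff])
      from partial_eqI[OF this]
      have "f = (\<lambda>x. of_real R * (- partial i (\<phi> 0 R) x))" unfolding f by (auto simp: fun_eq_iff partial_def)
      also have "\<dots> = (\<lambda>x. (of_real (- (2 / R)) * of_real (x $ i)) * \<phi> 1 R x)"
        unfolding part using R by (auto simp: fun_eq_iff power2_eq_square)
      finally have f': "f = (\<lambda>x. (of_real (- (2 / R)) * of_real (x $ i)) * \<phi> 1 R x)" .
      have "norm (complex_of_real (- (2 / R))) \<le> 2"
        unfolding norm_of_real using R by (simp add: pos_divide_le_eq)
      then have "(\<lambda>x. of_real (- (2 / R)) * of_real (x $ i)) \<in> linear_coords 2 i"
        unfolding linear_coords_def by blast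
      moreover have "\<phi> 1 R \<in> B 1" using R by (auto simp: B_def)
      ultimately show "f \<in> pointwise_mult (linear_coords 2 i) (B 1)"
        unfolding f' by (rule pointwise_multI)
    qed
    then show "bdd_smooth slow (partial i ` B')"
      by (rule growth.bdd_smooth_mono[OF growth_slow growth.bdd_smooth_mult[OF growth_slow bdd_smooth_linear_coords sm]])
  qed
  moreover have "even_fun f" if "f \<in> B'" for f
    using that even[of 0] by (auto simp: B'_def even_fun_def)
  ultimately have "mult_bdd B'" by (simp add: mult_bdd_def)
  moreover have "mult_bdd (B 0)" unfolding mult_bdd_def using sm even by (auto simp: B_def)
  moreover have "\<phi> 0 R x = 1" if "R \<ge> 1" "norm x \<le> R" for R x
  proof -
    have "(norm x)\<^sup>2 / R\<^sup>2 \<le> 1" using that by (simp add: pos_divide_le_eq power_mono)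
    then show ?thesis using h(3) by (simp add: \<phi>_def)
  qed
  moreover have "\<phi> 0 R x = 0" if "R \<ge> 1" "2 * R \<le> norm x" for R x
  proof -
    have "(2 * R)\<^sup>2 \<le> (norm x)\<^sup>2" using that by (intro power_mono) auto
    then have "4 * R\<^sup>2 \<le> (norm x)\<^sup>2" by (simp add: power_mult_distrib)
    moreover have "0 \<le> R\<^sup>2" by simp
    ultimately have "2 * R\<^sup>2 \<le> (norm x)\<^sup>2" by linarith
    then have "2 \<le> (norm x)\<^sup>2 / R\<^sup>2" using that by (subst pos_le_divide_eq) auto
    then show ?thesis using h(4) by (simp add: \<phi>_def)
  qed
  ultimately show ?thesis
    unfolding B'_def B_def by (intro exI[of _ "\<phi> 0"]) blast
qed

section \<open>Sobolev weights\<close>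

definition sob_weight :: "real \<Rightarrow> real ^ 'n \<Rightarrow> complex" where
  "sob_weight r \<xi> = complex_of_real ((1 + (norm \<xi>)\<^sup>2) powr r)"

lemma sob_weight_mult: "sob_weight r \<xi> * sob_weight s \<xi> = sob_weight (r + s) \<xi>"
  unfolding sob_weight_def by (simp only: powr_add of_real_mult)

lemma sob_weight_0 [simp]: "sob_weight 0 \<xi> = 1"
  using add_pos_nonneg[of 1 "(norm \<xi>)\<^sup>2"] by (simp add: sob_weight_def)

lemma norm_sob_weight_le:
  "norm (sob_weight r (\<xi> :: real ^ 'n)) \<le> (1 + norm \<xi>) ^ (2 * nat \<lceil>\<bar>r\<bar>\<rceil>)"
proof -
  have "(1 + (norm \<xi>)\<^sup>2) powr r \<le> (1 + (norm \<xi>)\<^sup>2) powr real (nat \<lceil>\<bar>r\<bar>\<rceil>)"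
    by (intro powr_mono) (auto intro: order_trans[OF abs_ge_self] real_nat_ceiling_ge)
  also have "\<dots> = (1 + (norm \<xi>)\<^sup>2) ^ nat \<lceil>\<bar>r\<bar>\<rceil>"
    by (intro powr_realpow add_pos_nonneg) auto
  also have "\<dots> \<le> ((1 + norm \<xi>)\<^sup>2) ^ nat \<lceil>\<bar>r\<bar>\<rceil>"
    by (intro power_mono) (auto simp: power2_sum)
  finally show ?thesis by (simp add: sob_weight_def power_mult)
qed

text \<open>A derivative lowers the exponent by 1 and brings out a coordinate, so the weights form a
  family indexed by the exponent.\<close>

lemma mult_bdd_sob_weight: "mult_bdd {sob_weight r :: real ^ 'n \<Rightarrow> complex}"
proof -
  have d: "((\<lambda>u. (1 + u) powr r) has_real_derivative r * (1 + u) powr (r - 1)) (at u)" if "u \<ge> 0" for r u :: real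
    using that by (auto intro!: derivative_eq_intros)
  have dd: "((\<lambda>u. (1 + u) powr r) has_real_derivative r * (1 + (norm x)\<^sup>2) powr (r - 1)) (at ((norm x)\<^sup>2))" for r and x :: "real ^ 'n"
    by (rule d) simp
  have "bdd_smooth slow {sob_weight r :: real ^ 'n \<Rightarrow> complex}"
  proof (rule growth.bdd_smooth_family[OF growth_slow, where I = UNIV and B = "\<lambda>r. {sob_weight r}"])
    show "slow {sob_weight r :: real ^ 'n \<Rightarrow> complex}" for r
      unfolding slow_def using norm_sob_weight_le by (intro exI[of _ "2 * nat \<lceil>\<bar>r\<bar>\<rceil>"] exI[of _ 1]) auto
    show "f differentiable at x" if "f \<in> {sob_weight r}" for r f and x :: "real ^ 'n"
      using that radial_has_derivative(1)[OF dd] unfolding sob_weight_def[abs_def] differentiable_def by blast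
    fix r i
    have "partial i (sob_weight r :: real ^ 'n \<Rightarrow> complex) = (\<lambda>x. (of_real (2 * r) * of_real (x $ i)) * sob_weight (r - 1) x)"
      unfolding sob_weight_def[abs_def] using radial_has_derivative(2)[OF dd] by (auto simp: fun_eq_iff)
    moreover have "(\<lambda>x::real ^ 'n. of_real (2 * r) * complex_of_real (x $ i)) \<in> linear_coords \<bar>2 * r\<bar> i"
      unfolding linear_coords_def by (intro CollectI exI conjI, rule refl) (simp only: norm_of_real)
    ultimately have "partial i ` {sob_weight r :: real ^ 'n \<Rightarrow> complex} \<subseteq> pointwise_mult (linear_coords \<bar>2 * r\<bar> i) {sob_weight (r - 1)}"
      using pointwise_multI[of _ "linear_coords \<bar>2 * r\<bar> i" "sob_weight (r - 1)" "{sob_weight (r - 1)}"] by auto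
    then show "\<exists>b\<in>UNIV. \<exists>C. partial i ` {sob_weight r :: real ^ 'n \<Rightarrow> complex} \<subseteq> pointwise_mult (linear_coords C i) {sob_weight b}"
      by blast
  qed simp
  moreover have "even_fun (sob_weight r :: real ^ 'n \<Rightarrow> complex)"
    unfolding sob_weight_def[abs_def] by (rule even_fun_radial)
  ultimately show ?thesis by (simp add: mult_bdd_def)
qed

lemma continuous_sob_weight: "continuous_on UNIV (sob_weight r)"
  unfolding sob_weight_def[abs_def]
  by (intro continuous_intros) (auto simp: add_nonneg_eq_0_iff)

lemma sob_weight_schwartz: "f \<in> schwartz_e \<Longrightarrow> (\<lambda>x. sob_weight r x * f x) \<in> schwartz_e"
  by (rule schwartz_e_mult[OF mult_bdd_sob_weight])

section \<open>Continuity of functionals that are bounded on bounded sets\<close>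

lemma schwartz_bddI:
  assumes "B \<subseteq> schwartz_e"
    and "\<And>k is. \<exists>C. \<forall>f\<in>B. \<forall>x. (1 + norm x) ^ k * norm (partials is f x) \<le> C"
  shows "schwartz_bdd B"
  unfolding schwartz_bdd_def bdd_smooth_iff rapid_def
proof (intro conjI allI ballI)
  show "\<exists>C. \<forall>f\<in>partials is ` B. \<forall>x. (1 + norm x) ^ k * norm (f x) \<le> C" for "is" k
    using assms(2)[of k "is"] by simp
  show "partials is f differentiable at x" if "f \<in> B" for "is" f x
    using schwartz_e_smooth that assms(1) by blast
  show "even_fun f" if "f \<in> B" for f
    using that assms(1) by (auto simp: schwartz_e_def)
qed

lemma partials_cmult:
  assumes "f \<in> schwartz_e"
  shows "partials is (\<lambda>x. c * f x) = (\<lambda>x. c * partials is f x)"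
proof (induction "is")
  case (Cons i js)
  have "partial i (\<lambda>x. c * partials js f x) x = c * partial i (partials js f) x" for x
    using partial_eqI[OF has_derivative_mult_right[OF frechet_derivative_works[THEN iffD1, OF schwartz_e_smooth[OF assms, of js x]]]]
    by (simp add: partial_def)
  then show ?case unfolding partials.simps Cons by (rule ext)
qed simp

lemma schwartz_seminorm_upper:
  assumes "f \<in> schwartz_e"
  shows "(1 + norm x) ^ k * norm (partials is f x) \<le> schwartz_seminorm k is f"
  unfolding schwartz_seminorm_def using assms by (intro cSUP_upper) (auto simp: schwartz_e_def)

lemma schwartz_seminorm_cmult_less:
  assumes f: "f \<in> schwartz_e" and c: "schwartz_seminorm k is f < e" "c > 0"
  shows "schwartz_seminorm k is (\<lambda>x. of_real c * f x) < c * e"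
proof -
  have "schwartz_seminorm k is (\<lambda>x. of_real c * f x) \<le> c * schwartz_seminorm k is f"
    unfolding schwartz_seminorm_def[of k "is" "\<lambda>x. of_real c * f x"] partials_cmult[OF f]
  proof (rule cSUP_least)
    fix x
    have "(1 + norm x) ^ k * norm (of_real c * partials is f x) = c * ((1 + norm x) ^ k * norm (partials is f x))"
      using c(2) by (simp add: norm_mult)
    also have "\<dots> \<le> c * schwartz_seminorm k is f"
      using c(2) by (intro mult_left_mono schwartz_seminorm_upper f) auto
    finally show "(1 + norm x) ^ k * norm (of_real c * partials is f x) \<le> c * schwartz_seminorm k is f" .
  qed simp
  also have "\<dots> < c * e" using c by simp
  finally show ?thesis .
qed

lemma schwartz_seminorm_zero: "schwartz_seminorm k is (\<lambda>x. 0 :: complex) = 0"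
proof -
  have "partials is (\<lambda>x. 0 :: complex) = (\<lambda>x. 0)"
    by (induction "is") (simp_all add: partial_def)
  then show ?thesis by (simp add: schwartz_seminorm_def)
qed

lemma topspace_schwartz_e: "topspace schwartz_e_topology = schwartz_e"
  unfolding schwartz_e_topology_def topology_generated_by_topspace
proof (rule antisym; rule subsetI)
  fix g :: "real ^ 'n \<Rightarrow> complex" assume g: "g \<in> schwartz_e"
  let ?V = "{h \<in> schwartz_e. schwartz_seminorm 0 [] (\<lambda>x. h x - g x) < 1}"
  show "g \<in> \<Union> {{g \<in> schwartz_e. schwartz_seminorm k is (\<lambda>x. g x - f x) < e} |f k is e. f \<in> schwartz_e \<and> 0 < e}"
  proof (rule UnionI[of ?V])
    show "?V \<in> {{g \<in> schwartz_e. schwartz_seminorm k is (\<lambda>x. g x - f x) < e} |f k is e. f \<in> schwartz_e \<and> 0 < e}"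
      by (intro CollectI exI[of _ g] exI[of _ 0] exI[of _ "[]"] exI[of _ 1] conjI refl g) simp
    show "g \<in> ?V" using g by (simp add: schwartz_seminorm_zero)
  qed
next
  fix g :: "real ^ 'n \<Rightarrow> complex"
  assume "g \<in> \<Union> {{g \<in> schwartz_e. schwartz_seminorm k is (\<lambda>x. g x - f x) < e} |f k is e. f \<in> schwartz_e \<and> 0 < e}"
  then show "g \<in> schwartz_e" by (elim UnionE CollectE exE conjE) simp
qed

text \<open>By contradiction: the m-th neighbourhood controls derivatives up to order m with weight
  m and size 1/(m + 1). If no such neighbourhood bounds \<open>T\<close>, violators from each of
  them, suitably enlarged, form a bounded set on which \<open>T\<close> is unbounded.\<close>

lemma functional_continuous:
  fixes T :: "'n::finite dist"
  assumes add: "\<And>f g. f \<in> schwartz_e \<Longrightarrow> g \<in> schwartz_e \<Longrightarrow> T (\<lambda>x. f x + g x) = T f + T g"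
    and scale: "\<And>c f. f \<in> schwartz_e \<Longrightarrow> T (\<lambda>x. c * f x) = c * T f"
    and bdd: "\<And>B. schwartz_bdd B \<Longrightarrow> \<exists>C. \<forall>f\<in>B. norm (T f) \<le> C"
  shows "continuous_map schwartz_e_topology euclidean T"
proof -
  have "\<exists>m. \<forall>f\<in>schwartz_e. (\<forall>is. length is \<le> m \<longrightarrow> schwartz_seminorm m is f < 1 / real (Suc m)) \<longrightarrow> norm (T f) \<le> 1"
  proof (rule ccontr)
    assume "\<not> ?thesis"
    then have "\<forall>m. \<exists>f. f \<in> schwartz_e \<and> (\<forall>is. length is \<le> m \<longrightarrow> schwartz_seminorm m is f < 1 / real (Suc m)) \<and> 1 < norm (T f)"
      by (meson not_le)
    then obtain f where f: "\<And>m. f m \<in> schwartz_e"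
      "\<And>m is. length is \<le> m \<Longrightarrow> schwartz_seminorm m is (f m) < 1 / real (Suc m)" "\<And>m. 1 < norm (T (f m))"
      by metis
    \<comment> \<open>The factor m + 1 cancels the size of the m-th neighbourhood, whereas the
      modulus of \<open>T (g m)\<close> exceeds m + 1.\<close>
    define g where "g m = (\<lambda>x. complex_of_real (real (Suc m)) * f m x)" for m
    have g: "g m \<in> schwartz_e" for m unfolding g_def by (rule schwartz_e_cmult[OF f(1)])
    have "schwartz_bdd (range g)"
    proof (rule schwartz_bddI)
      fix k and "is" :: "'n list"
      \<comment> \<open>For m \<ge> N the seminorm given by \<open>k\<close> and \<open>is\<close>
        is among those controlled by the choice of \<open>f m\<close>, and for \<open>g m\<close> it
        stays below 1; the finitely many smaller m are added to the constant.\<close>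
      define N where "N = max k (length is)"
      define C where "C = 1 + (\<Sum>m<N. \<bar>schwartz_seminorm k is (g m)\<bar>)"
      have "(1 + norm x) ^ k * norm (partials is (g m) x) \<le> C" for m x
      proof (cases "m < N")
        case True
        have "(1 + norm x) ^ k * norm (partials is (g m) x) \<le> schwartz_seminorm k is (g m)"
          by (rule schwartz_seminorm_upper[OF g])
        also have "\<dots> \<le> \<bar>schwartz_seminorm k is (g m)\<bar>" by simp
        also have "\<dots> \<le> (\<Sum>m<N. \<bar>schwartz_seminorm k is (g m)\<bar>)"
          using True by (intro member_le_sum) auto
        finally show ?thesis by (simp add: C_def)
      next
        case False
        then have m: "k \<le> m" "length is \<le> m" by (auto simp: N_def)
        have "(1 + norm x) ^ k * norm (partials is (g m) x) \<le> (1 + norm x) ^ m * norm (partials is (g m) x)"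
          using m by (intro mult_right_mono power_increasing) auto
        also have "\<dots> \<le> schwartz_seminorm m is (g m)"
          by (rule schwartz_seminorm_upper[OF g])
        also have "\<dots> < real (Suc m) * (1 / real (Suc m))"
          unfolding g_def by (rule schwartz_seminorm_cmult_less[OF f(1) f(2)[OF m(2)]]) simp
        also have "\<dots> = 1" by simp
        also have "\<dots> \<le> C" by (simp add: C_def sum_nonneg)
        finally show ?thesis by simp
      qed
      then show "\<exists>C. \<forall>f\<in>range g. \<forall>x. (1 + norm x) ^ k * norm (partials is f x) \<le> C" by blast
    qed (use g in auto)
    then obtain C where C: "\<And>m. norm (T (g m)) \<le> C" using bdd by blast
    obtain m where m: "C < real m" using reals_Archimedean2 by blast
    have "real (Suc m) * 1 \<le> real (Suc m) * norm (T (f m))"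
      using f(3)[of m] by (intro mult_left_mono) auto
    also have "\<dots> = norm (T (g m))"
      unfolding g_def scale[OF f(1)] norm_mult norm_of_real by simp
    also have "\<dots> \<le> C" by (rule C)
    finally show False using m by simp
  qed
  then obtain m where m: "\<And>f. f \<in> schwartz_e \<Longrightarrow> (\<And>is. length is \<le> m \<Longrightarrow> schwartz_seminorm m is f < 1 / real (Suc m)) \<Longrightarrow> norm (T f) \<le> 1"
    by blast
  define L where "L = {is :: 'n list. length is \<le> m}"
  have L: "finite L" "[] \<in> L"
    using finite_lists_length_le[of "UNIV :: 'n set" m] by (auto simp: L_def)
  have diff: "T (\<lambda>x. g x - f x) = T g - T f" if "f \<in> schwartz_e" "g \<in> schwartz_e" for f g
    using add[OF that(2) schwartz_e_cmult[OF that(1), of "-1"]] scale[OF that(1), of "-1"] by simp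
  show ?thesis
    unfolding continuous_map
  proof (intro conjI allI impI)
    show "T ` topspace schwartz_e_topology \<subseteq> topspace euclidean" by simp
    fix U :: "complex set" assume "openin euclidean U"
    then have U: "open U" by simp
    show "openin schwartz_e_topology {f \<in> topspace schwartz_e_topology. T f \<in> U}"
    proof (subst openin_subopen, intro ballI)
      fix f assume "f \<in> {f \<in> topspace schwartz_e_topology. T f \<in> U}"
      then have f: "f \<in> schwartz_e" and Tf: "T f \<in> U" by (auto simp: topspace_schwartz_e)
      obtain e where e: "e > 0" "ball (T f) e \<subseteq> U" using U Tf open_contains_ball by blast
      \<comment> \<open>Multiplication by \<open>2 / e\<close> maps this size to that of the m-th
        neighbourhood; the 2 turns the bound \<le> 1 into a distance at most \<open>e / 2\<close>,
        strictly below \<open>e\<close>.\<close>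
      define \<delta> where "\<delta> = (e / 2) * (1 / real (Suc m))"
      have \<delta>: "\<delta> > 0" using e by (simp add: \<delta>_def)
      define V where "V is = {g \<in> schwartz_e. schwartz_seminorm m is (\<lambda>x. g x - f x) < \<delta>}" for "is"
      have V: "openin schwartz_e_topology (V is)" for "is"
        unfolding V_def schwartz_e_topology_def
        by (rule topology_generated_by_Basis) (use f \<delta> in blast)
      have "openin schwartz_e_topology (\<Inter>is\<in>L. V is)"
        using L V by (intro openin_INT2) auto
      moreover have "f \<in> (\<Inter>is\<in>L. V is)"
        using f \<delta> by (simp add: V_def schwartz_seminorm_zero)
      moreover have "(\<Inter>is\<in>L. V is) \<subseteq> {f \<in> topspace schwartz_e_topology. T f \<in> U}"
      proof
        fix g assume g: "g \<in> (\<Inter>is\<in>L. V is)"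
        then have gs: "g \<in> schwartz_e" using L by (auto simp: V_def)
        have d: "(\<lambda>x. g x - f x) \<in> schwartz_e" by (rule schwartz_e_diff[OF gs f])
        have sc: "(\<lambda>x. of_real (2 / e) * (g x - f x)) \<in> schwartz_e" by (rule schwartz_e_cmult[OF d])
        have "norm (T (\<lambda>x. of_real (2 / e) * (g x - f x))) \<le> 1"
        proof (rule m[OF sc])
          fix "is" :: "'n list" assume "length is \<le> m"
          then have "schwartz_seminorm m is (\<lambda>x. g x - f x) < \<delta>" using g by (auto simp: L_def V_def)
          then have "schwartz_seminorm m is (\<lambda>x. of_real (2 / e) * (g x - f x)) < (2 / e) * \<delta>"
            using e by (intro schwartz_seminorm_cmult_less d) auto
          also have "(2 / e) * \<delta> = 1 / real (Suc m)" using e by (simp add: \<delta>_def del: of_nat_Suc)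
          finally show "schwartz_seminorm m is (\<lambda>x. of_real (2 / e) * (g x - f x)) < 1 / real (Suc m)" .
        qed
        then have "norm (of_real (2 / e) * (T g - T f)) \<le> 1"
          unfolding scale[OF d] diff[OF f gs] .
        then have "2 / e * norm (T g - T f) \<le> 1"
          unfolding norm_mult norm_of_real using e by simp
        then have "norm (T g - T f) < e" using e by (simp add: field_simps)
        then have "T g \<in> ball (T f) e" by (simp add: dist_norm norm_minus_commute)
        then show "g \<in> {f \<in> topspace schwartz_e_topology. T f \<in> U}"
          using e gs by (auto simp: topspace_schwartz_e)
      qed
      ultimately show "\<exists>S. openin schwartz_e_topology S \<and> f \<in> S \<and> S \<subseteq> {f \<in> topspace schwartz_e_topology. T f \<in> U}"
        by blast
    qed
  qed
qed

section \<open>The weighted space of square-integrable functions\<close>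

lemma L2D:
  assumes "\<psi> \<in> L2 \<alpha>"
  shows "\<psi> \<in> borel_measurable (bessel_measure \<alpha>)" "integrable (bessel_measure \<alpha>) (\<lambda>x. (norm (\<psi> x))\<^sup>2)"
  using assms by (auto simp: L2_def)

lemma L2_norm_nonneg: "0 \<le> L2_norm \<alpha> \<psi>"
  by (simp add: L2_norm_def)

lemma L2_norm_sq: "(L2_norm \<alpha> \<psi>)\<^sup>2 = (LINT x|bessel_measure \<alpha>. (norm (\<psi> x))\<^sup>2)"
  by (simp add: L2_norm_def)

lemma two_mult_le_squares: "2 * (a * b) \<le> a\<^sup>2 + (b :: real)\<^sup>2"
  using zero_le_power2[of "a - b"] by (simp add: power2_diff)

lemma L2_mult_integrable:
  assumes "\<psi> \<in> L2 \<alpha>" "\<phi> \<in> L2 \<alpha>"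
  shows "integrable (bessel_measure \<alpha>) (\<lambda>x. \<psi> x * \<phi> x)"
proof (rule Bochner_Integration.integrable_bound[OF Bochner_Integration.integrable_add[OF L2D(2)[OF assms(1)] L2D(2)[OF assms(2)]]])
  show "(\<lambda>x. \<psi> x * \<phi> x) \<in> borel_measurable (bessel_measure \<alpha>)"
    using L2D(1)[OF assms(1)] L2D(1)[OF assms(2)] by (rule borel_measurable_times)
  have "norm (\<psi> x * \<phi> x) \<le> norm ((norm (\<psi> x))\<^sup>2 + (norm (\<phi> x))\<^sup>2)" for x
  proof -
    have "norm (\<psi> x) * norm (\<phi> x) \<le> 2 * (norm (\<psi> x) * norm (\<phi> x))" by simp
    also have "\<dots> \<le> (norm (\<psi> x))\<^sup>2 + (norm (\<phi> x))\<^sup>2" by (rule two_mult_le_squares)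
    finally show ?thesis by (simp add: norm_mult)
  qed
  then show "AE x in bessel_measure \<alpha>. norm (\<psi> x * \<phi> x) \<le> norm ((norm (\<psi> x))\<^sup>2 + (norm (\<phi> x))\<^sup>2)" by simp
qed

text \<open>The discriminant argument: integrate \<open>2 * t * |\<psi> * \<phi>| \<le> t^2 *
  |\<psi>|^2 + |\<phi>|^2\<close> and choose \<open>t\<close>. The bound for the integral of the
  modulus is kept because the triangle inequality uses it.\<close>

lemma L2_Cauchy_Schwarz:
  assumes "\<psi> \<in> L2 \<alpha>" "\<phi> \<in> L2 \<alpha>"
  shows "(LINT x|bessel_measure \<alpha>. norm (\<psi> x * \<phi> x)) \<le> L2_norm \<alpha> \<psi> * L2_norm \<alpha> \<phi>"
    and "norm (LINT x|bessel_measure \<alpha>. \<psi> x * \<phi> x) \<le> L2_norm \<alpha> \<psi> * L2_norm \<alpha> \<phi>"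
proof -
  define A B P where "A = (L2_norm \<alpha> \<psi>)\<^sup>2" and "B = (L2_norm \<alpha> \<phi>)\<^sup>2" and "P = (LINT x|bessel_measure \<alpha>. norm (\<psi> x * \<phi> x))"
  have i: "integrable (bessel_measure \<alpha>) (\<lambda>x. (norm (\<psi> x))\<^sup>2)" "integrable (bessel_measure \<alpha>) (\<lambda>x. (norm (\<phi> x))\<^sup>2)"
    "integrable (bessel_measure \<alpha>) (\<lambda>x. norm (\<psi> x * \<phi> x))"
    using L2D(2)[OF assms(1)] L2D(2)[OF assms(2)] integrable_norm[OF L2_mult_integrable[OF assms]] .
  have AB: "A \<ge> 0" "B \<ge> 0" and P0: "P \<ge> 0" by (simp_all add: A_def B_def P_def)
  have quad: "2 * t * P \<le> t\<^sup>2 * A + B" for t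
  proof -
    have "(LINT x|bessel_measure \<alpha>. 2 * t * norm (\<psi> x * \<phi> x)) \<le> (LINT x|bessel_measure \<alpha>. t\<^sup>2 * (norm (\<psi> x))\<^sup>2 + (norm (\<phi> x))\<^sup>2)"
    proof (rule integral_mono)
      show "2 * t * norm (\<psi> x * \<phi> x) \<le> t\<^sup>2 * (norm (\<psi> x))\<^sup>2 + (norm (\<phi> x))\<^sup>2" for x
        using two_mult_le_squares[of "t * norm (\<psi> x)" "norm (\<phi> x)"] by (simp add: norm_mult power_mult_distrib mult_ac)
    qed (intro integrable_mult_right Bochner_Integration.integrable_add i)+
    then show ?thesis
      unfolding A_def B_def P_def L2_norm_sq
      by (simp add: Bochner_Integration.integral_add i integrable_mult_right)
  qed
  have "P\<^sup>2 \<le> A * B"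
  proof (cases "A = 0")
    case True
    \<comment> \<open>With \<open>A = 0\<close> the quadratic estimate bounds
      \<open>2 * t * P\<close> by \<open>B\<close> for every \<open>t\<close>, which a large
      \<open>t\<close> refutes.\<close>
    have "P = 0"
    proof (rule ccontr)
      assume "P \<noteq> 0"
      then have "P > 0" using P0 by simp
      then have "2 * ((B + 1) / P) * P = 2 * (B + 1)" by simp
      then have "2 * (B + 1) \<le> B" using quad[of "(B + 1) / P"] True by simp
      then show False using AB by simp
    qed
    then show ?thesis using AB by simp
  next
    case False
    then have "A > 0" using AB by simp
    then have "2 * (P / A) * P \<le> (P / A)\<^sup>2 * A + B" using quad by blast
    then have "P\<^sup>2 / A \<le> B" using \<open>A > 0\<close> by (simp add: power2_eq_square)
    then show ?thesis using \<open>A > 0\<close> by (simp add: pos_divide_le_eq mult.commute)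
  qed
  also have "A * B = (L2_norm \<alpha> \<psi> * L2_norm \<alpha> \<phi>)\<^sup>2" by (simp add: A_def B_def power_mult_distrib)
  finally show 1: "P \<le> L2_norm \<alpha> \<psi> * L2_norm \<alpha> \<phi>"
    by (rule power2_le_imp_le) (intro mult_nonneg_nonneg L2_norm_nonneg)
  show "norm (LINT x|bessel_measure \<alpha>. \<psi> x * \<phi> x) \<le> L2_norm \<alpha> \<psi> * L2_norm \<alpha> \<phi>"
    using integral_norm_bound[of "bessel_measure \<alpha>" "\<lambda>x. \<psi> x * \<phi> x"] 1 unfolding P_def by linarith
qed

lemma L2_cmult: "\<psi> \<in> L2 \<alpha> \<Longrightarrow> (\<lambda>x. c * \<psi> x) \<in> L2 \<alpha>"
  by (auto simp: L2_def norm_mult power_mult_distrib)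

lemma
  assumes "\<psi> \<in> L2 \<alpha>" "\<phi> \<in> L2 \<alpha>"
  shows L2_add: "(\<lambda>x. \<psi> x + \<phi> x) \<in> L2 \<alpha>"
    and L2_norm_triangle: "L2_norm \<alpha> (\<lambda>x. \<psi> x + \<phi> x) \<le> L2_norm \<alpha> \<psi> + L2_norm \<alpha> \<phi>"
proof -
  have i: "integrable (bessel_measure \<alpha>) (\<lambda>x. (norm (\<psi> x))\<^sup>2 + (norm (\<phi> x))\<^sup>2 + 2 * norm (\<psi> x * \<phi> x))"
    by (intro integrable_mult_right Bochner_Integration.integrable_add L2D(2) assms integrable_norm L2_mult_integrable)
  have m: "(\<lambda>x. \<psi> x + \<phi> x) \<in> borel_measurable (bessel_measure \<alpha>)"
    using L2D(1)[OF assms(1)] L2D(1)[OF assms(2)] by (rule borel_measurable_add)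
  have b: "(norm (\<psi> x + \<phi> x))\<^sup>2 \<le> (norm (\<psi> x))\<^sup>2 + (norm (\<phi> x))\<^sup>2 + 2 * norm (\<psi> x * \<phi> x)" for x
    using power_mono[OF norm_triangle_ineq[of "\<psi> x" "\<phi> x"], of 2] by (simp add: power2_sum norm_mult)
  have i': "integrable (bessel_measure \<alpha>) (\<lambda>x. (norm (\<psi> x + \<phi> x))\<^sup>2)"
    by (rule Bochner_Integration.integrable_bound[OF i])
      (use m b in \<open>auto intro!: AE_I2 order_trans[OF b abs_ge_self]\<close>)
  then show "(\<lambda>x. \<psi> x + \<phi> x) \<in> L2 \<alpha>" using m by (simp add: L2_def)
  have "(L2_norm \<alpha> (\<lambda>x. \<psi> x + \<phi> x))\<^sup>2 \<le> (LINT x|bessel_measure \<alpha>. (norm (\<psi> x))\<^sup>2 + (norm (\<phi> x))\<^sup>2 + 2 * norm (\<psi> x * \<phi> x))"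
    unfolding L2_norm_sq by (rule integral_mono[OF i' i b])
  also have "\<dots> = (L2_norm \<alpha> \<psi>)\<^sup>2 + (L2_norm \<alpha> \<phi>)\<^sup>2 + 2 * (LINT x|bessel_measure \<alpha>. norm (\<psi> x * \<phi> x))"
    unfolding L2_norm_sq
    by (subst Bochner_Integration.integral_add, (intro integrable_mult_right Bochner_Integration.integrable_add L2D(2) assms integrable_norm L2_mult_integrable)+,
       subst Bochner_Integration.integral_add) (auto intro!: L2D(2) assms)
  also have "\<dots> \<le> (L2_norm \<alpha> \<psi>)\<^sup>2 + (L2_norm \<alpha> \<phi>)\<^sup>2 + 2 * (L2_norm \<alpha> \<psi> * L2_norm \<alpha> \<phi>)"
    using L2_Cauchy_Schwarz(1)[OF assms] by simp
  also have "\<dots> = (L2_norm \<alpha> \<psi> + L2_norm \<alpha> \<phi>)\<^sup>2" by (simp add: power2_sum)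
  finally show "L2_norm \<alpha> (\<lambda>x. \<psi> x + \<phi> x) \<le> L2_norm \<alpha> \<psi> + L2_norm \<alpha> \<phi>"
    by (rule power2_le_imp_le) (intro add_nonneg_nonneg L2_norm_nonneg)
qed

lemma L2_norm_minus: "L2_norm \<alpha> (\<lambda>x. - \<psi> x) = L2_norm \<alpha> \<psi>"
  by (simp add: L2_norm_def)

lemma L2_minus: "\<psi> \<in> L2 \<alpha> \<Longrightarrow> (\<lambda>x. - \<psi> x) \<in> L2 \<alpha>"
  using L2_cmult[of \<psi> \<alpha> "-1"] by simp

lemma L2_diff: "\<psi> \<in> L2 \<alpha> \<Longrightarrow> \<phi> \<in> L2 \<alpha> \<Longrightarrow> (\<lambda>x. \<psi> x - \<phi> x) \<in> L2 \<alpha>"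
  using L2_add[OF _ L2_minus] by fastforce

lemma L2_norm_cong_AE:
  assumes "\<psi> \<in> L2 \<alpha>" "\<phi> \<in> L2 \<alpha>" "AE x in bessel_measure \<alpha>. \<psi> x = \<phi> x"
  shows "L2_norm \<alpha> \<psi> = L2_norm \<alpha> \<phi>"
  unfolding L2_norm_def
proof (intro arg_cong[where f = sqrt] integral_cong_AE)
  show "AE x in bessel_measure \<alpha>. (norm (\<psi> x))\<^sup>2 = (norm (\<phi> x))\<^sup>2"
    using assms(3) by eventually_elim simp
qed (rule borel_measurable_integrable[OF L2D(2)], rule assms)+

lemma rapid_L2_bound:
  assumes \<alpha>: "admissible \<alpha>" and B: "rapid B"
  obtains C where "C > 0" "\<And>f. f \<in> B \<Longrightarrow> f \<in> borel_measurable (bessel_measure \<alpha>) \<Longrightarrow> f \<in> L2 \<alpha> \<and> L2_norm \<alpha> f \<le> C"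
proof -
  obtain N where N: "integrable (bessel_measure \<alpha>) (\<lambda>x. 1 / (1 + norm x) ^ N)"
    using integrable_decay[OF \<alpha>] .
  obtain D where D: "D > 0" "\<And>f x. f \<in> B \<Longrightarrow> (1 + norm x) ^ N * norm (f x) \<le> D"
    using rapidE[OF B, of N] by metis
  define I where "I = (LINT x|bessel_measure \<alpha>. D\<^sup>2 * (1 / (1 + norm x) ^ N))"
  have b: "(norm (f x))\<^sup>2 \<le> D\<^sup>2 * (1 / (1 + norm x) ^ N)" if f: "f \<in> B" for f x
  proof -
    have p: "1 / (1 + norm x) ^ N \<le> 1"
      by (rule divide_le_eq_1_pos[THEN iffD2]) (auto intro!: one_le_power zero_less_power add_pos_nonneg)
    have "norm (f x) \<le> D / (1 + norm x) ^ N" by (rule le_divide_power[OF D(2)[OF f]])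
    then have "(norm (f x))\<^sup>2 \<le> (D / (1 + norm x) ^ N)\<^sup>2" by (intro power_mono) auto
    also have "\<dots> = D\<^sup>2 * (1 / (1 + norm x) ^ N) * (1 / (1 + norm x) ^ N)"
      by (simp add: power2_eq_square)
    also have "\<dots> \<le> D\<^sup>2 * (1 / (1 + norm x) ^ N) * 1"
      using p by (intro mult_left_mono) auto
    finally show ?thesis by simp
  qed
  have "f \<in> L2 \<alpha> \<and> L2_norm \<alpha> f \<le> sqrt I" if f: "f \<in> B" "f \<in> borel_measurable (bessel_measure \<alpha>)" for f
  proof -
    have i: "integrable (bessel_measure \<alpha>) (\<lambda>x. (norm (f x))\<^sup>2)"
    proof (rule Bochner_Integration.integrable_bound[OF integrable_mult_right[OF N, of "D\<^sup>2"]])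
      show "(\<lambda>x. (norm (f x))\<^sup>2) \<in> borel_measurable (bessel_measure \<alpha>)" using f(2) by measurable
      show "AE x in bessel_measure \<alpha>. norm ((norm (f x))\<^sup>2) \<le> norm (D\<^sup>2 * (1 / (1 + norm x) ^ N))"
        using b[OF f(1)] by (intro AE_I2) simp
    qed
    moreover have "L2_norm \<alpha> f \<le> sqrt I"
      unfolding L2_norm_def I_def
      by (intro real_sqrt_le_mono integral_mono[OF i] integrable_mult_right N b[OF f(1)])
    ultimately show ?thesis using f(2) by (simp add: L2_def)
  qed
  then show ?thesis using that[of "max (sqrt I) 1"] by (auto simp: le_max_iff_disj)
qed

lemma schwartz_L2: "admissible \<alpha> \<Longrightarrow> f \<in> schwartz_e \<Longrightarrow> f \<in> L2 \<alpha>"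
  using rapid_L2_bound[of \<alpha> "{f}"] schwartz_e_rapid continuous_imp_bessel_measurable[OF schwartz_e_continuous]
  by (metis singletonI)

section \<open>Sobolev spaces in terms of square-integrable representatives\<close>

lemma weighted_transform_apply:
  "weighted_transform \<alpha> s T \<phi> = (if \<phi> \<in> schwartz_e then T (fourier_bessel \<alpha> (\<lambda>x. sob_weight s x * \<phi> x)) else 0)"
  using sob_weight_schwartz[of \<phi> s]
  by (simp add: weighted_transform_def mult_dist_def fourier_bessel_dist_def sob_weight_def)

text \<open>A relation, because a representative is determined only up to null sets; later on it can
  be exchanged for one that is better behaved pointwise.\<close>

definition sob_rep :: "real ^ 'n \<Rightarrow> real \<Rightarrow> 'n::finite dist \<Rightarrow> (real ^ 'n \<Rightarrow> complex) \<Rightarrow> bool" where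
  "sob_rep \<alpha> s T \<psi> \<longleftrightarrow> \<psi> \<in> L2 \<alpha> \<and> weighted_transform \<alpha> s T = dist_of_fun \<alpha> \<psi>"

lemma sob_rep_iff:
  "sob_rep \<alpha> s T \<psi> \<longleftrightarrow> \<psi> \<in> L2 \<alpha> \<and>
     (\<forall>\<phi>\<in>schwartz_e. T (fourier_bessel \<alpha> (\<lambda>x. sob_weight s x * \<phi> x)) = (LINT x|bessel_measure \<alpha>. \<psi> x * \<phi> x))"
  unfolding sob_rep_def fun_eq_iff weighted_transform_apply dist_of_fun_def by auto

lemma sobolev_iff: "T \<in> sobolev \<alpha> s \<longleftrightarrow> T \<in> tempered_e \<and> (\<exists>\<psi>. sob_rep \<alpha> s T \<psi>)"
  by (auto simp: sobolev_def sob_rep_def)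

text \<open>Gaussians are admissible test functions, so the difference of two representatives has
  vanishing Gaussian moments.\<close>

lemma sob_rep_unique:
  assumes \<alpha>: "admissible \<alpha>" and "sob_rep \<alpha> s T \<psi>" "sob_rep \<alpha> s T \<psi>'"
  shows "AE x in bessel_measure \<alpha>. \<psi> x = \<psi>' x"
proof -
  have L: "\<psi> \<in> L2 \<alpha>" "\<psi>' \<in> L2 \<alpha>" using assms by (auto simp: sob_rep_iff)
  have "AE x in bessel_measure \<alpha>. \<psi> x - \<psi>' x = 0"
  proof (rule gauss_moments_zero)
    show "(\<lambda>x. \<psi> x - \<psi>' x) \<in> borel_measurable (bessel_measure \<alpha>)" by (rule L2D(1)[OF L2_diff[OF L]])
    show "integrable (bessel_measure \<alpha>) (\<lambda>x. (\<psi> x - \<psi>' x) * gauss 1 x)"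
      by (intro L2_mult_integrable L2_diff L schwartz_L2 \<alpha> gauss_schwartz) simp
    fix k :: "'a \<Rightarrow> nat" assume k: "\<And>i. 1 \<le> k i"
    have "0 < (\<chi> i. real (k i)) $ i" for i using k[of i] by simp
    then have g: "gauss (\<chi> i. real (k i)) \<in> schwartz_e" by (rule gauss_schwartz)
    show "(LINT x|bessel_measure \<alpha>. (\<psi> x - \<psi>' x) * gauss (\<chi> i. real (k i)) x) = 0"
      unfolding left_diff_distrib
      by (subst Bochner_Integration.integral_diff[OF L2_mult_integrable L2_mult_integrable])
        (use L schwartz_L2[OF \<alpha> g] g assms(2,3) in \<open>auto simp: sob_rep_iff\<close>)
  qed
  then show ?thesis by eventually_elim simp
qed

lemma sobolev_norm_eq:
  assumes \<alpha>: "admissible \<alpha>" and "sob_rep \<alpha> s T \<psi>"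
  shows "sobolev_norm \<alpha> s T = bessel_const \<alpha> * L2_norm \<alpha> \<psi>"
proof -
  define \<psi>' where "\<psi>' = (SOME \<psi>. sob_rep \<alpha> s T \<psi>)"
  have \<psi>': "sob_rep \<alpha> s T \<psi>'" unfolding \<psi>'_def by (rule someI[of "sob_rep \<alpha> s T", OF assms(2)])
  have "L2_norm \<alpha> \<psi>' = L2_norm \<alpha> \<psi>"
    using L2_norm_cong_AE sob_rep_unique[OF \<alpha> \<psi>' assms(2)] \<psi>' assms(2) by (metis sob_rep_def)
  then show ?thesis unfolding sobolev_norm_def \<psi>'_def sob_rep_def by simp
qed

lemma bessel_const_pos: "admissible \<alpha> \<Longrightarrow> bessel_const \<alpha> > 0"
proof -
  assume \<alpha>: "admissible \<alpha>"
  have "Gamma (\<alpha> $ i + 1) > 0" for i using admissibleD[OF \<alpha>, of i] by (intro Gamma_real_pos) auto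
  then show ?thesis unfolding bessel_const_def by (intro divide_pos_pos prod_pos) auto
qed

lemma sob_rep_diff:
  assumes \<alpha>: "admissible \<alpha>" and S: "sob_rep \<alpha> s S \<psi>" and T: "sob_rep \<alpha> s T \<phi>"
  shows "sob_rep \<alpha> s (\<lambda>f. S f - T f) (\<lambda>x. \<psi> x - \<phi> x)"
proof -
  have L: "\<psi> \<in> L2 \<alpha>" "\<phi> \<in> L2 \<alpha>" using assms by (auto simp: sob_rep_iff)
  have "(LINT x|bessel_measure \<alpha>. (\<psi> x - \<phi> x) * f x) = (LINT x|bessel_measure \<alpha>. \<psi> x * f x) - (LINT x|bessel_measure \<alpha>. \<phi> x * f x)"
    if "f \<in> schwartz_e" for f
    unfolding left_diff_distrib
    by (rule Bochner_Integration.integral_diff[OF L2_mult_integrable L2_mult_integrable]) (intro L schwartz_L2[OF \<alpha> that])+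
  then show ?thesis using assms L2_diff[OF L] by (simp add: sob_rep_iff)
qed

lemma sob_rep_minus: "sob_rep \<alpha> s (\<lambda>f. - T f) (\<lambda>x. - \<psi> x) \<longleftrightarrow> sob_rep \<alpha> s T \<psi>"
proof -
  have "sob_rep \<alpha> s (\<lambda>f. - T f) (\<lambda>x. - \<psi> x)" if "sob_rep \<alpha> s T \<psi>" for T \<psi>
    using that L2_minus by (auto simp: sob_rep_iff)
  from this[of T \<psi>] this[of "\<lambda>f. - T f" "\<lambda>x. - \<psi> x"] show ?thesis by auto
qed

text \<open>\<open>Metric_space\<close> demands symmetry for all functionals, including those
  without a representative. For these the choice in the norm ranges over the empty predicate on both
  sides and returns the same arbitrary function.\<close>

lemma sobolev_norm_minus:
  assumes \<alpha>: "admissible \<alpha>"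
  shows "sobolev_norm \<alpha> s (\<lambda>f. - T f) = sobolev_norm \<alpha> s T"
proof (cases "\<exists>\<psi>. sob_rep \<alpha> s T \<psi>")
  case True
  then obtain \<psi> where \<psi>: "sob_rep \<alpha> s T \<psi>" by blast
  then have "sob_rep \<alpha> s (\<lambda>f. - T f) (\<lambda>x. - \<psi> x)" by (simp add: sob_rep_minus)
  then show ?thesis using sobolev_norm_eq[OF \<alpha>] \<psi> by (simp add: L2_norm_minus)
next
  case False
  have "\<not> sob_rep \<alpha> s (\<lambda>f. - T f) \<psi>" for \<psi>
    using False sob_rep_minus[of \<alpha> s "\<lambda>f. - T f" \<psi>] by auto
  then have "sob_rep \<alpha> s (\<lambda>f. - T f) = (\<lambda>\<psi>. False)" "sob_rep \<alpha> s T = (\<lambda>\<psi>. False)"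
    using False by auto
  then show ?thesis
    unfolding sobolev_norm_def sob_rep_def[symmetric] by (simp only:)
qed

text \<open>The inverse of the passage from \<open>T\<close> to its representative:
  \<open>T f\<close> is the pairing of the transform of \<open>T\<close>, which is
  \<open>sob_weight (- s) * \<psi>\<close>, with the transform of \<open>f\<close>, divided by the
  constant of the inversion formula. The value 0 elsewhere follows the normalisation of
  distributions.\<close>

definition sob_dist :: "real ^ 'n \<Rightarrow> real \<Rightarrow> (real ^ 'n \<Rightarrow> complex) \<Rightarrow> 'n::finite dist" where
  "sob_dist \<alpha> s \<psi> = (\<lambda>f. if f \<in> schwartz_e
     then (LINT x|bessel_measure \<alpha>. \<psi> x * (sob_weight (- s) x * fourier_bessel \<alpha> f x)) / inversion_const \<alpha> else 0)"

lemma weighted_fourier_schwartz: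
  "admissible \<alpha> \<Longrightarrow> f \<in> schwartz_e \<Longrightarrow> (\<lambda>x. sob_weight r x * fourier_bessel \<alpha> f x) \<in> schwartz_e"
  by (intro sob_weight_schwartz fourier_bessel_schwartz)

lemma sob_rep_formula:
  assumes \<alpha>: "admissible \<alpha>" and T: "sob_rep \<alpha> s T \<psi>" and f: "f \<in> schwartz_e"
  shows "T f = sob_dist \<alpha> s \<psi> f"
proof -
  define \<kappa> where "\<kappa> = inversion_const \<alpha>"
  have \<kappa>: "\<kappa> \<noteq> 0" unfolding \<kappa>_def by (rule inversion_const_nonzero[OF \<alpha>])
  \<comment> \<open>Chosen so that the weight cancels and, by inversion, the transform of
    \<open>sob_weight s * \<phi>\<close> is \<open>f\<close>.\<close>
  define \<phi> where "\<phi> = (\<lambda>x. (1 / \<kappa>) * (sob_weight (- s) x * fourier_bessel \<alpha> f x))"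
  have \<phi>: "\<phi> \<in> schwartz_e" unfolding \<phi>_def by (intro schwartz_e_cmult weighted_fourier_schwartz \<alpha> f)
  have "(\<lambda>x. sob_weight s x * \<phi> x) = (\<lambda>x. (1 / \<kappa>) * fourier_bessel \<alpha> f x)"
  proof
    fix x
    have "sob_weight s x * \<phi> x = (1 / \<kappa>) * ((sob_weight s x * sob_weight (- s) x) * fourier_bessel \<alpha> f x)"
      by (simp add: \<phi>_def)
    then show "sob_weight s x * \<phi> x = (1 / \<kappa>) * fourier_bessel \<alpha> f x" by (simp add: sob_weight_mult)
  qed
  then have "fourier_bessel \<alpha> (\<lambda>x. sob_weight s x * \<phi> x) = f"
    using \<kappa> by (simp only: fun_eq_iff fourier_bessel_cmult fourier_bessel_inversion[OF \<alpha> f]) (simp add: \<kappa>_def)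
  then have "T f = (LINT x|bessel_measure \<alpha>. \<psi> x * \<phi> x)"
    using T \<phi> by (auto simp: sob_rep_iff)
  also have "\<dots> = (LINT x|bessel_measure \<alpha>. (1 / \<kappa>) * (\<psi> x * (sob_weight (- s) x * fourier_bessel \<alpha> f x)))"
    unfolding \<phi>_def by (simp only: mult_ac)
  also have "\<dots> = sob_dist \<alpha> s \<psi> f" using f by (simp add: sob_dist_def \<kappa>_def)
  finally show ?thesis .
qed

lemma sob_rep_sob_dist:
  fixes \<alpha> :: "real ^ 'n"
  assumes \<alpha>: "admissible \<alpha>" and \<psi>: "\<psi> \<in> L2 \<alpha>"
  shows "sob_rep \<alpha> s (sob_dist \<alpha> s \<psi>) \<psi>"
  unfolding sob_rep_iff
proof (intro conjI ballI \<psi>)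
  fix \<phi> :: "real ^ 'n \<Rightarrow> complex" assume \<phi>: "\<phi> \<in> schwartz_e"
  have \<kappa>: "inversion_const \<alpha> \<noteq> 0" by (rule inversion_const_nonzero[OF \<alpha>])
  have w: "(\<lambda>x. sob_weight s x * \<phi> x) \<in> schwartz_e" by (rule sob_weight_schwartz[OF \<phi>])
  have *: "\<psi> x * (sob_weight (- s) x * (inversion_const \<alpha> * (sob_weight s x * \<phi> x))) = inversion_const \<alpha> * (\<psi> x * \<phi> x)" for x
  proof -
    have "\<psi> x * (sob_weight (- s) x * (inversion_const \<alpha> * (sob_weight s x * \<phi> x))) =
      inversion_const \<alpha> * (\<psi> x * ((sob_weight (- s) x * sob_weight s x) * \<phi> x))" by (simp only: mult_ac)
    then show ?thesis by (simp add: sob_weight_mult)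
  qed
  show "sob_dist \<alpha> s \<psi> (fourier_bessel \<alpha> (\<lambda>x. sob_weight s x * \<phi> x)) = (LINT x|bessel_measure \<alpha>. \<psi> x * \<phi> x)"
    unfolding sob_dist_def fourier_bessel_inversion[OF \<alpha> w] *
    using fourier_bessel_schwartz[OF \<alpha> w] \<kappa> by simp
qed

lemma sob_dist_bound:
  assumes \<alpha>: "admissible \<alpha>" and \<psi>: "\<psi> \<in> L2 \<alpha>" and f: "f \<in> schwartz_e"
  shows "norm (sob_dist \<alpha> s \<psi> f) \<le> L2_norm \<alpha> \<psi> * (L2_norm \<alpha> (\<lambda>x. sob_weight (- s) x * fourier_bessel \<alpha> f x) / norm (inversion_const \<alpha>))"
proof -
  have "norm (LINT x|bessel_measure \<alpha>. \<psi> x * (sob_weight (- s) x * fourier_bessel \<alpha> f x))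
    \<le> L2_norm \<alpha> \<psi> * L2_norm \<alpha> (\<lambda>x. sob_weight (- s) x * fourier_bessel \<alpha> f x)"
    by (intro L2_Cauchy_Schwarz(2) \<psi> schwartz_L2 \<alpha> weighted_fourier_schwartz f)
  then show ?thesis using f by (simp add: sob_dist_def norm_divide divide_right_mono)
qed

text \<open>The transform and the weight keep bounded sets bounded, so Cauchy-Schwarz gives one
  bound for all of \<open>B\<close>. This is the hypothesis of
  \<open>functional_continuous\<close>.\<close>

lemma sob_dist_bdd:
  fixes \<alpha> :: "real ^ 'n"
  assumes \<alpha>: "admissible \<alpha>" and \<psi>: "\<psi> \<in> L2 \<alpha>" and B: "schwartz_bdd B"
  shows "\<exists>C. \<forall>f\<in>B. norm (sob_dist \<alpha> s \<psi> f) \<le> C"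
proof -
  let ?W = "pointwise_mult {sob_weight (- s) :: real ^ 'n \<Rightarrow> complex} (fourier_bessel \<alpha> ` B)"
  have "schwartz_bdd ?W"
    by (intro schwartz_bdd_mult mult_bdd_sob_weight schwartz_bdd_fourier_bessel \<alpha> B)
  then have "rapid ?W" by (rule schwartz_bdd_rapid)
  then obtain C where C: "C > 0" "\<And>f. f \<in> ?W \<Longrightarrow> f \<in> borel_measurable (bessel_measure \<alpha>) \<Longrightarrow> f \<in> L2 \<alpha> \<and> L2_norm \<alpha> f \<le> C"
    using rapid_L2_bound[OF \<alpha>] by metis
  have "norm (sob_dist \<alpha> s \<psi> f) \<le> L2_norm \<alpha> \<psi> * (C / norm (inversion_const \<alpha>))" if f: "f \<in> B" for f
  proof -
    have fs: "f \<in> schwartz_e" by (rule schwartz_bdd_single[OF B f])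
    have "(\<lambda>x. sob_weight (- s) x * fourier_bessel \<alpha> f x) \<in> ?W"
      by (intro pointwise_multI imageI f singletonI)
    moreover have "(\<lambda>x. sob_weight (- s) x * fourier_bessel \<alpha> f x) \<in> borel_measurable (bessel_measure \<alpha>)"
      by (intro continuous_imp_bessel_measurable schwartz_e_continuous weighted_fourier_schwartz \<alpha> fs)
    ultimately have "L2_norm \<alpha> (\<lambda>x. sob_weight (- s) x * fourier_bessel \<alpha> f x) \<le> C" using C by blast
    then have "L2_norm \<alpha> \<psi> * (L2_norm \<alpha> (\<lambda>x. sob_weight (- s) x * fourier_bessel \<alpha> f x) / norm (inversion_const \<alpha>)) \<le> L2_norm \<alpha> \<psi> * (C / norm (inversion_const \<alpha>))"
      by (intro mult_left_mono divide_right_mono L2_norm_nonneg) auto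
    with sob_dist_bound[OF \<alpha> \<psi> fs] show ?thesis by (rule order_trans)
  qed
  then show ?thesis by blast
qed

lemma sob_dist_linear:
  assumes \<alpha>: "admissible \<alpha>" and \<psi>: "\<psi> \<in> L2 \<alpha>"
  shows "f \<in> schwartz_e \<Longrightarrow> g \<in> schwartz_e \<Longrightarrow> sob_dist \<alpha> s \<psi> (\<lambda>x. f x + g x) = sob_dist \<alpha> s \<psi> f + sob_dist \<alpha> s \<psi> g"
    and "f \<in> schwartz_e \<Longrightarrow> sob_dist \<alpha> s \<psi> (\<lambda>x. c * f x) = c * sob_dist \<alpha> s \<psi> f"
proof -
  assume f: "f \<in> schwartz_e"
  have "(LINT x|bessel_measure \<alpha>. \<psi> x * (sob_weight (- s) x * (c * fourier_bessel \<alpha> f x))) =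
      (LINT x|bessel_measure \<alpha>. c * (\<psi> x * (sob_weight (- s) x * fourier_bessel \<alpha> f x)))"
    by (simp only: mult_ac)
  then show "sob_dist \<alpha> s \<psi> (\<lambda>x. c * f x) = c * sob_dist \<alpha> s \<psi> f"
    using f schwartz_e_cmult[OF f, of c] by (simp add: sob_dist_def fourier_bessel_cmult)
  assume g: "g \<in> schwartz_e"
  have "(LINT x|bessel_measure \<alpha>. \<psi> x * (sob_weight (- s) x * (fourier_bessel \<alpha> f x + fourier_bessel \<alpha> g x))) =
      (LINT x|bessel_measure \<alpha>. \<psi> x * (sob_weight (- s) x * fourier_bessel \<alpha> f x)) + (LINT x|bessel_measure \<alpha>. \<psi> x * (sob_weight (- s) x * fourier_bessel \<alpha> g x))"
    unfolding distrib_left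
    by (intro Bochner_Integration.integral_add L2_mult_integrable \<psi> schwartz_L2 \<alpha> weighted_fourier_schwartz f g)
  then show "sob_dist \<alpha> s \<psi> (\<lambda>x. f x + g x) = sob_dist \<alpha> s \<psi> f + sob_dist \<alpha> s \<psi> g"
    using f g schwartz_e_add[OF f g] by (simp add: sob_dist_def fourier_bessel_add[OF \<alpha> f g] add_divide_distrib)
qed

lemma sob_dist_tempered:
  assumes \<alpha>: "admissible \<alpha>" and \<psi>: "\<psi> \<in> L2 \<alpha>"
  shows "sob_dist \<alpha> s \<psi> \<in> tempered_e"
proof -
  have "continuous_map schwartz_e_topology euclidean (sob_dist \<alpha> s \<psi>)"
    by (rule functional_continuous) (use sob_dist_linear[OF assms] sob_dist_bdd[OF assms] in blast)+
  moreover have "\<forall>f. f \<notin> schwartz_e \<longrightarrow> sob_dist \<alpha> s \<psi> f = 0" by (simp add: sob_dist_def)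
  ultimately show ?thesis
    using sob_dist_linear[OF assms] unfolding tempered_e_def by blast
qed

lemma tempered_eq_sob_dist:
  assumes "admissible \<alpha>" "T \<in> tempered_e" "sob_rep \<alpha> s T \<psi>"
  shows "T = sob_dist \<alpha> s \<psi>"
proof
  fix f show "T f = sob_dist \<alpha> s \<psi> f"
  proof (cases "f \<in> schwartz_e")
    case True
    then show ?thesis using sob_rep_formula[OF assms(1,3)] by blast
  next
    case False
    then show ?thesis using assms(2) by (simp add: tempered_e_def sob_dist_def)
  qed
qed

lemma norm_sob_weight_neg: "r \<le> 0 \<Longrightarrow> norm (sob_weight r x) \<le> 1"
proof -
  assume r: "r \<le> 0"
  have "(1 + (norm x)\<^sup>2) powr r \<le> (1 + (norm x)\<^sup>2) powr 0"
    using r by (intro powr_mono) auto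
  also have "\<dots> = 1" using add_pos_nonneg[of 1 "(norm x)\<^sup>2"] by simp
  finally show ?thesis by (simp add: sob_weight_def)
qed

section \<open>Comparison of exponents and the metric\<close>

lemma L2_bounded_mult:
  assumes \<psi>: "\<psi> \<in> L2 \<alpha>" and w: "w \<in> borel_measurable (bessel_measure \<alpha>)" and b: "\<And>x. norm (w x) \<le> 1"
  shows "(\<lambda>x. w x * \<psi> x) \<in> L2 \<alpha>"
proof -
  have m: "(\<lambda>x. w x * \<psi> x) \<in> borel_measurable (bessel_measure \<alpha>)"
    using w L2D(1)[OF \<psi>] by (rule borel_measurable_times)
  have "integrable (bessel_measure \<alpha>) (\<lambda>x. (norm (w x * \<psi> x))\<^sup>2)"
  proof (rule Bochner_Integration.integrable_bound[OF L2D(2)[OF \<psi>]])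
    show "(\<lambda>x. (norm (w x * \<psi> x))\<^sup>2) \<in> borel_measurable (bessel_measure \<alpha>)" using m by measurable
    have "norm (w x * \<psi> x) \<le> norm (\<psi> x)" for x
      unfolding norm_mult using b[of x] by (simp add: mult_left_le_one_le)
    then show "AE x in bessel_measure \<alpha>. norm ((norm (w x * \<psi> x))\<^sup>2) \<le> norm ((norm (\<psi> x))\<^sup>2)"
      by (intro AE_I2) (simp add: power_mono)
  qed
  with m show ?thesis by (simp add: L2_def)
qed

lemma sob_rep_lower:
  fixes \<alpha> :: "real ^ 'n"
  assumes T: "sob_rep \<alpha> s T \<psi>" and "t \<le> s"
  shows "sob_rep \<alpha> t T (\<lambda>x. sob_weight (t - s) x * \<psi> x)"
  unfolding sob_rep_iff
proof (intro conjI ballI)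
  have \<psi>: "\<psi> \<in> L2 \<alpha>" using T by (simp add: sob_rep_iff)
  show "(\<lambda>x. sob_weight (t - s) x * \<psi> x) \<in> L2 \<alpha>"
    by (intro L2_bounded_mult \<psi> continuous_imp_bessel_measurable continuous_sob_weight norm_sob_weight_neg) (use assms in simp)
  fix \<phi> :: "real ^ 'n \<Rightarrow> complex" assume \<phi>: "\<phi> \<in> schwartz_e"
  have w: "(\<lambda>x. sob_weight (t - s) x * \<phi> x) \<in> schwartz_e" by (rule sob_weight_schwartz[OF \<phi>])
  have "sob_weight s x * (sob_weight (t - s) x * \<phi> x) = sob_weight t x * \<phi> x" for x
    using sob_weight_mult[of s x "t - s"] by (simp add: mult.assoc[symmetric])
  then have "T (fourier_bessel \<alpha> (\<lambda>x. sob_weight t x * \<phi> x)) = (LINT x|bessel_measure \<alpha>. \<psi> x * (sob_weight (t - s) x * \<phi> x))"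
    using T w unfolding sob_rep_iff by (metis (no_types, lifting) ext)
  then show "T (fourier_bessel \<alpha> (\<lambda>x. sob_weight t x * \<phi> x)) = (LINT x|bessel_measure \<alpha>. sob_weight (t - s) x * \<psi> x * \<phi> x)"
    by (simp only: mult_ac)
qed

text \<open>Distances are computed on representatives. Definiteness rests on
  \<open>sob_dist_bound\<close>: a difference whose representative has norm 0 vanishes on every
  Schwartz function, and all other values are 0 by normalisation.\<close>

lemma sobolev_supp_metric:
  fixes \<alpha> :: "real ^ 'n"
  assumes \<alpha>: "admissible \<alpha>"
  shows "Metric_space (sobolev_supp \<alpha> s K) (\<lambda>S T. sobolev_norm \<alpha> s (\<lambda>f. S f - T f))"
proof
  have c: "bessel_const \<alpha> > 0" by (rule bessel_const_pos[OF \<alpha>])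
  fix S T :: "'n dist"
  show "0 \<le> sobolev_norm \<alpha> s (\<lambda>f. S f - T f)"
    unfolding sobolev_norm_def using c by (intro mult_nonneg_nonneg L2_norm_nonneg) simp
  show "sobolev_norm \<alpha> s (\<lambda>f. S f - T f) = sobolev_norm \<alpha> s (\<lambda>f. T f - S f)"
    using sobolev_norm_minus[OF \<alpha>, of s "\<lambda>f. T f - S f"] by simp
  assume "S \<in> sobolev_supp \<alpha> s K" "T \<in> sobolev_supp \<alpha> s K"
  then have S: "S \<in> tempered_e" "\<exists>\<psi>. sob_rep \<alpha> s S \<psi>" and T: "T \<in> tempered_e" "\<exists>\<psi>. sob_rep \<alpha> s T \<psi>"
    by (auto simp: sobolev_supp_def sobolev_iff)
  then obtain \<psi> \<phi> where \<psi>: "sob_rep \<alpha> s S \<psi>" and \<phi>: "sob_rep \<alpha> s T \<phi>" by blast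
  have d: "sob_rep \<alpha> s (\<lambda>f. S f - T f) (\<lambda>x. \<psi> x - \<phi> x)" by (rule sob_rep_diff[OF \<alpha> \<psi> \<phi>])
  have L: "\<psi> \<in> L2 \<alpha>" "\<phi> \<in> L2 \<alpha>" "(\<lambda>x. \<psi> x - \<phi> x) \<in> L2 \<alpha>" using \<psi> \<phi> d by (auto simp: sob_rep_iff)
  show "sobolev_norm \<alpha> s (\<lambda>f. S f - T f) = 0 \<longleftrightarrow> S = T"
  proof
    assume "sobolev_norm \<alpha> s (\<lambda>f. S f - T f) = 0"
    then have n0: "L2_norm \<alpha> (\<lambda>x. \<psi> x - \<phi> x) = 0" using sobolev_norm_eq[OF \<alpha> d] c by simp
    have "S f = T f" if f: "f \<in> schwartz_e" for f
    proof -
      have "S f - T f = sob_dist \<alpha> s (\<lambda>x. \<psi> x - \<phi> x) f" by (rule sob_rep_formula[OF \<alpha> d f])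
      moreover have "norm (sob_dist \<alpha> s (\<lambda>x. \<psi> x - \<phi> x) f) \<le> 0"
        using sob_dist_bound[OF \<alpha> L(3) f, of s] unfolding n0 by simp
      ultimately show ?thesis by simp
    qed
    moreover have "S f = T f" if "f \<notin> schwartz_e" for f
      using that S(1) T(1) by (simp add: tempered_e_def)
    ultimately show "S = T" by blast
  next
    assume "S = T"
    then have "sob_rep \<alpha> s (\<lambda>f. S f - T f) (\<lambda>x. \<psi> x - \<psi> x)" using sob_rep_diff[OF \<alpha> \<psi> \<psi>] by simp
    from sobolev_norm_eq[OF \<alpha> this] show "sobolev_norm \<alpha> s (\<lambda>f. S f - T f) = 0"
      by (simp add: L2_norm_def)
  qed
  fix U assume "U \<in> sobolev_supp \<alpha> s K"
  then obtain \<rho> where \<rho>: "sob_rep \<alpha> s U \<rho>" by (auto simp: sobolev_supp_def sobolev_iff)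
  have Lr: "\<rho> \<in> L2 \<alpha>" using \<rho> by (simp add: sob_rep_iff)
  have "L2_norm \<alpha> (\<lambda>x. \<psi> x - \<rho> x) = L2_norm \<alpha> (\<lambda>x. (\<psi> x - \<phi> x) + (\<phi> x - \<rho> x))" by simp
  also have "\<dots> \<le> L2_norm \<alpha> (\<lambda>x. \<psi> x - \<phi> x) + L2_norm \<alpha> (\<lambda>x. \<phi> x - \<rho> x)"
    by (intro L2_norm_triangle L2_diff L Lr)
  finally have "bessel_const \<alpha> * L2_norm \<alpha> (\<lambda>x. \<psi> x - \<rho> x) \<le> bessel_const \<alpha> * (L2_norm \<alpha> (\<lambda>x. \<psi> x - \<phi> x) + L2_norm \<alpha> (\<lambda>x. \<phi> x - \<rho> x))"
    using c by (intro mult_left_mono) auto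
  then show "sobolev_norm \<alpha> s (\<lambda>f. S f - U f) \<le> sobolev_norm \<alpha> s (\<lambda>f. S f - T f) + sobolev_norm \<alpha> s (\<lambda>f. T f - U f)"
    unfolding sobolev_norm_eq[OF \<alpha> d] sobolev_norm_eq[OF \<alpha> sob_rep_diff[OF \<alpha> \<psi> \<rho>]] sobolev_norm_eq[OF \<alpha> sob_rep_diff[OF \<alpha> \<phi> \<rho>]]
    by (simp add: distrib_left)
qed

section \<open>Localisation to the support\<close>

lemma bounded_sign_orbit:
  fixes K :: "(real ^ 'n) set"
  assumes "compact K"
  obtains R where "R \<ge> 1" "\<And>x. x \<in> sign_orbit K \<Longrightarrow> norm x < R"
proof -
  obtain R where R: "\<And>x. x \<in> K \<Longrightarrow> norm x \<le> R"
    using compact_imp_bounded[OF assms] unfolding bounded_iff by blast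
  have "norm y < max 1 (R + 1)" if y0: "y \<in> sign_orbit K" for y
  proof -
    obtain \<epsilon> x where y: "y = (\<chi> i. \<epsilon> i * x $ i)" and x: "x \<in> K" and \<epsilon>: "\<And>i. \<epsilon> i \<in> {-1, 1}"
      using y0 unfolding sign_orbit_def by blast
    have "(y $ i)\<^sup>2 = (x $ i)\<^sup>2" for i using \<epsilon>[of i] by (auto simp: y)
    then have "(norm y)\<^sup>2 = (norm x)\<^sup>2" unfolding norm_square_sum by simp
    then have "norm y = norm x" by simp
    then show ?thesis using R[OF x] by simp
  qed
  then show ?thesis using that[of "max 1 (R + 1)"] by simp
qed

text \<open>The support condition tests only compactly supported functions. As
  \<open>cut R * g\<close> is one of these, the functional takes the same value at \<open>g\<close>
  and at \<open>(1 - cut R) * g\<close>, and the latter is of order \<open>1/R\<close>.\<close>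

lemma sob_dist_vanishing:
  fixes \<alpha> :: "real ^ 'n"
  assumes \<alpha>: "admissible \<alpha>" and \<psi>: "\<psi> \<in> L2 \<alpha>" and supp: "supp_in (sob_dist \<alpha> s \<psi>) K"
    and g: "g \<in> schwartz_e" and U: "open U" "sign_orbit K \<subseteq> U" "\<And>x. x \<in> U \<Longrightarrow> g x = 0"
  shows "sob_dist \<alpha> s \<psi> g = 0"
proof -
  let ?T = "sob_dist \<alpha> s \<psi>"
  obtain cut :: "real \<Rightarrow> real ^ 'n \<Rightarrow> complex" where
    cut: "\<And>R x. R \<ge> 1 \<Longrightarrow> norm x \<le> R \<Longrightarrow> cut R x = 1" "\<And>R x. R \<ge> 1 \<Longrightarrow> 2 * R \<le> norm x \<Longrightarrow> cut R x = 0"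
      "mult_bdd {cut R | R. R \<ge> 1}" "mult_bdd {\<lambda>x. of_real R * (1 - cut R x) | R. R \<ge> 1}"
    using cutoff_exists by blast
  have "schwartz_bdd (pointwise_mult {\<lambda>x. of_real R * (1 - cut R x) | R. R \<ge> 1} {g})"
    using g by (intro schwartz_bdd_mult cut(4)) (simp add: schwartz_e_iff)
  from sob_dist_bdd[OF \<alpha> \<psi> this, of s] obtain C where
    C: "\<And>f. f \<in> pointwise_mult {\<lambda>x. of_real R * (1 - cut R x) | R. R \<ge> 1} {g} \<Longrightarrow> norm (?T f) \<le> C" by blast
  have bound: "R * norm (?T g) \<le> C" if R: "R \<ge> 1" for R
  proof -
    have cg: "(\<lambda>x. cut R x * g x) \<in> schwartz_e"
      by (rule schwartz_e_mult[OF mult_bdd_mono[OF cut(3)] g]) (use R in blast)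
    have test: "(\<lambda>x. cut R x * g x) \<in> test_e"
    proof -
      have "\<forall>x. x \<notin> cball 0 (2 * R) \<longrightarrow> cut R x * g x = 0" using cut(2)[OF R] by simp
      moreover have "compact (cball (0 :: real ^ 'n) (2 * R))" by simp
      ultimately show ?thesis using cg unfolding test_e_def schwartz_e_def by blast
    qed
    have ex: "\<exists>U. open U \<and> sign_orbit K \<subseteq> U \<and> (\<forall>x\<in>U. cut R x * g x = 0)" using U by (intro exI[of _ U]) simp
    have z: "?T (\<lambda>x. cut R x * g x) = 0" using supp[unfolded supp_in_def, THEN bspec, OF test] ex by (rule mp)
    have rg: "(\<lambda>x. of_real R * (1 - cut R x) * g x) \<in> pointwise_mult {\<lambda>x. of_real R * (1 - cut R x) | R. R \<ge> 1} {g}"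
      by (rule pointwise_multI) (use R in blast, simp)
    have "?T (\<lambda>x. of_real R * g x + (- of_real R) * (cut R x * g x)) = of_real R * ?T g"
      using sob_dist_linear(1)[OF \<alpha> \<psi> schwartz_e_cmult[OF g, of "of_real R"] schwartz_e_cmult[OF cg, of "- of_real R"], of s]
        sob_dist_linear(2)[OF \<alpha> \<psi> g, of s "of_real R"] sob_dist_linear(2)[OF \<alpha> \<psi> cg, of s "- of_real R"] z by simp
    moreover have "(\<lambda>x. of_real R * g x + (- of_real R) * (cut R x * g x)) = (\<lambda>x. of_real R * (1 - cut R x) * g x)"
      by (simp add: fun_eq_iff algebra_simps)
    ultimately have "norm (of_real R * ?T g) \<le> C" using C[OF rg] by simp
    then show ?thesis using R by (simp add: norm_mult)
  qed
  show ?thesis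
  proof (rule ccontr)
    assume "?T g \<noteq> 0"
    then have p: "norm (?T g) > 0" by simp
    obtain n where n: "C / norm (?T g) < real n" using reals_Archimedean2 by blast
    then have "C < real n * norm (?T g)" using p by (simp add: pos_divide_less_eq)
    also have "\<dots> \<le> max 1 (real n) * norm (?T g)" by (intro mult_right_mono) auto
    finally show False using bound[of "max 1 (real n)"] by simp
  qed
qed

lemma schwartz_if_compact_support:
  fixes f :: "real ^ 'n \<Rightarrow> complex"
  assumes f: "mult_bdd {f}" and z: "\<And>x. \<rho> \<le> norm x \<Longrightarrow> f x = 0"
  shows "f \<in> schwartz_e"
proof -
  have b: "bdd_smooth slow {f}" and e: "even_fun f" using f by (auto simp: mult_bdd_def)
  \<comment> \<open>The strict inequality describes an open set, on which a vanishing function has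
    vanishing derivatives.\<close>
  have zero: "partials is f x = 0" if "\<rho> < norm x" for "is" x
    using that
  proof (induction "is" arbitrary: x)
    case Nil
    then show ?case using z by simp
  next
    case (Cons i js)
    have "open {x :: real ^ 'n. \<rho> < norm x}" by (intro open_Collect_less continuous_intros)
    then have "(partials js f has_derivative (\<lambda>h. 0)) (at x)"
      by (rule has_derivative_transform_within_open[OF has_derivative_const]) (use Cons in auto)
    from partial_eqI[OF this, of i] show ?case by simp
  qed
  have "schwartz_bdd {f}"
    unfolding schwartz_bdd_def bdd_smooth_iff
  proof (intro conjI allI ballI)
    fix "is" :: "'n list"
    show "rapid (partials is ` {f})"
      unfolding rapid_def
    proof
      fix k
      obtain C m where C: "C > 0" "\<And>g x. g \<in> partials is ` {f} \<Longrightarrow> norm (g x) \<le> C * (1 + norm x) ^ m"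
        using slowE[of "partials is ` {f}"] b unfolding bdd_smooth_iff by metis
      have "(1 + norm x) ^ k * norm (partials is f x) \<le> C * (1 + \<bar>\<rho>\<bar>) ^ (k + m)" for x
      proof (cases "\<rho> < norm x")
        case True
        then show ?thesis using zero C(1) by simp
      next
        case False
        have "(1 + norm x) ^ k * norm (partials is f x) \<le> (1 + norm x) ^ k * (C * (1 + norm x) ^ m)"
          using C(2) by (intro mult_left_mono) auto
        also have "\<dots> = C * (1 + norm x) ^ (k + m)" by (simp add: power_add)
        also have "\<dots> \<le> C * (1 + \<bar>\<rho>\<bar>) ^ (k + m)"
          using False C(1) by (intro mult_left_mono power_mono) auto
        finally show ?thesis .
      qed
      then show "\<exists>C. \<forall>f\<in>partials is ` {f}. \<forall>x. (1 + norm x) ^ k * norm (f x) \<le> C" by blast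
    qed
    show "partials is g differentiable at x" if "g \<in> {f}" for g x
      using b that unfolding bdd_smooth_iff by blast
  qed (use e in simp)
  then show ?thesis by (simp add: schwartz_e_iff)
qed

text \<open>A derivative of the kernel in \<open>x\<close> costs a factor \<eta>_i^2. The Gaussian
  bound on the coefficient \<open>c\<close> absorbs every such power, so one family covers all
  \<eta>; the index \<open>N\<close> counts the derivatives taken so far.\<close>

lemma mult_bdd_kernels:
  fixes \<alpha> :: "real ^ 'n"
  assumes \<alpha>: "admissible \<alpha>"
  shows "mult_bdd {\<lambda>x. complex_of_real (c * bessel_kernel \<alpha> \<eta> x) | c \<eta>. \<bar>c\<bar> \<le> exp (- ((norm \<eta>)\<^sup>2 / 2))}"
proof -
  define B where "B = (\<lambda>(\<beta>, N). {\<lambda>x. complex_of_real (c * bessel_kernel \<beta> \<eta> x) | c (\<eta> :: real ^ 'n).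
      \<bar>c\<bar> \<le> exp (- ((norm \<eta>)\<^sup>2 / 2)) * (1 + (norm \<eta>)\<^sup>2) ^ N})"
  have "bdd_smooth slow (B (\<alpha>, 0))"
  proof (rule growth.bdd_smooth_family[OF growth_slow, where I = "Collect admissible \<times> UNIV" and B = B])
    show "(\<alpha>, 0) \<in> Collect admissible \<times> UNIV" using \<alpha> by simp
    fix a :: "(real ^ 'n) \<times> nat" assume "a \<in> Collect admissible \<times> UNIV"
    then obtain \<beta> N where a: "a = (\<beta>, N)" and \<beta>: "admissible \<beta>" by auto
    have der: "((\<lambda>x. complex_of_real (c * bessel_kernel \<beta> \<eta> x)) has_derivative
        (\<lambda>h. complex_of_real (c * (\<Sum>i\<in>UNIV. h $ i * bessel_kernel_deriv \<beta> i x \<eta>)))) (at x)" for c \<eta> x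
      unfolding bessel_kernel_commute[of \<beta> \<eta>]
      by (intro has_derivative_of_real has_derivative_mult_right bessel_kernel_has_derivative \<beta>)
    show "slow (B a)"
    proof -
      \<comment> \<open>The constant of \<open>poly_exp_bound\<close> with \<open>m = 1/2\<close>
        and exponent \<open>2 * N\<close>, because \<open>1 + |\<eta>|^2\<close> is at most
        \<open>(1 + |\<eta>|)^2\<close>.\<close>
      define C where "C = 2 ^ (2 * N) * ((real (2 * N) / (1 / 2)) ^ (2 * N) * exp (1 / 2))"
      have "norm (complex_of_real (c * bessel_kernel \<beta> \<eta> x)) \<le> C * (1 + norm x) ^ 0"
        if c: "\<bar>c\<bar> \<le> exp (- ((norm \<eta>)\<^sup>2 / 2)) * (1 + (norm \<eta>)\<^sup>2) ^ N" for c and \<eta> x :: "real ^ 'n"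
      proof -
        have "norm (complex_of_real (c * bessel_kernel \<beta> \<eta> x)) \<le> \<bar>c\<bar> * 1"
          unfolding norm_of_real abs_mult by (intro mult_left_mono abs_bessel_kernel_le \<beta>) simp
        also have "\<dots> \<le> exp (- ((norm \<eta>)\<^sup>2 / 2)) * (1 + (norm \<eta>)\<^sup>2) ^ N" using c by simp
        also have "\<dots> \<le> exp (- ((norm \<eta>)\<^sup>2 / 2)) * ((1 + norm \<eta>)\<^sup>2) ^ N"
          by (intro mult_left_mono power_mono) (auto simp: power2_sum)
        also have "\<dots> = (1 + norm \<eta>) ^ (2 * N) * exp (- ((norm \<eta>)\<^sup>2 / 2))"
          by (subst power_mult) (rule mult.commute)
        also have "\<dots> = (1 + norm \<eta>) ^ (2 * N) * exp (- (1 / 2) * (norm \<eta>)\<^sup>2)" by simp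
        also have "\<dots> \<le> C" unfolding C_def by (intro poly_exp_bound) auto
        finally show ?thesis by simp
      qed
      then show ?thesis unfolding slow_def B_def a prod.case by blast
    qed
    show "f differentiable at x" if "f \<in> B a" for f x
      using that der unfolding B_def a differentiable_def by auto
    fix i :: 'n
    have sub: "partial i ` B a \<subseteq> pointwise_mult (linear_coords \<bar>1 / (2 * (\<beta> $ i + 1))\<bar> i) (B (\<beta> + axis i 1, Suc N))"
    proof
      fix h assume "h \<in> partial i ` B a"
      then obtain c and \<eta> :: "real ^ 'n" where c: "\<bar>c\<bar> \<le> exp (- ((norm \<eta>)\<^sup>2 / 2)) * (1 + (norm \<eta>)\<^sup>2) ^ N"
        and h: "h = partial i (\<lambda>x. complex_of_real (c * bessel_kernel \<beta> \<eta> x))" by (auto simp: B_def a)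
      have h': "h = (\<lambda>x. (complex_of_real (- (1 / (2 * (\<beta> $ i + 1)))) * of_real (x $ i)) *
          complex_of_real ((c * (\<eta> $ i)\<^sup>2) * bessel_kernel (\<beta> + axis i 1) \<eta> x))"
      proof
        fix x
        have "h x = complex_of_real (c * (\<Sum>j\<in>UNIV. axis i 1 $ j * bessel_kernel_deriv \<beta> j x \<eta>))"
          unfolding h by (rule partial_eqI[OF der])
        also have "(\<Sum>j\<in>UNIV. axis i 1 $ j * bessel_kernel_deriv \<beta> j x \<eta>) = bessel_kernel_deriv \<beta> i x \<eta>"
          by (auto simp: axis_def if_distrib if_distribR cong: if_cong)
        finally show "h x = (complex_of_real (- (1 / (2 * (\<beta> $ i + 1)))) * of_real (x $ i)) *
          complex_of_real ((c * (\<eta> $ i)\<^sup>2) * bessel_kernel (\<beta> + axis i 1) \<eta> x)"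
          unfolding bessel_kernel_deriv_def bessel_kernel_commute[of _ \<eta> x] by (simp add: mult_ac)
      qed
      have m: "(\<lambda>x. complex_of_real (- (1 / (2 * (\<beta> $ i + 1)))) * of_real (x $ i)) \<in> linear_coords \<bar>1 / (2 * (\<beta> $ i + 1))\<bar> i"
        unfolding linear_coords_def by (intro CollectI exI conjI, rule refl, rule norm_of_real_minus_le)
      have "\<bar>c * (\<eta> $ i)\<^sup>2\<bar> \<le> exp (- ((norm \<eta>)\<^sup>2 / 2)) * (1 + (norm \<eta>)\<^sup>2) ^ Suc N"
      proof -
        have "(\<eta> $ i)\<^sup>2 \<le> (norm \<eta>)\<^sup>2"
          using component_le_norm_cart[of \<eta> i] by (simp add: abs_le_square_iff[symmetric])
        then have "(\<eta> $ i)\<^sup>2 \<le> 1 + (norm \<eta>)\<^sup>2" by simp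
        then have "\<bar>c\<bar> * (\<eta> $ i)\<^sup>2 \<le> (exp (- ((norm \<eta>)\<^sup>2 / 2)) * (1 + (norm \<eta>)\<^sup>2) ^ N) * (1 + (norm \<eta>)\<^sup>2)"
          using c by (intro mult_mono) auto
        then show ?thesis by (simp add: abs_mult mult_ac)
      qed
      then have k: "(\<lambda>x. complex_of_real ((c * (\<eta> $ i)\<^sup>2) * bessel_kernel (\<beta> + axis i 1) \<eta> x)) \<in> B (\<beta> + axis i 1, Suc N)"
        unfolding B_def by blast
      show "h \<in> pointwise_mult (linear_coords \<bar>1 / (2 * (\<beta> $ i + 1))\<bar> i) (B (\<beta> + axis i 1, Suc N))"
        unfolding h' by (rule pointwise_multI[OF m k])
    qed
    have "(\<beta> + axis i 1, Suc N) \<in> Collect admissible \<times> UNIV" using admissible_shift[OF \<beta>] by simp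
    then show "\<exists>b\<in>Collect admissible \<times> UNIV. \<exists>C. partial i ` B a \<subseteq> pointwise_mult (linear_coords C i) (B b)"
      by (rule bexI[rotated]) (rule exI, rule sub)
  qed
  moreover have "even_fun f" if "f \<in> B (\<alpha>, 0)" for f
  proof -
    have "bessel_kernel \<alpha> \<eta> (reflect i x) = bessel_kernel \<alpha> \<eta> x" for \<eta> x i
      using bessel_kernel_reflect[OF \<alpha>, of i x \<eta>] by (simp only: bessel_kernel_commute[of \<alpha> \<eta>])
    then show ?thesis using that by (auto simp: B_def even_fun_reflect)
  qed
  ultimately have "mult_bdd (B (\<alpha>, 0))" unfolding mult_bdd_def by blast
  then show ?thesis unfolding B_def by simp
qed

section \<open>The transform of a compactly supported distribution is given by a kernel\<close>

lemma bessel_kernel_measurable: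
  assumes \<alpha>: "admissible \<alpha>" and u: "u \<in> N \<rightarrow>\<^sub>M borel" and v: "v \<in> N \<rightarrow>\<^sub>M borel"
  shows "(\<lambda>w. bessel_kernel \<alpha> (u w) (v w)) \<in> borel_measurable N"
proof -
  have "(\<lambda>z. bessel_kernel \<alpha> (fst z) (snd z)) \<in> borel_measurable (borel \<Otimes>\<^sub>M borel)"
    unfolding borel_prod by (intro borel_measurable_continuous_onI continuous_intros \<alpha>)
  from measurable_compose[OF measurable_Pair[OF u v] this] show ?thesis by simp
qed

lemma id_bessel_measurable: "(\<lambda>x. x) \<in> bessel_measure \<alpha> \<rightarrow>\<^sub>M borel"
  by (intro borel_imp_bessel_measurable) simp

lemma integrable_tensor:
  fixes u v :: "real ^ 'n \<Rightarrow> real"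
  assumes u: "integrable (bessel_measure \<alpha>) u" and v: "integrable (bessel_measure \<alpha>) v"
  shows "integrable (bessel_measure \<alpha> \<Otimes>\<^sub>M bessel_measure \<alpha>) (\<lambda>(x, y). u x * v y)"
proof -
  interpret M: sigma_finite_measure "bessel_measure \<alpha>" by (rule sigma_finite_bessel)
  interpret P: pair_sigma_finite "bessel_measure \<alpha>" "bessel_measure \<alpha>" ..
  have [measurable]: "u \<in> borel_measurable (bessel_measure \<alpha>)" "v \<in> borel_measurable (bessel_measure \<alpha>)"
    using u v by auto
  show ?thesis
  proof (rule P.Fubini_integrable)
    show "integrable (bessel_measure \<alpha>) (\<lambda>x. LINT y|bessel_measure \<alpha>. norm (case (x, y) of (x, y) \<Rightarrow> u x * v y))"
      using u by (simp add: abs_mult)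
    show "AE x in bessel_measure \<alpha>. integrable (bessel_measure \<alpha>) (\<lambda>y. case (x, y) of (x, y) \<Rightarrow> u x * v y)"
      using v by simp
  qed measurable
qed

text \<open>Divided by the exponential in \<eta>, the functions \<open>k \<eta>\<close> form a
  rapidly decreasing family, hence their norms are bounded. Along a convergent sequence the
  exponential is bounded as well, and dominated convergence gives continuity into L2.\<close>

lemma kernel_L2:
  fixes k :: "real ^ 'n \<Rightarrow> real ^ 'n \<Rightarrow> complex"
  assumes \<alpha>: "admissible \<alpha>"
    and k: "\<And>N. \<exists>C. \<forall>\<eta> \<xi>. (1 + norm \<xi>) ^ N * norm (k \<eta> \<xi>) \<le> C * exp ((norm \<eta>)\<^sup>2 / 2)"
    and c1: "\<And>\<eta>. continuous_on UNIV (k \<eta>)" and c2: "\<And>\<xi>. continuous_on UNIV (\<lambda>\<eta>. k \<eta> \<xi>)"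
  shows "k \<eta> \<in> L2 \<alpha>"
    and "\<exists>C. \<forall>\<eta>. L2_norm \<alpha> (k \<eta>) \<le> C * exp ((norm \<eta>)\<^sup>2 / 2)"
    and "X \<longlonglongrightarrow> \<eta> \<Longrightarrow> (\<lambda>m. L2_norm \<alpha> (\<lambda>\<xi>. k (X m) \<xi> - k \<eta> \<xi>)) \<longlonglongrightarrow> 0"
proof -
  let ?e = "\<lambda>\<eta>::real ^ 'n. exp ((norm \<eta>)\<^sup>2 / 2)"
  define B where "B = {\<lambda>\<xi>. of_real (inverse (?e \<eta>)) * k \<eta> \<xi> | \<eta>. True}"
  have "rapid B"
    unfolding rapid_def
  proof
    fix N
    obtain C where C: "\<And>\<eta> \<xi>. (1 + norm \<xi>) ^ N * norm (k \<eta> \<xi>) \<le> C * ?e \<eta>" using k by blast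
    have "(1 + norm \<xi>) ^ N * norm (of_real (inverse (?e \<eta>)) * k \<eta> \<xi>) \<le> C" for \<eta> \<xi>
    proof -
      have "(1 + norm \<xi>) ^ N * norm (of_real (inverse (?e \<eta>)) * k \<eta> \<xi>) = inverse (?e \<eta>) * ((1 + norm \<xi>) ^ N * norm (k \<eta> \<xi>))"
        unfolding norm_mult norm_of_real by simp
      also have "\<dots> \<le> inverse (?e \<eta>) * (C * ?e \<eta>)" by (intro mult_left_mono C) simp
      also have "\<dots> = C" by simp
      finally show ?thesis .
    qed
    then show "\<exists>C. \<forall>f\<in>B. \<forall>x. (1 + norm x) ^ N * norm (f x) \<le> C" unfolding B_def by blast
  qed
  then obtain C where C: "C > 0" "\<And>f. f \<in> B \<Longrightarrow> f \<in> borel_measurable (bessel_measure \<alpha>) \<Longrightarrow> f \<in> L2 \<alpha> \<and> L2_norm \<alpha> f \<le> C"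
    using rapid_L2_bound[OF \<alpha>] by metis
  have C': "(\<lambda>\<xi>. of_real (inverse (?e \<eta>)) * k \<eta> \<xi>) \<in> L2 \<alpha> \<and> L2_norm \<alpha> (\<lambda>\<xi>. of_real (inverse (?e \<eta>)) * k \<eta> \<xi>) \<le> C" for \<eta>
  proof (rule C(2))
    show "(\<lambda>\<xi>. of_real (inverse (?e \<eta>)) * k \<eta> \<xi>) \<in> B" unfolding B_def by blast
    show "(\<lambda>\<xi>. of_real (inverse (?e \<eta>)) * k \<eta> \<xi>) \<in> borel_measurable (bessel_measure \<alpha>)"
      by (intro continuous_imp_bessel_measurable continuous_intros c1)
  qed
  have kL: "k \<eta> \<in> L2 \<alpha>" for \<eta>
    using L2_cmult[OF conjunct1[OF C'], of "of_real (?e \<eta>)" \<eta>] by (simp add: mult.assoc[symmetric] of_real_mult[symmetric] del: of_real_mult)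
  then show "k \<eta> \<in> L2 \<alpha>" .
  have "L2_norm \<alpha> (k \<eta>) \<le> C * ?e \<eta>" for \<eta>
  proof -
    have "L2_norm \<alpha> (\<lambda>\<xi>. of_real (inverse (?e \<eta>)) * k \<eta> \<xi>) = inverse (?e \<eta>) * L2_norm \<alpha> (k \<eta>)"
      unfolding L2_norm_def norm_mult norm_of_real power_mult_distrib by (simp add: real_sqrt_mult)
    then have "inverse (?e \<eta>) * L2_norm \<alpha> (k \<eta>) \<le> C" using C' by metis
    then have "?e \<eta> * (inverse (?e \<eta>) * L2_norm \<alpha> (k \<eta>)) \<le> ?e \<eta> * C" by (intro mult_left_mono) auto
    then show ?thesis
      by (simp only: mult.assoc[symmetric] right_inverse[OF exp_not_eq_zero] mult_1_left mult.commute[of C])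
  qed
  then show "\<exists>C. \<forall>\<eta>. L2_norm \<alpha> (k \<eta>) \<le> C * ?e \<eta>" by blast
  assume X: "X \<longlonglongrightarrow> \<eta>"
  obtain N where N: "integrable (bessel_measure \<alpha>) (\<lambda>x. 1 / (1 + norm x) ^ N)"
    using integrable_decay[OF \<alpha>] .
  obtain D where D: "\<And>\<eta> \<xi>. (1 + norm \<xi>) ^ N * norm (k \<eta> \<xi>) \<le> D * ?e \<eta>" using k by blast
  obtain R where R: "\<And>m. norm (X m) \<le> R"
    using convergent_imp_bounded[OF X] unfolding bounded_iff by auto
  have R': "norm \<eta> \<le> R" using LIMSEQ_le_const2[OF tendsto_norm[OF X]] R by blast
  have "norm (k 0 0) \<le> D" using D[of 0 0] by simp
  then have D0: "0 \<le> D" by (rule order_trans[OF norm_ge_zero])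
  define E where "E = D * exp (R\<^sup>2 / 2)"
  have E0: "0 \<le> E" using D0 by (simp add: E_def)
  have b: "norm (k \<zeta> \<xi>) \<le> E / (1 + norm \<xi>) ^ N" if "norm \<zeta> \<le> R" for \<zeta> \<xi>
  proof (rule le_divide_power)
    have "D * ?e \<zeta> \<le> E" unfolding E_def
      using that D0 by (intro mult_left_mono) (auto intro!: power_mono)
    with D[of \<xi> \<zeta>] show "(1 + norm \<xi>) ^ N * norm (k \<zeta> \<xi>) \<le> E" by simp
  qed
  have "(\<lambda>m. LINT \<xi>|bessel_measure \<alpha>. (norm (k (X m) \<xi> - k \<eta> \<xi>))\<^sup>2) \<longlonglongrightarrow> (LINT \<xi>|bessel_measure \<alpha>. 0)"
  proof (rule integral_dominated_convergence[where w = "\<lambda>\<xi>. (2 * E)\<^sup>2 * (1 / (1 + norm \<xi>) ^ N)"])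
    show "integrable (bessel_measure \<alpha>) (\<lambda>\<xi>. (2 * E)\<^sup>2 * (1 / (1 + norm \<xi>) ^ N))" by (intro integrable_mult_right N)
    show "(\<lambda>\<xi>. (norm (k (X m) \<xi> - k \<eta> \<xi>))\<^sup>2) \<in> borel_measurable (bessel_measure \<alpha>)" for m
      by (intro continuous_imp_bessel_measurable continuous_intros c1)
    show "AE \<xi> in bessel_measure \<alpha>. (\<lambda>m. (norm (k (X m) \<xi> - k \<eta> \<xi>))\<^sup>2) \<longlonglongrightarrow> 0"
    proof (rule AE_I2)
      fix \<xi>
      have "(\<lambda>m. k (X m) \<xi>) \<longlonglongrightarrow> k \<eta> \<xi>"
        using continuous_on_tendsto_compose[OF c2 X] by simp
      then have "(\<lambda>m. (norm (k (X m) \<xi> - k \<eta> \<xi>))\<^sup>2) \<longlonglongrightarrow> (norm (k \<eta> \<xi> - k \<eta> \<xi>))\<^sup>2"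
        by (intro tendsto_intros)
      then show "(\<lambda>m. (norm (k (X m) \<xi> - k \<eta> \<xi>))\<^sup>2) \<longlonglongrightarrow> 0" by simp
    qed
    show "AE \<xi> in bessel_measure \<alpha>. norm ((norm (k (X m) \<xi> - k \<eta> \<xi>))\<^sup>2) \<le> (2 * E)\<^sup>2 * (1 / (1 + norm \<xi>) ^ N)" for m
    proof (rule AE_I2)
      fix \<xi> :: "real ^ 'n"
      have p: "1 / (1 + norm \<xi>) ^ N \<le> 1"
        by (rule divide_le_eq_1_pos[THEN iffD2]) (auto intro!: one_le_power zero_less_power add_pos_nonneg)
      have "norm (k (X m) \<xi> - k \<eta> \<xi>) \<le> 2 * E * (1 / (1 + norm \<xi>) ^ N)"
        using norm_triangle_ineq4[of "k (X m) \<xi>" "k \<eta> \<xi>"] b[OF R[of m], of \<xi>] b[OF R', of \<xi>] by simp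
      then have "(norm (k (X m) \<xi> - k \<eta> \<xi>))\<^sup>2 \<le> (2 * E * (1 / (1 + norm \<xi>) ^ N))\<^sup>2"
        by (intro power_mono) auto
      also have "\<dots> = (2 * E)\<^sup>2 * ((1 / (1 + norm \<xi>) ^ N) * (1 / (1 + norm \<xi>) ^ N))"
        unfolding power_mult_distrib power2_eq_square[of "1 / _"] ..
      also have "\<dots> \<le> (2 * E)\<^sup>2 * ((1 / (1 + norm \<xi>) ^ N) * 1)"
        using p by (intro mult_left_mono) auto
      finally show "norm ((norm (k (X m) \<xi> - k \<eta> \<xi>))\<^sup>2) \<le> (2 * E)\<^sup>2 * (1 / (1 + norm \<xi>) ^ N)" by simp
    qed
  qed simp
  then have "(\<lambda>m. sqrt (LINT \<xi>|bessel_measure \<alpha>. (norm (k (X m) \<xi> - k \<eta> \<xi>))\<^sup>2)) \<longlonglongrightarrow> sqrt 0"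
    by (intro tendsto_real_sqrt) simp
  then show "(\<lambda>m. L2_norm \<alpha> (\<lambda>\<xi>. k (X m) \<xi> - k \<eta> \<xi>)) \<longlonglongrightarrow> 0" by (simp add: L2_norm_def)
qed

lemma kernel_operator_difference:
  assumes \<psi>: "\<psi> \<in> L2 \<alpha>" and k: "k \<in> L2 \<alpha>" "k' \<in> L2 \<alpha>"
  shows "norm ((LINT \<xi>|bessel_measure \<alpha>. \<psi> \<xi> * k \<xi>) - (LINT \<xi>|bessel_measure \<alpha>. \<psi> \<xi> * k' \<xi>))
    \<le> L2_norm \<alpha> \<psi> * L2_norm \<alpha> (\<lambda>\<xi>. k \<xi> - k' \<xi>)"
proof -
  have "(LINT \<xi>|bessel_measure \<alpha>. \<psi> \<xi> * k \<xi>) - (LINT \<xi>|bessel_measure \<alpha>. \<psi> \<xi> * k' \<xi>) = (LINT \<xi>|bessel_measure \<alpha>. \<psi> \<xi> * (k \<xi> - k' \<xi>))"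
    unfolding right_diff_distrib
    by (rule Bochner_Integration.integral_diff[symmetric]) (intro L2_mult_integrable \<psi> k)+
  then show ?thesis using L2_Cauchy_Schwarz(2)[OF \<psi> L2_diff[OF k]] by simp
qed

lemma kernel_operator_continuous:
  fixes k :: "real ^ 'n \<Rightarrow> real ^ 'n \<Rightarrow> complex"
  assumes \<alpha>: "admissible \<alpha>" and \<psi>: "\<psi> \<in> L2 \<alpha>"
    and k: "\<And>N. \<exists>C. \<forall>\<eta> \<xi>. (1 + norm \<xi>) ^ N * norm (k \<eta> \<xi>) \<le> C * exp ((norm \<eta>)\<^sup>2 / 2)"
    and c1: "\<And>\<eta>. continuous_on UNIV (k \<eta>)" and c2: "\<And>\<xi>. continuous_on UNIV (\<lambda>\<eta>. k \<eta> \<xi>)"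
  shows "continuous_on UNIV (\<lambda>\<eta>. LINT \<xi>|bessel_measure \<alpha>. \<psi> \<xi> * k \<eta> \<xi>)"
  unfolding continuous_on_sequentially
proof (intro allI ballI impI)
  fix X and \<eta> :: "real ^ 'n" assume "(\<forall>n. X n \<in> UNIV) \<and> X \<longlonglongrightarrow> \<eta>"
  then have X: "X \<longlonglongrightarrow> \<eta>" by simp
  note kL = kernel_L2(1)[OF \<alpha> k c1 c2]
  have "(\<lambda>m. L2_norm \<alpha> \<psi> * L2_norm \<alpha> (\<lambda>\<xi>. k (X m) \<xi> - k \<eta> \<xi>)) \<longlonglongrightarrow> 0"
    using tendsto_mult_right_zero[OF kernel_L2(3)[OF \<alpha> k c1 c2 X]] .
  then have "(\<lambda>m. (LINT \<xi>|bessel_measure \<alpha>. \<psi> \<xi> * k (X m) \<xi>) - (LINT \<xi>|bessel_measure \<alpha>. \<psi> \<xi> * k \<eta> \<xi>)) \<longlonglongrightarrow> 0"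
    by (rule Lim_null_comparison[rotated]) (intro always_eventually allI kernel_operator_difference \<psi> kL)
  then show "((\<lambda>\<eta>. LINT \<xi>|bessel_measure \<alpha>. \<psi> \<xi> * k \<eta> \<xi>) \<circ> X) \<longlonglongrightarrow> (LINT \<xi>|bessel_measure \<alpha>. \<psi> \<xi> * k \<eta> \<xi>)"
    using LIM_zero_iff by (simp add: comp_def LIM_zero_iff)
qed

text \<open>Formally the transform of \<open>T\<close> at \<eta> is \<open>T\<close> applied to the
  Bessel kernel of \<eta>, which support in \<open>K\<close> permits to be cut off to
  \<open>e \<eta>\<close>. Inserting \<open>e \<eta>\<close> into the formula for
  \<open>sob_dist\<close> gives \<open>k\<close>. The identity is proved by testing both sides
  against Gaussians in \<eta> and exchanging the integrals.\<close>

lemma rellich_kernel: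
  fixes \<alpha> :: "real ^ 'n"
  assumes \<alpha>: "admissible \<alpha>" and K: "compact K"
  shows "\<exists>k :: real ^ 'n \<Rightarrow> real ^ 'n \<Rightarrow> complex.
    (\<forall>N. \<exists>C. \<forall>\<eta> \<xi>. (1 + norm \<xi>) ^ N * norm (k \<eta> \<xi>) \<le> C * exp ((norm \<eta>)\<^sup>2 / 2)) \<and>
    (\<forall>\<eta>. continuous_on UNIV (k \<eta>)) \<and> (\<forall>\<xi>. continuous_on UNIV (\<lambda>\<eta>. k \<eta> \<xi>)) \<and>
    (\<forall>\<psi>\<in>L2 \<alpha>. supp_in (sob_dist \<alpha> s \<psi>) K \<longrightarrow>
      (AE \<eta> in bessel_measure \<alpha>. (LINT \<xi>|bessel_measure \<alpha>. \<psi> \<xi> * k \<eta> \<xi>) = sob_weight (- s) \<eta> * \<psi> \<eta>))"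
proof -
  let ?F = "fourier_bessel \<alpha>" and ?M = "bessel_measure \<alpha>"
  define \<kappa> where "\<kappa> = inversion_const \<alpha>"
  have \<kappa>: "\<kappa> \<noteq> 0" unfolding \<kappa>_def by (rule inversion_const_nonzero[OF \<alpha>])
  obtain R where R: "R \<ge> 1" "\<And>x. x \<in> sign_orbit K \<Longrightarrow> norm x < R"
    using bounded_sign_orbit[OF K] by metis
  obtain cut :: "real \<Rightarrow> real ^ 'n \<Rightarrow> complex" where
    cut: "\<And>R x. R \<ge> 1 \<Longrightarrow> norm x \<le> R \<Longrightarrow> cut R x = 1" "\<And>R x. R \<ge> 1 \<Longrightarrow> 2 * R \<le> norm x \<Longrightarrow> cut R x = 0"
      "mult_bdd {cut R | R. R \<ge> 1}"
    using cutoff_exists by blast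
  define \<chi>0 where "\<chi>0 = cut R"
  have m0: "mult_bdd {\<chi>0}" by (rule mult_bdd_mono[OF cut(3)]) (use R(1) in \<open>auto simp: \<chi>0_def\<close>)
  have s0: "\<chi>0 \<in> schwartz_e"
    by (rule schwartz_if_compact_support[OF m0, of "2 * R"]) (use cut(2)[OF R(1)] in \<open>simp add: \<chi>0_def\<close>)
  define e where "e \<eta> = (\<lambda>x. complex_of_real (bessel_kernel \<alpha> \<eta> x) * \<chi>0 x)" for \<eta>
  define Bk where "Bk = {\<lambda>x. complex_of_real (c * bessel_kernel \<alpha> \<eta> x) | c \<eta>. \<bar>c\<bar> \<le> exp (- ((norm \<eta>)\<^sup>2 / 2))}"
  have Bk: "mult_bdd Bk" unfolding Bk_def by (rule mult_bdd_kernels[OF \<alpha>])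
  have Be: "schwartz_bdd (pointwise_mult Bk {\<chi>0})"
    using s0 by (intro schwartz_bdd_mult Bk) (simp add: schwartz_e_iff)
  \<comment> \<open>This damping puts all functions \<open>e \<eta>\<close> into one bounded set;
    removing it again leaves its reciprocal in the bounds for \<open>k\<close>.\<close>
  let ?\<theta> = "\<lambda>\<eta>::real ^ 'n. exp (- ((norm \<eta>)\<^sup>2 / 2))"
  have mem: "(\<lambda>x. of_real (?\<theta> \<eta>) * e \<eta> x) \<in> pointwise_mult Bk {\<chi>0}" for \<eta>
  proof -
    have "(\<lambda>x. complex_of_real (?\<theta> \<eta> * bessel_kernel \<alpha> \<eta> x)) \<in> Bk"
      unfolding Bk_def by (intro CollectI exI[of _ "?\<theta> \<eta>"] exI[of _ \<eta>] conjI refl) simp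
    from pointwise_multI[OF this singletonI[of \<chi>0]] show ?thesis
      unfolding e_def by (simp add: mult.assoc)
  qed
  have es: "e \<eta> \<in> schwartz_e" for \<eta>
  proof -
    have "(\<lambda>x. of_real (inverse (?\<theta> \<eta>)) * (of_real (?\<theta> \<eta>) * e \<eta> x)) \<in> schwartz_e"
      by (rule schwartz_e_cmult[OF schwartz_bdd_single[OF Be mem]])
    then show ?thesis by (simp add: mult.assoc[symmetric] of_real_mult[symmetric] del: of_real_mult)
  qed
  \<comment> \<open>The cut-off kernel is integrated against a second kernel, so \<eta> and \<xi>
    play the same role. Continuity in \<eta> and the integration over \<eta> are thereby reduced to
    facts about the transform of the fixed function \<open>e \<xi>\<close>.\<close>
  have sym: "?F (e \<eta>) \<xi> = ?F (e \<xi>) \<eta>" for \<eta> \<xi>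
    unfolding fourier_bessel_eq e_def by (simp only: mult_ac)
  define k where "k \<eta> \<xi> = sob_weight (- s) \<xi> * ?F (e \<eta>) \<xi> / \<kappa>" for \<eta> \<xi>
  have k1: "\<exists>C. \<forall>\<eta> \<xi>. (1 + norm \<xi>) ^ N * norm (k \<eta> \<xi>) \<le> C * exp ((norm \<eta>)\<^sup>2 / 2)" for N
  proof -
    let ?W = "pointwise_mult {sob_weight (- s) :: real ^ 'n \<Rightarrow> complex} (?F ` pointwise_mult Bk {\<chi>0})"
    have "schwartz_bdd ?W"
      by (intro schwartz_bdd_mult[OF mult_bdd_sob_weight] schwartz_bdd_fourier_bessel \<alpha> Be)
    then obtain C where C: "\<And>f \<xi>. f \<in> ?W \<Longrightarrow> (1 + norm \<xi>) ^ N * norm (f \<xi>) \<le> C"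
      using rapidE[OF schwartz_bdd_rapid, of ?W N] by metis
    have "(1 + norm \<xi>) ^ N * norm (k \<eta> \<xi>) \<le> (C / norm \<kappa>) * exp ((norm \<eta>)\<^sup>2 / 2)" for \<eta> \<xi>
    proof -
      have "(\<lambda>\<xi>. sob_weight (- s) \<xi> * ?F (\<lambda>x. of_real (?\<theta> \<eta>) * e \<eta> x) \<xi>) \<in> ?W"
        by (intro pointwise_multI singletonI imageI mem)
      from C[OF this, of \<xi>]
      have "(1 + norm \<xi>) ^ N * norm (sob_weight (- s) \<xi> * (of_real (?\<theta> \<eta>) * ?F (e \<eta>) \<xi>)) \<le> C"
        unfolding fourier_bessel_cmult .
      then have "?\<theta> \<eta> * ((1 + norm \<xi>) ^ N * norm (sob_weight (- s) \<xi> * ?F (e \<eta>) \<xi>)) \<le> C"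
        by (simp add: norm_mult mult_ac)
      then have "exp ((norm \<eta>)\<^sup>2 / 2) * (?\<theta> \<eta> * ((1 + norm \<xi>) ^ N * norm (sob_weight (- s) \<xi> * ?F (e \<eta>) \<xi>))) \<le> exp ((norm \<eta>)\<^sup>2 / 2) * C"
        by (intro mult_left_mono) auto
      then have "(1 + norm \<xi>) ^ N * norm (sob_weight (- s) \<xi> * ?F (e \<eta>) \<xi>) \<le> C * exp ((norm \<eta>)\<^sup>2 / 2)"
        by (simp only: mult.assoc[symmetric] exp_add[symmetric] add.right_inverse exp_zero mult_1_left mult.commute[of C])
      then have "(1 + norm \<xi>) ^ N * norm (sob_weight (- s) \<xi> * ?F (e \<eta>) \<xi>) / norm \<kappa> \<le> C * exp ((norm \<eta>)\<^sup>2 / 2) / norm \<kappa>"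
        by (intro divide_right_mono) auto
      then show ?thesis by (simp add: k_def norm_divide)
    qed
    then show ?thesis by blast
  qed
  have c1: "continuous_on UNIV (k \<eta>)" for \<eta>
    unfolding k_def[abs_def]
    by (intro continuous_on_divide continuous_on_mult continuous_sob_weight schwartz_e_continuous fourier_bessel_schwartz \<alpha> es continuous_on_const) (use \<kappa> in simp)
  have c2: "continuous_on UNIV (\<lambda>\<eta>. k \<eta> \<xi>)" for \<xi>
    unfolding k_def sym[of _ \<xi>]
    by (intro continuous_on_divide continuous_on_mult schwartz_e_continuous fourier_bessel_schwartz \<alpha> es continuous_on_const) (use \<kappa> in simp)
  note kL = kernel_L2(1)[OF \<alpha> k1 c1 c2]
  have kmeas: "(\<lambda>z. k (fst z) (snd z)) \<in> borel_measurable (?M \<Otimes>\<^sub>M ?M)"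
  proof -
    interpret M: sigma_finite_measure ?M by (rule sigma_finite_bessel)
    note id [measurable] = id_bessel_measurable[of \<alpha>]
    have f1: "fst \<in> ?M \<Otimes>\<^sub>M ?M \<rightarrow>\<^sub>M borel" and f2: "snd \<in> ?M \<Otimes>\<^sub>M ?M \<rightarrow>\<^sub>M borel"
      using measurable_compose[OF measurable_fst id] measurable_compose[OF measurable_snd id] by simp_all
    have g1: "(\<lambda>w. fst (fst w)) \<in> (?M \<Otimes>\<^sub>M ?M) \<Otimes>\<^sub>M ?M \<rightarrow>\<^sub>M borel"
      and g2: "(\<lambda>w. snd (fst w)) \<in> (?M \<Otimes>\<^sub>M ?M) \<Otimes>\<^sub>M ?M \<rightarrow>\<^sub>M borel"
      and g3: "(\<lambda>w. snd w) \<in> (?M \<Otimes>\<^sub>M ?M) \<Otimes>\<^sub>M ?M \<rightarrow>\<^sub>M borel"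
      using measurable_compose[OF measurable_fst f1] measurable_compose[OF measurable_fst f2] measurable_compose[OF measurable_snd id] by simp_all
    have "\<chi>0 \<in> borel_measurable borel" by (intro borel_measurable_continuous_onI schwartz_e_continuous s0)
    from measurable_compose[OF g3 this] have x: "(\<lambda>w. \<chi>0 (snd w)) \<in> borel_measurable ((?M \<Otimes>\<^sub>M ?M) \<Otimes>\<^sub>M ?M)" .
    have "(\<lambda>w. complex_of_real (bessel_kernel \<alpha> (fst (fst w)) (snd w)) * \<chi>0 (snd w) * complex_of_real (bessel_kernel \<alpha> (snd (fst w)) (snd w)))
      \<in> borel_measurable ((?M \<Otimes>\<^sub>M ?M) \<Otimes>\<^sub>M ?M)"
      by (intro borel_measurable_times x measurable_compose[OF bessel_kernel_measurable[OF \<alpha> g1 g3]]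
        measurable_compose[OF bessel_kernel_measurable[OF \<alpha> g2 g3]] borel_measurable_of_real)
    then have "(\<lambda>(z, x). e (fst z) x * complex_of_real (bessel_kernel \<alpha> (snd z) x)) \<in> borel_measurable ((?M \<Otimes>\<^sub>M ?M) \<Otimes>\<^sub>M ?M)"
      by (simp add: e_def split_beta')
    from M.borel_measurable_lebesgue_integral[OF this]
    have "(\<lambda>z. ?F (e (fst z)) (snd z)) \<in> borel_measurable (?M \<Otimes>\<^sub>M ?M)" unfolding fourier_bessel_eq by simp
    moreover have "(\<lambda>z. sob_weight (- s) (snd z)) \<in> borel_measurable (?M \<Otimes>\<^sub>M ?M)"
      by (intro measurable_compose[OF f2] borel_measurable_continuous_onI continuous_sob_weight)
    ultimately show ?thesis unfolding k_def by (intro borel_measurable_divide borel_measurable_times) auto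
  qed
  have rep: "AE \<eta> in ?M. (LINT \<xi>|?M. \<psi> \<xi> * k \<eta> \<xi>) = sob_weight (- s) \<eta> * \<psi> \<eta>"
    if \<psi>: "\<psi> \<in> L2 \<alpha>" and supp: "supp_in (sob_dist \<alpha> s \<psi>) K" for \<psi>
  proof -
    define g where "g \<eta> = (LINT \<xi>|?M. \<psi> \<xi> * k \<eta> \<xi>)" for \<eta>
    have gc: "continuous_on UNIV g"
      unfolding g_def by (rule kernel_operator_continuous[OF \<alpha> \<psi> k1 c1 c2])
    obtain C where C: "\<And>\<eta>. L2_norm \<alpha> (k \<eta>) \<le> C * exp ((norm \<eta>)\<^sup>2 / 2)"
      using kernel_L2(2)[OF \<alpha> k1 c1 c2] by blast
    have gb: "norm (g \<eta>) \<le> L2_norm \<alpha> \<psi> * C * exp ((norm \<eta>)\<^sup>2 / 2)" for \<eta>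
    proof -
      have "norm (g \<eta>) \<le> L2_norm \<alpha> \<psi> * L2_norm \<alpha> (k \<eta>)" unfolding g_def by (intro L2_Cauchy_Schwarz(2) \<psi> kL)
      also have "\<dots> \<le> L2_norm \<alpha> \<psi> * (C * exp ((norm \<eta>)\<^sup>2 / 2))" by (intro mult_left_mono C L2_norm_nonneg)
      finally show ?thesis by (simp add: mult.assoc)
    qed
    \<comment> \<open>Half the rate of \<open>gauss 1\<close>: the growth
      \<open>exp (|\<eta>|^2/2)\<close> times a Gaussian with rates at least 1 is bounded by
      \<open>gauss h\<close>, which is integrable.\<close>
    define h :: "real ^ 'n" where "h = (\<chi> i. 1 / 2)"
    have gh: "integrable ?M (\<lambda>\<eta>. norm (gauss h \<eta>))"
      by (intro integrable_norm schwartz_integrable \<alpha> gauss_schwartz) (simp add: h_def)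
    have gauss_h: "norm (gauss h \<eta>) = exp (- ((norm \<eta>)\<^sup>2 / 2))" for \<eta> :: "real ^ 'n"
      by (simp add: gauss_def h_def norm_square_sum sum_divide_distrib)
    have gauss_le: "norm (gauss a \<eta>) \<le> exp (- (norm \<eta>)\<^sup>2)" if "\<And>i. 1 \<le> a $ i" for a \<eta> :: "real ^ 'n"
    proof -
      have "(\<eta> $ i)\<^sup>2 \<le> a $ i * (\<eta> $ i)\<^sup>2" for i
        using mult_right_mono[OF that[of i] zero_le_power2[of "\<eta> $ i"]] by simp
      then have "(\<Sum>i\<in>UNIV. (\<eta> $ i)\<^sup>2) \<le> (\<Sum>i\<in>UNIV. a $ i * (\<eta> $ i)\<^sup>2)" by (intro sum_mono)
      then show ?thesis by (simp add: gauss_def norm_square_sum)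
    qed
    have eg: "exp ((norm \<eta>)\<^sup>2 / 2) * norm (gauss a \<eta>) \<le> norm (gauss h \<eta>)" if "\<And>i. 1 \<le> a $ i" for a \<eta> :: "real ^ 'n"
    proof -
      have "exp ((norm \<eta>)\<^sup>2 / 2) * norm (gauss a \<eta>) \<le> exp ((norm \<eta>)\<^sup>2 / 2) * exp (- (norm \<eta>)\<^sup>2)"
        by (intro mult_left_mono gauss_le that) auto
      also have "\<dots> = exp (- ((norm \<eta>)\<^sup>2 / 2))" by (simp add: exp_add[symmetric])
      finally show ?thesis by (simp add: gauss_h)
    qed
    have wpsi: "integrable ?M (\<lambda>\<eta>. sob_weight (- s) \<eta> * \<psi> \<eta> * gauss a \<eta>)" if "\<And>i. a $ i > 0" for a
    proof -
      have "integrable ?M (\<lambda>\<eta>. \<psi> \<eta> * (sob_weight (- s) \<eta> * gauss a \<eta>))"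
        by (intro L2_mult_integrable \<psi> schwartz_L2 \<alpha> sob_weight_schwartz gauss_schwartz that)
      then show ?thesis by (simp only: mult_ac)
    qed
    have gint: "integrable ?M (\<lambda>\<eta>. g \<eta> * gauss a \<eta>)" if a: "\<And>i. 1 \<le> a $ i" for a
    proof (rule Bochner_Integration.integrable_bound[OF integrable_mult_right[OF gh, of "L2_norm \<alpha> \<psi> * C"]])
      have "a $ i > 0" for i using a[of i] by simp
      then show "(\<lambda>\<eta>. g \<eta> * gauss a \<eta>) \<in> borel_measurable ?M"
        by (intro continuous_imp_bessel_measurable continuous_on_mult gc schwartz_e_continuous gauss_schwartz)
      show "AE \<eta> in ?M. norm (g \<eta> * gauss a \<eta>) \<le> norm (L2_norm \<alpha> \<psi> * C * norm (gauss h \<eta>))"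
      proof (rule AE_I2)
        fix \<eta> :: "real ^ 'n"
        have LC: "0 \<le> L2_norm \<alpha> \<psi> * C"
        proof -
          have "norm (g 0) \<le> L2_norm \<alpha> \<psi> * C" using gb[of 0] by simp
          then show ?thesis by (rule order_trans[OF norm_ge_zero])
        qed
        have "norm (g \<eta> * gauss a \<eta>) \<le> (L2_norm \<alpha> \<psi> * C * exp ((norm \<eta>)\<^sup>2 / 2)) * norm (gauss a \<eta>)"
          unfolding norm_mult by (intro mult_right_mono gb) simp
        also have "\<dots> = L2_norm \<alpha> \<psi> * C * (exp ((norm \<eta>)\<^sup>2 / 2) * norm (gauss a \<eta>))" by (simp only: mult.assoc)
        also have "\<dots> \<le> L2_norm \<alpha> \<psi> * C * norm (gauss h \<eta>)" by (intro mult_left_mono eg a LC)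
        finally show "norm (g \<eta> * gauss a \<eta>) \<le> norm (L2_norm \<alpha> \<psi> * C * norm (gauss h \<eta>))" by simp
      qed
    qed
    have "AE \<eta> in ?M. g \<eta> - sob_weight (- s) \<eta> * \<psi> \<eta> = 0"
    proof (rule gauss_moments_zero)
      have "(\<lambda>\<eta>. sob_weight (- s) \<eta> * \<psi> \<eta>) \<in> borel_measurable ?M"
        by (intro borel_measurable_times continuous_imp_bessel_measurable continuous_sob_weight L2D(1)[OF \<psi>])
      then show "(\<lambda>\<eta>. g \<eta> - sob_weight (- s) \<eta> * \<psi> \<eta>) \<in> borel_measurable ?M"
        by (rule borel_measurable_diff[OF continuous_imp_bessel_measurable[OF gc]])
      show "integrable ?M (\<lambda>\<eta>. (g \<eta> - sob_weight (- s) \<eta> * \<psi> \<eta>) * gauss 1 \<eta>)"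
        unfolding left_diff_distrib by (intro Bochner_Integration.integrable_diff gint wpsi) simp_all
      fix m :: "'n \<Rightarrow> nat" assume m: "\<And>i. 1 \<le> m i"
      define a :: "real ^ 'n" where "a = (\<chi> i. real (m i))"
      have a1: "1 \<le> a $ i" for i using m[of i] by (simp add: a_def)
      then have a0: "0 < a $ i" for i using less_le_trans[OF zero_less_one] by blast
      define \<phi> where "\<phi> = gauss a"
      have \<phi>: "\<phi> \<in> schwartz_e" unfolding \<phi>_def by (rule gauss_schwartz[OF a0])
      interpret M: sigma_finite_measure ?M by (rule sigma_finite_bessel)
      interpret P: pair_sigma_finite ?M ?M ..
      obtain N where N: "integrable ?M (\<lambda>x. 1 / (1 + norm x) ^ N)" using integrable_decay[OF \<alpha>] .
      \<comment> \<open>A square-integrable majorant of the kernel in \<xi>. The function \<psi> is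
        only known to be in L2, but its product with \<open>d\<close> is integrable, as Fubini
        requires.\<close>
      define d where "d \<xi> = complex_of_real (1 / (1 + norm \<xi>) ^ N)" for \<xi> :: "real ^ 'n"
      have dp: "0 \<le> 1 / (1 + norm \<xi>) ^ N" "1 / (1 + norm \<xi>) ^ N \<le> 1" for \<xi> :: "real ^ 'n"
        by simp (rule divide_le_eq_1_pos[THEN iffD2], auto intro!: one_le_power zero_less_power add_pos_nonneg)
      have dL: "d \<in> L2 \<alpha>"
      proof -
        have "continuous_on UNIV d" unfolding d_def by (intro continuous_intros) (auto simp: add_nonneg_eq_0_iff)
        then have dm: "d \<in> borel_measurable ?M" by (rule continuous_imp_bessel_measurable)
        moreover have "integrable ?M (\<lambda>x. (norm (d x))\<^sup>2)"
        proof (rule Bochner_Integration.integrable_bound[OF N])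
          show "(\<lambda>x. (norm (d x))\<^sup>2) \<in> borel_measurable ?M" using dm by measurable
          have "(norm (d x))\<^sup>2 \<le> 1 / (1 + norm x) ^ N" for x
          proof -
            have "norm (d x) = 1 / (1 + norm x) ^ N" unfolding d_def norm_of_real by (rule abs_of_nonneg[OF dp(1)])
            then show ?thesis using mult_left_mono[OF dp(2) dp(1), of x x] by (simp add: power2_eq_square)
          qed
          then show "AE x in ?M. norm ((norm (d x))\<^sup>2) \<le> norm (1 / (1 + norm x) ^ N)"
            using dp(1) by (intro AE_I2) simp
        qed
        ultimately show ?thesis by (simp add: L2_def)
      qed
      obtain D where D: "\<And>\<eta> \<xi>. (1 + norm \<xi>) ^ N * norm (k \<eta> \<xi>) \<le> D * exp ((norm \<eta>)\<^sup>2 / 2)" using k1 by blast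
      have "norm (k 0 0) \<le> D" using D[of 0 0] by simp
  then have D0: "0 \<le> D" by (rule order_trans[OF norm_ge_zero])
      have ui: "integrable ?M (\<lambda>\<xi>. norm (\<psi> \<xi> * d \<xi>))" by (intro integrable_norm L2_mult_integrable \<psi> dL)
      define H where "H \<eta> \<xi> = \<psi> \<xi> * k \<eta> \<xi> * \<phi> \<eta>" for \<eta> \<xi>
      have Hint: "integrable (?M \<Otimes>\<^sub>M ?M) (case_prod H)"
      proof (rule Bochner_Integration.integrable_bound[OF integrable_mult_right[OF integrable_tensor[OF gh ui], of D]])
        have [measurable]: "\<psi> \<in> borel_measurable ?M" "\<phi> \<in> borel_measurable ?M"
          by (auto intro!: L2D(1) \<psi> schwartz_L2 \<phi> \<alpha>)
        have "(\<lambda>z. \<psi> (snd z) * k (fst z) (snd z) * \<phi> (fst z)) \<in> borel_measurable (?M \<Otimes>\<^sub>M ?M)"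
          using kmeas by measurable
        then show "case_prod H \<in> borel_measurable (?M \<Otimes>\<^sub>M ?M)" by (simp add: H_def split_beta')
        have "norm (H \<eta> \<xi>) \<le> D * (norm (gauss h \<eta>) * norm (\<psi> \<xi> * d \<xi>))" for \<eta> \<xi>
        proof -
          have nd: "norm (d \<xi>) = 1 / (1 + norm \<xi>) ^ N" unfolding d_def norm_of_real by (rule abs_of_nonneg[OF dp(1)])
          have "norm (k \<eta> \<xi>) \<le> D * exp ((norm \<eta>)\<^sup>2 / 2) / (1 + norm \<xi>) ^ N" by (rule le_divide_power[OF D])
          then have "norm (k \<eta> \<xi>) \<le> D * exp ((norm \<eta>)\<^sup>2 / 2) * norm (d \<xi>)" by (simp add: nd)
          then have "norm (\<psi> \<xi>) * norm (k \<eta> \<xi>) * norm (\<phi> \<eta>) \<le> norm (\<psi> \<xi>) * (D * exp ((norm \<eta>)\<^sup>2 / 2) * norm (d \<xi>)) * norm (\<phi> \<eta>)"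
            by (intro mult_right_mono mult_left_mono) auto
          also have "\<dots> = D * (norm (\<psi> \<xi>) * norm (d \<xi>)) * (exp ((norm \<eta>)\<^sup>2 / 2) * norm (\<phi> \<eta>))" by (simp only: mult_ac)
          also have "\<dots> \<le> D * (norm (\<psi> \<xi>) * norm (d \<xi>)) * norm (gauss h \<eta>)"
            unfolding \<phi>_def using D0 by (intro mult_left_mono eg a1) auto
          finally show ?thesis by (simp add: H_def norm_mult mult_ac)
        qed
        then show "AE z in ?M \<Otimes>\<^sub>M ?M. norm (case_prod H z) \<le> norm (D * (case z of (x, y) \<Rightarrow> norm (gauss h x) * norm (\<psi> y * d y)))"
          using D0 by (intro AE_I2) (auto simp: split_beta')
      qed
      \<comment> \<open>Symmetry of the transform moves it from \<open>e \<xi>\<close> to \<phi>;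
        the two factors of \<open>e \<xi>\<close> then form the transform of the cutoff function
        times \<open>?F \<phi>\<close>.\<close>
      have inner: "(LINT \<eta>|?M. H \<eta> \<xi>) = \<psi> \<xi> * (sob_weight (- s) \<xi> * ?F (\<lambda>x. \<chi>0 x * ?F \<phi> x) \<xi>) / \<kappa>" for \<xi>
      proof -
        have "(LINT \<eta>|?M. ?F (e \<xi>) \<eta> * \<phi> \<eta>) = (LINT \<eta>|?M. e \<xi> \<eta> * ?F \<phi> \<eta>)"
          by (intro fourier_bessel_symmetric schwartz_integrable \<alpha> es \<phi>)
        also have "\<dots> = ?F (\<lambda>x. \<chi>0 x * ?F \<phi> x) \<xi>"
          unfolding fourier_bessel_eq[of _ "\<lambda>x. \<chi>0 x * ?F \<phi> x"] e_def by (simp only: mult_ac)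
        finally have 1: "(LINT \<eta>|?M. ?F (e \<xi>) \<eta> * \<phi> \<eta>) = ?F (\<lambda>x. \<chi>0 x * ?F \<phi> x) \<xi>" .
        have "H \<eta> \<xi> = (\<psi> \<xi> * sob_weight (- s) \<xi> / \<kappa>) * (?F (e \<xi>) \<eta> * \<phi> \<eta>)" for \<eta>
          unfolding H_def k_def sym[of \<eta> \<xi>] by simp
        then have "(LINT \<eta>|?M. H \<eta> \<xi>) = (\<psi> \<xi> * sob_weight (- s) \<xi> / \<kappa>) * (LINT \<eta>|?M. ?F (e \<xi>) \<eta> * \<phi> \<eta>)" by simp
        then show ?thesis unfolding 1 by simp
      qed
      have "(LINT \<eta>|?M. g \<eta> * \<phi> \<eta>) = (LINT \<eta>|?M. LINT \<xi>|?M. H \<eta> \<xi>)"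
        unfolding H_def g_def by simp
      also have "\<dots> = (LINT \<xi>|?M. LINT \<eta>|?M. H \<eta> \<xi>)"
        using P.Fubini_integral[OF Hint] by simp
      also have "\<dots> = (LINT \<xi>|?M. \<psi> \<xi> * (sob_weight (- s) \<xi> * ?F (\<lambda>x. \<chi>0 x * ?F \<phi> x) \<xi>) / \<kappa>)"
        unfolding inner ..
      finally have G: "(LINT \<eta>|?M. g \<eta> * \<phi> \<eta>) = (LINT \<xi>|?M. \<psi> \<xi> * (sob_weight (- s) \<xi> * ?F (\<lambda>x. \<chi>0 x * ?F \<phi> x) \<xi>) / \<kappa>)" .
      have F\<phi>: "?F \<phi> \<in> schwartz_e" by (rule fourier_bessel_schwartz[OF \<alpha> \<phi>])
      have cF: "(\<lambda>x. \<chi>0 x * ?F \<phi> x) \<in> schwartz_e" by (rule schwartz_e_mult[OF m0 F\<phi>])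
      have "(LINT \<eta>|?M. g \<eta> * \<phi> \<eta>) = sob_dist \<alpha> s \<psi> (\<lambda>x. \<chi>0 x * ?F \<phi> x)"
        unfolding G sob_dist_def using cF by (simp add: \<kappa>_def)
      \<comment> \<open>Here the support enters: \<open>?F \<phi>\<close> and its cut-off version
        agree on a ball around 0 that contains the sign orbit of \<open>K\<close>.\<close>
      also have "\<dots> = sob_dist \<alpha> s \<psi> (?F \<phi>)"
      proof -
        have "sob_dist \<alpha> s \<psi> (\<lambda>x. ?F \<phi> x - \<chi>0 x * ?F \<phi> x) = 0"
        proof (rule sob_dist_vanishing[OF \<alpha> \<psi> supp schwartz_e_diff[OF F\<phi> cF], of "ball 0 R"])
          show "sign_orbit K \<subseteq> ball 0 R" using R(2) by auto
          show "?F \<phi> x - \<chi>0 x * ?F \<phi> x = 0" if "x \<in> ball 0 R" for x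
            using that cut(1)[OF R(1), of x] by (simp add: \<chi>0_def)
        qed simp
        moreover have "sob_dist \<alpha> s \<psi> (\<lambda>x. ?F \<phi> x - \<chi>0 x * ?F \<phi> x) = sob_dist \<alpha> s \<psi> (?F \<phi>) - sob_dist \<alpha> s \<psi> (\<lambda>x. \<chi>0 x * ?F \<phi> x)"
          using sob_dist_linear(1)[OF \<alpha> \<psi> F\<phi> schwartz_e_cmult[OF cF, of "-1"], of s] sob_dist_linear(2)[OF \<alpha> \<psi> cF, of s "-1"] by simp
        ultimately show ?thesis by simp
      qed
      also have "\<dots> = (LINT \<xi>|?M. sob_weight (- s) \<xi> * \<psi> \<xi> * \<phi> \<xi>)"
      proof -
        have *: "\<psi> \<xi> * (sob_weight (- s) \<xi> * (inversion_const \<alpha> * \<phi> \<xi>)) = inversion_const \<alpha> * (sob_weight (- s) \<xi> * \<psi> \<xi> * \<phi> \<xi>)" for \<xi>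
          by (simp only: mult_ac)
        show ?thesis
          unfolding sob_dist_def fourier_bessel_inversion[OF \<alpha> \<phi>] * using F\<phi> \<kappa> by (simp add: \<kappa>_def)
      qed
      finally have "(LINT \<eta>|?M. g \<eta> * \<phi> \<eta> - sob_weight (- s) \<eta> * \<psi> \<eta> * \<phi> \<eta>) = 0"
        unfolding \<phi>_def by (subst Bochner_Integration.integral_diff[OF gint[OF a1] wpsi[OF a0]]) simp
      then show "(LINT \<eta>|?M. (g \<eta> - sob_weight (- s) \<eta> * \<psi> \<eta>) * gauss (\<chi> i. real (m i)) \<eta>) = 0"
        unfolding \<phi>_def a_def left_diff_distrib .
    qed
    then show ?thesis unfolding g_def by eventually_elim simp
  qed
  show ?thesis
    using k1 c1 c2 rep by (intro exI[of _ k]) blast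
qed

section \<open>Compactness\<close>

text \<open>The constant \<open>A\<close> is preserved, so the limit remains in the same ball and
  not merely in a larger one.\<close>

lemma L2_fatou:
  fixes f :: "nat \<Rightarrow> real ^ 'n \<Rightarrow> complex"
  assumes f: "\<And>m. f m \<in> L2 \<alpha>" "\<And>m. L2_norm \<alpha> (f m) \<le> A" and lim: "\<And>x. (\<lambda>m. f m x) \<longlonglongrightarrow> g x"
  shows "g \<in> L2 \<alpha>" "L2_norm \<alpha> g \<le> A"
proof -
  let ?M = "bessel_measure \<alpha>"
  have A0: "0 \<le> A" using L2_norm_nonneg[of \<alpha> "f 0"] f(2)[of 0] by linarith
  have gm: "g \<in> borel_measurable ?M"
    by (rule borel_measurable_LIMSEQ_metric[OF L2D(1)[OF f(1)]]) (rule lim)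
  have fm: "(\<lambda>x. ennreal ((norm (f m x))\<^sup>2)) \<in> borel_measurable ?M" for m
    using L2D(1)[OF f(1)[of m]] by measurable
  have li: "liminf (\<lambda>m. ennreal ((norm (f m x))\<^sup>2)) = ennreal ((norm (g x))\<^sup>2)" for x
  proof (rule lim_imp_Liminf)
    show "(\<lambda>m. ennreal ((norm (f m x))\<^sup>2)) \<longlonglongrightarrow> ennreal ((norm (g x))\<^sup>2)"
      by (intro tendsto_ennrealI tendsto_intros lim)
  qed simp
  have "(\<integral>\<^sup>+ x. ennreal ((norm (g x))\<^sup>2) \<partial>?M) \<le> liminf (\<lambda>m. \<integral>\<^sup>+ x. ennreal ((norm (f m x))\<^sup>2) \<partial>?M)"
    using nn_integral_liminf[of "\<lambda>m x. ennreal ((norm (f m x))\<^sup>2)" ?M] fm unfolding li by simp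
  also have "\<dots> \<le> liminf (\<lambda>m. ennreal (A\<^sup>2))"
  proof (intro Liminf_mono always_eventually allI)
    fix m
    have "(\<integral>\<^sup>+ x. ennreal ((norm (f m x))\<^sup>2) \<partial>?M) = ennreal ((L2_norm \<alpha> (f m))\<^sup>2)"
      unfolding L2_norm_sq by (intro nn_integral_eq_integral L2D(2) f(1)) simp
    also have "\<dots> \<le> ennreal (A\<^sup>2)" by (intro ennreal_leI power_mono f(2) L2_norm_nonneg)
    finally show "(\<integral>\<^sup>+ x. ennreal ((norm (f m x))\<^sup>2) \<partial>?M) \<le> ennreal (A\<^sup>2)" .
  qed
  also have "\<dots> = ennreal (A\<^sup>2)" by (simp add: Liminf_const)
  finally have le: "(\<integral>\<^sup>+ x. ennreal ((norm (g x))\<^sup>2) \<partial>?M) \<le> ennreal (A\<^sup>2)" .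
  have gi: "integrable ?M (\<lambda>x. (norm (g x))\<^sup>2)"
  proof (rule integrableI_bounded)
    show "(\<lambda>x. (norm (g x))\<^sup>2) \<in> borel_measurable ?M" using gm by measurable
    show "(\<integral>\<^sup>+ x. ennreal (norm ((norm (g x))\<^sup>2)) \<partial>?M) < \<infinity>"
      using le by (simp add: order_le_less_trans)
  qed
  then show "g \<in> L2 \<alpha>" using gm by (simp add: L2_def)
  have "ennreal ((L2_norm \<alpha> g)\<^sup>2) \<le> ennreal (A\<^sup>2)"
    using le unfolding L2_norm_sq by (subst (asm) nn_integral_eq_integral[OF gi]) auto
  then have "(L2_norm \<alpha> g)\<^sup>2 \<le> A\<^sup>2" by (subst (asm) ennreal_le_iff) auto
  then show "L2_norm \<alpha> g \<le> A" using A0 by (rule power2_le_imp_le)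
qed

section \<open>Convergence in the weaker norm\<close>

lemma norm_sob_weight_tail:
  fixes x :: "real ^ 'n"
  assumes "r \<le> 0" "0 \<le> \<rho>" "\<rho> < norm x"
  shows "norm (sob_weight r x) \<le> (1 + \<rho>\<^sup>2) powr r"
proof -
  have "\<rho>\<^sup>2 \<le> (norm x)\<^sup>2" using assms by (intro power_mono) auto
  moreover have "0 < 1 + \<rho>\<^sup>2" by (intro add_pos_nonneg) auto
  ultimately show ?thesis
    unfolding sob_weight_def norm_of_real using assms(1) by (simp add: powr_mono2')
qed

lemma L2_weighted_convergence:
  fixes f :: "nat \<Rightarrow> real ^ 'n \<Rightarrow> complex"
  assumes \<alpha>: "admissible \<alpha>" and r: "r < 0"
    and f: "\<And>m. f m \<in> L2 \<alpha>" "\<And>m. L2_norm \<alpha> (f m) \<le> A"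
    and g: "g \<in> L2 \<alpha>" "L2_norm \<alpha> g \<le> A" and lim: "\<And>x. (\<lambda>m. f m x) \<longlonglongrightarrow> g x"
    and b: "\<And>m x. norm (f m x) \<le> b x" "continuous_on UNIV b"
  shows "(\<lambda>m. L2_norm \<alpha> (\<lambda>x. sob_weight r x * (f m x - g x))) \<longlonglongrightarrow> 0"
proof -
  let ?M = "bessel_measure \<alpha>"
  define I where "I m = (LINT x|?M. (norm (sob_weight r x * (f m x - g x)))\<^sup>2)" for m
  have A0: "0 \<le> A" using L2_norm_nonneg[of \<alpha> g] g(2) by linarith
  have dL: "(\<lambda>x. f m x - g x) \<in> L2 \<alpha>" for m by (intro L2_diff f g)
  have dn: "L2_norm \<alpha> (\<lambda>x. f m x - g x) \<le> 2 * A" for m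
    using L2_norm_triangle[OF f(1)[of m] L2_minus[OF g(1)]] f(2)[of m] g(2) by (simp add: L2_norm_minus)
  have wL: "(\<lambda>x. sob_weight r x * (f m x - g x)) \<in> L2 \<alpha>" for m
    by (intro L2_bounded_mult dL continuous_imp_bessel_measurable continuous_sob_weight norm_sob_weight_neg) (use r in simp)
  have gb: "norm (g x) \<le> b x" for x
    by (rule LIMSEQ_le_const2[OF tendsto_norm[OF lim[of x]]]) (use b(1) in blast)
  have wint: "integrable ?M (\<lambda>x. (norm (sob_weight r x * (f m x - g x)))\<^sup>2)" for m by (rule L2D(2)[OF wL])
  have I0: "I m \<ge> 0" for m by (simp add: I_def)
  have "I \<longlonglongrightarrow> 0"
  proof (rule LIMSEQ_I)
    fix \<epsilon> :: real assume \<epsilon>: "0 < \<epsilon>"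
    \<comment> \<open>The squared norm of \<open>f m - g\<close> is at most
      \<open>(2 * A)^2\<close>, so the exterior of the ball contributes at most
      \<open>\<epsilon> / 2\<close>; the summand 1 covers the case \<open>A = 0\<close>.\<close>
    define \<delta> where "\<delta> = \<epsilon> / (2 * ((2 * A)\<^sup>2 + 1))"
    have q: "0 < 2 * ((2 * A)\<^sup>2 + 1)" using zero_le_power2[of "2 * A"] by argo
    have \<delta>: "\<delta> > 0" unfolding \<delta>_def using \<epsilon> q by (rule divide_pos_pos)
    \<comment> \<open>The solution of \<open>(\<rho>^2) powr (2 * r) = \<delta>\<close>. As
      \<open>r\<close> is negative, the squared weight is at most \<open>\<delta>\<close> outside
      the ball of radius \<rho>.\<close>
    define \<rho> where "\<rho> = sqrt (\<delta> powr (1 / (2 * r)))"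
    have \<rho>: "\<rho> \<ge> 0" "\<rho>\<^sup>2 = \<delta> powr (1 / (2 * r))" by (simp_all add: \<rho>_def)
    have wt: "((1 + \<rho>\<^sup>2) powr r)\<^sup>2 \<le> \<delta>"
    proof -
      have p: "0 < \<rho>\<^sup>2" using \<delta> by (simp add: \<rho>(2))
      have "((1 + \<rho>\<^sup>2) powr r)\<^sup>2 = (1 + \<rho>\<^sup>2) powr (2 * r)"
        by (simp add: power2_eq_square powr_add[symmetric])
      also have "\<dots> \<le> (\<rho>\<^sup>2) powr (2 * r)" using p r by (intro powr_mono2') auto
      also have "\<dots> = \<delta>" unfolding \<rho>(2) powr_powr using r \<delta> by simp
      finally show ?thesis .
    qed
    define J where "J m = (LINT x|?M. indicator (cball 0 \<rho>) x * (norm (sob_weight r x * (f m x - g x)))\<^sup>2)" for m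
    have cb: "(\<lambda>x. indicat_real (cball 0 \<rho>) x) \<in> borel_measurable ?M"
      by (intro borel_imp_bessel_measurable borel_measurable_indicator borel_closed closed_cball)
    have "compact (b ` cball 0 \<rho>)" by (intro compact_continuous_image continuous_on_subset[OF b(2)]) auto
    then have "\<exists>C. \<forall>y\<in>b ` cball 0 \<rho>. norm y \<le> C" using compact_imp_bounded[of "b ` cball 0 \<rho>"] by (simp only: bounded_iff)
    then obtain C where C: "\<And>x. x \<in> cball 0 \<rho> \<Longrightarrow> b x \<le> C"
      by (metis abs_le_D1 image_eqI real_norm_def)
    have C0: "0 \<le> C"
    proof -
      have "norm (g 0) \<le> C" using gb[of 0] C[of 0] \<rho>(1) by simp
      then show ?thesis using norm_ge_zero[of "g 0"] by linarith
    qed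
    obtain N where N: "integrable ?M (\<lambda>x. 1 / (1 + norm x) ^ N)" using integrable_decay[OF \<alpha>] .
    \<comment> \<open>On the ball the differences are bounded by \<open>2 * C\<close>, and the
      quotient of \<open>(1 + \<rho>) ^ N\<close> by \<open>(1 + norm x) ^ N\<close> is at least 1
      there; this makes the constant bound integrable over the whole orthant.\<close>
    have "J \<longlonglongrightarrow> (LINT x|?M. 0)"
      unfolding J_def
    proof (rule integral_dominated_convergence[where w = "\<lambda>x. (2 * C)\<^sup>2 * (1 + \<rho>) ^ N * (1 / (1 + norm x) ^ N)"])
      show "integrable ?M (\<lambda>x. (2 * C)\<^sup>2 * (1 + \<rho>) ^ N * (1 / (1 + norm x) ^ N))" by (intro integrable_mult_right N)
      show "(\<lambda>x. indicat_real (cball 0 \<rho>) x * (norm (sob_weight r x * (f m x - g x)))\<^sup>2) \<in> borel_measurable ?M" for m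
        by (intro borel_measurable_times cb borel_measurable_integrable[OF wint])
      show "AE x in ?M. (\<lambda>m. indicat_real (cball 0 \<rho>) x * (norm (sob_weight r x * (f m x - g x)))\<^sup>2) \<longlonglongrightarrow> 0"
      proof (rule AE_I2)
        fix x
        have "(\<lambda>m. indicat_real (cball 0 \<rho>) x * (norm (sob_weight r x * (f m x - g x)))\<^sup>2)
            \<longlonglongrightarrow> indicat_real (cball 0 \<rho>) x * (norm (sob_weight r x * (g x - g x)))\<^sup>2"
          by (intro tendsto_intros lim)
        then show "(\<lambda>m. indicat_real (cball 0 \<rho>) x * (norm (sob_weight r x * (f m x - g x)))\<^sup>2) \<longlonglongrightarrow> 0" by simp
      qed
      show "AE x in ?M. norm (indicat_real (cball 0 \<rho>) x * (norm (sob_weight r x * (f m x - g x)))\<^sup>2)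
          \<le> (2 * C)\<^sup>2 * (1 + \<rho>) ^ N * (1 / (1 + norm x) ^ N)" for m
      proof (rule AE_I2)
        fix x :: "real ^ 'n"
        show "norm (indicat_real (cball 0 \<rho>) x * (norm (sob_weight r x * (f m x - g x)))\<^sup>2)
          \<le> (2 * C)\<^sup>2 * (1 + \<rho>) ^ N * (1 / (1 + norm x) ^ N)"
        proof (cases "x \<in> cball 0 \<rho>")
          case True
          have "norm (f m x - g x) \<le> 2 * C"
            using norm_triangle_ineq4[of "f m x" "g x"] b(1)[of m x] gb[of x] C[OF True] by linarith
          then have "norm (sob_weight r x * (f m x - g x)) \<le> 1 * (2 * C)"
            unfolding norm_mult using norm_sob_weight_neg[of r x] r by (intro mult_mono) auto
          then have 1: "(norm (sob_weight r x * (f m x - g x)))\<^sup>2 \<le> (2 * C)\<^sup>2" by (intro power_mono) auto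
          have pos: "0 < (1 + norm x) ^ N" by (intro zero_less_power add_pos_nonneg) auto
          have "(1 + norm x) ^ N \<le> (1 + \<rho>) ^ N" using True by (intro power_mono) auto
          then have "1 \<le> (1 + \<rho>) ^ N * (1 / (1 + norm x) ^ N)" using pos by simp
          then have "(2 * C)\<^sup>2 * 1 \<le> (2 * C)\<^sup>2 * ((1 + \<rho>) ^ N * (1 / (1 + norm x) ^ N))" by (intro mult_left_mono) auto
          with 1 have "(norm (sob_weight r x * (f m x - g x)))\<^sup>2 \<le> (2 * C)\<^sup>2 * (1 + \<rho>) ^ N * (1 / (1 + norm x) ^ N)"
            by (simp only: mult.assoc mult_1_right)
          then show ?thesis using True by simp
        next
          case False
          then show ?thesis using \<rho>(1) by simp
        qed
      qed
    qed simp
    then have "J \<longlonglongrightarrow> 0" by simp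
    then obtain m0 where m0: "\<And>m. m \<ge> m0 \<Longrightarrow> norm (J m - 0) < \<epsilon> / 2"
      using LIMSEQ_D[of J 0 "\<epsilon> / 2"] \<epsilon> by auto
    have IJ: "I m \<le> J m + \<delta> * (2 * A)\<^sup>2" for m
    proof -
      have i1: "integrable ?M (\<lambda>x. indicator (cball 0 \<rho>) x * (norm (sob_weight r x * (f m x - g x)))\<^sup>2)"
      proof (rule Bochner_Integration.integrable_bound[OF wint[of m]])
        show "(\<lambda>x. indicat_real (cball 0 \<rho>) x * (norm (sob_weight r x * (f m x - g x)))\<^sup>2) \<in> borel_measurable ?M"
          by (intro borel_measurable_times cb borel_measurable_integrable[OF wint])
        show "AE x in ?M. norm (indicat_real (cball 0 \<rho>) x * (norm (sob_weight r x * (f m x - g x)))\<^sup>2)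
            \<le> norm ((norm (sob_weight r x * (f m x - g x)))\<^sup>2)"
          by (intro AE_I2) (auto simp: indicator_def)
      qed
      have i2: "integrable ?M (\<lambda>x. \<delta> * (norm (f m x - g x))\<^sup>2)" by (intro integrable_mult_right L2D(2)[OF dL])
      have "I m \<le> (LINT x|?M. indicator (cball 0 \<rho>) x * (norm (sob_weight r x * (f m x - g x)))\<^sup>2 + \<delta> * (norm (f m x - g x))\<^sup>2)"
        unfolding I_def
      proof (rule integral_mono[OF wint Bochner_Integration.integrable_add[OF i1 i2]])
        fix x
        show "(norm (sob_weight r x * (f m x - g x)))\<^sup>2 \<le> indicator (cball 0 \<rho>) x * (norm (sob_weight r x * (f m x - g x)))\<^sup>2 + \<delta> * (norm (f m x - g x))\<^sup>2"
        proof (cases "x \<in> cball 0 \<rho>")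
          case True
          then show ?thesis using \<delta> by simp
        next
          case False
          then have "norm (sob_weight r x) \<le> (1 + \<rho>\<^sup>2) powr r" using r \<rho>(1) by (intro norm_sob_weight_tail) auto
          then have "(norm (sob_weight r x))\<^sup>2 \<le> ((1 + \<rho>\<^sup>2) powr r)\<^sup>2" by (intro power_mono) auto
          then have "(norm (sob_weight r x))\<^sup>2 \<le> \<delta>" using wt by (rule order_trans)
          then have "(norm (sob_weight r x))\<^sup>2 * (norm (f m x - g x))\<^sup>2 \<le> \<delta> * (norm (f m x - g x))\<^sup>2" by (intro mult_right_mono) auto
          then show ?thesis using False by (simp add: norm_mult power_mult_distrib)
        qed
      qed
      also have "\<dots> = J m + \<delta> * (L2_norm \<alpha> (\<lambda>x. f m x - g x))\<^sup>2"
        unfolding J_def L2_norm_sq using Bochner_Integration.integral_add[OF i1 i2] by simp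
      also have "\<dots> \<le> J m + \<delta> * (2 * A)\<^sup>2"
        using \<delta> by (intro add_left_mono mult_left_mono power_mono dn L2_norm_nonneg) auto
      finally show ?thesis .
    qed
    have "\<delta> * (2 * A)\<^sup>2 \<le> \<epsilon> / 2"
    proof -
      have "\<delta> * (2 * A)\<^sup>2 \<le> \<delta> * ((2 * A)\<^sup>2 + 1)" using \<delta> by (intro mult_left_mono) auto
      also have "\<dots> = \<epsilon> / 2" unfolding \<delta>_def using q by (simp add: field_simps)
      finally show ?thesis .
    qed
    then have "norm (I m - 0) < \<epsilon>" if "m \<ge> m0" for m
      using IJ[of m] m0[OF that] I0[of m] by (simp add: abs_if split: if_splits)
    then show "\<exists>no. \<forall>n\<ge>no. norm (I n - 0) < \<epsilon>" by blast
  qed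
  then have "(\<lambda>m. sqrt (I m)) \<longlonglongrightarrow> sqrt 0" by (rule tendsto_real_sqrt)
  then show ?thesis by (simp add: I_def L2_norm_def)
qed

text \<open>Permits replacing an arbitrary representative by the continuous one that the kernel
  defines at every point.\<close>

lemma sob_rep_cong_AE:
  assumes \<alpha>: "admissible \<alpha>" and T: "sob_rep \<alpha> s T \<psi>" and m: "\<phi> \<in> borel_measurable (bessel_measure \<alpha>)"
    and ae: "AE x in bessel_measure \<alpha>. \<phi> x = \<psi> x"
  shows "sob_rep \<alpha> s T \<phi>"
proof -
  have \<psi>: "\<psi> \<in> L2 \<alpha>" using T by (simp add: sob_rep_iff)
  have "integrable (bessel_measure \<alpha>) (\<lambda>x. (norm (\<phi> x))\<^sup>2)"
    by (rule integrable_cong_AE_imp[OF L2D(2)[OF \<psi>]]) (use m ae in auto)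
  then have \<phi>: "\<phi> \<in> L2 \<alpha>" using m by (simp add: L2_def)
  have "(LINT x|bessel_measure \<alpha>. \<phi> x * f x) = (LINT x|bessel_measure \<alpha>. \<psi> x * f x)" if "f \<in> schwartz_e" for f
  proof (rule integral_cong_AE)
    show "(\<lambda>x. \<phi> x * f x) \<in> borel_measurable (bessel_measure \<alpha>)" "(\<lambda>x. \<psi> x * f x) \<in> borel_measurable (bessel_measure \<alpha>)"
      by (intro borel_measurable_times L2D(1) \<phi> \<psi> schwartz_L2 \<alpha> that)+
    show "AE x in bessel_measure \<alpha>. \<phi> x * f x = \<psi> x * f x" using ae by eventually_elim simp
  qed
  then show ?thesis using T \<phi> by (simp add: sob_rep_iff)
qed

section \<open>Extraction of a subsequence\<close>

lemma pointwise_convergent_subsequence: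
  fixes g :: "nat \<Rightarrow> real ^ 'n \<Rightarrow> complex"
  assumes bound: "\<And>m x. norm (g m x) \<le> C * exp ((norm x)\<^sup>2 / 2)"
    and equi: "\<And>x \<epsilon>. 0 < \<epsilon> \<Longrightarrow> \<exists>\<delta>>0. \<forall>y. dist y x < \<delta> \<longrightarrow> (\<forall>m. norm (g m y - g m x) < \<epsilon>)"
  obtains r where "strict_mono (r :: nat \<Rightarrow> nat)" "\<And>x. convergent (\<lambda>m. g (r m) x)"
proof -
  obtain D :: "(real ^ 'n) set" where D: "countable D" "\<And>X. open X \<Longrightarrow> X \<noteq> {} \<Longrightarrow> \<exists>d\<in>D. d \<in> X"
    using countable_dense_exists by blast
  \<comment> \<open>The selection on a countable dense set asks for one bound valid at all points;
    the damping provides it and is undone pointwise afterwards. Equicontinuity then carries the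
    Cauchy property from the dense set to every point.\<close>
  define f where "f m x = of_real (exp (- ((norm x)\<^sup>2 / 2))) * g m x" for m x
  have fb: "norm (f m x) \<le> C" for m x
  proof -
    have "norm (f m x) \<le> exp (- ((norm x)\<^sup>2 / 2)) * (C * exp ((norm x)\<^sup>2 / 2))"
      unfolding f_def norm_mult norm_of_real by (simp add: bound)
    also have "\<dots> = C" by (simp add: exp_minus)
    finally show ?thesis .
  qed
  obtain r where r: "strict_mono (r :: nat \<Rightarrow> nat)" "\<And>x. x \<in> D \<Longrightarrow> \<exists>l. (\<lambda>m. f (r m) x) \<longlonglongrightarrow> l"
    using function_convergent_subsequence[OF D(1), of f C] fb by metis
  have cD: "Cauchy (\<lambda>m. g (r m) y)" if y: "y \<in> D" for y
  proof -
    obtain l where "(\<lambda>m. f (r m) y) \<longlonglongrightarrow> l" using r(2)[OF y] by blast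
    then have "(\<lambda>m. of_real (exp ((norm y)\<^sup>2 / 2)) * f (r m) y) \<longlonglongrightarrow> of_real (exp ((norm y)\<^sup>2 / 2)) * l"
      by (rule tendsto_mult_left)
    moreover have "of_real (exp ((norm y)\<^sup>2 / 2)) * f m y = g m y" for m
      unfolding f_def mult.assoc[symmetric] of_real_mult[symmetric] by (simp add: exp_add[symmetric] del: of_real_mult)
    ultimately show ?thesis by (simp add: LIMSEQ_imp_Cauchy)
  qed
  have "convergent (\<lambda>m. g (r m) x)" for x
    unfolding Cauchy_convergent_iff[symmetric]
  proof (rule CauchyI)
    fix \<epsilon> :: real assume \<epsilon>: "0 < \<epsilon>"
    obtain \<delta> where \<delta>: "\<delta> > 0" "\<And>y m. dist y x < \<delta> \<Longrightarrow> norm (g m y - g m x) < \<epsilon> / 3"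
      using equi[of "\<epsilon> / 3" x] \<epsilon> by auto
    obtain y where y: "y \<in> D" "y \<in> ball x \<delta>" using D(2)[of "ball x \<delta>"] \<delta>(1) by auto
    then have d: "norm (g m y - g m x) < \<epsilon> / 3" for m using \<delta>(2)[of y m] by (simp add: dist_commute)
    obtain M where M: "\<And>m n. m \<ge> M \<Longrightarrow> n \<ge> M \<Longrightarrow> norm (g (r m) y - g (r n) y) < \<epsilon> / 3"
      using CauchyD[OF cD[OF y(1)], of "\<epsilon> / 3"] \<epsilon> by auto
    have "norm (g (r m) x - g (r n) x) < \<epsilon>" if "m \<ge> M" "n \<ge> M" for m n
    proof -
      have "norm (g (r m) x - g (r n) x) = norm ((g (r m) y - g (r n) y) - (g (r m) y - g (r m) x) + (g (r n) y - g (r n) x))"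
        by simp
      also have "\<dots> \<le> norm (g (r m) y - g (r n) y) + norm (g (r m) y - g (r m) x) + norm (g (r n) y - g (r n) x)"
        by (intro order_trans[OF norm_triangle_ineq] add_right_mono norm_triangle_ineq4)
      also have "\<dots> < \<epsilon>" using M[OF that] d[of "r m"] d[of "r n"] by linarith
      finally show ?thesis .
    qed
    then show "\<exists>M. \<forall>m\<ge>M. \<forall>n\<ge>M. norm (g (r m) x - g (r n) x) < \<epsilon>" by blast
  qed
  then show ?thesis using that r(1) by blast
qed

text \<open>The limit keeps the support in \<open>K\<close> and the bound \<open>C\<close> in the
  stronger norm, so the ball itself, and not only its closure, is sequentially compact for the
  weaker norm.\<close>

lemma sobolev_ball_sequentially_compact:
  fixes \<alpha> :: "real ^ 'n" and \<sigma> :: "nat \<Rightarrow> 'n dist"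
  assumes \<alpha>: "admissible \<alpha>" and ts: "t < s" and K: "compact K"
    and \<sigma>: "\<And>m. \<sigma> m \<in> sobolev_supp \<alpha> s K" "\<And>m. sobolev_norm \<alpha> s (\<sigma> m) \<le> C"
  obtains T r where "T \<in> sobolev_supp \<alpha> s K" "sobolev_norm \<alpha> s T \<le> C" "strict_mono (r :: nat \<Rightarrow> nat)"
    "(\<lambda>m. sobolev_norm \<alpha> t (\<lambda>f. \<sigma> (r m) f - T f)) \<longlonglongrightarrow> 0"
proof -
  let ?M = "bessel_measure \<alpha>"
  have c: "bessel_const \<alpha> > 0" by (rule bessel_const_pos[OF \<alpha>])
  define A where "A = C / bessel_const \<alpha>"
  have "\<exists>\<psi>. sob_rep \<alpha> s (\<sigma> m) \<psi>" and temp: "\<sigma> m \<in> tempered_e" and supp: "supp_in (\<sigma> m) K" for m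
    using \<sigma>(1)[of m] by (auto simp: sobolev_supp_def sobolev_iff)
  then obtain \<psi> where \<psi>: "\<And>m. sob_rep \<alpha> s (\<sigma> m) (\<psi> m)" by metis
  have \<psi>L: "\<psi> m \<in> L2 \<alpha>" for m using \<psi>[of m] by (simp add: sob_rep_iff)
  have \<psi>n: "L2_norm \<alpha> (\<psi> m) \<le> A" for m
    using \<sigma>(2)[of m] c unfolding sobolev_norm_eq[OF \<alpha> \<psi>] A_def by (simp add: pos_le_divide_eq mult.commute)
  have A0: "0 \<le> A" using L2_norm_nonneg[of \<alpha> "\<psi> 0"] \<psi>n[of 0] by linarith
  have \<sigma>eq: "\<sigma> m = sob_dist \<alpha> s (\<psi> m)" for m by (rule tempered_eq_sob_dist[OF \<alpha> temp \<psi>])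
  obtain k :: "real ^ 'n \<Rightarrow> real ^ 'n \<Rightarrow> complex" where
    kk: "(\<forall>N. \<exists>C. \<forall>\<eta> \<xi>. (1 + norm \<xi>) ^ N * norm (k \<eta> \<xi>) \<le> C * exp ((norm \<eta>)\<^sup>2 / 2)) \<and>
    (\<forall>\<eta>. continuous_on UNIV (k \<eta>)) \<and> (\<forall>\<xi>. continuous_on UNIV (\<lambda>\<eta>. k \<eta> \<xi>)) \<and>
    (\<forall>\<psi>\<in>L2 \<alpha>. supp_in (sob_dist \<alpha> s \<psi>) K \<longrightarrow>
      (AE \<eta> in ?M. (LINT \<xi>|?M. \<psi> \<xi> * k \<eta> \<xi>) = sob_weight (- s) \<eta> * \<psi> \<eta>))"
    by (rule exE[OF rellich_kernel[OF \<alpha> K, of s]])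
  note k1 = spec[OF conjunct1[OF kk]]
    and c1 = spec[OF conjunct1[OF conjunct2[OF kk]]]
    and c2 = spec[OF conjunct1[OF conjunct2[OF conjunct2[OF kk]]]]
    and krep = mp[OF bspec[OF conjunct2[OF conjunct2[OF conjunct2[OF kk]]]]]
  note kL = kernel_L2(1)[OF \<alpha> k1 c1 c2]
  define g where "g m \<eta> = (LINT \<xi>|?M. \<psi> m \<xi> * k \<eta> \<xi>)" for m \<eta>
  have gc: "continuous_on UNIV (g m)" for m
    unfolding g_def by (rule kernel_operator_continuous[OF \<alpha> \<psi>L k1 c1 c2])
  obtain D where D: "\<And>\<eta>. L2_norm \<alpha> (k \<eta>) \<le> D * exp ((norm \<eta>)\<^sup>2 / 2)"
    using kernel_L2(2)[OF \<alpha> k1 c1 c2] by blast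
  have gb: "norm (g m \<eta>) \<le> A * D * exp ((norm \<eta>)\<^sup>2 / 2)" for m \<eta>
  proof -
    have "norm (g m \<eta>) \<le> L2_norm \<alpha> (\<psi> m) * L2_norm \<alpha> (k \<eta>)" unfolding g_def by (intro L2_Cauchy_Schwarz(2) \<psi>L kL)
    also have "\<dots> \<le> A * (D * exp ((norm \<eta>)\<^sup>2 / 2))" by (intro mult_mono \<psi>n D A0 L2_norm_nonneg)
    finally show ?thesis by (simp add: mult.assoc)
  qed
  \<comment> \<open>Cauchy-Schwarz bounds the increment of \<open>g m\<close> by \<open>A\<close>
    times the L2 distance of two kernels, which does not involve \<open>m\<close>. The argument runs
    by contradiction because continuity of the kernel in L2 was stated for sequences.\<close>
  have equi: "\<exists>\<delta>>0. \<forall>y. dist y \<eta> < \<delta> \<longrightarrow> (\<forall>m. norm (g m y - g m \<eta>) < \<epsilon>)" if \<epsilon>: "0 < \<epsilon>" for \<eta> \<epsilon>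
  proof (rule ccontr)
    assume "\<not> ?thesis"
    then have "\<forall>n. \<exists>y. dist y \<eta> < 1 / real (Suc n) \<and> (\<exists>m. \<not> norm (g m y - g m \<eta>) < \<epsilon>)"
      by (metis of_nat_0_less_iff zero_less_Suc zero_less_divide_1_iff)
    then obtain y p where y: "\<And>n. dist (y n) \<eta> < 1 / real (Suc n)" "\<And>n. \<epsilon> \<le> norm (g (p n) (y n) - g (p n) \<eta>)"
      by (metis not_less)
    have "(\<lambda>n. dist (y n) \<eta>) \<longlonglongrightarrow> 0"
      by (rule tendsto_sandwich[OF _ _ tendsto_const lim_1_over_n[THEN LIMSEQ_Suc]])
        (use y(1) in \<open>auto intro!: always_eventually less_imp_le\<close>)
    then have "y \<longlonglongrightarrow> \<eta>" by (rule tendsto_dist_iff[THEN iffD2])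
    from tendsto_mult_right_zero[OF kernel_L2(3)[OF \<alpha> k1 c1 c2 this], of A]
    have "(\<lambda>n. A * L2_norm \<alpha> (\<lambda>\<xi>. k (y n) \<xi> - k \<eta> \<xi>)) \<longlonglongrightarrow> 0" .
    then have "\<forall>\<^sub>F n in sequentially. A * L2_norm \<alpha> (\<lambda>\<xi>. k (y n) \<xi> - k \<eta> \<xi>) < \<epsilon>"
      using \<epsilon> by (rule order_tendstoD)
    then obtain n where n: "A * L2_norm \<alpha> (\<lambda>\<xi>. k (y n) \<xi> - k \<eta> \<xi>) < \<epsilon>"
      using eventually_happens'[OF sequentially_bot] by blast
    have "norm (g (p n) (y n) - g (p n) \<eta>) \<le> L2_norm \<alpha> (\<psi> (p n)) * L2_norm \<alpha> (\<lambda>\<xi>. k (y n) \<xi> - k \<eta> \<xi>)"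
      unfolding g_def by (intro kernel_operator_difference \<psi>L kL)
    also have "\<dots> \<le> A * L2_norm \<alpha> (\<lambda>\<xi>. k (y n) \<xi> - k \<eta> \<xi>)" by (intro mult_right_mono \<psi>n L2_norm_nonneg)
    finally show False using n y(2)[of n] by linarith
  qed
  obtain r where r: "strict_mono (r :: nat \<Rightarrow> nat)" "\<And>x. convergent (\<lambda>m. g (r m) x)"
    using pointwise_convergent_subsequence[of g "A * D", OF gb equi] by metis
  then obtain G where G: "\<And>x. (\<lambda>m. g (r m) x) \<longlonglongrightarrow> G x" unfolding convergent_def by metis
  \<comment> \<open>Continuous versions of the representatives. Pointwise limits of the original
    ones would make no sense, as these are fixed only up to null sets.\<close>
  define f where "f m \<eta> = sob_weight s \<eta> * g (r m) \<eta>" for m \<eta>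
  define \<Psi> where "\<Psi> \<eta> = sob_weight s \<eta> * G \<eta>" for \<eta>
  have fc: "continuous_on UNIV (f m)" for m
    unfolding f_def by (intro continuous_on_mult continuous_sob_weight gc)
  have frep: "sob_rep \<alpha> s (\<sigma> (r m)) (f m)" for m
  proof (rule sob_rep_cong_AE[OF \<alpha> \<psi>])
    show "f m \<in> borel_measurable ?M" by (rule continuous_imp_bessel_measurable[OF fc])
    have "AE \<eta> in ?M. g (r m) \<eta> = sob_weight (- s) \<eta> * \<psi> (r m) \<eta>"
      unfolding g_def by (rule krep[OF \<psi>L]) (use supp[of "r m"] \<sigma>eq in simp)
    then show "AE \<eta> in ?M. f m \<eta> = \<psi> (r m) \<eta>"
    proof eventually_elim
      case (elim \<eta>)
      have "f m \<eta> = (sob_weight s \<eta> * sob_weight (- s) \<eta>) * \<psi> (r m) \<eta>" unfolding f_def elim by simp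
      then show ?case by (simp add: sob_weight_mult)
    qed
  qed
  have fL: "f m \<in> L2 \<alpha>" for m using frep[of m] by (simp add: sob_rep_iff)
  have fn: "L2_norm \<alpha> (f m) \<le> A" for m
    using L2_norm_cong_AE[OF fL \<psi>L sob_rep_unique[OF \<alpha> frep \<psi>], of m] \<psi>n by metis
  have flim: "(\<lambda>m. f m x) \<longlonglongrightarrow> \<Psi> x" for x
    unfolding f_def \<Psi>_def by (intro tendsto_mult_left G)
  note \<Psi>L = L2_fatou[OF fL fn flim]
  define T where "T = sob_dist \<alpha> s \<Psi>"
  have Trep: "sob_rep \<alpha> s T \<Psi>" unfolding T_def by (rule sob_rep_sob_dist[OF \<alpha> \<Psi>L(1)])
  have Ttemp: "T \<in> tempered_e" unfolding T_def by (rule sob_dist_tempered[OF \<alpha> \<Psi>L(1)])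
  have Tn: "sobolev_norm \<alpha> s T \<le> C"
    using mult_left_mono[OF \<Psi>L(2), of "bessel_const \<alpha>"] c unfolding sobolev_norm_eq[OF \<alpha> Trep] A_def by simp
  define \<Delta> where "\<Delta> m = (\<lambda>x. sob_weight (t - s) x * (f m x - \<Psi> x))" for m
  have conv: "(\<lambda>m. L2_norm \<alpha> (\<Delta> m)) \<longlonglongrightarrow> 0"
    unfolding \<Delta>_def
  proof (rule L2_weighted_convergence[OF \<alpha> _ fL fn \<Psi>L flim])
    show "t - s < 0" using ts by simp
    show "norm (f m x) \<le> norm (sob_weight s x) * (A * D * exp ((norm x)\<^sup>2 / 2))" for m x
      unfolding f_def norm_mult by (intro mult_left_mono gb) simp
    show "continuous_on UNIV (\<lambda>x::real ^ 'n. norm (sob_weight s x) * (A * D * exp ((norm x)\<^sup>2 / 2)))"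
      by (intro continuous_intros continuous_sob_weight) simp
  qed
  have drep: "sob_rep \<alpha> t (\<lambda>h. \<sigma> (r m) h - T h) (\<Delta> m)" for m
    using sob_rep_lower[OF sob_rep_diff[OF \<alpha> frep[of m] Trep], of t] ts by (simp add: \<Delta>_def)
  have lim0: "(\<lambda>m. sobolev_norm \<alpha> t (\<lambda>h. \<sigma> (r m) h - T h)) \<longlonglongrightarrow> 0"
    unfolding sobolev_norm_eq[OF \<alpha> drep] using tendsto_mult_right_zero[OF conv] .
  \<comment> \<open>The support condition passes to the limit since evaluation at a fixed Schwartz
    function is bounded by the weaker norm.\<close>
  have "supp_in T K"
    unfolding supp_in_def
  proof (intro ballI impI)
    fix \<phi> assume \<phi>: "\<phi> \<in> test_e" and ex: "\<exists>U. open U \<and> sign_orbit K \<subseteq> U \<and> (\<forall>x\<in>U. \<phi> x = 0)"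
    have z: "\<sigma> m \<phi> = 0" for m using supp[of m, unfolded supp_in_def, THEN bspec, OF \<phi>] ex by (rule mp)
    show "T \<phi> = 0"
    proof (cases "\<phi> \<in> schwartz_e")
      case False
      then show ?thesis by (simp add: T_def sob_dist_def)
    next
      case True
      define E where "E = L2_norm \<alpha> (\<lambda>x. sob_weight (- t) x * fourier_bessel \<alpha> \<phi> x) / norm (inversion_const \<alpha>)"
      have "norm (T \<phi>) \<le> L2_norm \<alpha> (\<Delta> m) * E" for m
      proof -
        have L: "\<Delta> m \<in> L2 \<alpha>" using drep[of m] by (simp add: sob_rep_iff)
        have "\<sigma> (r m) \<phi> - T \<phi> = sob_dist \<alpha> t (\<Delta> m) \<phi>" by (rule sob_rep_formula[OF \<alpha> drep True])
        then have "norm (T \<phi>) = norm (sob_dist \<alpha> t (\<Delta> m) \<phi>)" using z by (metis diff_0 norm_minus_cancel)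
        then show ?thesis using sob_dist_bound[OF \<alpha> L True, of t] by (simp add: E_def)
      qed
      then have "norm (T \<phi>) \<le> 0"
        using LIMSEQ_le_const[OF tendsto_mult_left_zero[OF conv, of E], of "norm (T \<phi>)"] by blast
      then show ?thesis by simp
    qed
  qed
  then have "T \<in> sobolev_supp \<alpha> s K" using Ttemp Trep by (auto simp: sobolev_supp_def sobolev_iff)
  then show ?thesis using Tn r(1) lim0 by (rule that)
qed

section \<open>Compactness of the embedding\<close>

lemma sobolev_supp_mono:
  assumes "t \<le> s"
  shows "sobolev_supp \<alpha> s K \<subseteq> sobolev_supp \<alpha> t K"
  using sob_rep_lower[OF _ assms] by (auto simp: sobolev_supp_def sobolev_iff)

theorem theorem22:
  fixes \<alpha> :: "real ^ 'n" and s t :: real and K :: "(real ^ 'n) set"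
  assumes "\<And>i. \<alpha> $ i > - (1/2)"
    and "t < s"
    and "compact K"
  shows "compact_operator (sobolev_supp \<alpha> s K) (sobolev_norm \<alpha> s)
           (sobolev_supp \<alpha> t K) (sobolev_norm \<alpha> t) (\<lambda>T. T)"
proof -
  have \<alpha>: "admissible \<alpha>" using assms(1) by (simp add: admissible_def)
  define d where "d = (\<lambda>S T :: 'n dist. sobolev_norm \<alpha> t (\<lambda>f. S f - T f))"
  interpret M: Metric_space "sobolev_supp \<alpha> t K" d
    unfolding d_def by (rule sobolev_supp_metric[OF \<alpha>])
  have top: "norm_topology (sobolev_supp \<alpha> t K) (sobolev_norm \<alpha> t) = M.mtopology"
    by (simp add: norm_topology_def d_def)
  have sub: "sobolev_supp \<alpha> s K \<subseteq> sobolev_supp \<alpha> t K"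
    using assms(2) by (intro sobolev_supp_mono) simp
  have "compactin M.mtopology (M.mtopology closure_of B)"
    if B: "B \<subseteq> sobolev_supp \<alpha> s K" and C: "\<forall>T\<in>B. sobolev_norm \<alpha> s T \<le> C" for B C
  proof -
    \<comment> \<open>The full ball that contains \<open>B\<close>. Being compact in a Hausdorff
      topology it is closed, so it contains the closure of \<open>B\<close>, which is then a closed
      subset of a compact set.\<close>
    define L where "L = {T \<in> sobolev_supp \<alpha> s K. sobolev_norm \<alpha> s T \<le> C}"
    have Lsub: "L \<subseteq> sobolev_supp \<alpha> t K" using sub by (auto simp: L_def)
    have comp: "compactin M.mtopology L"
      unfolding M.compactin_sequentially
    proof (intro conjI allI impI Lsub)
      fix \<sigma> :: "nat \<Rightarrow> 'n dist" assume "range \<sigma> \<subseteq> L"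
      then have \<sigma>: "\<sigma> m \<in> sobolev_supp \<alpha> s K" "sobolev_norm \<alpha> s (\<sigma> m) \<le> C" for m by (auto simp: L_def)
      obtain T r where T: "T \<in> sobolev_supp \<alpha> s K" "sobolev_norm \<alpha> s T \<le> C" "strict_mono (r :: nat \<Rightarrow> nat)"
        "(\<lambda>m. sobolev_norm \<alpha> t (\<lambda>f. \<sigma> (r m) f - T f)) \<longlonglongrightarrow> 0"
        by (rule sobolev_ball_sequentially_compact[where \<sigma> = \<sigma> and C = C, OF \<alpha> assms(2,3) \<sigma>])
      have "limitin M.mtopology (\<sigma> \<circ> r) T sequentially"
        unfolding M.limit_metric_sequentially
      proof (intro conjI allI impI)
        show "T \<in> sobolev_supp \<alpha> t K" using T(1) sub by blast
        fix \<epsilon> :: real assume "\<epsilon> > 0"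
        then have "\<forall>\<^sub>F m in sequentially. sobolev_norm \<alpha> t (\<lambda>f. \<sigma> (r m) f - T f) < \<epsilon>"
          by (rule order_tendstoD(2)[OF T(4)])
        then obtain N where "\<And>n. n \<ge> N \<Longrightarrow> sobolev_norm \<alpha> t (\<lambda>f. \<sigma> (r n) f - T f) < \<epsilon>"
          by (auto simp: eventually_sequentially)
        then show "\<exists>N. \<forall>n\<ge>N. (\<sigma> \<circ> r) n \<in> sobolev_supp \<alpha> t K \<and> d ((\<sigma> \<circ> r) n) T < \<epsilon>"
          using \<sigma>(1) sub by (intro exI[of _ N]) (auto simp: d_def)
      qed
      then show "\<exists>l r. l \<in> L \<and> strict_mono r \<and> limitin M.mtopology (\<sigma> \<circ> r) l sequentially"
        using T by (auto simp: L_def)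
    qed
    have "closedin M.mtopology L"
      by (rule compactin_imp_closedin[OF M.Hausdorff_space_mtopology comp])
    then have "M.mtopology closure_of B \<subseteq> L"
      by (rule closure_of_minimal[rotated]) (use B C in \<open>auto simp: L_def\<close>)
    with comp show ?thesis
      by (rule closed_compactin[OF _ _ closedin_closure_of])
  qed
  then show ?thesis
    unfolding compact_operator_def top using sub by (simp add: image_ident) metis
qed

end
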